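(* Let $\mathcal{H}$ be an admissible affine hyperplane arrangement in $E$, let $K$ be an admissible group and let $L$ be a flat lying over $\overline{\mathcal{A}}$. Then $X(\mathcal{H},K,L)$ is normal in codimension $1$ if and only if for every flat $L'\subset L$ of codimension $1$ in $L$ lying over $\overline{\mathcal{A}}$, setting $F'=\mathring{L'}\cap\overline{\mathcal{A}}$, the set $$\{F''\in\Sigma(\mathcal{H},K,L)~:~F'\subset\overline{F''}\}$$ is a single $K^{L'}$-orbit.
   Context: $E$ is a finite-dimensional Euclidean affine space with direction vector space $V$, and $E_{\mathbb{C}}=E+iV$ is its complexification. $\mathcal{H}$ is a (possibly infinite) set of affine hyperplanes of $E$, and $\mathcal{W}_{\mathcal{H}}$ is the group generated by the orthogonal reflections in the elements of $\mathcal{H}$. $\mathcal{H}$ is admissible if $\mathcal{W}_{\mathcal{H}}$, with the discrete topology, acts properly on $E$ and preserves $\mathcal{H}$. The closure $\overline{\mathcal{A}}$ of a fixed connected component $\mathcal{A}$ of $E\setminus\bigcup_{H\in\mathcal{H}}H$ is a fundamental domain for $\mathcal{W}_{\mathcal{H}}$. For an affine subspace $A$, $V(A)$ is its direction, and $V_{\mathcal{H}}=\bigcap_{H\in\mathcal{H}}V(H)$. $K$ is a subgroup of the group of isometries of $E$ stabilising $\mathcal{A}$; it is admissible if its action is pulled back from $E/V_{\mathcal{H}}$, i.e. for some $p\in E$ every $k\in K$ preserves $E^{ess}=p+V_{\mathcal{H}}^{\perp}$ and satisfies $k(x+v)=kx+v$ for all $x\in E$, $v\in V_{\mathcal{H}}$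 (so $K$ is finite). Put $\mathcal{W}_{\mathcal{H},K}=K\ltimes\mathcal{W}_{\mathcal{H}}$; it acts on $E_{\mathbb{C}}$. A flat is a nonempty intersection of elements of $\mathcal{H}$ ($E$ included); $L_{\mathbb{C}}=L+iV(L)$; $\mathring{L}$ is $L$ minus all flats strictly contained in $L$. A flat $L$ lies over $\overline{\mathcal{A}}$ if $L$ is the affine span of $L\cap\overline{\mathcal{A}}$; then $\mathring{L}\cap\overline{\mathcal{A}}$ is a face of $\overline{\mathcal{A}}$, open in $L$. The stratum $X(\mathcal{H},K,L):=\mathcal{W}_{\mathcal{H},K}L_{\mathbb{C}}/\mathcal{W}_{\mathcal{H},K}$ is a closed (reduced) analytic subvariety of $E_{\mathbb{C}}/\mathcal{W}_{\mathcal{H},K}$, whose functions are the $\mathcal{W}_{\mathcal{H},K}$-invariant analytic functions on $\mathcal{W}_{\mathcal{H},K}L_{\mathbb{C}}$ (it carries a structure of affine algebraic variety). It is normal in codimension $1$ if its non-normality locus has codimension greater than $1$. $\Sigma(\mathcal{H},K,L):=\{w\mathring{L}\cap\overline{\mathcal{A}}~:~w\in\mathcal{W}_{\mathcal{H},K},\ wL\text{ lies over }\overline{\mathcal{A}}\}$, a $K$-stable set of faces of $\overline{\mathcal{A}}$. $K^{L'}$ is the pointwise stabiliser of $L'$ in $K$. Closures $\overline{F''}$ are taken in $E$. *)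

theory Defs
  imports "HOL-Analysis.Analysis" "HOL-Algebra.Generated_Groups" "HOL-Algebra.Bij"
    "HOL-Algebra.QuotRing"
begin

section \<open>Reduced complex spaces as spaces with functions\<close>

text \<open>
  A reduced complex space is recorded as its underlying topology together with, for every open set
  \<open>U\<close>, the set of holomorphic functions on \<open>U\<close>.  Functions are total;
  only their values on \<open>U\<close> matter.
\<close>

record 'p fspace =
  ftop :: "'p topology"
  fsec :: "'p set \<Rightarrow> ('p \<Rightarrow> complex) set"

text \<open>
  The complexification of a Euclidean space \<open>'a\<close> is modelled by pairs: \<open>(x, v)\<close> stands for
  \<open>x + iv\<close>, so multiplication by \<open>i\<close> is \<open>(x, v) \<mapsto> (- v, x)\<close>.
\<close>

type_synonym 'a cx = "'a \<times> 'a"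

definition cx_holomorphic_on :: "('a::euclidean_space cx \<Rightarrow> complex) \<Rightarrow> 'a cx set \<Rightarrow> bool" where
  "cx_holomorphic_on F U \<longleftrightarrow> open U \<and>
     (\<forall>z\<in>U. \<exists>D. (F has_derivative D) (at z) \<and> (\<forall>x v. D (- v, x) = \<i> * D (x, v)))"

definition analytic_fun_on :: "('a::euclidean_space cx \<Rightarrow> complex) \<Rightarrow> 'a cx set \<Rightarrow> bool" where
  "analytic_fun_on f T \<longleftrightarrow>
     (\<forall>z\<in>T. \<exists>U F. z \<in> U \<and> cx_holomorphic_on F U \<and> (\<forall>y\<in>U \<inter> T. f y = F y))"

definition analytic_space :: "'a::euclidean_space cx set \<Rightarrow> 'a cx fspace" where
  "analytic_space T = \<lparr>ftop = top_of_set T, fsec = (\<lambda>U. {f. analytic_fun_on f U})\<rparr>"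

definition quotient_space :: "('p \<Rightarrow> 'q) \<Rightarrow> 'p fspace \<Rightarrow> 'q fspace" where
  "quotient_space q X =
     \<lparr>ftop = topology (\<lambda>U. U \<subseteq> q ` topspace (ftop X) \<and>
                            openin (ftop X) {z \<in> topspace (ftop X). q z \<in> U}),
      fsec = (\<lambda>U. {f. f \<circ> q \<in> fsec X {z \<in> topspace (ftop X). q z \<in> U}})\<rparr>"

lemma istopology_quotient:
  "istopology (\<lambda>U. U \<subseteq> q ` topspace T \<and> openin T {z \<in> topspace T. q z \<in> U})"
proof -
  have "{z \<in> topspace T. q z \<in> S \<inter> S'}
      = {z \<in> topspace T. q z \<in> S} \<inter> {z \<in> topspace T. q z \<in> S'}" for S S'
    by blast
  moreover have "{z \<in> topspace T. q z \<in> \<Union>\<K>} = \<Union> ((\<lambda>U. {z \<in> topspace T. q z \<in> U}) ` \<K>)"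
    for \<K>
    by blast
  ultimately show ?thesis
    unfolding istopology_def by (simp only:) (blast intro: openin_Int openin_Union)
qed

text \<open>A (locally closed) analytic subset \<open>S\<close> of \<open>X\<close> with its reduced structure.\<close>

definition reduced_subspace :: "'p fspace \<Rightarrow> 'p set \<Rightarrow> 'p fspace" where
  "reduced_subspace X S =
     \<lparr>ftop = subtopology (ftop X) S,
      fsec = (\<lambda>U. {f. \<forall>x\<in>U. \<exists>V. openin (ftop X) V \<and> x \<in> V \<and>
                        (\<exists>g\<in>fsec X V. \<forall>y\<in>V \<inter> U. f y = g y)})\<rparr>"

definition fspace_iso :: "'p fspace \<Rightarrow> 'q fspace \<Rightarrow> ('p \<Rightarrow> 'q) \<Rightarrow> bool" where
  "fspace_iso X Y \<phi> \<longleftrightarrow> homeomorphic_map (ftop X) (ftop Y) \<phi> \<and>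
     (\<forall>U f. openin (ftop Y) U \<longrightarrow>
        (f \<in> fsec Y U \<longleftrightarrow> f \<circ> \<phi> \<in> fsec X {x \<in> topspace (ftop X). \<phi> x \<in> U}))"

section \<open>Normality\<close>

definition near_ring :: "'p fspace \<Rightarrow> 'p \<Rightarrow> ('p \<Rightarrow> complex) ring" where
  "near_ring X x =
     \<lparr>carrier = {f. \<exists>U. openin (ftop X) U \<and> x \<in> U \<and> f \<in> fsec X U},
      mult = (\<lambda>f g y. f y * g y), one = (\<lambda>_. 1), zero = (\<lambda>_. 0), add = (\<lambda>f g y. f y + g y)\<rparr>"

definition vanishing_near :: "'p fspace \<Rightarrow> 'p \<Rightarrow> ('p \<Rightarrow> complex) set" where
  "vanishing_near X x =
     {f \<in> carrier (near_ring X x). \<exists>U. openin (ftop X) U \<and> x \<in> U \<and> (\<forall>y\<in>U. f y = 0)}"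

text \<open>
  The local ring at \<open>x\<close>: functions holomorphic near \<open>x\<close>, modulo those vanishing near \<open>x\<close>.
\<close>

definition stalk :: "'p fspace \<Rightarrow> 'p \<Rightarrow> ('p \<Rightarrow> complex) set ring" where
  "stalk X x = near_ring X x Quot vanishing_near X x"

text \<open>
  An integral domain is normal if every element \<open>a/b\<close> of its field of fractions that is integral
  over it lies in it.  Here \<open>(a/b)\<^sup>n + \<Sum>\<^bsub>i<n\<^esub> c\<^sub>i (a/b)\<^sup>i = 0\<close> is multiplied by \<open>b\<^sup>n\<close>.
\<close>

definition normal_domain :: "('r, 'm) ring_scheme \<Rightarrow> bool" where
  "normal_domain R \<longleftrightarrow> domain R \<and>
     (\<forall>a\<in>carrier R. \<forall>b\<in>carrier R - {\<zero>\<^bsub>R\<^esub>}. \<forall>(n::nat) c.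
        c \<in> {..<n} \<rightarrow> carrier R \<longrightarrow>
        a [^]\<^bsub>R\<^esub> n \<oplus>\<^bsub>R\<^esub>
          (\<Oplus>\<^bsub>R\<^esub>i\<in>{..<n}. c i \<otimes>\<^bsub>R\<^esub> a [^]\<^bsub>R\<^esub> i \<otimes>\<^bsub>R\<^esub> b [^]\<^bsub>R\<^esub> (n - i)) = \<zero>\<^bsub>R\<^esub> \<longrightarrow>
        (\<exists>r\<in>carrier R. a = r \<otimes>\<^bsub>R\<^esub> b))"

definition nonnormal_locus :: "'p fspace \<Rightarrow> 'p set" where
  "nonnormal_locus X = {x \<in> topspace (ftop X). \<not> normal_domain (stalk X x)}"

section \<open>Affine subspaces, complexification, dimension\<close>

definition direction :: "'a::euclidean_space set \<Rightarrow> 'a set" where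
  "direction A = {x - y | x y. x \<in> A \<and> y \<in> A}"

definition complexify :: "'a::euclidean_space set \<Rightarrow> 'a cx set" where
  "complexify A = A \<times> direction A"

text \<open>
  \<open>x\<close> is a manifold point of \<open>S\<close> of complex dimension \<open>k\<close> if \<open>S\<close> is near \<open>x\<close> isomorphic to an open
  subset of \<open>\<complex>\<^sup>k\<close>.  As \<open>k\<close> varies, \<open>\<complex>\<^sup>k\<close> is realised as the complexification of a
  \<open>k\<close>-dimensional linear subspace of \<open>'a\<close>.  The points of the spaces considered are subsets of the
  complexification of \<open>'a\<close> (orbits of a discrete group), so no \<open>k > DIM('a)\<close> can occur.
\<close>

definition manifold_point :: "'a::euclidean_space cx set fspace \<Rightarrow> 'a cx set set \<Rightarrow>
    'a cx set \<Rightarrow> nat \<Rightarrow> bool" where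
  "manifold_point X S x k \<longleftrightarrow>
     (\<exists>U M D \<phi>. openin (ftop X) U \<and> x \<in> U \<inter> S \<and>
        subspace (M :: 'a set) \<and> dim M = k \<and> openin (top_of_set (complexify M)) D \<and>
        fspace_iso (analytic_space D) (reduced_subspace X (U \<inter> S)) \<phi>)"

text \<open>
  The dimension of an analytic subset is the largest dimension of its manifold points, and
  \<open>-\<infinity>\<close> for the empty set, whose codimension is thus \<open>\<infinity>\<close>.  The codimension as defined
  here is the usual one when \<open>X\<close> is pure-dimensional.
\<close>

definition cdim :: "'a::euclidean_space cx set fspace \<Rightarrow> 'a cx set set \<Rightarrow> ereal" where
  "cdim X S = (SUP k \<in> {k. \<exists>x\<in>S. manifold_point X S x k}. ereal (real k))"

definition codim :: "'a::euclidean_space cx set fspace \<Rightarrow> 'a cx set set \<Rightarrow> ereal" where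
  "codim X S = cdim X (topspace (ftop X)) - cdim X S"

definition normal_in_codim_1 :: "'a::euclidean_space cx set fspace \<Rightarrow> bool" where
  "normal_in_codim_1 X \<longleftrightarrow> codim X (nonnormal_locus X) > 1"

section \<open>Hyperplane arrangements and their groups\<close>

definition affine_hyperplane :: "'a::euclidean_space set \<Rightarrow> bool" where
  "affine_hyperplane H \<longleftrightarrow> (\<exists>a b. a \<noteq> 0 \<and> H = {x. a \<bullet> x = b})"

text \<open>\<open>closest_point H x\<close> is the orthogonal projection of \<open>x\<close> to \<open>H\<close>.\<close>

definition orth_reflection :: "'a::euclidean_space set \<Rightarrow> 'a \<Rightarrow> 'a" where
  "orth_reflection H x = x + 2 *\<^sub>R (closest_point H x - x)"

definition isometry_group :: "('a::euclidean_space \<Rightarrow> 'a) monoid" where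
  "isometry_group = (BijGroup UNIV)
     \<lparr>carrier := {g. bij g \<and> (\<forall>x y. dist (g x) (g y) = dist x y)}\<rparr>"

definition refl_group :: "'a::euclidean_space set set \<Rightarrow> ('a \<Rightarrow> 'a) set" where
  "refl_group \<H> = generate isometry_group (orth_reflection ` \<H>)"

definition acts_properly :: "('a::euclidean_space \<Rightarrow> 'a) set \<Rightarrow> bool" where
  "acts_properly G \<longleftrightarrow>
     proper_map (prod_topology (discrete_topology G) euclidean) euclidean (\<lambda>(g, x). (g x, x))"

definition admissible_arrangement :: "'a::euclidean_space set set \<Rightarrow> bool" where
  "admissible_arrangement \<H> \<longleftrightarrow>
     (\<forall>H\<in>\<H>. affine_hyperplane H) \<and> acts_properly (refl_group \<H>) \<and>
     (\<forall>w\<in>refl_group \<H>. (`) w ` \<H> = \<H>)"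

definition chamber :: "'a::euclidean_space set set \<Rightarrow> 'a set \<Rightarrow> bool" where
  "chamber \<H> \<A> \<longleftrightarrow> \<A> \<in> components (UNIV - \<Union>\<H>)"

definition V_arr :: "'a::euclidean_space set set \<Rightarrow> 'a set" where
  "V_arr \<H> = (\<Inter>H\<in>\<H>. direction H)"

definition admissible_group ::
    "'a::euclidean_space set set \<Rightarrow> 'a set \<Rightarrow> ('a \<Rightarrow> 'a) set \<Rightarrow> bool" where
  "admissible_group \<H> \<A> K \<longleftrightarrow>
     subgroup K isometry_group \<and> (\<forall>k\<in>K. k ` \<A> = \<A>) \<and>
     (\<exists>p. \<forall>k\<in>K.
        k ` ((+) p ` (V_arr \<H>)\<^sup>\<bottom>) = (+) p ` (V_arr \<H>)\<^sup>\<bottom> \<and>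
        (\<forall>x. \<forall>v\<in>V_arr \<H>. k (x + v) = k x + v))"

text \<open>
  The semidirect product of \<open>K\<close> and the reflection group acts faithfully, since a nontrivial element
  of the latter moves the chamber stabilised by \<open>K\<close>; so it is identified with a group of isometries.
\<close>

definition ext_group :: "'a::euclidean_space set set \<Rightarrow> ('a \<Rightarrow> 'a) set \<Rightarrow> ('a \<Rightarrow> 'a) set" where
  "ext_group \<H> K = K <#>\<^bsub>isometry_group\<^esub> refl_group \<H>"

text \<open>An affine map \<open>g\<close> acts on \<open>x + iv\<close> by its linear part \<open>v \<mapsto> g v - g 0\<close> on \<open>v\<close>.\<close>

definition cx_map :: "('a::euclidean_space \<Rightarrow> 'a) \<Rightarrow> 'a cx \<Rightarrow> 'a cx" where
  "cx_map g = (\<lambda>(x, v). (g x, g v - g 0))"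

definition cx_orbit :: "('a::euclidean_space \<Rightarrow> 'a) set \<Rightarrow> 'a cx \<Rightarrow> 'a cx set" where
  "cx_orbit G z = (\<lambda>g. cx_map g z) ` G"

section \<open>Flats, faces and strata\<close>

definition flat :: "'a::euclidean_space set set \<Rightarrow> 'a set \<Rightarrow> bool" where
  "flat \<H> L \<longleftrightarrow> L \<noteq> {} \<and> (\<exists>\<S>\<subseteq>\<H>. L = \<Inter>\<S>)"

definition flat_interior :: "'a::euclidean_space set set \<Rightarrow> 'a set \<Rightarrow> 'a set" where
  "flat_interior \<H> L = L - \<Union>{M. flat \<H> M \<and> M \<subset> L}"

definition lies_over :: "'a::euclidean_space set \<Rightarrow> 'a set \<Rightarrow> bool" where
  "lies_over \<A> L \<longleftrightarrow> L = affine hull (L \<inter> closure \<A>)"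

definition stratum ::
    "'a::euclidean_space set set \<Rightarrow> ('a \<Rightarrow> 'a) set \<Rightarrow> 'a set \<Rightarrow> 'a cx set fspace" where
  "stratum \<H> K L =
     quotient_space (cx_orbit (ext_group \<H> K))
       (analytic_space (\<Union>w\<in>ext_group \<H> K. cx_map w ` complexify L))"

definition Sigma_faces ::
    "'a::euclidean_space set set \<Rightarrow> 'a set \<Rightarrow> ('a \<Rightarrow> 'a) set \<Rightarrow> 'a set \<Rightarrow> 'a set set" where
  "Sigma_faces \<H> \<A> K L =
     {w ` flat_interior \<H> L \<inter> closure \<A> | w. w \<in> ext_group \<H> K \<and> lies_over \<A> (w ` L)}"

definition pointwise_stabiliser :: "('a \<Rightarrow> 'a) set \<Rightarrow> 'a set \<Rightarrow> ('a \<Rightarrow> 'a) set" where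
  "pointwise_stabiliser K M = {k \<in> K. \<forall>x\<in>M. k x = x}"

definition single_orbit :: "('a \<Rightarrow> 'a) set \<Rightarrow> 'a set set \<Rightarrow> bool" where
  "single_orbit G \<F> \<longleftrightarrow> (\<exists>F\<in>\<F>. \<F> = (\<lambda>g. g ` F) ` G)"

end

theory Submission
  imports Defs "HOL-Complex_Analysis.Complex_Analysis"
begin

text \<open>
  A germ of the stratum at the orbit of \<open>z\<close> is a germ, invariant under the stabiliser of \<open>z\<close>, on the
  union of the complexified translates of \<open>L\<close> through \<open>z\<close>.  If \<open>L\<close> is the smallest flat whose
  complexification contains \<open>z\<close>, there is one linear component and the stratum is normal there.  If the
  smallest such flat \<open>P\<close> has codimension one in \<open>L\<close>, the components are spanned by \<open>P\<close> and finitely many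
  rays orthogonal to \<open>P\<close>.  When the pointwise stabiliser of \<open>P\<close> is transitive on these rays, it contains
  a reflection of one component, invariant germs are even in the transversal coordinate \<open>c\<close>, hence
  holomorphic in \<open>c\<^sup>2\<close>, and \<open>c\<^sup>2\<close> extends to all components; so the stratum is normal at \<open>z\<close>.
  Otherwise there are invariant zero divisors, or an element of the normalisation that is odd in \<open>c\<close>
  and does not extend, because linear parts of invariant germs are killed by the reflections fixing \<open>P\<close>;
  so the stratum is not normal along \<open>P\<close>.

  Since the closed chamber is a fundamental domain, transitivity on rays means transitivity of the
  pointwise stabiliser of \<open>P\<close> in \<open>K\<close> on the faces adjacent to that of \<open>P\<close>, if \<open>P\<close> lies over the chamber.  All \<open>P\<close> are
  reduced to this case by folding \<open>L\<close> into the chamber with the reflections of \<open>L\<close> obtained from the facets.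
\<close>

section \<open>Holomorphic functions on the complexification\<close>

text \<open>The arrangement that \<H> induces on \<open>L\<close> need not be stable under
  reflections of \<open>L\<close>, so the theory of reflection groups cannot simply be applied
  inside \<open>L\<close>. A reflection of \<open>L\<close> in a facet of its face exists only
  because the rays at that facet are transitive; the condition over the chamber must itself produce
  the maps that carry it to all other flats. Facets suffice, because a segment that leaves a face
  from a generic point crosses a facet.

  The odd element of the normalisation cannot be an averaged linear form, since the stabiliser fixes
  no nonzero vector normal to \<open>P\<close>. Instead the powers \<open>2 * k + 1\<close> of a
  linear form are summed over the stabiliser, with \<open>k\<close> so large that no cancellation
  occurs on the chosen ray, and the degree is brought back to one by dividing by
  \<open>qf ^ k\<close>.

  The dimension of an analytic subset is defined through arbitrary charts. Upper bounds come from
  measure theory: a chart cannot be covered by countably many differentiable images of smaller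
  dimension. Infinite families of hyperplanes are controlled by Baire's theorem: a convex set
  covered by countably many affine subspaces lies in one of them.\<close>

definition cscale :: "complex \<Rightarrow> 'a::euclidean_space cx \<Rightarrow> 'a cx" where
  "cscale c z = (Re c *\<^sub>R fst z - Im c *\<^sub>R snd z, Re c *\<^sub>R snd z + Im c *\<^sub>R fst z)"

lemma norm_cscale: "norm (cscale c z) = cmod c * norm (z::'a::euclidean_space cx)"
proof -
  obtain x v where z: "z = (x, v)" by (cases z)
  have "(norm (cscale c z))\<^sup>2 = (cmod c)\<^sup>2 * (norm z)\<^sup>2"
    unfolding z cscale_def cmod_power2 power2_norm_eq_inner
    by (simp add: inner_diff_left inner_diff_right inner_add_left
        inner_add_right inner_commute[of v x] algebra_simps power2_eq_square)
  then show ?thesis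
    by (simp flip: power_mult_distrib)
qed

lemma bounded_bilinear_cscale: "bounded_bilinear cscale"
proof (unfold_locales)
  show "\<exists>K. \<forall>a b. norm (cscale a (b::'a cx)) <= norm a * norm b * K"
    by (rule exI[of _ 1]) (simp add: norm_cscale)
qed (auto simp: cscale_def algebra_simps)

interpretation cscale: bounded_bilinear "cscale :: complex \<Rightarrow> 'a::euclidean_space cx \<Rightarrow> 'a cx"
  by (rule bounded_bilinear_cscale)

lemma cscale_one [simp]: "cscale 1 z = z"
  by (simp add: cscale_def)

lemma cscale_cscale: "cscale a (cscale b z) = cscale (a * b) z"
  by (auto simp: cscale_def algebra_simps)

lemma continuous_on_cscale [continuous_intros]:
  "continuous_on S f ==> continuous_on S g ==> continuous_on S (%x. cscale (f x) (g x))"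
  by (rule cscale.continuous_on)

lemma cscale_eq: "cscale c (x, v) = Re c *\<^sub>R (x, v) + Im c *\<^sub>R (- v, x)"
  by (simp add: cscale_def)

definition complex_linear :: "('a::euclidean_space cx \<Rightarrow> complex) \<Rightarrow> bool" where
  "complex_linear D \<longleftrightarrow> (\<forall>x v. D (- v, x) = \<i> * D (x, v))"

lemma complex_linear_cscale:
  assumes "linear D" "complex_linear D"
  shows "D (cscale c z) = c * D z"
proof -
  obtain x v where z: "z = (x, v)" by (cases z)
  have "D (cscale c z) = Re c *\<^sub>R D (x, v) + Im c *\<^sub>R D (- v, x)"
    unfolding z cscale_eq linear_add[OF assms(1)] linear_scale[OF assms(1)] ..
  also have "\<dots> = c * D z"
    using assms(2) unfolding complex_linear_def z
    by (metis (no_types, opaque_lifting) complex_eq distrib_right mult.assoc mult.commute scaleR_conv_of_real)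
  finally show ?thesis .
qed

lemma cx_holomorphic_on_def':
  "cx_holomorphic_on F U \<longleftrightarrow> open U \<and> (\<forall>z\<in>U. \<exists>D. (F has_derivative D) (at z) \<and> complex_linear D)"
  by (auto simp: cx_holomorphic_on_def complex_linear_def)

lemma cx_holomorphic_on_open: "cx_holomorphic_on F U ==> open U"
  by (simp add: cx_holomorphic_on_def)

lemma cx_holomorphic_onI:
  assumes "open U" "!!z. z \<in> U ==> \<exists>D. (F has_derivative D) (at z) \<and> complex_linear D"
  shows "cx_holomorphic_on F U"
  using assms by (auto simp: cx_holomorphic_on_def')

lemma cx_holomorphic_onE:
  assumes "cx_holomorphic_on F U" "z \<in> U"
  obtains D where "(F has_derivative D) (at z)" "complex_linear D"
  using assms by (auto simp: cx_holomorphic_on_def')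

lemma cx_holomorphic_on_subset:
  "cx_holomorphic_on F U ==> open V ==> V \<subseteq> U ==> cx_holomorphic_on F V"
  by (auto simp: cx_holomorphic_on_def)

lemma cx_holomorphic_on_cong:
  assumes "cx_holomorphic_on F U" "!!z. z \<in> U ==> F z = G z"
  shows "cx_holomorphic_on G U"
proof (rule cx_holomorphic_onI)
  show "open U" using assms(1) by (rule cx_holomorphic_on_open)
  fix z assume z: "z \<in> U"
  obtain D where D: "(F has_derivative D) (at z)" "complex_linear D"
    using assms(1) z by (rule cx_holomorphic_onE)
  have "(G has_derivative D) (at z)"
    by (rule has_derivative_transform_within_open[OF D(1) \<open>open U\<close> z]) (use assms(2) in auto)
  then show "\<exists>D. (G has_derivative D) (at z) \<and> complex_linear D" using D(2) by blast
qed

lemma cx_holomorphic_on_local: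
  assumes "!!z. z \<in> U ==> \<exists>V. z \<in> V \<and> cx_holomorphic_on F V"
  assumes "open U"
  shows "cx_holomorphic_on F U"
  using assms by (fastforce simp: cx_holomorphic_on_def')

lemma cx_holomorphic_on_continuous_on: "cx_holomorphic_on F U ==> continuous_on U F"
  by (meson continuous_at_imp_continuous_on cx_holomorphic_onE has_derivative_continuous)

lemma cx_holomorphic_on_const [simp]: "open U ==> cx_holomorphic_on (%_. c) U"
  by (rule cx_holomorphic_onI) (auto intro!: exI[of _ "%_. 0"] simp: complex_linear_def)

lemma cx_holomorphic_on_add:
  assumes "cx_holomorphic_on F U" "cx_holomorphic_on G U"
  shows "cx_holomorphic_on (%z. F z + G z) U"
proof (rule cx_holomorphic_onI)
  show "open U" using assms(1) by (rule cx_holomorphic_on_open)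
  fix z assume z: "z \<in> U"
  obtain D where D: "(F has_derivative D) (at z)" "complex_linear D"
    using assms(1) z by (rule cx_holomorphic_onE)
  obtain E where E: "(G has_derivative E) (at z)" "complex_linear E"
    using assms(2) z by (rule cx_holomorphic_onE)
  show "\<exists>D. ((%z. F z + G z) has_derivative D) (at z) \<and> complex_linear D"
    using has_derivative_add[OF D(1) E(1)] D(2) E(2)
    by (auto simp: complex_linear_def distrib_left intro!: exI)
qed

lemma cx_holomorphic_on_mult:
  assumes "cx_holomorphic_on F U" "cx_holomorphic_on G U"
  shows "cx_holomorphic_on (%z. F z * G z) U"
proof (rule cx_holomorphic_onI)
  show "open U" using assms(1) by (rule cx_holomorphic_on_open)
  fix z assume z: "z \<in> U"
  obtain D where D: "(F has_derivative D) (at z)" "complex_linear D"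
    using assms(1) z by (rule cx_holomorphic_onE)
  obtain E where E: "(G has_derivative E) (at z)" "complex_linear E"
    using assms(2) z by (rule cx_holomorphic_onE)
  show "\<exists>D. ((%z. F z * G z) has_derivative D) (at z) \<and> complex_linear D"
    using has_derivative_mult[OF D(1) E(1)] D(2) E(2)
    by (auto simp: complex_linear_def algebra_simps intro!: exI)
qed

lemma cx_holomorphic_on_uminus:
  "cx_holomorphic_on F U ==> cx_holomorphic_on (%z. - F z) U"
  using cx_holomorphic_on_mult[of "%_. -1" U F] by (simp add: cx_holomorphic_on_open)

lemma cx_holomorphic_on_sum:
  "open U ==> (!!i. i \<in> I ==> cx_holomorphic_on (F i) U) ==> cx_holomorphic_on (%z. \<Sum>i\<in>I. F i z) U"
  by (induction I rule: infinite_finite_induct) (auto intro: cx_holomorphic_on_add)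

lemma cx_holomorphic_on_prod:
  "open U ==> (!!i. i \<in> I ==> cx_holomorphic_on (F i) U) ==> cx_holomorphic_on (%z. \<Prod>i\<in>I. F i z) U"
  by (induction I rule: infinite_finite_induct) (auto intro: cx_holomorphic_on_mult)

lemma cx_holomorphic_on_power:
  "cx_holomorphic_on F U ==> cx_holomorphic_on (%z. F z ^ n) U"
  by (induction n) (auto intro: cx_holomorphic_on_mult simp: cx_holomorphic_on_open)

lemma cx_holomorphic_on_linear:
  assumes "bounded_linear F" "complex_linear F" "open U"
  shows "cx_holomorphic_on F U"
  using assms by (intro cx_holomorphic_onI) (auto intro!: bounded_linear_imp_has_derivative)

lemma cx_holomorphic_on_compose_holomorphic:
  assumes F: "cx_holomorphic_on F U" and g: "g holomorphic_on V" "open V" "F ` U \<subseteq> V"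
  shows "cx_holomorphic_on (%z. g (F z)) U"
proof (rule cx_holomorphic_onI)
  show "open U" using F by (rule cx_holomorphic_on_open)
  fix z assume z: "z \<in> U"
  obtain D where D: "(F has_derivative D) (at z)" "complex_linear D"
    using F z by (rule cx_holomorphic_onE)
  obtain g' where g': "(g has_field_derivative g') (at (F z))"
    using g z by (metis field_differentiable_def holomorphic_on_imp_differentiable_at image_subset_iff)
  have "((%z. g (F z)) has_derivative (%h. g' * D h)) (at z)"
    using diff_chain_at[OF D(1) g'[unfolded has_field_derivative_def]] by (simp add: o_def)
  then show "\<exists>D. ((%z. g (F z)) has_derivative D) (at z) \<and> complex_linear D"
    using D(2) by (auto simp: complex_linear_def intro!: exI)
qed

lemma cx_holomorphic_on_divide:
  assumes "cx_holomorphic_on F U" "cx_holomorphic_on G U" "!!z. z \<in> U ==> G z ~= 0"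
  shows "cx_holomorphic_on (%z. F z / G z) U"
proof -
  have "inverse holomorphic_on (- {0::complex})"
    by (intro holomorphic_intros) auto
  then have "cx_holomorphic_on (%z. inverse (G z)) U"
    by (rule cx_holomorphic_on_compose_holomorphic[OF assms(2)]) (use assms(3) in auto)
  then show ?thesis
    using cx_holomorphic_on_mult[OF assms(1)] by (simp add: divide_inverse)
qed

text \<open>Inner maps of compositions take values in pairs, so complex linearity of their
  derivative is expressed by commuting with \<open>cscale \<i>\<close> instead of multiplication by
  \<open>\<i>\<close>.\<close>

definition cx_hol_map :: "('a::euclidean_space cx \<Rightarrow> 'a cx) \<Rightarrow> 'a cx set \<Rightarrow> bool" where
  "cx_hol_map P U \<longleftrightarrow> open U \<and> (\<forall>z\<in>U. \<exists>D. (P has_derivative D) (at z) \<and>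
     (\<forall>w. D (cscale \<i> w) = cscale \<i> (D w)))"

lemma cscale_ii: "cscale \<i> (x, v) = (- v, x)"
  by (simp add: cscale_def)

lemma cx_hol_map_open: "cx_hol_map P U ==> open U"
  by (simp add: cx_hol_map_def)

lemma cx_hol_map_continuous_on: "cx_hol_map P U ==> continuous_on U P"
  unfolding cx_hol_map_def
  by (meson continuous_at_imp_continuous_on has_derivative_continuous)

lemma cx_holomorphic_on_compose:
  assumes P: "cx_hol_map P U" and F: "cx_holomorphic_on F V" and sub: "P ` U \<subseteq> V"
  shows "cx_holomorphic_on (%z. F (P z)) U"
proof (rule cx_holomorphic_onI)
  show "open U" using P by (rule cx_hol_map_open)
  fix z assume z: "z \<in> U"
  obtain E where E: "(P has_derivative E) (at z)" "!!w. E (cscale \<i> w) = cscale \<i> (E w)"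
    using P z by (auto simp: cx_hol_map_def)
  obtain D where D: "(F has_derivative D) (at (P z))" "complex_linear D"
    using F sub z by (meson cx_holomorphic_onE image_subset_iff)
  have "((%z. F (P z)) has_derivative (%h. D (E h))) (at z)"
    using diff_chain_at[OF E(1) D(1)] by (simp add: o_def)
  moreover have "complex_linear (%h. D (E h))"
    unfolding complex_linear_def
    by (metis D(2) E(2) complex_linear_def cscale_ii surj_pair)
  ultimately show "\<exists>D. ((%z. F (P z)) has_derivative D) (at z) \<and> complex_linear D"
    by blast
qed

lemma cx_hol_map_affine:
  assumes "bounded_linear D" "!!w. D (cscale \<i> w) = cscale \<i> (D w)" "open U"
  shows "cx_hol_map (%z. c + D z) U"
  unfolding cx_hol_map_def using assms
  by (auto intro!: exI[of _ D] derivative_eq_intros bounded_linear_imp_has_derivative)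

lemma cx_hol_map_add:
  assumes "cx_hol_map P U" "cx_hol_map Q U"
  shows "cx_hol_map (%z. P z + Q z) U"
  unfolding cx_hol_map_def
proof (intro conjI ballI)
  show "open U" using assms(1) by (rule cx_hol_map_open)
  fix z assume z: "z \<in> U"
  obtain E where E: "(P has_derivative E) (at z)" "!!w. E (cscale \<i> w) = cscale \<i> (E w)"
    using assms(1) z by (auto simp: cx_hol_map_def)
  obtain D where D: "(Q has_derivative D) (at z)" "!!w. D (cscale \<i> w) = cscale \<i> (D w)"
    using assms(2) z by (auto simp: cx_hol_map_def)
  show "\<exists>D. ((%z. P z + Q z) has_derivative D) (at z) \<and> (\<forall>w. D (cscale \<i> w) = cscale \<i> (D w))"
    by (intro exI[of _ "%h. E h + D h"] conjI has_derivative_add[OF E(1) D(1)])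
      (simp only: E(2) D(2) cscale.add_right simp_thms)
qed

lemma cx_hol_map_cscale:
  assumes "cx_holomorphic_on F U"
  shows "cx_hol_map (%z. cscale (F z) w) U"
  unfolding cx_hol_map_def
proof (intro conjI ballI)
  show "open U" using assms by (rule cx_holomorphic_on_open)
  fix z assume z: "z \<in> U"
  obtain D where D: "(F has_derivative D) (at z)" "complex_linear D"
    using assms z by (rule cx_holomorphic_onE)
  have "((%z. cscale (F z) w) has_derivative (%h. cscale (D h) w)) (at z)"
    by (rule bounded_linear.has_derivative[OF cscale.bounded_linear_left D(1)])
  moreover have "linear D" using D(1) has_derivative_linear by blast
  ultimately show "\<exists>D. ((%z. cscale (F z) w) has_derivative D) (at z) \<and>
      (\<forall>w. D (cscale \<i> w) = cscale \<i> (D w))"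
    using complex_linear_cscale[OF _ D(2)] by (intro exI conjI) (auto simp: cscale_cscale)
qed

text \<open>Restriction to a complex line is how one-variable theory enters: the identity theorem,
  Cauchy's formula and removable singularities are all applied to such restrictions.\<close>

lemma holomorphic_on_cx_line:
  assumes "cx_holomorphic_on F U"
  shows "(%c. F (y + cscale c w)) holomorphic_on {c. y + cscale c w \<in> U}"
proof (rule holomorphic_onI)
  fix c assume c: "c \<in> {c. y + cscale c w \<in> U}"
  obtain D where D: "(F has_derivative D) (at (y + cscale c w))" "complex_linear D"
    using assms c by (auto elim: cx_holomorphic_onE)
  have lin: "linear D" using D(1) has_derivative_linear by blast
  have "((%c. y + cscale c w) has_derivative (%h. cscale h w)) (at c)"
    by (auto intro!: derivative_eq_intros bounded_linear_imp_has_derivative cscale.bounded_linear_left)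
  then have "((%c. F (y + cscale c w)) has_derivative (%h. D (cscale h w))) (at c)"
    using diff_chain_at[of "%c. y + cscale c w" _ _ F, OF _ D(1)] by (fastforce simp: o_def)
  then have "((%c. F (y + cscale c w)) has_field_derivative D w) (at c)"
    unfolding has_field_derivative_def using complex_linear_cscale[OF lin D(2)]
    by (simp add: mult_commute_abs)
  then show "(%c. F (y + cscale c w)) field_differentiable (at c within {c. y + cscale c w \<in> U})"
    using field_differentiable_at_within field_differentiable_def by blast
qed

lemma deriv_cx_line:
  assumes D: "(F has_derivative D) (at y)" "complex_linear D"
  shows "((%c. F (y + cscale c w)) has_field_derivative D w) (at 0)"
proof -
  have lin: "linear D" using D(1) has_derivative_linear by blast
  have "((%c. y + cscale c w) has_derivative (%h. cscale h w)) (at 0)"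
    by (auto intro!: derivative_eq_intros bounded_linear_imp_has_derivative cscale.bounded_linear_left)
  moreover have "(F has_derivative D) (at (y + cscale 0 w))" using D(1) by (simp add: cscale.zero_left)
  ultimately have "((%c. F (y + cscale c w)) has_derivative (%h. D (cscale h w))) (at 0)"
    using diff_chain_at by (fastforce simp: o_def)
  then show ?thesis
    unfolding has_field_derivative_def using complex_linear_cscale[OF lin D(2)]
    by (simp add: mult_commute_abs)
qed

section \<open>Identity theorem and absence of zero divisors on convex sets\<close>

lemma open_line_preimage: "open U ==> open {c. y + cscale c w \<in> U}"
proof -
  assume "open U"
  moreover have "{c. y + cscale c w \<in> U} = (%c. y + cscale c w) -` U" by auto
  moreover have "continuous_on UNIV (%c. y + cscale c w)" by (intro continuous_intros)
  ultimately show ?thesis by (simp add: continuous_on_open_vimage)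
qed

lemma convex_line_preimage: "convex U ==> convex {c. y + cscale c w \<in> U}"
proof -
  assume "convex U"
  then show ?thesis
    unfolding convex_def
  proof (intro allI impI ballI, goal_cases)
    case (1 a b u v)
    have "y + cscale (u *\<^sub>R a + v *\<^sub>R b) w = u *\<^sub>R (y + cscale a w) + v *\<^sub>R (y + cscale b w)"
      using 1(6) by (simp add: cscale.add_left cscale.scaleR_left algebra_simps flip: scaleR_add_left)
    with 1 show ?case by auto
  qed
qed

text \<open>The complex line through \<open>y\<close> and a point \<open>p\<close> of
  \<open>V\<close> meets the convex set \<open>U\<close> in a connected set, on which the
  one-variable identity theorem applies; the parameter 1 gives \<open>y\<close>.\<close>

lemma cx_identity:
  assumes F: "cx_holomorphic_on F U" and "convex U" and V: "open V" "V \<subseteq> U" "V ~= {}"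
    and F0: "!!z. z \<in> V ==> F z = 0" and y: "y \<in> U"
  shows "F y = 0"
proof -
  obtain p where p: "p \<in> V" using V by auto
  let ?S = "{c. p + cscale c (y - p) \<in> U}" and ?S' = "{c. p + cscale c (y - p) \<in> V}"
  have "(%c. F (p + cscale c (y - p))) 1 = (%_. 0) 1"
  proof (rule analytic_continuation_open[of ?S' ?S "%c. F (p + cscale c (y - p))" "%_. 0" 1])
    show "open ?S'" "open ?S" using V(1) cx_holomorphic_on_open[OF F] by (simp_all add: open_line_preimage)
    have "0 \<in> ?S'" using p by (simp add: cscale.zero_left)
    then show "?S' ~= {}" by blast
    show "connected ?S" using convex_line_preimage[OF \<open>convex U\<close>] convex_connected by blast
    show "(%c. F (p + cscale c (y - p))) holomorphic_on ?S" by (rule holomorphic_on_cx_line[OF F])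
  qed (use V F0 y in auto)
  then show ?thesis by simp
qed

text \<open>Where \<open>G\<close> does not vanish, \<open>F\<close> must, and that set is open; the
  identity theorem spreads the zeros of \<open>F\<close>.\<close>

lemma cx_integral_domain:
  assumes F: "cx_holomorphic_on F U" and G: "cx_holomorphic_on G U" and "convex U"
    and FG: "!!z. z \<in> U ==> F z * G z = 0"
  shows "(\<forall>z\<in>U. F z = 0) \<or> (\<forall>z\<in>U. G z = 0)"
proof (rule disjCI)
  assume "\<not> (\<forall>z\<in>U. G z = 0)"
  then obtain p where p: "p \<in> U" "G p ~= 0" by auto
  have "open (G -` (- {0}) \<inter> U)"
    using cx_holomorphic_on_continuous_on[OF G] cx_holomorphic_on_open[OF G]
    by (simp add: continuous_on_open_vimage open_Compl)
  then show "\<forall>z\<in>U. F z = 0"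
    using cx_identity[OF F \<open>convex U\<close>, of "G -` (- {0}) \<inter> U"] p FG by fastforce
qed

section \<open>Cauchy integrals over circles and continuity of the derivative\<close>

lemma deriv_circle_integral:
  fixes f :: "complex \<Rightarrow> complex"
  assumes f: "f holomorphic_on U" and U: "cball 0 r \<subseteq> U" "open U" and r: "0 < r"
  shows "deriv f 0 = integral {0..2 * pi} (%t. f (of_real r * cis t) / (of_real r * cis t)) / (2 * pi)"
proof -
  have "f holomorphic_on cball 0 r" using f U(1) holomorphic_on_subset by blast
  then have "(f has_field_derivative (1 / (2 * of_real pi * \<i>) *
      contour_integral (circlepath 0 r) (%u. f u / (u - 0)^2))) (at 0)"
    using r by (intro Cauchy_derivative_integral_circlepath)
      (auto intro: holomorphic_on_imp_continuous_on holomorphic_on_subset)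
  then have "deriv f 0 = 1 / (2 * of_real pi * \<i>) * contour_integral (circlepath 0 r) (%u. f u / u^2)"
    using DERIV_imp_deriv by fastforce
  also have "contour_integral (circlepath 0 r) (%u. f u / u^2) =
      integral {0..2 * pi} (%t. \<i> * (f (of_real r * cis t) / (of_real r * cis t)))"
    unfolding circlepath_def
    by (subst contour_integral_part_circlepath_eq)
      (use r in \<open>auto intro!: integral_cong simp: power2_eq_square field_simps\<close>)
  also have "\<dots> = \<i> * integral {0..2 * pi} (%t. f (of_real r * cis t) / (of_real r * cis t))"
    by (simp flip: integral_mult_right)
  finally show ?thesis by simp
qed

lemma mean_value_circle:
  fixes f :: "complex \<Rightarrow> complex"
  assumes f: "f holomorphic_on U" and U: "cball 0 r \<subseteq> U" and r: "0 < r"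
  shows "f 0 = integral {0..2 * pi} (%t. f (of_real r * cis t)) / (2 * pi)"
proof -
  have "f holomorphic_on cball 0 r" using f U(1) holomorphic_on_subset by blast
  then have "((%u. f u / (u - 0)) has_contour_integral (2 * of_real pi * \<i> * f 0)) (circlepath 0 r)"
    using r by (intro Cauchy_integral_circlepath_simple) auto
  then have "((%t. f (0 + of_real r * cis t) / (0 + of_real r * cis t - 0) * r * \<i> * cis t) has_integral
      2 * of_real pi * \<i> * f 0) {0..2 * pi}"
    unfolding circlepath_def by (subst (asm) has_contour_integral_part_circlepath_iff) auto
  then have "((%t. \<i> * f (of_real r * cis t)) has_integral 2 * of_real pi * \<i> * f 0) {0..2 * pi}"
    by (rule has_integral_eq[rotated]) (use r in auto)
  then have "\<i> * integral {0..2 * pi} (%t. f (of_real r * cis t)) = 2 * of_real pi * \<i> * f 0"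
    by (simp add: integral_unique flip: integral_mult_right)
  then show ?thesis by (simp add: field_simps)
qed

text \<open>Bundled as a bounded linear function because differentiation under the integral sign
  asks for a continuous family of such derivatives.\<close>

definition cx_deriv :: "('a::euclidean_space cx \<Rightarrow> complex) \<Rightarrow> 'a cx \<Rightarrow> 'a cx \<Rightarrow>\<^sub>L complex" where
  "cx_deriv F z = Blinfun (frechet_derivative F (at z))"

lemma cx_deriv:
  assumes "cx_holomorphic_on F U" "z \<in> U"
  shows "(F has_derivative cx_deriv F z) (at z)" "complex_linear (cx_deriv F z)"
proof -
  obtain D where D: "(F has_derivative D) (at z)" "complex_linear D"
    using assms by (rule cx_holomorphic_onE)
  have "frechet_derivative F (at z) = D" using D(1) frechet_derivative_at by metis
  moreover have "bounded_linear D" using D(1) has_derivative_bounded_linear by blast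
  ultimately have "blinfun_apply (cx_deriv F z) = D"
    unfolding cx_deriv_def by (simp add: bounded_linear_Blinfun_apply)
  then show "(F has_derivative cx_deriv F z) (at z)" "complex_linear (cx_deriv F z)"
    using D by simp_all
qed

text \<open>Holomorphy is given only as pointwise complex differentiability. Cauchy's formula writes
  the derivative in a direction \<open>w\<close> as an integral over a circle in that direction,
  over a fixed real interval, and this integral depends continuously on the centre.\<close>

lemma continuous_on_cx_deriv:
  assumes F: "cx_holomorphic_on F U"
  shows "continuous_on U (cx_deriv F)"
proof (rule continuous_on_blinfun_componentwise)
  fix w :: "'a \<times> 'a"
  have opU: "open U" using F by (rule cx_holomorphic_on_open)
  have "continuous (at z) (%x. blinfun_apply (cx_deriv F x) w)" if z: "z \<in> U" for z
  proof -
    obtain e where e: "e > 0" "ball z e \<subseteq> U" using opU z openE by blast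
    \<comment> \<open>Circles of radius \<open>r\<close> in direction \<open>w\<close> about points
      of the half ball stay in \<open>U\<close>; the added 1 covers \<open>w = 0\<close>.\<close>
    define r where "r = e / 2 / (norm w + 1)"
    have r: "r > 0" "r * norm w < e / 2"
      using e by (auto simp: r_def field_simps add_pos_nonneg)
    have inU: "x + cscale c w \<in> U" if "x \<in> ball z (e / 2)" "cmod c <= r" for x c
    proof -
      have "norm (cscale c w) <= r * norm w" using that by (simp add: norm_cscale mult_right_mono)
      then have "dist z (x + cscale c w) < e"
        using that r(2) dist_triangle[of z "x + cscale c w" x] by (simp add: dist_norm)
      then show ?thesis using e(2) by auto
    qed
    have eq: "blinfun_apply (cx_deriv F x) w = integral (cbox 0 (2 * pi))
        (%t. F (x + cscale (of_real r * cis t) w) / (of_real r * cis t)) / (2 * pi)" if x: "x \<in> ball z (e / 2)" for x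
    proof -
      have xU: "x \<in> U" using inU[OF x, of 0] r(1) by (simp add: cscale.zero_left)
      have "blinfun_apply (cx_deriv F x) w = deriv (%c. F (x + cscale c w)) 0"
        using deriv_cx_line[OF cx_deriv[OF F xU]] DERIV_imp_deriv by metis
      then show ?thesis
        using deriv_circle_integral[OF holomorphic_on_cx_line[OF F, of x w] _
            open_line_preimage[OF opU] r(1)] inU[OF x]
        by (simp add: cbox_interval subset_eq)
    qed
    have "continuous_on (ball z (e / 2) \<times> cbox 0 (2 * pi))
        (%(x, t). F (x + cscale (of_real r * cis t) w) / (of_real r * cis t))"
      unfolding split_beta using r(1) inU
      by (intro continuous_intros continuous_on_compose2[OF cx_holomorphic_on_continuous_on[OF F]])
        (auto simp: norm_mult)
    then have "continuous_on (ball z (e / 2)) (%x. integral (cbox 0 (2 * pi))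
        (%t. F (x + cscale (of_real r * cis t) w) / (of_real r * cis t)) / (2 * pi))"
      by (intro continuous_intros integral_continuous_on_param) auto
    then have "continuous_on (ball z (e / 2)) (%x. blinfun_apply (cx_deriv F x) w)"
      by (rule continuous_on_eq) (use eq in auto)
    then show ?thesis using e(1) by (simp add: continuous_on_eq_continuous_at)
  qed
  then show "continuous_on U (%x. blinfun_apply (cx_deriv F x) w)"
    by (simp add: continuous_at_imp_continuous_on)
qed

text \<open>Differentiation under the integral sign. Evaluating the integrated derivative at a
  vector commutes with the integral, so complex linearity is inherited.\<close>

lemma cx_holomorphic_circle_mean:
  assumes f: "cx_holomorphic_on f V" and B: "!!y t. y \<in> ball z \<eta> ==> y + cscale (of_real r * cis t) w \<in> V"
  shows "cx_holomorphic_on (%y. integral {0..2 * pi} (%t. f (y + cscale (of_real r * cis t) w))) (ball z \<eta>)"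
proof (rule cx_holomorphic_onI)
  fix y assume y: "y \<in> ball z \<eta>"
  let ?D = "%y t. cx_deriv f (y + cscale (of_real r * cis t) w)"
  have der: "((%y. f (y + cscale (of_real r * cis t) w)) has_derivative ?D x t) (at x)"
    if "x \<in> ball z \<eta>" for x t
    using cx_deriv(1)[OF f B[OF that]]
      diff_chain_at[of "%y. y + cscale (of_real r * cis t) w" "%h. h" x f "?D x t"]
    by (simp add: o_def has_derivative_add_const)
  have cont: "continuous_on (ball z \<eta> \<times> cbox 0 (2 * pi)) (%(x, t). ?D x t)"
    unfolding split_beta using B
    by (intro continuous_intros continuous_on_compose2[OF continuous_on_cx_deriv[OF f]]) auto
  have int: "(%t. f (x + cscale (of_real r * cis t) w)) integrable_on cbox 0 (2 * pi)" if "x \<in> ball z \<eta>" for x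
    using B[OF that] by (intro integrable_continuous continuous_intros
        continuous_on_compose2[OF cx_holomorphic_on_continuous_on[OF f]]) auto
  have "((%y. integral (cbox 0 (2 * pi)) (%t. f (y + cscale (of_real r * cis t) w))) has_derivative
      integral (cbox 0 (2 * pi)) (?D y)) (at y within ball z \<eta>)"
    by (rule leibniz_rule[OF has_derivative_at_withinI[OF der] int cont y convex_ball])
  then have d: "((%y. integral {0..2 * pi} (%t. f (y + cscale (of_real r * cis t) w))) has_derivative
      integral (cbox 0 (2 * pi)) (?D y)) (at y)"
    unfolding at_within_open[OF y open_ball] cbox_interval .
  have "continuous_on (cbox 0 (2 * pi)) (?D y)"
    using B[OF y] by (intro continuous_intros continuous_on_compose2[OF continuous_on_cx_deriv[OF f]]) auto
  then have "(?D y) integrable_on cbox 0 (2 * pi)" by (rule integrable_continuous)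
  then have ap: "blinfun_apply (integral (cbox 0 (2 * pi)) (?D y)) h =
      integral (cbox 0 (2 * pi)) (%t. blinfun_apply (?D y t) h)" for h
    by (rule blinfun_apply_integral)
  have "complex_linear (integral (cbox 0 (2 * pi)) (?D y))"
    unfolding complex_linear_def ap
    using cx_deriv(2)[OF f B[OF y]] by (simp add: complex_linear_def)
  with d show "\<exists>D. ((%y. integral {0..2 * pi} (%t. f (y + cscale (of_real r * cis t) w))) has_derivative D) (at y)
      \<and> complex_linear D" by blast
qed simp

section \<open>Riemann extension and integral closedness of holomorphic germs\<close>

lemma removable_bounded:
  assumes "open S" "finite X" "X \<subseteq> S" and f: "f holomorphic_on (S - X)"
    and bd: "!!c. c \<in> S - X ==> cmod (f c) <= M"
  shows "\<exists>g. g holomorphic_on S \<and> (\<forall>z\<in>S - X. g z = f z)"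
proof (rule removable_singularities)
  fix c assume c: "c \<in> X"
  have "open (S - (X - {c}))" using assms by (simp add: finite_imp_closed open_Diff)
  then have "eventually (%x. x \<in> S - (X - {c}) - {c}) (at c)"
    using c assms(3) by (intro eventually_at_in_open) auto
  then have "eventually (%x. norm (f x) <= M * norm (1::complex)) (at c)"
    by eventually_elim (use bd in auto)
  then show "f \<in> O[at c](%_. 1)" by (rule bigoI)
qed (use assms in \<open>auto simp: interior_open\<close>)

text \<open>On lines transversal to the zero set of \<open>B\<close> the singularities are isolated; the
  extension is the mean value over a circle in such a line.\<close>

lemma riemann_extension:
  assumes B: "cx_holomorphic_on B (ball z r)" and p: "p \<in> ball z r" "B p ~= 0"
    and f: "cx_holomorphic_on f {x \<in> ball z r. B x ~= 0}"
    and bd: "!!x. x \<in> ball z r ==> B x ~= 0 ==> cmod (f x) <= M"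
  obtains \<rho> R where "0 < \<rho>" "\<rho> <= r" "cx_holomorphic_on R (ball z \<rho>)"
    "!!x. x \<in> ball z \<rho> ==> B x ~= 0 ==> R x = f x"
proof -
  \<comment> \<open>The line from \<open>z\<close> towards a point where \<open>B\<close> is
    nonzero: on it \<open>B\<close> does not vanish identically, so its zeros are isolated.\<close>
  define w where "w = p - z"
  define \<Omega> where "\<Omega> y = {c. y + cscale c w \<in> ball z r}" for y
  have r: "r > 0" using p(1) by (metis mem_ball dist_not_less_zero le_less_trans less_eq_real_def not_le zero_le_dist)
  have \<Omega>: "open (\<Omega> y)" "connected (\<Omega> y)" "convex (\<Omega> y)" for y
    unfolding \<Omega>_def by (simp_all only: open_line_preimage open_ball convex_ball convex_line_preimage convex_connected)
  have holB: "(%c. B (y + cscale c w)) holomorphic_on \<Omega> y" for y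
    unfolding \<Omega>_def by (rule holomorphic_on_cx_line[OF B])
  have \<Omega>01: "0 \<in> \<Omega> z" "1 \<in> \<Omega> z" using p r by (auto simp: \<Omega>_def w_def cscale.zero_left)
  obtain d where d: "0 < d" "!!c. c \<in> ball 0 d - {0} ==> B (z + cscale c w) ~= 0"
  proof (cases "B z = 0")
    case True
    obtain d where d: "d > 0" "ball 0 d \<subseteq> \<Omega> z" "!!c. c \<in> ball 0 d - {0} ==> B (z + cscale c w) ~= 0"
      by (rule isolated_zeros[OF holB[of z] \<Omega>(1) \<Omega>(2) \<Omega>01(1) _ \<Omega>01(2)])
        (use True p in \<open>auto simp: cscale.zero_left w_def\<close>)
    then show ?thesis using that by blast
  next
    case False
    have "continuous_on (\<Omega> z) (%c. B (z + cscale c w))"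
      using holB holomorphic_on_imp_continuous_on by blast
    then have "open ((%c. B (z + cscale c w)) -` (- {0}) \<inter> \<Omega> z)"
      using \<Omega>(1) by (simp add: continuous_on_open_vimage open_Compl)
    moreover have "0 \<in> (%c. B (z + cscale c w)) -` (- {0}) \<inter> \<Omega> z"
      using False \<Omega>01 by (simp add: cscale.zero_left)
    ultimately obtain d where "d > 0" "ball 0 d \<subseteq> (%c. B (z + cscale c w)) -` (- {0}) \<inter> \<Omega> z"
      using openE by blast
    then show ?thesis using that by blast
  qed
  obtain d2 where d2: "d2 > 0" "ball 0 d2 \<subseteq> \<Omega> z" using \<Omega>(1) \<Omega>01(1) openE by blast
  \<comment> \<open>A circle about \<open>z\<close> in this line that avoids the zeros of
    \<open>B\<close> and whose disc stays in the ball.\<close>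
  define \<delta> where "\<delta> = min d d2 / 2"
  have \<delta>0: "\<delta> > 0" "\<delta> < d" "\<delta> < d2" using d d2 by (auto simp: \<delta>_def min_def)
  have "B (z + cscale c w) ~= 0" if "c \<in> sphere 0 \<delta>" for c
    using that \<delta>0 by (intro d(2)) auto
  moreover have "cball 0 \<delta> \<subseteq> \<Omega> z" using \<delta>0 by (intro order_trans[OF _ d2(2)]) auto
  ultimately have \<delta>: "\<delta> > 0" "cball 0 \<delta> \<subseteq> \<Omega> z" "!!c. c \<in> sphere 0 \<delta> ==> B (z + cscale c w) ~= 0"
    using \<delta>0 by auto
  let ?O = "{x \<in> ball z r. B x ~= 0}"
  have opO: "open ?O" using f by (rule cx_holomorphic_on_open)
  have comp: "compact ((%c. z + cscale c w) ` T)" if "compact T" for T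
    using that by (intro compact_continuous_image continuous_intros) auto
  \<comment> \<open>By compactness, parallel lines through points near \<open>z\<close> keep the
    disc inside the ball and the circle off the zeros of \<open>B\<close>.\<close>
  obtain e1 where e1: "e1 > 0" "(\<Union>x\<in>(%c. z + cscale c w) ` cball 0 \<delta>. ball x e1) \<subseteq> ball z r"
    by (rule compact_subset_open_imp_ball_epsilon_subset[OF comp[of "cball 0 \<delta>"], of "ball z r"])
      (use \<delta>(2) in \<open>auto simp: \<Omega>_def\<close>)
  obtain e2 where e2: "e2 > 0" "(\<Union>x\<in>(%c. z + cscale c w) ` sphere 0 \<delta>. ball x e2) \<subseteq> ?O"
    by (rule compact_subset_open_imp_ball_epsilon_subset[OF comp[of "sphere 0 \<delta>"], of ?O])
      (use \<delta> opO in \<open>auto simp: \<Omega>_def\<close>)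
  define \<eta> where "\<eta> = Min {e1, e2, r}"
  have \<eta>: "\<eta> > 0" "\<eta> <= r" "\<eta> <= e1" "\<eta> <= e2" using e1 e2 r by (auto simp: \<eta>_def)
  have cb: "y + cscale c w \<in> ball z r" if "y \<in> ball z \<eta>" "c \<in> cball 0 \<delta>" for y c
    using that \<eta> e1(2) by (force simp: dist_norm algebra_simps)
  have sp: "y + cscale c w \<in> ?O" if "y \<in> ball z \<eta>" "c \<in> sphere 0 \<delta>" for y c
  proof -
    have "y + cscale c w \<in> ball (z + cscale c w) e2" using that \<eta> by (auto simp: dist_norm)
    then show ?thesis using e2(2) that by blast
  qed
  define R where "R y = integral {0..2 * pi} (%t. f (y + cscale (of_real \<delta> * cis t) w)) / (2 * pi)" for y
  have "cx_holomorphic_on (%y. integral {0..2 * pi} (%t. f (y + cscale (of_real \<delta> * cis t) w))) (ball z \<eta>)"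
    by (rule cx_holomorphic_circle_mean[OF f]) (use sp \<delta>(1) in \<open>auto simp: norm_mult\<close>)
  then have R: "cx_holomorphic_on R (ball z \<eta>)"
    unfolding R_def by (intro cx_holomorphic_on_divide) auto
  have Rf: "R y = f y" if y: "y \<in> ball z \<eta>" "B y ~= 0" for y
  proof -
    define b where "b c = B (y + cscale c w)" for c
    have holb: "b holomorphic_on \<Omega> y" using holB[of y] unfolding b_def .
    have cb\<Omega>: "cball 0 \<delta> \<subseteq> \<Omega> y" using cb[OF y(1)] by (auto simp: \<Omega>_def)
    have b0: "b 0 ~= 0" using y by (simp add: b_def cscale.zero_left)
    define X where "X = {c \<in> cball 0 \<delta>. b c = 0}"
    have "finite X"
    proof (cases "b constant_on \<Omega> y")
      case True
      have "0 \<in> \<Omega> y" using cb\<Omega> \<delta>(1) by auto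
      then have "X = {}" using True b0 cb\<Omega> by (force simp: constant_on_def X_def)
      then show ?thesis by simp
    next
      case False
      show ?thesis unfolding X_def
        by (rule holomorphic_compact_finite_zeros[OF holb \<Omega>(1) \<Omega>(2) compact_cball cb\<Omega> False])
    qed
    \<comment> \<open>An open neighbourhood of the closed disc in which the only zeros of
      \<open>b\<close> are the finitely many in \<open>X\<close>; the bounded function extends
      across these, and the mean value property then applies at the centre.\<close>
    define S where "S = ball 0 \<delta> \<union> (b -` (- {0}) \<inter> \<Omega> y)"
    have "open (b -` (- {0}) \<inter> \<Omega> y)"
      using iffD1[OF continuous_on_open_vimage[OF \<Omega>(1)] holomorphic_on_imp_continuous_on[OF holb]]
      by (simp add: open_Compl)
    then have S: "open S" unfolding S_def by (intro open_Un open_ball)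
    have bsp: "b c ~= 0" if "c \<in> sphere 0 \<delta>" for c using sp[OF y(1) that] by (simp add: b_def)
    have XS: "X \<subseteq> S"
    proof
      fix c assume "c \<in> X"
      then have "c \<in> cball 0 \<delta>" "b c = 0" by (auto simp: X_def)
      then show "c \<in> S" using bsp[of c] by (cases "cmod c = \<delta>") (auto simp: S_def)
    qed
    have cbS: "cball 0 \<delta> \<subseteq> S"
    proof
      fix c :: complex assume "c \<in> cball 0 \<delta>"
      then show "c \<in> S" using bsp[of c] cb\<Omega> by (cases "cmod c = \<delta>") (auto simp: S_def)
    qed
    have SX: "S - X \<subseteq> {c. y + cscale c w \<in> ?O}"
    proof
      fix c assume c: "c \<in> S - X"
      then have "c \<in> \<Omega> y" using cb\<Omega> by (auto simp: S_def)
      moreover have "b c ~= 0" using c by (auto simp: S_def X_def)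
      ultimately show "c \<in> {c. y + cscale c w \<in> ?O}" by (auto simp: \<Omega>_def b_def)
    qed
    obtain g where g: "g holomorphic_on S" "!!c. c \<in> S - X ==> g c = f (y + cscale c w)"
      using removable_bounded[OF S \<open>finite X\<close> XS, of "%c. f (y + cscale c w)" M]
        holomorphic_on_subset[OF holomorphic_on_cx_line[OF f] SX] bd SX by blast
    have "f y = g 0" using g(2)[of 0] b0 \<delta>(1) by (simp add: S_def X_def cscale.zero_left)
    also have "\<dots> = integral {0..2 * pi} (%t. g (of_real \<delta> * cis t)) / (2 * pi)"
      by (rule mean_value_circle[OF g(1) cbS \<delta>(1)])
    also have "integral {0..2 * pi} (%t. g (of_real \<delta> * cis t)) =
        integral {0..2 * pi} (%t. f (y + cscale (of_real \<delta> * cis t) w))"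
    proof (rule integral_cong)
      fix t :: real
      have "of_real \<delta> * cis t \<in> sphere 0 \<delta>" using \<delta>(1) by (simp add: norm_mult)
      then show "g (of_real \<delta> * cis t) = f (y + cscale (of_real \<delta> * cis t) w)"
        using bsp cbS g(2) by (auto simp: X_def subset_eq)
    qed
    finally show ?thesis by (simp add: R_def)
  qed
  show ?thesis by (rule that[OF \<eta>(1,2) R Rf])
qed

text \<open>If \<open>cmod x > 1\<close>, the equation gives
  \<open>cmod x ^ n <= n * C * cmod x ^ (n - 1)\<close>, and the common power can be
  cancelled.\<close>

lemma cmod_le_of_monic_root:
  assumes "x ^ n + (\<Sum>i<n. c i * x ^ i) = 0" "!!i. i < n ==> cmod (c i) <= C"
  shows "cmod x <= 1 + real n * C"
proof (cases "cmod x <= 1")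
  case True
  have "0 <= real n * C"
    using order_trans[OF norm_ge_zero assms(2)[of 0]] by (cases "n = 0") auto
  with True show ?thesis by linarith
next
  case False
  have n: "n ~= 0" using assms(1) by (intro notI) simp
  have "cmod x ^ n = cmod (\<Sum>i<n. c i * x ^ i)"
    using assms(1) by (metis add_eq_0_iff2 norm_minus_cancel norm_power)
  also have "\<dots> <= (\<Sum>i<n. C * cmod x ^ (n - 1))"
  proof (rule sum_norm_le)
    fix i assume "i \<in> {..<n}"
    then show "cmod (c i * x ^ i) <= C * cmod x ^ (n - 1)"
      unfolding norm_mult norm_power using assms(2)[of i] False
      by (intro mult_mono power_increasing) (auto intro: order_trans[OF norm_ge_zero])
  qed
  also have "\<dots> = real n * C * cmod x ^ (n - 1)" by simp
  finally have "cmod x * cmod x ^ (n - 1) <= real n * C * cmod x ^ (n - 1)"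
    using n by (metis power_eq_if)
  moreover have "0 < cmod x ^ (n - 1)" using False by (intro zero_less_power) auto
  ultimately show ?thesis by (auto dest: mult_right_le_imp_le)
qed

text \<open>Normality of the local rings of a complex vector space: \<open>A / B\<close> satisfies a
  monic equation with bounded coefficients, hence is bounded and extends across the zeros of
  \<open>B\<close>.\<close>

lemma cx_integrally_closed:
  assumes A: "cx_holomorphic_on A (ball z r)" and B: "cx_holomorphic_on B (ball z r)"
    and c: "!!i. i < n ==> cx_holomorphic_on (c i) (ball z r)"
    and nz: "!!\<rho>. 0 < \<rho> ==> \<rho> <= r ==> \<exists>p\<in>ball z \<rho>. B p ~= 0" and r: "r > 0"
    and eq: "!!x. x \<in> ball z r ==> A x ^ n + (\<Sum>i<n. c i x * A x ^ i * B x ^ (n - i)) = 0"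
  obtains \<rho> R where "0 < \<rho>" "\<rho> <= r" "cx_holomorphic_on R (ball z \<rho>)"
    "!!x. x \<in> ball z \<rho> ==> A x = R x * B x"
proof -
  define s where "s = r / 2"
  have s: "0 < s" "s < r" "ball z s \<subseteq> ball z r" "cball z s \<subseteq> ball z r" using r by (auto simp: s_def)
  have "\<exists>C. \<forall>x\<in>cball z s. cmod (c i x) <= C" if "i < n" for i
  proof -
    have "compact (c i ` cball z s)"
      by (intro compact_continuous_image compact_cball continuous_on_subset[OF
            cx_holomorphic_on_continuous_on[OF c[OF that]] s(4)])
    then show ?thesis
      by (meson bounded_iff compact_imp_bounded imageI)
  qed
  then obtain C where C: "!!i x. i < n ==> x \<in> cball z s ==> cmod (c i x) <= C i" by metis
  define M where "M = (\<Sum>i<n. \<bar>C i\<bar>)"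
  have CM: "cmod (c i x) <= M" if "i < n" "x \<in> cball z s" for i x
  proof -
    have "\<bar>C i\<bar> <= M" unfolding M_def by (rule member_le_sum) (use that in auto)
    then show ?thesis using C[OF that] by linarith
  qed
  have B': "cx_holomorphic_on B (ball z s)" and A': "cx_holomorphic_on A (ball z s)"
    using A B s(3) by (auto intro: cx_holomorphic_on_subset)
  have op: "open {x \<in> ball z s. B x ~= 0}"
  proof -
    have "{x \<in> ball z s. B x ~= 0} = B -` (- {0}) \<inter> ball z s" by auto
    then show ?thesis
      using cx_holomorphic_on_continuous_on[OF B'] by (simp add: continuous_on_open_vimage open_Compl)
  qed
  have "cx_holomorphic_on (%x. A x / B x) {x \<in> ball z s. B x ~= 0}"
    by (intro cx_holomorphic_on_divide cx_holomorphic_on_subset[OF A'] cx_holomorphic_on_subset[OF B'] op) auto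
  moreover have "cmod (A x / B x) <= 1 + real n * M" if x: "x \<in> ball z s" "B x ~= 0" for x
  proof (rule cmod_le_of_monic_root)
    have "(A x / B x) ^ n + (\<Sum>i<n. c i x * (A x / B x) ^ i) =
        (A x ^ n + (\<Sum>i<n. c i x * A x ^ i * B x ^ (n - i))) / B x ^ n"
      unfolding add_divide_distrib sum_divide_distrib
      using x(2) by (auto intro!: sum.cong simp: power_divide power_diff field_simps)
    then show "(A x / B x) ^ n + (\<Sum>i<n. c i x * (A x / B x) ^ i) = 0"
      using eq[OF subsetD[OF s(3) x(1)]] by simp
  qed (use CM x in auto)
  moreover obtain p where "p \<in> ball z s" "B p ~= 0" using nz[of s] s by auto
  ultimately obtain \<rho> R where R: "0 < \<rho>" "\<rho> <= s" "cx_holomorphic_on R (ball z \<rho>)"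
    "!!x. x \<in> ball z \<rho> ==> B x ~= 0 ==> R x = A x / B x"
    using riemann_extension[OF B', of p "%x. A x / B x"] by blast
  have sub: "ball z \<rho> \<subseteq> ball z s" using R(2) by auto
  have \<rho>r: "ball z \<rho> \<subseteq> ball z r" using sub s(3) by auto
  \<comment> \<open>At zeros of \<open>B\<close> the identity \<open>A = R * B\<close> follows from
    \<open>(A - R * B) * B = 0\<close> by cancelling \<open>B\<close>, which vanishes on no ball
    about \<open>z\<close>.\<close>
  have 1: "cx_holomorphic_on (%x. A x + - (R x * B x)) (ball z \<rho>)"
    by (intro cx_holomorphic_on_add cx_holomorphic_on_uminus cx_holomorphic_on_mult R
        cx_holomorphic_on_subset[OF A ] cx_holomorphic_on_subset[OF B] \<rho>r) auto
  have 2: "(A x + - (R x * B x)) * B x = 0" if "x \<in> ball z \<rho>" for x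
    using R(4)[OF that] by auto
  obtain q where q: "q \<in> ball z \<rho>" "B q ~= 0" using nz[of \<rho>] R(1,2) s by auto
  have "\<forall>x\<in>ball z \<rho>. A x + - (R x * B x) = 0"
    using cx_integral_domain[OF 1 cx_holomorphic_on_subset[OF B] convex_ball 2] \<rho>r q by auto
  then have "A x = R x * B x" if "x \<in> ball z \<rho>" for x using that by (simp add: add_eq_0_iff2)
  then show ?thesis using that[OF R(1) _ R(3)] R(2) s by auto
qed

declare split_paired_All [simp del] split_paired_Ex [simp del]

section \<open>Normality of a quotient ring\<close>

text \<open>Restates normality of the quotient through representatives modulo \<open>I\<close>,
  since germs are handled below as functions. Coefficients of an integral equation lift because the
  projection is a surjective ring homomorphism.\<close>

lemma (in cring) normal_domain_Quot:
  assumes I: "ideal I R"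
  shows "normal_domain (R Quot I) \<longleftrightarrow> I ~= carrier R \<and>
    (\<forall>a\<in>carrier R. \<forall>b\<in>carrier R. a \<otimes> b \<in> I --> a \<in> I \<or> b \<in> I) \<and>
    (\<forall>a\<in>carrier R. \<forall>b\<in>carrier R - I. \<forall>(n::nat) c. c \<in> {..<n} \<rightarrow> carrier R -->
       a [^] n \<oplus> (\<Oplus>i\<in>{..<n}. c i \<otimes> a [^] i \<otimes> b [^] (n - i)) \<in> I -->
       (\<exists>r\<in>carrier R. a \<ominus> r \<otimes> b \<in> I))"
proof -
  let ?Q = "R Quot I" and ?\<phi> = "(+>) I"
  have zero: "\<zero>\<^bsub>?Q\<^esub> = I" by (simp add: FactRing_def)
  interpret I: ideal I R by (rule I)
  interpret \<phi>: ring_hom_cring R ?Q ?\<phi> by (rule I.rcos_ring_hom_cring) (rule is_cring)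
  have phi0: "?\<phi> x = I \<longleftrightarrow> x \<in> I" if "x \<in> carrier R" for x
    using I.a_rcos_const[of x] I.a_rcos_self[OF that] by blast
  have carrQ: "carrier ?Q = ?\<phi> ` carrier R"
    unfolding FactRing_def A_RCOSETS_def' by auto
  have phieq: "a \<ominus> b \<in> I \<longleftrightarrow> ?\<phi> a = ?\<phi> b" if "a \<in> carrier R" "b \<in> carrier R" for a b
    using quotient_eq_iff_same_a_r_cos[OF I that] .
  have "domain ?Q \<longleftrightarrow> primeideal I R"
    using quot_domain_imp_primeideal[OF I] primeideal.quotient_is_domain by blast
  also have "\<dots> \<longleftrightarrow> I ~= carrier R \<and> (\<forall>a\<in>carrier R. \<forall>b\<in>carrier R. a \<otimes> b \<in> I --> a \<in> I \<or> b \<in> I)"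
    using I is_cring by (auto simp: primeideal_def primeideal_axioms_def)
  finally have 1: "domain ?Q \<longleftrightarrow> \<dots>" .
  have pow: "?\<phi> (a [^] i) = ?\<phi> a [^]\<^bsub>?Q\<^esub> i" if "a \<in> carrier R" for a and i :: nat
    using that by (induction i) simp_all
  have eq: "?\<phi> (a [^] n \<oplus> (\<Oplus>i\<in>{..<n}. c i \<otimes> a [^] i \<otimes> b [^] (n - i))) =
      ?\<phi> a [^]\<^bsub>?Q\<^esub> n \<oplus>\<^bsub>?Q\<^esub> (\<Oplus>\<^bsub>?Q\<^esub>i\<in>{..<n}. d i \<otimes>\<^bsub>?Q\<^esub> ?\<phi> a [^]\<^bsub>?Q\<^esub> i \<otimes>\<^bsub>?Q\<^esub> ?\<phi> b [^]\<^bsub>?Q\<^esub> (n - i))"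
    if "a \<in> carrier R" "b \<in> carrier R" "c \<in> {..<n} \<rightarrow> carrier R" "!!i. i < n ==> d i = ?\<phi> (c i)"
    for a b c d and n :: nat
  proof -
    have fs: "(%i. c i \<otimes> a [^] i \<otimes> b [^] (n - i)) \<in> {..<n} \<rightarrow> carrier R"
      using that(1,2) funcset_mem[OF that(3)] by (intro funcsetI m_closed nat_pow_closed) auto
    have "?\<phi> (\<Oplus>i\<in>{..<n}. c i \<otimes> a [^] i \<otimes> b [^] (n - i)) =
        (\<Oplus>\<^bsub>?Q\<^esub>i\<in>{..<n}. ?\<phi> (c i \<otimes> a [^] i \<otimes> b [^] (n - i)))"
      using \<phi>.hom_finsum[OF fs] by (simp add: o_def)
    also have "\<dots> = (\<Oplus>\<^bsub>?Q\<^esub>i\<in>{..<n}. d i \<otimes>\<^bsub>?Q\<^esub> ?\<phi> a [^]\<^bsub>?Q\<^esub> i \<otimes>\<^bsub>?Q\<^esub> ?\<phi> b [^]\<^bsub>?Q\<^esub> (n - i))"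
    proof (rule \<phi>.S.finsum_cong')
      fix i assume i: "i \<in> {..<n}"
      have "c i \<in> carrier R" using funcset_mem[OF that(3) i] .
      then show "?\<phi> (c i \<otimes> a [^] i \<otimes> b [^] (n - i)) =
          d i \<otimes>\<^bsub>?Q\<^esub> ?\<phi> a [^]\<^bsub>?Q\<^esub> i \<otimes>\<^bsub>?Q\<^esub> ?\<phi> b [^]\<^bsub>?Q\<^esub> (n - i)"
        using that i by (simp add: pow)
    next
      show "(%i. d i \<otimes>\<^bsub>?Q\<^esub> ?\<phi> a [^]\<^bsub>?Q\<^esub> i \<otimes>\<^bsub>?Q\<^esub> ?\<phi> b [^]\<^bsub>?Q\<^esub> (n - i)) \<in> {..<n} \<rightarrow> carrier ?Q"
      proof
        fix i assume "i \<in> {..<n}"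
        moreover from this have "c i \<in> carrier R" using funcset_mem[OF that(3)] by blast
        ultimately show "d i \<otimes>\<^bsub>?Q\<^esub> ?\<phi> a [^]\<^bsub>?Q\<^esub> i \<otimes>\<^bsub>?Q\<^esub> ?\<phi> b [^]\<^bsub>?Q\<^esub> (n - i) \<in> carrier ?Q"
          using that by simp
      qed
    qed simp
    finally show ?thesis
      using that fs by (simp add: pow)
  qed
  have 2: "(\<forall>a\<in>carrier ?Q. \<forall>b\<in>carrier ?Q - {\<zero>\<^bsub>?Q\<^esub>}. \<forall>(n::nat) c. c \<in> {..<n} \<rightarrow> carrier ?Q -->
        a [^]\<^bsub>?Q\<^esub> n \<oplus>\<^bsub>?Q\<^esub> (\<Oplus>\<^bsub>?Q\<^esub>i\<in>{..<n}. c i \<otimes>\<^bsub>?Q\<^esub> a [^]\<^bsub>?Q\<^esub> i \<otimes>\<^bsub>?Q\<^esub> b [^]\<^bsub>?Q\<^esub> (n - i)) = \<zero>\<^bsub>?Q\<^esub> -->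
        (\<exists>r\<in>carrier ?Q. a = r \<otimes>\<^bsub>?Q\<^esub> b)) \<longleftrightarrow>
    (\<forall>a\<in>carrier R. \<forall>b\<in>carrier R - I. \<forall>(n::nat) c. c \<in> {..<n} \<rightarrow> carrier R -->
       a [^] n \<oplus> (\<Oplus>i\<in>{..<n}. c i \<otimes> a [^] i \<otimes> b [^] (n - i)) \<in> I -->
       (\<exists>r\<in>carrier R. a \<ominus> r \<otimes> b \<in> I))" (is "?L \<longleftrightarrow> ?R")
  proof (intro iffI ballI allI impI)
    fix a b and n :: nat and c
    assume L: "?L" and a: "a \<in> carrier R" and b: "b \<in> carrier R - I" and c: "c \<in> {..<n} \<rightarrow> carrier R"
      and e: "a [^] n \<oplus> (\<Oplus>i\<in>{..<n}. c i \<otimes> a [^] i \<otimes> b [^] (n - i)) \<in> I"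
    have fs: "(%i. c i \<otimes> a [^] i \<otimes> b [^] (n - i)) \<in> {..<n} \<rightarrow> carrier R"
      using a b funcset_mem[OF c] by (intro funcsetI m_closed nat_pow_closed) auto
    have "\<exists>r\<in>carrier ?Q. ?\<phi> a = r \<otimes>\<^bsub>?Q\<^esub> ?\<phi> b"
    proof (rule L[rule_format, of "?\<phi> a" "?\<phi> b" "%i. ?\<phi> (c i)" n])
      show "?\<phi> b \<in> carrier ?Q - {\<zero>\<^bsub>?Q\<^esub>}" using b phi0 by (auto simp: zero)
      show "?\<phi> a [^]\<^bsub>?Q\<^esub> n \<oplus>\<^bsub>?Q\<^esub> (\<Oplus>\<^bsub>?Q\<^esub>i\<in>{..<n}. ?\<phi> (c i) \<otimes>\<^bsub>?Q\<^esub> ?\<phi> a [^]\<^bsub>?Q\<^esub> i \<otimes>\<^bsub>?Q\<^esub> ?\<phi> b [^]\<^bsub>?Q\<^esub> (n - i)) = \<zero>\<^bsub>?Q\<^esub>"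
        using eq[OF a _ c, of b "%i. ?\<phi> (c i)"] b e phi0[OF I.Icarr[OF e]] by (simp add: zero)
    qed (use a c in auto)
    then obtain r where r: "r \<in> carrier R" "?\<phi> a = ?\<phi> r \<otimes>\<^bsub>?Q\<^esub> ?\<phi> b" unfolding carrQ by auto
    then have "?\<phi> a = ?\<phi> (r \<otimes> b)" using b by simp
    then show "\<exists>r\<in>carrier R. a \<ominus> r \<otimes> b \<in> I"
      using r(1) a b phieq by (intro bexI[of _ r]) auto
  next
    fix A B and n :: nat and C
    assume R: "?R" and A: "A \<in> carrier ?Q" and B: "B \<in> carrier ?Q - {\<zero>\<^bsub>?Q\<^esub>}"
      and C: "C \<in> {..<n} \<rightarrow> carrier ?Q"
      and e: "A [^]\<^bsub>?Q\<^esub> n \<oplus>\<^bsub>?Q\<^esub> (\<Oplus>\<^bsub>?Q\<^esub>i\<in>{..<n}. C i \<otimes>\<^bsub>?Q\<^esub> A [^]\<^bsub>?Q\<^esub> i \<otimes>\<^bsub>?Q\<^esub> B [^]\<^bsub>?Q\<^esub> (n - i)) = \<zero>\<^bsub>?Q\<^esub>"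
    obtain a where a: "a \<in> carrier R" "A = ?\<phi> a" using A unfolding carrQ by auto
    obtain b where b: "b \<in> carrier R" "B = ?\<phi> b" using B unfolding carrQ by auto
    have bI: "b \<notin> I" using B phi0 b by (auto simp: zero)
    have "\<forall>i\<in>{..<n}. \<exists>c\<in>carrier R. C i = ?\<phi> c" using C unfolding carrQ by auto
    then obtain c where c: "!!i. i < n ==> c i \<in> carrier R" "!!i. i < n ==> C i = ?\<phi> (c i)"
      by (metis lessThan_iff)
    have cP: "c \<in> {..<n} \<rightarrow> carrier R" using c(1) by auto
    have fs: "(%i. c i \<otimes> a [^] i \<otimes> b [^] (n - i)) \<in> {..<n} \<rightarrow> carrier R"
      using a b c(1) by auto
    have "?\<phi> (a [^] n \<oplus> (\<Oplus>i\<in>{..<n}. c i \<otimes> a [^] i \<otimes> b [^] (n - i))) = I"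
      by (rule trans[OF eq[OF a(1) b(1) cP c(2)] e[unfolded a b zero]])
    moreover have "a [^] n \<oplus> (\<Oplus>i\<in>{..<n}. c i \<otimes> a [^] i \<otimes> b [^] (n - i)) \<in> carrier R"
      using a(1) fs by simp
    ultimately have "a [^] n \<oplus> (\<Oplus>i\<in>{..<n}. c i \<otimes> a [^] i \<otimes> b [^] (n - i)) \<in> I"
      using phi0 by blast
    then obtain r where "r \<in> carrier R" "a \<ominus> r \<otimes> b \<in> I" using R a b bI cP by blast
    then show "\<exists>r\<in>carrier ?Q. A = r \<otimes>\<^bsub>?Q\<^esub> B"
      using phieq[of a "r \<otimes> b"] a b by (intro bexI[of _ "?\<phi> r"]) auto
  qed
  show ?thesis unfolding normal_domain_def 1 2 by blast
qed

section \<open>Discrete groups of isometries and their quotients\<close>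

lemma analytic_fun_onE:
  assumes "analytic_fun_on f T" "z \<in> T"
  obtains U F where "z \<in> U" "cx_holomorphic_on F U" "!!y. y \<in> U ==> y \<in> T ==> f y = F y"
  using assms unfolding analytic_fun_on_def by (metis IntI)

lemma analytic_fun_onI:
  assumes "!!z. z \<in> T ==> \<exists>U F. z \<in> U \<and> cx_holomorphic_on F U \<and> (\<forall>y. y \<in> U --> y \<in> T --> f y = F y)"
  shows "analytic_fun_on f T"
  unfolding analytic_fun_on_def
proof
  fix z assume "z \<in> T"
  then obtain U F where "z \<in> U" "cx_holomorphic_on F U" "\<forall>y. y \<in> U --> y \<in> T --> f y = F y"
    using assms by meson
  then show "\<exists>U F. z \<in> U \<and> cx_holomorphic_on F U \<and> (\<forall>y\<in>U \<inter> T. f y = F y)"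
    by (intro exI[of _ U] exI[of _ F]) simp
qed

lemma analytic_fun_on_subset:
  assumes "analytic_fun_on f T" "S \<subseteq> T"
  shows "analytic_fun_on f S"
proof (rule analytic_fun_onI)
  fix z assume "z \<in> S"
  then obtain U F where "z \<in> U" "cx_holomorphic_on F U" "!!y. y \<in> U ==> y \<in> T ==> f y = F y"
    using assms by (auto elim: analytic_fun_onE)
  then show "\<exists>U F. z \<in> U \<and> cx_holomorphic_on F U \<and> (\<forall>y. y \<in> U --> y \<in> S --> f y = F y)"
    using assms(2) by (intro exI[of _ U] exI[of _ F]) auto
qed

lemma analytic_fun_onI_holomorphic:
  assumes "cx_holomorphic_on f U" "T \<subseteq> U"
  shows "analytic_fun_on f T"
  by (rule analytic_fun_onI) (use assms in \<open>intro exI[of _ U] exI[of _ f], auto\<close>)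

lemma analytic_fun_on_const [simp]: "analytic_fun_on (%_. c) T"
  by (rule analytic_fun_onI_holomorphic[of _ UNIV]) auto

lemma analytic_fun_on_binary:
  fixes f g :: "'a::euclidean_space cx \<Rightarrow> complex"
  assumes op: "!!F G (U :: 'a cx set). cx_holomorphic_on F U ==> cx_holomorphic_on G U ==> cx_holomorphic_on (%z. op (F z) (G z)) U"
    and f: "analytic_fun_on f T" and g: "analytic_fun_on g T"
  shows "analytic_fun_on (%z. op (f z) (g z)) T"
proof (rule analytic_fun_onI)
  fix z assume z: "z \<in> T"
  obtain U F where 1: "z \<in> U" "cx_holomorphic_on F U" "!!y. y \<in> U ==> y \<in> T ==> f y = F y"
    using analytic_fun_onE[OF f z] by metis
  obtain V G where 2: "z \<in> V" "cx_holomorphic_on G V" "!!y. y \<in> V ==> y \<in> T ==> g y = G y"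
    using analytic_fun_onE[OF g z] by metis
  note * = 1 2
  have o: "open (U \<inter> V)" using * by (auto dest: cx_holomorphic_on_open)
  then have "cx_holomorphic_on (%z. op (F z) (G z)) (U \<inter> V)"
    by (intro op cx_holomorphic_on_subset[OF *(2) o Int_lower1] cx_holomorphic_on_subset[OF *(5) o Int_lower2])
  then show "\<exists>U F. z \<in> U \<and> cx_holomorphic_on F U \<and> (\<forall>y. y \<in> U --> y \<in> T --> op (f y) (g y) = F y)"
    using * by (intro exI[of _ "U \<inter> V"] exI[of _ "%z. op (F z) (G z)"]) auto
qed

lemma analytic_fun_on_add:
  "analytic_fun_on f T ==> analytic_fun_on g T ==> analytic_fun_on (%z. f z + g z) T"
  by (rule analytic_fun_on_binary[where op = "(+)"]) (rule cx_holomorphic_on_add)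

lemma analytic_fun_on_mult:
  "analytic_fun_on f T ==> analytic_fun_on g T ==> analytic_fun_on (%z. f z * g z) T"
  by (rule analytic_fun_on_binary[where op = "(*)"]) (rule cx_holomorphic_on_mult)

section \<open>Isometries acting on the complexification\<close>

definition lin :: "('a::real_vector \<Rightarrow> 'a) \<Rightarrow> 'a \<Rightarrow> 'a" where
  "lin g v = g v - g 0"

text \<open>The local analysis uses only this much of a proper isometric action.
  \<open>finite_displacement\<close> yields finite stabilisers and small balls in which two points
  of one orbit differ by the stabiliser of the centre.\<close>

locale discrete_isometry_group =
  fixes G :: "('a::euclidean_space \<Rightarrow> 'a) set"
  assumes id_mem: "(%x. x) \<in> G"
    and comp_mem: "g \<in> G ==> h \<in> G ==> (%x. g (h x)) \<in> G"
    and inverse_mem: "g \<in> G ==> \<exists>h\<in>G. (\<forall>x. h (g x) = x) \<and> (\<forall>x. g (h x) = x)"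
    and isometry: "g \<in> G ==> dist (g x) (g y) = dist x y"
    and finite_displacement: "finite {g \<in> G. dist (g x) x <= R}"
begin

lemma lin_orthogonal:
  assumes "g \<in> G"
  shows "orthogonal_transformation (lin g)"
  unfolding lin_def
  by (rule orthogonal_transformation_isometry[THEN iffD2])
    (simp add: dist_norm, simp add: isometry[OF assms] flip: dist_norm)

lemma lin_linear: "g \<in> G ==> linear (lin g)"
  using lin_orthogonal orthogonal_transformation_linear by blast

lemma lin_inner: "g \<in> G ==> lin g x \<bullet> lin g y = x \<bullet> y"
  using lin_orthogonal by (auto simp: orthogonal_transformation_def)

lemma lin_norm: "g \<in> G ==> norm (lin g x) = norm x"
  using lin_orthogonal orthogonal_transformation by blast

lemma apply_diff: "g \<in> G ==> g x - g y = lin g (x - y)"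
  using linear_diff[OF lin_linear, of g x y] by (simp add: lin_def)

lemma lin_comp: "g \<in> G ==> h \<in> G ==> lin (%x. g (h x)) v = lin g (lin h v)"
  unfolding lin_def[of "%x. g (h x)"] lin_def[of h] by (simp add: apply_diff)

lemma cx_map_lin: "cx_map g (x, v) = (g x, lin g v)"
  by (simp add: cx_map_def lin_def)

lemma cx_map_diff:
  "g \<in> G ==> cx_map g y - cx_map g z = (lin g (fst y - fst z), lin g (snd y - snd z))"
  by (cases y; cases z) (simp add: cx_map_lin apply_diff linear_diff[OF lin_linear])

lemma cx_map_eq: "g \<in> G ==> cx_map g z = cx_map g 0 + (lin g (fst z), lin g (snd z))"
  using cx_map_diff[of g z 0] by (simp add: algebra_simps)

lemma cx_map_id: "cx_map (%x. x) z = z"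
  by (cases z) (simp add: cx_map_def)

lemma cx_map_comp: "g \<in> G ==> h \<in> G ==> cx_map (%x. g (h x)) z = cx_map g (cx_map h z)"
  by (cases z) (simp add: cx_map_lin lin_comp)

lemma dist_cx_map: "g \<in> G ==> dist (cx_map g y) (cx_map g z) = dist y z"
  by (simp add: dist_norm cx_map_diff) (simp add: norm_prod_def lin_norm)

lemma inverse_obtain:
  assumes "g \<in> G"
  obtains h where "h \<in> G" "!!x. h (g x) = x" "!!x. g (h x) = x"
    "!!z. cx_map h (cx_map g z) = z" "!!z. cx_map g (cx_map h z) = z"
proof -
  obtain h where h: "h \<in> G" "!!x. h (g x) = x" "!!x. g (h x) = x" using inverse_mem[OF assms] by auto
  have "cx_map h (cx_map g z) = z" "cx_map g (cx_map h z) = z" for z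
    using cx_map_comp[OF h(1) assms, of z] cx_map_comp[OF assms h(1), of z] h by (simp_all add: cx_map_id)
  with h show ?thesis using that by blast
qed

lemma cx_hol_map_cx_map: "g \<in> G ==> open U ==> cx_hol_map (cx_map g) U"
proof -
  assume g: "g \<in> G" and U: "open U"
  have "linear (%z. (lin g (fst z), lin g (snd z)))"
    by (intro linearI) (auto simp: linear_add[OF lin_linear[OF g]] linear_scale[OF lin_linear[OF g]])
  then have "cx_hol_map (%z. cx_map g 0 + (lin g (fst z), lin g (snd z))) U"
    using U
    by (intro cx_hol_map_affine linear_conv_bounded_linear[THEN iffD1])
      (auto simp: cscale_def linear_neg[OF lin_linear[OF g]])
  then show ?thesis by (simp only: cx_map_eq[OF g, symmetric])
qed

lemma cx_orbit_eq_iff: "cx_orbit G y = cx_orbit G z \<longleftrightarrow> (\<exists>g\<in>G. y = cx_map g z)"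
proof
  assume "cx_orbit G y = cx_orbit G z"
  moreover have "y \<in> cx_orbit G y"
    unfolding cx_orbit_def using id_mem cx_map_id by (metis image_eqI)
  ultimately show "\<exists>g\<in>G. y = cx_map g z" unfolding cx_orbit_def by auto
next
  assume "\<exists>g\<in>G. y = cx_map g z"
  then obtain g where g: "g \<in> G" "y = cx_map g z" by auto
  obtain h where h: "h \<in> G" "!!z. cx_map h (cx_map g z) = z" using inverse_obtain[OF g(1)] by metis
  show "cx_orbit G y = cx_orbit G z"
    unfolding cx_orbit_def
  proof (intro equalityI subsetI; elim imageE)
    fix w k assume "w = cx_map k y" "k \<in> G"
    then show "w \<in> (%g. cx_map g z) ` G"
      using g by (auto intro!: image_eqI[of _ _ "%x. k (g x)"] simp: cx_map_comp comp_mem)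
  next
    fix w k assume "w = cx_map k z" "k \<in> G"
    then show "w \<in> (%g. cx_map g y) ` G"
      using g h by (intro image_eqI[of _ _ "%x. k (h x)"]) (simp_all add: cx_map_comp comp_mem)
  qed
qed

lemma cx_orbit_cx_map: "g \<in> G ==> cx_orbit G (cx_map g z) = cx_orbit G z"
  using cx_orbit_eq_iff by blast

definition stab :: "'a cx \<Rightarrow> ('a \<Rightarrow> 'a) set" where
  "stab z = {g \<in> G. cx_map g z = z}"

lemma finite_cx_displacement: "finite {g \<in> G. dist (cx_map g z) z <= R}"
proof (rule finite_subset[OF _ finite_displacement[of "fst z" R]])
  have "dist (g (fst z)) (fst z) <= dist (cx_map g z) z" for g
    using dist_fst_le[of "cx_map g z" z] by (cases z) (simp add: cx_map_def)
  then show "{g \<in> G. dist (cx_map g z) z <= R} \<subseteq> {g \<in> G. dist (g (fst z)) (fst z) <= R}"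
    using order_trans by blast
qed

lemma finite_stab: "finite (stab z)"
  by (rule finite_subset[OF _ finite_cx_displacement[of z 0]]) (auto simp: stab_def)

lemma stab_id: "(%x. x) \<in> stab z"
  by (simp add: stab_def id_mem cx_map_id)

lemma stab_comp: "g \<in> stab z ==> h \<in> stab z ==> (%x. g (h x)) \<in> stab z"
  by (simp add: stab_def comp_mem cx_map_comp)

lemma stab_inverse:
  assumes "g \<in> stab z"
  obtains h where "h \<in> stab z" "!!x. h (g x) = x" "!!x. g (h x) = x"
    "!!z. cx_map h (cx_map g z) = z" "!!z. cx_map g (cx_map h z) = z"
proof -
  have "g \<in> G" using assms by (simp add: stab_def)
  then show ?thesis
  proof (rule inverse_obtain)
    fix h assume h: "h \<in> G" "!!x. h (g x) = x" "!!x. g (h x) = x"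
      "!!z. cx_map h (cx_map g z) = z" "!!z. cx_map g (cx_map h z) = z"
    have "cx_map h (cx_map g z) = z" by (rule h(4))
    then have "h \<in> stab z" using assms h(1) by (simp add: stab_def)
    with h show ?thesis by (intro that) auto
  qed
qed

lemma cx_map_ball: "g \<in> stab z ==> y \<in> ball z r ==> cx_map g y \<in> ball z r"
  using dist_cx_map[of g z y] by (auto simp: stab_def)

text \<open>Only finitely many elements move \<open>z\<close> by at most 1, so those not fixing
  \<open>z\<close> move it by some least positive amount, and half of that serves as radius: if
  \<open>y\<close> and its image both lie within \<open>r\<close> of \<open>z\<close>, then
  \<open>z\<close> is moved by less than \<open>2 * r\<close>.\<close>

lemma small_ball_ex:
  obtains r where "r > 0" "!!g y. g \<in> G ==> y \<in> ball z r ==> cx_map g y \<in> ball z r ==> g \<in> stab z"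
proof -
  define D where "D = {g \<in> G. dist (cx_map g z) z <= 1} - stab z"
  define r where "r = Min (insert 1 ((%g. dist (cx_map g z) z) ` D)) / 2"
  have fin: "finite D" using finite_cx_displacement by (simp add: D_def)
  have pos: "r > 0" using fin by (auto simp: r_def D_def stab_def)
  have le: "2 * r <= 1" "!!g. g \<in> D ==> 2 * r <= dist (cx_map g z) z"
    using fin by (auto simp: r_def)
  have "g \<in> stab z" if g: "g \<in> G" "y \<in> ball z r" "cx_map g y \<in> ball z r" for g y
  proof (rule ccontr)
    assume ns: "g \<notin> stab z"
    have "dist (cx_map g z) z < 2 * r"
      using g dist_cx_map[OF g(1), of z y] dist_triangle[of "cx_map g z" z "cx_map g y"]
      by (simp add: dist_commute)
    then show False using le ns g by (fastforce simp: D_def)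
  qed
  with pos that show ?thesis by blast
qed

end

section \<open>The quotient of a stable set and its germs\<close>

locale stable_set = discrete_isometry_group +
  fixes T :: "'a cx set"
  assumes T_stable: "g \<in> G ==> z \<in> T ==> cx_map g z \<in> T"
begin

abbreviation "q \<equiv> cx_orbit G"

definition "X = quotient_space q (analytic_space T)"

lemma openin_X: "openin (ftop X) U \<longleftrightarrow> U \<subseteq> q ` T \<and> openin (top_of_set T) {z \<in> T. q z \<in> U}"
  using istopology_quotient[of q "top_of_set T"]
  by (simp add: X_def quotient_space_def analytic_space_def)

lemma topspace_X: "topspace (ftop X) = q ` T"
proof
  show "topspace (ftop X) \<subseteq> q ` T" using openin_X openin_topspace by blast
  have "{z \<in> T. q z \<in> q ` T} = T" by auto
  then have "openin (ftop X) (q ` T)" by (simp add: openin_X)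
  then show "q ` T \<subseteq> topspace (ftop X)" using openin_subset by blast
qed

lemma fsec_X: "f \<in> fsec X U \<longleftrightarrow> analytic_fun_on (%z. f (q z)) {z \<in> T. q z \<in> U}"
  by (simp add: X_def quotient_space_def analytic_space_def o_def)

lemma fsec_X_subset: "f \<in> fsec X U ==> V \<subseteq> U ==> f \<in> fsec X V"
  unfolding fsec_X by (erule analytic_fun_on_subset) auto

lemma preimage_image: "{z \<in> T. q z \<in> q ` (V \<inter> T)} = {z \<in> T. \<exists>g\<in>G. cx_map g z \<in> V}"
proof -
  have "q z \<in> q ` (V \<inter> T) \<longleftrightarrow> (\<exists>g\<in>G. cx_map g z \<in> V)" if z: "z \<in> T" for z
  proof
    assume "q z \<in> q ` (V \<inter> T)"
    then obtain y where y: "y \<in> V" "q y = q z" by auto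
    then obtain g where "g \<in> G" "y = cx_map g z" using cx_orbit_eq_iff[of y z] by auto
    with y show "\<exists>g\<in>G. cx_map g z \<in> V" by auto
  next
    assume "\<exists>g\<in>G. cx_map g z \<in> V"
    then obtain g where "g \<in> G" "cx_map g z \<in> V" by auto
    then show "q z \<in> q ` (V \<inter> T)"
      using cx_orbit_cx_map[of g z] T_stable z by (intro image_eqI[of _ _ "cx_map g z"]) simp_all
  qed
  then show ?thesis by auto
qed

lemma openin_image: "open V ==> openin (ftop X) (q ` (V \<inter> T))"
proof -
  assume V: "open V"
  have "open (cx_map g -` V)" if "g \<in> G" for g
    using continuous_on_open_vimage[of UNIV "cx_map g"] cx_hol_map_continuous_on[OF cx_hol_map_cx_map[OF that open_UNIV]] V
    by simp
  then have "open (\<Union>g\<in>G. cx_map g -` V)" by blast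
  moreover have "{z \<in> T. q z \<in> q ` (V \<inter> T)} = T \<inter> (\<Union>g\<in>G. cx_map g -` V)"
    unfolding preimage_image by blast
  ultimately show ?thesis unfolding openin_X by (auto intro: openin_open_Int)
qed

text \<open>Germs along \<open>T\<close> as a filter: two functions have the same germ at
  \<open>z\<close> when they agree eventually in it.\<close>

definition germ :: "'a cx \<Rightarrow> 'a cx filter" where
  "germ z = inf (nhds z) (principal T)"

lemma eventually_germ: "eventually P (germ z) \<longleftrightarrow> (\<exists>r>0. \<forall>y\<in>T \<inter> ball z r. P y)"
  unfolding germ_def eventually_inf_principal eventually_nhds_metric
  by (auto simp: dist_commute)

lemma eventually_germ_at: "eventually P (germ z) ==> z \<in> T ==> P z"
  unfolding eventually_germ by force

lemma eventually_germ_openin: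
  assumes "openin (ftop X) U" "z \<in> T" "q z \<in> U"
  shows "eventually (%y. y \<in> T \<and> q y \<in> U) (germ z)"
proof -
  obtain W where "open W" "{z \<in> T. q z \<in> U} = T \<inter> W"
    using assms(1) by (auto simp: openin_X openin_open)
  then have "eventually (%y. y \<in> W) (nhds z)" using assms by (intro eventually_nhds_in_open) auto
  then show ?thesis
    unfolding germ_def eventually_inf_principal
    by eventually_elim (use \<open>{z \<in> T. q z \<in> U} = T \<inter> W\<close> in auto)
qed

text \<open>Represents an element of the local ring at the orbit of \<open>z\<close> by an ambient
  holomorphic function. Invariance is demanded along \<open>T\<close> only, because values off
  \<open>T\<close> do not belong to the germ.\<close>

definition hol_germ :: "'a cx \<Rightarrow> ('a cx \<Rightarrow> complex) \<Rightarrow> bool" where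
  "hol_germ z F \<longleftrightarrow> (\<exists>r>0. cx_holomorphic_on F (ball z r)) \<and>
     (\<forall>g\<in>stab z. eventually (%y. F (cx_map g y) = F y) (germ z))"

text \<open>Two points of the ball in one orbit differ by an element of the stabiliser of
  \<open>z\<close>, so any choice of representative in the ball defines the same \<open>f\<close>.
  On translates of the ball \<open>f\<close> is holomorphic by transport.\<close>

lemma descend:
  assumes F: "cx_holomorphic_on F (ball z r)"
    and small: "!!g y. g \<in> G ==> y \<in> ball z r ==> cx_map g y \<in> ball z r ==> g \<in> stab z"
    and inv: "!!g y. g \<in> stab z ==> y \<in> T \<inter> ball z r ==> F (cx_map g y) = F y"
  obtains f where "f \<in> fsec X (q ` (ball z r \<inter> T))" "!!y. y \<in> T \<inter> ball z r ==> f (q y) = F y"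
proof -
  define f where "f p = F (SOME y. y \<in> T \<inter> ball z r \<and> q y = p)" for p
  have f: "f (q y) = F y" if y: "y \<in> T \<inter> ball z r" for y
  proof -
    define y' where "y' = (SOME y'. y' \<in> T \<inter> ball z r \<and> q y' = q y)"
    have y': "y' \<in> T \<inter> ball z r" "q y' = q y"
      using someI[of "%y'. y' \<in> T \<inter> ball z r \<and> q y' = q y", OF conjI[OF y refl]] by (auto simp: y'_def)
    then obtain g where g: "g \<in> G" "y' = cx_map g y" using cx_orbit_eq_iff by blast
    then have "g \<in> stab z" using small[of g y] y y' by auto
    then show ?thesis using inv[of g y] y g by (simp add: f_def y'_def)
  qed
  have "analytic_fun_on (%z. f (q z)) {y \<in> T. \<exists>g\<in>G. cx_map g y \<in> ball z r}"
    unfolding analytic_fun_on_def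
  proof
    fix y assume "y \<in> {y \<in> T. \<exists>g\<in>G. cx_map g y \<in> ball z r}"
    then obtain g where g: "g \<in> G" "cx_map g y \<in> ball z r" "y \<in> T" by auto
    let ?U = "cx_map g -` ball z r"
    have "open ?U"
      using continuous_on_open_vimage[of UNIV "cx_map g"]
        cx_hol_map_continuous_on[OF cx_hol_map_cx_map[OF g(1) open_UNIV]] by simp
    then have "cx_holomorphic_on (%y. F (cx_map g y)) ?U"
      by (intro cx_holomorphic_on_compose[OF cx_hol_map_cx_map[OF g(1)] F]) auto
    moreover have "f (q y) = F (cx_map g y)" if "y \<in> ?U \<inter> {y \<in> T. \<exists>g\<in>G. cx_map g y \<in> ball z r}" for y
      using f[of "cx_map g y"] that T_stable[OF g(1)] cx_orbit_cx_map[OF g(1)] by auto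
    ultimately show "\<exists>U F. y \<in> U \<and> cx_holomorphic_on F U \<and>
        (\<forall>y\<in>U \<inter> {y \<in> T. \<exists>g\<in>G. cx_map g y \<in> ball z r}. f (q y) = F y)"
      using g by blast
  qed
  then have "f \<in> fsec X (q ` (ball z r \<inter> T))" unfolding fsec_X preimage_image .
  with f that show ?thesis by blast
qed

lemma hol_germ_descend:
  assumes F: "hol_germ z F" and z: "z \<in> T"
  obtains f where "f \<in> carrier (near_ring X (q z))" "eventually (%y. f (q y) = F y) (germ z)"
proof -
  obtain r1 where r1: "r1 > 0" "cx_holomorphic_on F (ball z r1)" using F by (auto simp: hol_germ_def)
  have "eventually (%y. \<forall>g\<in>stab z. F (cx_map g y) = F y) (germ z)"
    by (rule eventually_ball_finite[OF finite_stab]) (use F in \<open>simp add: hol_germ_def\<close>)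
  then obtain r2 where r2: "r2 > 0" "!!y g. y \<in> T \<inter> ball z r2 ==> g \<in> stab z ==> F (cx_map g y) = F y"
    by (auto simp: eventually_germ)
  obtain r3 where r3: "r3 > 0" "!!g y. g \<in> G ==> y \<in> ball z r3 ==> cx_map g y \<in> ball z r3 ==> g \<in> stab z"
    using small_ball_ex[of z] by metis
  define r where "r = min r1 (min r2 r3)"
  have r: "r > 0" "ball z r \<subseteq> ball z r1" "ball z r \<subseteq> ball z r2" "ball z r \<subseteq> ball z r3"
    using r1(1) r2(1) r3(1) by (auto simp: r_def)
  obtain f where f: "f \<in> fsec X (q ` (ball z r \<inter> T))" "!!y. y \<in> T \<inter> ball z r ==> f (q y) = F y"
  proof (rule descend[of F z r])
    show "cx_holomorphic_on F (ball z r)" by (rule cx_holomorphic_on_subset[OF r1(2) _ r(2)]) simp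
    show "g \<in> stab z" if "g \<in> G" "y \<in> ball z r" "cx_map g y \<in> ball z r" for g y
      using that r(4) r3(2) by blast
    show "F (cx_map g y) = F y" if "g \<in> stab z" "y \<in> T \<inter> ball z r" for g y
      using that r(3) r2(2) by blast
  qed (use that in blast)
  have "f \<in> carrier (near_ring X (q z))"
    using f(1) openin_image[of "ball z r"] z r(1) by (auto simp: near_ring_def)
  moreover have "eventually (%y. f (q y) = F y) (germ z)"
    unfolding eventually_germ using f(2) r(1) by blast
  ultimately show ?thesis using that by blast
qed

text \<open>Converse of \<open>hol_germ_descend\<close>: an ambient extension of \<open>f\<close>
  composed with the orbit map is invariant along \<open>T\<close>, because points of one orbit have
  the same image.\<close>

lemma near_ring_lift:
  assumes f: "f \<in> carrier (near_ring X (q z))" and z: "z \<in> T"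
  obtains F where "hol_germ z F" "eventually (%y. f (q y) = F y) (germ z)"
proof -
  obtain U where U: "openin (ftop X) U" "q z \<in> U" "f \<in> fsec X U" using f by (auto simp: near_ring_def)
  have zz: "z \<in> {z \<in> T. q z \<in> U}" using z U(2) by simp
  obtain V F where V: "z \<in> V" "cx_holomorphic_on F V" "!!y. y \<in> V ==> y \<in> {z \<in> T. q z \<in> U} ==> f (q y) = F y"
    by (rule analytic_fun_onE[OF U(3)[unfolded fsec_X] zz]) (use that in blast)
  have opV: "open V" using V(2) by (rule cx_holomorphic_on_open)
  obtain r where r: "r > 0" "ball z r \<subseteq> V" using V(1) opV openE by blast
  have F: "cx_holomorphic_on F (ball z r)" by (rule cx_holomorphic_on_subset[OF V(2) _ r(2)]) simp
  have "eventually (%y. y \<in> ball z r) (germ z)"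
    unfolding germ_def eventually_inf_principal using r(1) by (auto intro: eventually_mono[OF eventually_nhds_in_open[of "ball z r"]])
  with eventually_germ_openin[OF U(1) z U(2)] have ev: "eventually (%y. y \<in> T \<and> q y \<in> U \<and> y \<in> ball z r) (germ z)"
    by eventually_elim auto
  have fF: "f (q y) = F y" if "y \<in> T" "q y \<in> U" "y \<in> ball z r" for y
    using V(3)[OF subsetD[OF r(2) that(3)]] that by simp
  have "eventually (%y. F (cx_map g y) = F y) (germ z)" if g: "g \<in> stab z" for g
    using ev
  proof eventually_elim
    case (elim y)
    have "g \<in> G" using g by (simp add: stab_def)
    then show ?case
      using fF[of y] fF[of "cx_map g y"] elim cx_map_ball[OF g] T_stable cx_orbit_cx_map by metis
  qed
  then have "hol_germ z F" using F r(1) by (auto simp: hol_germ_def)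
  moreover have "eventually (%y. f (q y) = F y) (germ z)" using ev by eventually_elim (use fF in auto)
  ultimately show ?thesis using that by blast
qed

end

section \<open>Local rings of the quotient\<close>

context stable_set
begin

lemma near_ring_simps:
  "f \<in> carrier (near_ring X x) \<longleftrightarrow> (\<exists>U. openin (ftop X) U \<and> x \<in> U \<and> f \<in> fsec X U)"
  "f \<otimes>\<^bsub>near_ring X x\<^esub> g = (%y. f y * g y)" "\<one>\<^bsub>near_ring X x\<^esub> = (%_. 1)"
  "f \<oplus>\<^bsub>near_ring X x\<^esub> g = (%y. f y + g y)" "\<zero>\<^bsub>near_ring X x\<^esub> = (%_. 0)"
  by (simp_all add: near_ring_def)

lemma near_ring_binary:
  assumes op: "!!f g (S :: 'a cx set). analytic_fun_on f S ==> analytic_fun_on g S ==>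
      analytic_fun_on (%z. op (f z) (g z)) S"
    and "f \<in> carrier (near_ring X x)" "g \<in> carrier (near_ring X x)"
  shows "(%y. op (f y) (g y)) \<in> carrier (near_ring X x)"
proof -
  obtain U V where UV: "openin (ftop X) U" "x \<in> U" "f \<in> fsec X U"
    "openin (ftop X) V" "x \<in> V" "g \<in> fsec X V"
    using assms by (auto simp: near_ring_simps)
  have "f \<in> fsec X (U \<inter> V)" "g \<in> fsec X (U \<inter> V)" using UV by (auto intro: fsec_X_subset)
  then have "(%y. op (f y) (g y)) \<in> fsec X (U \<inter> V)" unfolding fsec_X by (rule op)
  then show ?thesis using UV by (auto simp: near_ring_simps)
qed

lemma near_ring_add:
  "f \<in> carrier (near_ring X x) ==> g \<in> carrier (near_ring X x) ==>
   (%y. f y + g y) \<in> carrier (near_ring X x)"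
  by (rule near_ring_binary[where op = "(+)"]) (rule analytic_fun_on_add)

lemma near_ring_mult:
  "f \<in> carrier (near_ring X x) ==> g \<in> carrier (near_ring X x) ==>
   (%y. f y * g y) \<in> carrier (near_ring X x)"
  by (rule near_ring_binary[where op = "(*)"]) (rule analytic_fun_on_mult)

lemma near_ring_const: "x \<in> q ` T ==> (%_. c) \<in> carrier (near_ring X x)"
  using openin_topspace[of "ftop X"] by (auto simp: near_ring_simps fsec_X topspace_X)

lemma near_ring_cring:
  assumes x: "x \<in> q ` T"
  shows "cring (near_ring X x)"
proof (rule cringI)
  note add = near_ring_add and mult = near_ring_mult
  show "abelian_group (near_ring X x)"
  proof (rule abelian_groupI)
    fix f assume f: "f \<in> carrier (near_ring X x)"
    have "(%y. - 1 * f y) \<in> carrier (near_ring X x)"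
      by (rule mult[OF near_ring_const[OF x] f])
    then show "\<exists>g\<in>carrier (near_ring X x). g \<oplus>\<^bsub>near_ring X x\<^esub> f = \<zero>\<^bsub>near_ring X x\<^esub>"
      by (intro bexI[of _ "%y. - 1 * f y"]) (auto simp: near_ring_simps(4,5))
  qed (use add near_ring_const[OF x] in \<open>auto simp: near_ring_simps(4,5)\<close>)
  show "comm_monoid (near_ring X x)"
    by (rule comm_monoidI) (use mult near_ring_const[OF x] in \<open>auto simp: near_ring_simps(2,3)\<close>)
qed (auto simp: near_ring_simps(2,4) algebra_simps)

text \<open>Neighbourhoods of an orbit correspond to neighbourhoods of \<open>z\<close> in
  \<open>T\<close>, since orbit images of open balls are open.\<close>

lemma vanishing_near_iff:
  assumes z: "z \<in> T"
  shows "f \<in> vanishing_near X (q z) \<longleftrightarrow>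
    f \<in> carrier (near_ring X (q z)) \<and> eventually (%y. f (q y) = 0) (germ z)"
proof -
  have "(\<exists>U. openin (ftop X) U \<and> q z \<in> U \<and> (\<forall>y\<in>U. f y = 0)) \<longleftrightarrow> eventually (%y. f (q y) = 0) (germ z)"
  proof
    assume "\<exists>U. openin (ftop X) U \<and> q z \<in> U \<and> (\<forall>y\<in>U. f y = 0)"
    then obtain U where U: "openin (ftop X) U" "q z \<in> U" "!!y. y \<in> U ==> f y = 0" by blast
    show "eventually (%y. f (q y) = 0) (germ z)"
      using eventually_germ_openin[OF U(1) z U(2)] by eventually_elim (use U(3) in simp)
  next
    assume "eventually (%y. f (q y) = 0) (germ z)"
    then obtain r where "r > 0" "\<forall>y\<in>T \<inter> ball z r. f (q y) = 0" unfolding eventually_germ by blast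
    then show "\<exists>U. openin (ftop X) U \<and> q z \<in> U \<and> (\<forall>y\<in>U. f y = 0)"
      using openin_image[of "ball z r"] z by (intro exI[of _ "q ` (ball z r \<inter> T)"]) force
  qed
  then show ?thesis by (simp add: vanishing_near_def)
qed

lemma vanishing_near_ideal:
  assumes z: "z \<in> T"
  shows "ideal (vanishing_near X (q z)) (near_ring X (q z))"
proof -
  have x: "q z \<in> q ` T" using z by simp
  note add = near_ring_add and mult = near_ring_mult
  interpret N: cring "near_ring X (q z)" by (rule near_ring_cring[OF x])
  show ?thesis
  proof (rule idealI[OF N.ring_axioms])
    show "subgroup (vanishing_near X (q z)) (add_monoid (near_ring X (q z)))"
    proof (rule group.subgroupI[OF N.a_group])
      show "vanishing_near X (q z) \<subseteq> carrier (add_monoid (near_ring X (q z)))"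
        by (auto simp: vanishing_near_def)
      show "vanishing_near X (q z) ~= {}"
        using near_ring_const[OF x, of 0] vanishing_near_iff[OF z, of "%_. 0"] by auto
      fix f assume f: "f \<in> vanishing_near X (q z)"
      then have fc: "f \<in> carrier (near_ring X (q z))" by (simp add: vanishing_near_def)
      have mc: "(%y. - 1 * f y) \<in> carrier (near_ring X (q z))" by (rule mult[OF near_ring_const[OF x] fc])
      have "inv\<^bsub>add_monoid (near_ring X (q z))\<^esub> f = (%y. - 1 * f y)"
        using N.minus_equality[OF _ fc mc] by (simp add: near_ring_simps(4,5) a_inv_def)
      then show "inv\<^bsub>add_monoid (near_ring X (q z))\<^esub> f \<in> vanishing_near X (q z)"
        using f mc by (simp add: vanishing_near_iff[OF z])
      fix g assume g: "g \<in> vanishing_near X (q z)"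
      have "eventually (%y. f (q y) + g (q y) = 0) (germ z)"
        using f[unfolded vanishing_near_iff[OF z], THEN conjunct2] g[unfolded vanishing_near_iff[OF z], THEN conjunct2]
        by eventually_elim simp
      then show "f \<otimes>\<^bsub>add_monoid (near_ring X (q z))\<^esub> g \<in> vanishing_near X (q z)"
        using f g add[of f "q z" g] by (simp add: vanishing_near_iff[OF z] near_ring_simps(4))
    qed
    fix f g assume f: "f \<in> vanishing_near X (q z)" and g: "g \<in> carrier (near_ring X (q z))"
    have "eventually (%y. f (q y) * g (q y) = 0) (germ z)"
      using f[unfolded vanishing_near_iff[OF z], THEN conjunct2] by eventually_elim simp
    then have "(%y. f y * g y) \<in> vanishing_near X (q z)"
      using f g mult[of f "q z" g] by (simp add: vanishing_near_iff[OF z])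
    then show "g \<otimes>\<^bsub>near_ring X (q z)\<^esub> f \<in> vanishing_near X (q z)"
      "f \<otimes>\<^bsub>near_ring X (q z)\<^esub> g \<in> vanishing_near X (q z)"
      by (simp_all add: near_ring_simps(2) mult.commute)
  qed
qed

lemma near_ring_pow:
  assumes "x \<in> q ` T"
  shows "f [^]\<^bsub>near_ring X x\<^esub> (n::nat) = (%y. f y ^ n)"
proof -
  interpret N: cring "near_ring X x" by (rule near_ring_cring[OF assms])
  show ?thesis by (induction n) (simp_all add: near_ring_simps(2,3) mult.commute)
qed

lemma near_ring_finsum:
  assumes "x \<in> q ` T" "!!i. i < (n::nat) ==> F i \<in> carrier (near_ring X x)"
  shows "(\<Oplus>\<^bsub>near_ring X x\<^esub>i\<in>{..<n}. F i) = (%y. \<Sum>i<n. F i y)"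
proof -
  interpret N: cring "near_ring X x" by (rule near_ring_cring[OF assms(1)])
  show ?thesis using assms(2)
  proof (induction n)
    case 0
    then show ?case by (simp add: near_ring_simps(5))
  next
    case (Suc n)
    have "(\<Oplus>\<^bsub>near_ring X x\<^esub>i\<in>{..<Suc n}. F i) = F n \<oplus>\<^bsub>near_ring X x\<^esub> (\<Oplus>\<^bsub>near_ring X x\<^esub>i\<in>{..<n}. F i)"
      unfolding lessThan_Suc by (rule N.finsum_insert) (use Suc.prems in auto)
    then show ?case using Suc by (simp add: near_ring_simps(4) add.commute)
  qed
qed

lemma near_ring_monic:
  assumes x: "x \<in> q ` T" and a: "a \<in> carrier (near_ring X x)" and b: "b \<in> carrier (near_ring X x)"
    and c: "c \<in> {..<(n::nat)} \<rightarrow> carrier (near_ring X x)"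
  shows "a [^]\<^bsub>near_ring X x\<^esub> n \<oplus>\<^bsub>near_ring X x\<^esub> (\<Oplus>\<^bsub>near_ring X x\<^esub>i\<in>{..<n}.
      c i \<otimes>\<^bsub>near_ring X x\<^esub> a [^]\<^bsub>near_ring X x\<^esub> i \<otimes>\<^bsub>near_ring X x\<^esub> b [^]\<^bsub>near_ring X x\<^esub> (n - i)) =
    (%y. a y ^ n + (\<Sum>i<n. c i y * a y ^ i * b y ^ (n - i)))"
proof -
  interpret N: cring "near_ring X x" by (rule near_ring_cring[OF x])
  have "c i \<otimes>\<^bsub>near_ring X x\<^esub> a [^]\<^bsub>near_ring X x\<^esub> i \<otimes>\<^bsub>near_ring X x\<^esub> b [^]\<^bsub>near_ring X x\<^esub> (n - i)
      \<in> carrier (near_ring X x)" if "i < n" for i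
    using a b funcset_mem[OF c, of i] that by (intro N.m_closed N.nat_pow_closed) auto
  then show ?thesis
    by (subst near_ring_finsum[OF x]) (simp_all add: near_ring_simps(2,4) near_ring_pow[OF x])
qed

text \<open>Normality of the local ring spelled out on ambient representatives, with equality of
  germs along \<open>T\<close>: no zero divisors, and every integral quotient \<open>A / B\<close>
  is again an invariant germ.\<close>

definition normal_germ :: "'a cx \<Rightarrow> bool" where
  "normal_germ z \<longleftrightarrow>
    (\<forall>F1 F2. hol_germ z F1 --> hol_germ z F2 --> eventually (%y. F1 y * F2 y = 0) (germ z) -->
       eventually (%y. F1 y = 0) (germ z) \<or> eventually (%y. F2 y = 0) (germ z)) \<and>
    (\<forall>A B (n::nat) c. hol_germ z A --> hol_germ z B --> (\<forall>i<n. hol_germ z (c i)) -->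
       \<not> eventually (%y. B y = 0) (germ z) -->
       eventually (%y. A y ^ n + (\<Sum>i<n. c i y * A y ^ i * B y ^ (n - i)) = 0) (germ z) -->
       (\<exists>R. hol_germ z R \<and> eventually (%y. A y = R y * B y) (germ z)))"

text \<open>Descent and lifting match \<open>near_ring\<close> with the invariant ambient germs,
  sums and products being pointwise; passing to the quotient by vanishing functions becomes equality
  along \<open>T\<close>.\<close>

lemma normal_domain_stalk_iff:
  assumes z: "z \<in> T"
  shows "normal_domain (stalk X (q z)) \<longleftrightarrow> normal_germ z"
proof -
  let ?N = "near_ring X (q z)" and ?I = "vanishing_near X (q z)"
  have x: "q z \<in> q ` T" using z by simp
  interpret N: cring ?N by (rule near_ring_cring[OF x])
  note add = near_ring_add and mult = near_ring_mult
  define rel where "rel f F \<longleftrightarrow> eventually (%y. f (q y) = F y) (germ z)" for f :: "'a cx set \<Rightarrow> complex" and F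
  have down: "\<exists>f\<in>carrier ?N. rel f F" if "hol_germ z F" for F
    using hol_germ_descend[OF that z] unfolding rel_def by metis
  have up: "\<exists>F. hol_germ z F \<and> rel f F" if "f \<in> carrier ?N" for f
    using near_ring_lift[OF that z] unfolding rel_def by metis
  have van: "f \<in> ?I \<longleftrightarrow> eventually (%y. F y = 0) (germ z)" if "f \<in> carrier ?N" "rel f F" for f F
  proof -
    have "eventually (%y. f (q y) = 0) (germ z) \<longleftrightarrow> eventually (%y. F y = 0) (germ z)"
      by (rule eventually_cong[OF that(2)[unfolded rel_def]]) simp
    then show ?thesis using that by (simp add: vanishing_near_iff[OF z])
  qed
  have one: "?I ~= carrier ?N"
  proof
    assume "?I = carrier ?N"
    then have "(%_. 1) \<in> ?I" using near_ring_const[OF x] by simp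
    then have "eventually (%y. (1::complex) = 0) (germ z)" by (simp add: vanishing_near_iff[OF z])
    then show False using eventually_germ_at[OF _ z] by fastforce
  qed
  have relmult: "rel (%y. f y * g y) (%y. F y * G y)" if "rel f F" "rel g G" for f g F G
    using that unfolding rel_def by eventually_elim simp
  have dom: "(\<forall>a\<in>carrier ?N. \<forall>b\<in>carrier ?N. a \<otimes>\<^bsub>?N\<^esub> b \<in> ?I --> a \<in> ?I \<or> b \<in> ?I) \<longleftrightarrow>
    (\<forall>F1 F2. hol_germ z F1 --> hol_germ z F2 --> eventually (%y. F1 y * F2 y = 0) (germ z) -->
       eventually (%y. F1 y = 0) (germ z) \<or> eventually (%y. F2 y = 0) (germ z))" (is "?L \<longleftrightarrow> ?R")
  proof
    assume L: ?L
    show ?R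
    proof (intro allI impI)
      fix F1 F2 assume F: "hol_germ z F1" "hol_germ z F2" "eventually (%y. F1 y * F2 y = 0) (germ z)"
      obtain a where a: "a \<in> carrier ?N" "rel a F1" using down[OF F(1)] by blast
      obtain b where b: "b \<in> carrier ?N" "rel b F2" using down[OF F(2)] by blast
      have "a \<otimes>\<^bsub>?N\<^esub> b \<in> ?I"
        unfolding near_ring_simps(2) using van[OF mult[OF a(1) b(1)] relmult[OF a(2) b(2)]] F(3) by blast
      then show "eventually (%y. F1 y = 0) (germ z) \<or> eventually (%y. F2 y = 0) (germ z)"
        using L a b van by blast
    qed
  next
    assume R: ?R
    show ?L
    proof (intro ballI impI)
      fix a b assume ab: "a \<in> carrier ?N" "b \<in> carrier ?N" "a \<otimes>\<^bsub>?N\<^esub> b \<in> ?I"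
      obtain F1 where F1: "hol_germ z F1" "rel a F1" using up[OF ab(1)] by blast
      obtain F2 where F2: "hol_germ z F2" "rel b F2" using up[OF ab(2)] by blast
      have "eventually (%y. F1 y * F2 y = 0) (germ z)"
        using ab(3) van[OF mult[OF ab(1,2)] relmult[OF F1(2) F2(2)]] unfolding near_ring_simps(2) by blast
      then show "a \<in> ?I \<or> b \<in> ?I" using R F1 F2 ab van by blast
    qed
  qed
  have monic: "a [^]\<^bsub>?N\<^esub> n \<oplus>\<^bsub>?N\<^esub> (\<Oplus>\<^bsub>?N\<^esub>i\<in>{..<n}. c i \<otimes>\<^bsub>?N\<^esub> a [^]\<^bsub>?N\<^esub> i \<otimes>\<^bsub>?N\<^esub> b [^]\<^bsub>?N\<^esub> (n - i)) \<in> ?I \<longleftrightarrow>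
      eventually (%y. A y ^ n + (\<Sum>i<n. C i y * A y ^ i * B y ^ (n - i)) = 0) (germ z)"
    if a: "a \<in> carrier ?N" "rel a A" and b: "b \<in> carrier ?N" "rel b B"
      and c: "c \<in> {..<(n::nat)} \<rightarrow> carrier ?N" "!!i. i < n ==> rel (c i) (C i)" for a b c n A B C
  proof (rule van)
    have "(%i. c i \<otimes>\<^bsub>?N\<^esub> a [^]\<^bsub>?N\<^esub> i \<otimes>\<^bsub>?N\<^esub> b [^]\<^bsub>?N\<^esub> (n - i)) \<in> {..<n} \<rightarrow> carrier ?N"
      using a b funcset_mem[OF c(1)] by (intro funcsetI N.m_closed N.nat_pow_closed) auto
    then show "a [^]\<^bsub>?N\<^esub> n \<oplus>\<^bsub>?N\<^esub> (\<Oplus>\<^bsub>?N\<^esub>i\<in>{..<n}. c i \<otimes>\<^bsub>?N\<^esub> a [^]\<^bsub>?N\<^esub> i \<otimes>\<^bsub>?N\<^esub> b [^]\<^bsub>?N\<^esub> (n - i)) \<in> carrier ?N"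
      using a by simp
    have "eventually (%y. \<forall>i\<in>{..<n}. c i (q y) = C i y) (germ z)"
      using c(2) by (intro eventually_ball_finite) (auto simp: rel_def)
    then have "eventually (%y. a (q y) ^ n + (\<Sum>i<n. c i (q y) * a (q y) ^ i * b (q y) ^ (n - i)) =
        A y ^ n + (\<Sum>i<n. C i y * A y ^ i * B y ^ (n - i))) (germ z)"
      using a(2)[unfolded rel_def] b(2)[unfolded rel_def] by eventually_elim simp
    then show "rel (a [^]\<^bsub>?N\<^esub> n \<oplus>\<^bsub>?N\<^esub> (\<Oplus>\<^bsub>?N\<^esub>i\<in>{..<n}. c i \<otimes>\<^bsub>?N\<^esub> a [^]\<^bsub>?N\<^esub> i \<otimes>\<^bsub>?N\<^esub> b [^]\<^bsub>?N\<^esub> (n - i)))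
        (%y. A y ^ n + (\<Sum>i<n. C i y * A y ^ i * B y ^ (n - i)))"
      unfolding near_ring_monic[OF x a(1) b(1) c(1)] rel_def .
  qed
  have quo: "a \<ominus>\<^bsub>?N\<^esub> r \<otimes>\<^bsub>?N\<^esub> b \<in> ?I \<longleftrightarrow> eventually (%y. A y = R y * B y) (germ z)"
    if a: "a \<in> carrier ?N" "rel a A" and b: "b \<in> carrier ?N" "rel b B" and r: "r \<in> carrier ?N" "rel r R"
    for a b r A B R
  proof -
    have rb: "(%y. r y * b y) \<in> carrier ?N" by (rule mult[OF r(1) b(1)])
    have mc: "(%y. - 1 * (r y * b y)) \<in> carrier ?N" by (rule mult[OF near_ring_const[OF x] rb])
    have "\<ominus>\<^bsub>?N\<^esub> (%y. r y * b y) = (%y. - 1 * (r y * b y))"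
      by (rule N.minus_equality[OF _ rb mc]) (simp add: near_ring_simps(4,5))
    then have e: "a \<ominus>\<^bsub>?N\<^esub> r \<otimes>\<^bsub>?N\<^esub> b = (%y. a y + - 1 * (r y * b y))"
      by (simp add: a_minus_def near_ring_simps(2,4))
    have c: "(%y. a y + - 1 * (r y * b y)) \<in> carrier ?N" by (rule add[OF a(1) mc])
    have "rel (%y. a y + - 1 * (r y * b y)) (%y. A y + - 1 * (R y * B y))"
      using a(2) b(2) r(2) unfolding rel_def by eventually_elim simp
    from van[OF c this] show ?thesis unfolding e by simp
  qed
  have int: "(\<forall>a\<in>carrier ?N. \<forall>b\<in>carrier ?N - ?I. \<forall>(n::nat) c. c \<in> {..<n} \<rightarrow> carrier ?N -->
       a [^]\<^bsub>?N\<^esub> n \<oplus>\<^bsub>?N\<^esub> (\<Oplus>\<^bsub>?N\<^esub>i\<in>{..<n}. c i \<otimes>\<^bsub>?N\<^esub> a [^]\<^bsub>?N\<^esub> i \<otimes>\<^bsub>?N\<^esub> b [^]\<^bsub>?N\<^esub> (n - i)) \<in> ?I -->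
       (\<exists>r\<in>carrier ?N. a \<ominus>\<^bsub>?N\<^esub> r \<otimes>\<^bsub>?N\<^esub> b \<in> ?I)) \<longleftrightarrow>
    (\<forall>A B (n::nat) c. hol_germ z A --> hol_germ z B --> (\<forall>i<n. hol_germ z (c i)) -->
       \<not> eventually (%y. B y = 0) (germ z) -->
       eventually (%y. A y ^ n + (\<Sum>i<n. c i y * A y ^ i * B y ^ (n - i)) = 0) (germ z) -->
       (\<exists>R. hol_germ z R \<and> eventually (%y. A y = R y * B y) (germ z)))" (is "?L \<longleftrightarrow> ?R")
  proof
    assume L: ?L
    show ?R
    proof (intro allI impI)
      fix A B C and n :: nat
      assume A: "hol_germ z A" and B: "hol_germ z B" and C: "\<forall>i<n. hol_germ z (C i)"
        and B0: "\<not> eventually (%y. B y = 0) (germ z)"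
        and e: "eventually (%y. A y ^ n + (\<Sum>i<n. C i y * A y ^ i * B y ^ (n - i)) = 0) (germ z)"
      obtain a where a: "a \<in> carrier ?N" "rel a A" using down[OF A] by blast
      obtain b where b: "b \<in> carrier ?N" "rel b B" using down[OF B] by blast
      have "\<forall>i. \<exists>f. i < n --> f \<in> carrier ?N \<and> rel f (C i)" using C down by blast
      then obtain c where c: "!!i. i < n ==> c i \<in> carrier ?N \<and> rel (c i) (C i)" by metis
      then have cP: "c \<in> {..<n} \<rightarrow> carrier ?N" by auto
      obtain r where r: "r \<in> carrier ?N" "a \<ominus>\<^bsub>?N\<^esub> r \<otimes>\<^bsub>?N\<^esub> b \<in> ?I"
        using L[rule_format, OF a(1) _ cP] monic[OF a b cP, of C] c e van[OF b] B0 b(1) by blast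
      obtain R where R: "hol_germ z R" "rel r R" using up[OF r(1)] by blast
      then show "\<exists>R. hol_germ z R \<and> eventually (%y. A y = R y * B y) (germ z)"
        using quo[OF a b r(1) R(2)] r(2) by blast
    qed
  next
    assume R: ?R
    show ?L
    proof (intro ballI allI impI)
      fix a b c and n :: nat
      assume a: "a \<in> carrier ?N" and b: "b \<in> carrier ?N - ?I" and c: "c \<in> {..<n} \<rightarrow> carrier ?N"
        and e: "a [^]\<^bsub>?N\<^esub> n \<oplus>\<^bsub>?N\<^esub> (\<Oplus>\<^bsub>?N\<^esub>i\<in>{..<n}. c i \<otimes>\<^bsub>?N\<^esub> a [^]\<^bsub>?N\<^esub> i \<otimes>\<^bsub>?N\<^esub> b [^]\<^bsub>?N\<^esub> (n - i)) \<in> ?I"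
      obtain A where A: "hol_germ z A" "rel a A" using up[OF a] by blast
      have b': "b \<in> carrier ?N" using b by blast
      obtain B where B: "hol_germ z B" "rel b B" using up[OF b'] by blast
      have "\<forall>i. \<exists>F. i < n --> hol_germ z F \<and> rel (c i) F" using funcset_mem[OF c] up by blast
      then obtain C where C: "!!i. i < n ==> hol_germ z (C i) \<and> rel (c i) (C i)" by metis
      have m: "eventually (%y. A y ^ n + (\<Sum>i<n. C i y * A y ^ i * B y ^ (n - i)) = 0) (germ z)"
        using monic[OF a A(2) b' B(2) c, of C] C e by blast
      have nz: "\<not> eventually (%y. B y = 0) (germ z)" using van[OF b' B(2)] b by blast
      obtain R' where R': "hol_germ z R'" "eventually (%y. A y = R' y * B y) (germ z)"
        using R[rule_format, OF A(1) B(1) _ nz m] C by blast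
      obtain r where r: "r \<in> carrier ?N" "rel r R'" using down[OF R'(1)] by blast
      show "\<exists>r\<in>carrier ?N. a \<ominus>\<^bsub>?N\<^esub> r \<otimes>\<^bsub>?N\<^esub> b \<in> ?I"
        using quo[OF a A(2) b' B(2) r] R'(2) r(1) by blast
    qed
  qed
  show ?thesis
    unfolding stalk_def N.normal_domain_Quot[OF vanishing_near_ideal[OF z]] normal_germ_def dom int
    using one by simp
qed

lemma nonnormal_locus_X: "nonnormal_locus X = q ` {z \<in> T. \<not> normal_germ z}"
  unfolding nonnormal_locus_def topspace_X using normal_domain_stalk_iff by auto

end

section \<open>Orthogonal projections\<close>

definition oproj :: "'a::euclidean_space set \<Rightarrow> 'a \<Rightarrow> 'a" where
  "oproj V x = (SOME y. y \<in> V \<and> (\<forall>w\<in>V. (x - y) \<bullet> w = 0))"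

lemma oproj:
  assumes "subspace V"
  shows "oproj V x \<in> V" "w \<in> V ==> (x - oproj V x) \<bullet> w = 0"
proof -
  obtain y z where "y \<in> span V" "!!w. w \<in> span V ==> orthogonal z w" "x = y + z"
    using orthogonal_subspace_decomp_exists[of V x] by blast
  then have "\<exists>y. y \<in> V \<and> (\<forall>w\<in>V. (x - y) \<bullet> w = 0)"
    using assms by (intro exI[of _ y]) (auto simp: orthogonal_def span_eq_iff[THEN iffD2])
  from someI_ex[OF this] show "oproj V x \<in> V" "w \<in> V ==> (x - oproj V x) \<bullet> w = 0"
    by (auto simp: oproj_def)
qed

lemma oproj_unique:
  assumes "subspace V" "y \<in> V" "!!w. w \<in> V ==> (x - y) \<bullet> w = 0"
  shows "oproj V x = y"
proof -
  have "y - oproj V x \<in> V" using assms(1,2) by (simp add: subspace_diff oproj(1))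
  then have "(x - oproj V x) \<bullet> (y - oproj V x) = 0" "(x - y) \<bullet> (y - oproj V x) = 0"
    using assms oproj by blast+
  then have "(y - oproj V x) \<bullet> (y - oproj V x) = 0" by (simp add: inner_diff_left inner_diff_right)
  then show ?thesis by simp
qed

lemma oproj_self: "subspace V ==> x \<in> V ==> oproj V x = x"
  by (rule oproj_unique) auto

lemma oproj_orth: "subspace V ==> (!!w. w \<in> V ==> x \<bullet> w = 0) ==> oproj V x = 0"
  by (rule oproj_unique) (auto simp: subspace_0)

lemma linear_oproj:
  assumes V: "subspace V"
  shows "linear (oproj V)"
proof (rule linearI)
  fix x y c
  show "oproj V (x + y) = oproj V x + oproj V y"
  proof (rule oproj_unique[OF V])
    fix w assume "w \<in> V"
    then have "(x - oproj V x) \<bullet> w + (y - oproj V y) \<bullet> w = 0" using oproj(2)[OF V] by simp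
    then show "(x + y - (oproj V x + oproj V y)) \<bullet> w = 0" by (simp add: inner_diff_left inner_add_left)
  qed (simp add: V oproj subspace_add)
  show "oproj V (c *\<^sub>R x) = c *\<^sub>R oproj V x"
  proof (rule oproj_unique[OF V])
    fix w assume "w \<in> V"
    then have "c * ((x - oproj V x) \<bullet> w) = 0" using oproj(2)[OF V] by simp
    then show "(c *\<^sub>R x - c *\<^sub>R oproj V x) \<bullet> w = 0" by (simp flip: scaleR_diff_right)
  qed (simp add: V oproj subspace_scale)
qed

lemma norm_oproj_le:
  assumes V: "subspace V"
  shows "norm (oproj V x) <= norm x"
proof -
  have "(x - oproj V x) \<bullet> oproj V x = 0" using oproj[OF V] by blast
  then have "norm x ^ 2 = norm (x - oproj V x) ^ 2 + norm (oproj V x) ^ 2"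
    by (simp add: power2_norm_eq_inner inner_diff_left inner_diff_right inner_commute)
  then show ?thesis by (simp add: power2_le_imp_le)
qed

lemma oproj_orthogonal_transformation:
  assumes V: "subspace V" and f: "!!x y. f x \<bullet> f y = x \<bullet> y" "linear f" and fV: "f ` V = V"
  shows "oproj V (f x) = f (oproj V x)"
proof (rule oproj_unique[OF V])
  show "f (oproj V x) \<in> V" using oproj(1)[OF V] fV by blast
  fix w assume "w \<in> V"
  then obtain v where "v \<in> V" "w = f v" using fV by blast
  then show "(f x - f (oproj V x)) \<bullet> w = 0"
    using oproj(2)[OF V] by (simp add: f(1) flip: linear_diff[OF f(2)])
qed

definition cproj :: "'a::euclidean_space set \<Rightarrow> 'a cx \<Rightarrow> 'a cx" where
  "cproj V z = (oproj V (fst z), oproj V (snd z))"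

lemma bounded_linear_cproj: "subspace V ==> bounded_linear (cproj V)"
  by (intro linear_conv_bounded_linear[THEN iffD1] linearI)
    (simp_all add: cproj_def linear_add[OF linear_oproj] linear_scale[OF linear_oproj])

lemma cproj_cscale: "subspace V ==> cproj V (cscale c z) = cscale c (cproj V z)"
  by (simp add: cproj_def cscale_def linear_add[OF linear_oproj] linear_scale[OF linear_oproj]
      linear_diff[OF linear_oproj])

lemma cx_hol_map_cproj: "subspace V ==> open U ==> cx_hol_map (%z. c + cproj V z) U"
  by (intro cx_hol_map_affine bounded_linear_cproj cproj_cscale)

lemma cproj_mem: "subspace V ==> cproj V z \<in> V \<times> V"
  by (simp add: cproj_def oproj)

lemma cproj_self: "subspace V ==> z \<in> V \<times> V ==> cproj V z = z"
  by (cases z) (simp add: cproj_def oproj_self)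

lemma norm_cproj_le:
  assumes "subspace V"
  shows "norm (cproj V z) <= norm z"
  unfolding cproj_def norm_prod_def
  using norm_oproj_le[OF assms] by (simp add: add_mono power_mono)

section \<open>Dimension of strata\<close>

text \<open>The set lies in a differentiable image of a set of smaller dimension than the whole
  space. As the affine span of \<open>A\<close> has dimension below \<open>dim W\<close>, its
  orthogonal complement has room for a copy \<open>Z\<close> of the complement of \<open>W\<close>,
  and the sums of points of \<open>A\<close> and \<open>Z\<close> still form a negligible
  set.\<close>

lemma negligible_image_plus_orthogonal:
  fixes \<psi> :: "'b::euclidean_space \<Rightarrow> 'b"
  assumes W: "subspace W" and A: "aff_dim A < int (dim W)" and \<psi>: "\<psi> differentiable_on A"
  shows "negligible {\<psi> y + c | y c. y \<in> A \<and> c \<in> W\<^sup>\<bottom>}"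
proof (cases "A = {}")
  case True
  then show ?thesis by simp
next
  case False
  then obtain a where a: "a \<in> A" by blast
  define V where "V = span ((+) (- a) ` A)"
  have V: "subspace V" by (simp add: V_def)
  have dimV: "dim V < dim W"
    using A aff_dim_eq_dim[of a A] a by (simp add: V_def hull_inc)
  have AV: "y - a \<in> V" if "y \<in> A" for y
    using that by (auto simp: V_def intro!: span_base)
  have comp: "dim (U\<^sup>\<bottom>) + dim U = DIM('b)" if "subspace U" for U :: "'b set"
    using dim_subspace_orthogonal_to_vectors[OF that subspace_UNIV] by (simp add: orthogonal_comp_def)
  have "dim (W\<^sup>\<bottom>) <= dim (V\<^sup>\<bottom>)" using comp[OF W] comp[OF V] dimV by linarith
  then obtain Z where Z: "subspace Z" "Z \<subseteq> span (V\<^sup>\<bottom>)" "dim Z = dim (W\<^sup>\<bottom>)"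
    by (rule choose_subspace_of_subspace)
  have ZV: "Z \<subseteq> V\<^sup>\<bottom>" using Z(2) by (simp add: subspace_orthogonal_comp span_eq_iff[THEN iffD2])
  obtain g where g: "linear g" "g ` Z = W\<^sup>\<bottom>"
    using subspace_isomorphism[OF Z(1) subspace_orthogonal_comp[of W] Z(3)] by blast
  \<comment> \<open>Sends \<open>y + z\<close> with \<open>y\<close> in \<open>A\<close> and
    \<open>z\<close> in \<open>Z\<close> to \<open>\<psi> y + g z\<close>; the two summands are
    recovered by projections, so differentiability of \<psi> along \<open>A\<close>
    suffices.\<close>
  define h where "h x = \<psi> (a + oproj V (x - a)) + g (oproj Z (x - a))" for x
  define B where "B = {y + z | y z. y \<in> A \<and> z \<in> Z}"
  have VZ: "oproj V (y + z - a) = y - a" "oproj Z (y + z - a) = z" if "y \<in> A" "z \<in> Z" for y z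
  proof -
    have o: "v \<bullet> z' = 0" if "v \<in> V" "z' \<in> Z" for v z'
      using that ZV by (auto simp: orthogonal_comp_def orthogonal_def)
    show "oproj V (y + z - a) = y - a"
      by (rule oproj_unique[OF V]) (use AV that o in \<open>auto simp: inner_commute\<close>)
    show "oproj Z (y + z - a) = z"
    proof (rule oproj_unique[OF Z(1)])
      fix w assume "w \<in> Z"
      then have "(y - a) \<bullet> w = 0" by (intro o AV that)
      then show "(y + z - a - z) \<bullet> w = 0" by (simp add: algebra_simps)
    qed (use that in auto)
  qed
  have "dim {x + y | x y. x \<in> V \<and> y \<in> Z} <= dim V + dim Z"
    using dim_sums_Int[OF V Z(1)] by linarith
  also have "\<dots> < DIM('b)" using Z(3) comp[OF W] dimV by linarith
  finally have "negligible ((+) a ` {x + y | x y. x \<in> V \<and> y \<in> Z})"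
    by (intro negligible_translation negligible_lowdim)
  moreover have "B \<subseteq> (+) a ` {x + y | x y. x \<in> V \<and> y \<in> Z}"
  proof
    fix x assume "x \<in> B"
    then obtain y z where "x = y + z" "y \<in> A" "z \<in> Z" by (auto simp: B_def)
    then show "x \<in> (+) a ` {x + y | x y. x \<in> V \<and> y \<in> Z}"
      using AV by (intro image_eqI[of _ _ "(y - a) + z"]) auto
  qed
  ultimately have negB: "negligible B" by (rule negligible_subset)
  have bl: "bounded_linear (oproj V)" "bounded_linear (oproj Z)" "bounded_linear g"
    using linear_oproj[OF V] linear_oproj[OF Z(1)] g(1) by (simp_all add: linear_conv_bounded_linear)
  have "h differentiable (at x within B)" if x: "x \<in> B" for x
  proof -
    have im: "(%x. a + oproj V (x - a)) ` B \<subseteq> A" using VZ by (auto simp: B_def)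
    have d1: "((%x. a + oproj V (x - a)) has_derivative oproj V) (at x within B)"
      by (auto intro!: derivative_eq_intros bounded_linear.has_derivative[OF bl(1)])
    have d2: "((%x. g (oproj Z (x - a))) has_derivative (%x. g (oproj Z x))) (at x within B)"
      by (auto intro!: derivative_eq_intros bounded_linear.has_derivative[OF bl(2)]
          bounded_linear.has_derivative[OF bl(3)])
    obtain D where "(\<psi> has_derivative D) (at (a + oproj V (x - a)) within A)"
      using \<psi> im x unfolding differentiable_on_def differentiable_def by blast
    then have "(\<psi> has_derivative D) (at (a + oproj V (x - a)) within (%x. a + oproj V (x - a)) ` B)"
      using im by (rule has_derivative_subset)
    from has_derivative_add[OF diff_chain_within[OF d1 this] d2]
    show ?thesis unfolding h_def differentiable_def o_def by blast
  qed
  then have "h differentiable_on B" by (simp add: differentiable_on_def)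
  then have "negligible (h ` B)"
    by (rule negligible_differentiable_image_negligible[OF order_refl negB])
  moreover have "{\<psi> y + c | y c. y \<in> A \<and> c \<in> W\<^sup>\<bottom>} \<subseteq> h ` B"
  proof
    fix x assume "x \<in> {\<psi> y + c | y c. y \<in> A \<and> c \<in> W\<^sup>\<bottom>}"
    then obtain y z where "x = \<psi> y + g z" "y \<in> A" "z \<in> Z" using g(2) by (auto simp: image_iff) (metis imageE)
    then show "x \<in> h ` B"
      using VZ[of y z] by (intro image_eqI[of _ _ "y + z"]) (auto simp: h_def B_def)
  qed
  ultimately show ?thesis by (rule negligible_subset)
qed

lemma complexify_subspace: "subspace M ==> complexify M = M \<times> M"
proof -
  assume M: "subspace M"
  have "direction M = M"
  proof
    show "direction M \<subseteq> M" unfolding direction_def using M by (auto simp: subspace_diff)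
    show "M \<subseteq> direction M"
    proof
      fix x assume "x \<in> M"
      then show "x \<in> direction M"
        unfolding direction_def using subspace_0[OF M] by (intro CollectI exI[of _ x] exI[of _ 0]) simp
    qed
  qed
  then show ?thesis by (simp add: complexify_def)
qed

context stable_set
begin

text \<open>Otherwise a chart domain, open in a real space \<open>W\<close> of dimension
  \<open>2 * k\<close>, would be covered by countably many differentiable images of sets of smaller
  dimension. Adding the complement of \<open>W\<close> makes the domain open in the whole space and
  keeps the images negligible, a contradiction.\<close>

lemma manifold_point_dim_le:
  assumes mp: "manifold_point X S x k" and cov: "countable \<Q>" "S \<subseteq> q ` (T \<inter> \<Union>\<Q>)"
  shows "\<exists>Q\<in>\<Q>. 2 * int k <= aff_dim Q"
proof (rule ccontr)
  assume "\<not> ?thesis"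
  then have small: "aff_dim Q < int (2 * k)" if "Q \<in> \<Q>" for Q using that by force
  obtain U \<phi> and M :: "'a set" and D where U: "openin (ftop X) U" and x: "x \<in> U \<inter> S" and M: "subspace M" "dim M = k"
    and D: "openin (top_of_set (complexify M)) D"
    and iso: "fspace_iso (analytic_space D) (reduced_subspace X (U \<inter> S)) \<phi>"
    using mp unfolding manifold_point_def by metis
  define W where "W = M \<times> M"
  have W: "subspace W" "dim W = 2 * k" using M by (simp_all add: W_def subspace_Times dim_Times)
  have DW: "openin (top_of_set W) D" using D by (simp add: complexify_subspace[OF M(1)] W_def)
  have topU: "topspace (ftop (reduced_subspace X (U \<inter> S))) = U \<inter> S"
    using openin_subset[OF U] by (auto simp: reduced_subspace_def)
  have topD: "topspace (ftop (analytic_space D)) = D" by (simp add: analytic_space_def)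
  have hom: "homeomorphic_map (top_of_set D) (ftop (reduced_subspace X (U \<inter> S))) \<phi>"
    using iso by (simp add: fspace_iso_def analytic_space_def)
  have inj: "inj_on \<phi> D" and im: "\<phi> ` D = U \<inter> S"
    using homeomorphic_imp_injective_map[OF hom] homeomorphic_imp_surjective_map[OF hom] topU by auto
  \<comment> \<open>The inverse chart pulled back along the orbit map. Its complex coordinates come
    from sections of the reduced subspace, so locally they are restrictions of holomorphic functions
    and differentiable.\<close>
  define \<psi> where "\<psi> y = inv_into D \<phi> (q y)" for y
  have \<psi>D: "\<psi> y \<in> D" "\<phi> (\<psi> y) = q y" if "q y \<in> U \<inter> S" for y
    using that im unfolding \<psi>_def by (metis inv_into_into, metis f_inv_into_f)
  define cd :: "'a \<Rightarrow> 'a cx \<Rightarrow> complex" where "cd b z = Complex (fst z \<bullet> b) (snd z \<bullet> b)" for b z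
  have cd_hol: "cx_holomorphic_on (cd b) UNIV" for b
  proof (rule cx_holomorphic_on_linear)
    show "bounded_linear (cd b)"
      unfolding linear_conv_bounded_linear[symmetric] cd_def
      by (rule linearI) (auto simp: complex_eq_iff inner_add_left)
    show "complex_linear (cd b)" by (simp add: complex_linear_def cd_def complex_eq_iff)
  qed simp
  have diffc: "(%y. cd b (\<psi> y)) differentiable (at y within A)"
    if A: "A \<subseteq> {y \<in> T. q y \<in> U \<inter> S}" and y: "y \<in> A" for A b y
  proof -
    define f where "f p = cd b (inv_into D \<phi> p)" for p
    have opU: "openin (ftop (reduced_subspace X (U \<inter> S))) (U \<inter> S)" using openin_topspace topU by metis
    have "analytic_fun_on (f \<circ> \<phi>) D"
    proof (rule analytic_fun_onI)
      fix z assume "z \<in> D"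
      show "\<exists>U F. z \<in> U \<and> cx_holomorphic_on F U \<and> (\<forall>y. y \<in> U --> y \<in> D --> (f \<circ> \<phi>) y = F y)"
        using cd_hol[of b] inj by (intro exI[of _ UNIV] exI[of _ "cd b"]) (auto simp: f_def)
    qed
    moreover have "{x \<in> D. \<phi> x \<in> U \<inter> S} = D" using im by auto
    ultimately have "f \<in> fsec (reduced_subspace X (U \<inter> S)) (U \<inter> S)"
      using iso opU unfolding fspace_iso_def topD
      by (auto simp: analytic_space_def)
    then have loc: "\<exists>V. openin (ftop X) V \<and> x \<in> V \<and> (\<exists>g\<in>fsec X V. \<forall>y\<in>V \<inter> (U \<inter> S). f y = g y)"
      if "x \<in> U \<inter> S" for x
      using that unfolding reduced_subspace_def fspace.simps mem_Collect_eq by (rule bspec)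
    have "q y \<in> U \<inter> S" using A y by auto
    from loc[OF this] obtain V g where V: "openin (ftop X) V" "q y \<in> V" "g \<in> fsec X V"
      "!!p. p \<in> V ==> p \<in> U \<inter> S ==> f p = g p"
      by blast
    have yV: "y \<in> {z \<in> T. q z \<in> V}" using A y V(2) by auto
    obtain O' F where O': "y \<in> O'" "cx_holomorphic_on F O'"
      "!!z. z \<in> O' ==> z \<in> {z \<in> T. q z \<in> V} ==> g (q z) = F z"
      by (rule analytic_fun_onE[OF V(3)[unfolded fsec_X] yV]) (use that in blast)
    obtain O2 where O2: "open O2" "{z \<in> T. q z \<in> V} = T \<inter> O2"
      using V(1) by (auto simp: openin_X openin_open)
    have "open (O' \<inter> O2)" using O' O2 cx_holomorphic_on_open by blast
    moreover have "y \<in> O' \<inter> O2" using O'(1) O2 yV by auto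
    ultimately obtain d where d: "d > 0" "ball y d \<subseteq> O' \<inter> O2" using openE by blast
    obtain E where E: "(F has_derivative E) (at y)" using O' by (meson cx_holomorphic_onE)
    have "((%y. cd b (\<psi> y)) has_derivative E) (at y within A)"
    proof (rule has_derivative_transform_within[OF has_derivative_at_withinI[OF E] d(1) y])
      fix y' assume y': "y' \<in> A" "dist y' y < d"
      then have "y' \<in> O'" "y' \<in> O2" using d(2) by (auto simp: dist_commute)
      moreover have "y' \<in> T" "q y' \<in> U \<inter> S" using A y' by auto
      moreover have "q y' \<in> V" using O2(2) \<open>y' \<in> O2\<close> \<open>y' \<in> T\<close> by blast
      ultimately have "g (q y') = F y'" "f (q y') = g (q y')" using O'(3) V(4) by auto
      then show "F y' = cd b (\<psi> y')" by (simp add: f_def \<psi>_def)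
    qed
    then show ?thesis by (auto simp: differentiable_def)
  qed
  have \<psi>sum: "\<psi> y = (\<Sum>b\<in>Basis. Re (cd b (\<psi> y)) *\<^sub>R (b, 0) + Im (cd b (\<psi> y)) *\<^sub>R (0, b))" for y
  proof -
    have "(\<Sum>b\<in>Basis. Re (cd b z) *\<^sub>R (b, 0) + Im (cd b z) *\<^sub>R (0, b)) = z" for z :: "'a cx"
      by (cases z) (simp add: cd_def sum_prod euclidean_representation)
    then show ?thesis by simp
  qed
  have neg: "negligible {\<psi> y + c | y c. y \<in> {y \<in> T \<inter> Q. q y \<in> U \<inter> S} \<and> c \<in> W\<^sup>\<bottom>}" if Q: "Q \<in> \<Q>" for Q
  proof (rule negligible_image_plus_orthogonal[OF W(1)])
    show "aff_dim {y \<in> T \<inter> Q. q y \<in> U \<inter> S} < int (dim W)"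
    proof -
      have "aff_dim {y \<in> T \<inter> Q. q y \<in> U \<inter> S} <= aff_dim Q" by (rule aff_dim_subset) blast
      then show ?thesis using small[OF Q] W(2) by simp
    qed
    show "\<psi> differentiable_on {y \<in> T \<inter> Q. q y \<in> U \<inter> S}"
      unfolding differentiable_on_def
    proof
      fix y assume y: "y \<in> {y \<in> T \<inter> Q. q y \<in> U \<inter> S}"
      let ?F = "at y within {y \<in> T \<inter> Q. q y \<in> U \<inter> S}"
      have "(%y. Re (cd b (\<psi> y))) differentiable ?F \<and> (%y. Im (cd b (\<psi> y))) differentiable ?F" for b
      proof -
        obtain E where E: "((%y. cd b (\<psi> y)) has_derivative E) ?F"
          using diffc[OF _ y, of b] unfolding differentiable_def by blast
        show ?thesis
          unfolding differentiable_def
          using bounded_linear.has_derivative[OF bounded_linear_Re E]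
            bounded_linear.has_derivative[OF bounded_linear_Im E] by blast
      qed
      then have "(%y. \<Sum>b\<in>Basis. Re (cd b (\<psi> y)) *\<^sub>R (b, 0) + Im (cd b (\<psi> y)) *\<^sub>R (0::'a, b)) differentiable ?F"
        by (intro differentiable_sum ballI differentiable_add differentiable_scaleR differentiable_const) auto
      then show "\<psi> differentiable ?F" using \<psi>sum by simp
    qed
  qed
  have "negligible (\<Union>Q\<in>\<Q>. {\<psi> y + c | y c. y \<in> {y \<in> T \<inter> Q. q y \<in> U \<inter> S} \<and> c \<in> W\<^sup>\<bottom>})"
    by (rule negligible_countable_Union) (use cov(1) neg in auto)
  moreover have "{z. oproj W z \<in> D} \<subseteq> (\<Union>Q\<in>\<Q>. {\<psi> y + c | y c. y \<in> {y \<in> T \<inter> Q. q y \<in> U \<inter> S} \<and> c \<in> W\<^sup>\<bottom>})"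
  proof
    fix z assume "z \<in> {z. oproj W z \<in> D}"
    then have zD: "oproj W z \<in> D" by simp
    then have "\<phi> (oproj W z) \<in> U \<inter> S" using im by blast
    then obtain y Q where y: "y \<in> T \<inter> Q" "Q \<in> \<Q>" "\<phi> (oproj W z) = q y" using cov(2) by blast
    have "\<psi> y = oproj W z" unfolding \<psi>_def y(3)[symmetric] using inj zD by simp
    moreover have "z - oproj W z \<in> W\<^sup>\<bottom>"
      using oproj(2)[OF W(1)] by (auto simp: orthogonal_comp_def orthogonal_def inner_commute)
    ultimately show "z \<in> (\<Union>Q\<in>\<Q>. {\<psi> y + c | y c. y \<in> {y \<in> T \<inter> Q. q y \<in> U \<inter> S} \<and> c \<in> W\<^sup>\<bottom>})"
      using y \<open>\<phi> (oproj W z) \<in> U \<inter> S\<close> by (intro UN_I[OF y(2)] CollectI exI[of _ y] exI[of _ "z - oproj W z"]) auto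
  qed
  ultimately have "negligible {z. oproj W z \<in> D}" by (rule negligible_subset)
  moreover have "open {z. oproj W z \<in> D}"
  proof -
    obtain O' where O': "open O'" "D = W \<inter> O'" using DW by (auto simp: openin_open)
    have "{z. oproj W z \<in> D} = oproj W -` O'" using oproj(1)[OF W(1)] O' by auto
    moreover have "continuous_on UNIV (oproj W)"
      using linear_oproj[OF W(1)] by (simp add: linear_continuous_on linear_conv_bounded_linear)
    ultimately show ?thesis using O'(1) continuous_on_open_vimage[of UNIV "oproj W"] by simp
  qed
  ultimately have "{z. oproj W z \<in> D} = {}" using open_not_negligible by blast
  moreover obtain w where "w \<in> D" using x im by blast
  moreover have "w \<in> W" using \<open>w \<in> D\<close> DW openin_imp_subset by blast
  ultimately show False using oproj_self[OF W(1), of w] by (metis empty_iff mem_Collect_eq)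
qed

end

context stable_set
begin

lemma openin_X_obtain:
  assumes "openin (ftop X) U"
  obtains O' where "open O'" "!!y. y \<in> T ==> q y \<in> U \<longleftrightarrow> y \<in> O'"
proof -
  obtain O' where "open O'" "{z \<in> T. q z \<in> U} = T \<inter> O'"
    using assms by (auto simp: openin_X openin_open)
  then show ?thesis using that by (metis (no_types, lifting) IntD2 IntI mem_Collect_eq)
qed

text \<open>The chart is \<open>q (z + w)\<close> for small \<open>w\<close> in
  \<open>V \<times> V\<close>. It is injective because points of one orbit near \<open>z\<close>
  differ by the stabiliser of \<open>z\<close>, which fixes \<open>z + w\<close>.\<close>

lemma manifold_pointI:
  fixes V :: "'a set"
  assumes z: "z \<in> T" and V: "subspace V" and r: "r > 0"
    and small: "!!g y. g \<in> G ==> y \<in> ball z r ==> cx_map g y \<in> ball z r ==> g \<in> stab z"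
    and fx: "!!g v. g \<in> stab z ==> v \<in> V ==> lin g v = v"
    and VT: "!!w. w \<in> V \<times> V ==> norm w < r ==> z + w \<in> T"
    and S: "S \<subseteq> q ` T" "!!y. y \<in> T ==> y \<in> ball z r ==> q y \<in> S \<longleftrightarrow> y - z \<in> V \<times> V"
  shows "manifold_point X S (q z) (dim V)"
proof -
  define U where "U = q ` (ball z r \<inter> T)"
  define D where "D = (V \<times> V) \<inter> ball 0 r"
  define \<phi> where "\<phi> w = q (z + w)" for w
  let ?Y = "reduced_subspace X (U \<inter> S)"
  have U: "openin (ftop X) U" unfolding U_def by (rule openin_image) simp
  have DV: "w \<in> V \<times> V" "norm w < r" "z + w \<in> T" "z + w \<in> ball z r" if "w \<in> D" for w
    using that VT by (auto simp: D_def dist_norm)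
  have W: "subspace (V \<times> V)" using V by (simp add: subspace_Times)
  have fixD: "cx_map g (z + w) = z + w" if "g \<in> stab z" "w \<in> V \<times> V" for g w
  proof -
    have g: "g \<in> G" "cx_map g z = z" using that by (auto simp: stab_def)
    have "cx_map g (z + w) - cx_map g z = w"
      unfolding cx_map_diff[OF g(1)] using fx[OF that(1)] that(2) by (cases w) auto
    then show ?thesis using g(2) by (simp add: algebra_simps)
  qed
  have phiS: "\<phi> w \<in> U \<inter> S" if "w \<in> D" for w
    using DV[OF that] S(2)[of "z + w"] by (auto simp: \<phi>_def U_def)
  have USy: "\<exists>y. y \<in> T \<and> y \<in> ball z r \<and> y - z \<in> D \<and> p = q y \<and> p = \<phi> (y - z)" if p: "p \<in> U \<inter> S" for p
  proof -
    obtain y where y: "y \<in> ball z r" "y \<in> T" "p = q y" using p by (auto simp: U_def)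
    then have "y - z \<in> D" using S(2)[of y] p by (simp add: D_def dist_norm norm_minus_commute)
    with y show ?thesis by (auto simp: \<phi>_def)
  qed
  have im: "\<phi> ` D = U \<inter> S"
  proof
    show "\<phi> ` D \<subseteq> U \<inter> S" using phiS by blast
    show "U \<inter> S \<subseteq> \<phi> ` D"
    proof
      fix p assume "p \<in> U \<inter> S"
      from USy[OF this] show "p \<in> \<phi> ` D" by auto
    qed
  qed
  have inj: "inj_on \<phi> D"
  proof (rule inj_onI)
    fix w w' assume w: "w \<in> D" "w' \<in> D" "\<phi> w = \<phi> w'"
    then obtain g where g: "g \<in> G" "z + w = cx_map g (z + w')" unfolding \<phi>_def cx_orbit_eq_iff by blast
    then have "g \<in> stab z" using small[of g "z + w'"] DV[OF w(1)] DV[OF w(2)] by simp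
    then show "w = w'" using fixD DV(1)[OF w(2)] g(2) by simp
  qed
  have topD: "topspace (ftop (analytic_space D)) = D" "ftop (analytic_space D) = top_of_set D"
    by (simp_all add: analytic_space_def)
  have topY: "topspace (ftop ?Y) = U \<inter> S" "ftop ?Y = subtopology (ftop X) (U \<inter> S)"
    using openin_subset[OF U] by (auto simp: reduced_subspace_def)
  have opY: "\<exists>O'. open O' \<and> (\<forall>w\<in>D. \<phi> w \<in> P0 \<longleftrightarrow> z + w \<in> O')" if "openin (ftop ?Y) P0" for P0
  proof -
    have "\<exists>P. openin (ftop X) P \<and> P0 = P \<inter> (U \<inter> S)"
      using that unfolding topY(2) openin_subtopology .
    then obtain P where P: "openin (ftop X) P" "P0 = P \<inter> (U \<inter> S)" by metis
    obtain O' where "open O'" "!!y. y \<in> T ==> q y \<in> P \<longleftrightarrow> y \<in> O'" using openin_X_obtain[OF P(1)] by metis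
    then show ?thesis
      using phiS DV(3) P(2) unfolding \<phi>_def by (intro exI[of _ O'] conjI ballI) simp_all
  qed
  have optr: "open {w. z + w \<in> O'}" if "open O'" for O' :: "'a cx set"
  proof -
    have "{w. z + w \<in> O'} = (%w. z + w) -` O'" by auto
    moreover have "continuous_on UNIV (%w. z + w)" by (intro continuous_intros)
    ultimately show ?thesis using that continuous_on_open_vimage[of UNIV "%w. z + w"] by simp
  qed
  have cont: "continuous_map (top_of_set D) (ftop ?Y) \<phi>"
    unfolding continuous_map_def
  proof (intro conjI allI impI)
    show "\<phi> \<in> topspace (top_of_set D) \<rightarrow> topspace (ftop ?Y)" using phiS topY by auto
    fix P0 assume "openin (ftop ?Y) P0"
    from opY[OF this] obtain O' where "open O'" "\<forall>w\<in>D. \<phi> w \<in> P0 \<longleftrightarrow> z + w \<in> O'" by blast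
    then have "{x \<in> topspace (top_of_set D). \<phi> x \<in> P0} = D \<inter> {w. z + w \<in> O'}" by auto
    then show "openin (top_of_set D) {x \<in> topspace (top_of_set D). \<phi> x \<in> P0}"
      using optr[OF \<open>open O'\<close>] by (simp add: openin_open_Int)
  qed
  have opmap: "open_map (top_of_set D) (ftop ?Y) \<phi>"
    unfolding open_map_def
  proof (intro allI impI)
    fix N assume "openin (top_of_set D) N"
    then obtain N' where N': "open N'" "N = D \<inter> N'" by (auto simp: openin_open)
    let ?B = "{y. y - z \<in> N'} \<inter> ball z r"
    have "open {y. y - z \<in> N'}"
    proof -
      have "{y. y - z \<in> N'} = (%y. y - z) -` N'" by auto
      moreover have "continuous_on UNIV (%y. y - z)" by (intro continuous_intros)
      ultimately show ?thesis using N'(1) continuous_on_open_vimage[of UNIV "%y. y - z"] by simp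
    qed
    then have "openin (ftop X) (q ` (?B \<inter> T))" by (intro openin_image open_Int open_ball)
    moreover have "\<phi> ` N = q ` (?B \<inter> T) \<inter> (U \<inter> S)"
    proof
      show "\<phi> ` N \<subseteq> q ` (?B \<inter> T) \<inter> (U \<inter> S)"
        using phiS DV N' unfolding \<phi>_def by (fastforce intro!: imageI)
      show "q ` (?B \<inter> T) \<inter> (U \<inter> S) \<subseteq> \<phi> ` N"
      proof
        fix p assume p: "p \<in> q ` (?B \<inter> T) \<inter> (U \<inter> S)"
        then obtain y where y: "y \<in> T" "y \<in> ball z r" "y - z \<in> N'" "p = q y" by blast
        then have "y - z \<in> D" using S(2)[of y] p by (simp add: D_def dist_norm norm_minus_commute)
        then show "p \<in> \<phi> ` N" using y N' by (intro image_eqI[of _ _ "y - z"]) (auto simp: \<phi>_def)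
      qed
    qed
    ultimately show "openin (ftop ?Y) (\<phi> ` N)" unfolding topY openin_subtopology by blast
  qed
  have hom: "homeomorphic_map (top_of_set D) (ftop ?Y) \<phi>"
    by (rule bijective_open_imp_homeomorphic_map[OF cont opmap]) (use im inj topY in auto)
  have sec: "f \<in> fsec ?Y P0 \<longleftrightarrow> f \<circ> \<phi> \<in> fsec (analytic_space D) {w \<in> D. \<phi> w \<in> P0}"
    if P0: "openin (ftop ?Y) P0" for P0 f
  proof -
    have Osub: "P0 \<subseteq> U \<inter> S" using openin_subset[OF P0] topY by simp
    obtain O' where O': "open O'" "!!w. w \<in> D ==> \<phi> w \<in> P0 \<longleftrightarrow> z + w \<in> O'" using opY[OF P0] by blast
    have fsecY: "f \<in> fsec ?Y P0 \<longleftrightarrow> (\<forall>x\<in>P0. \<exists>V. openin (ftop X) V \<and> x \<in> V \<and> (\<exists>g\<in>fsec X V. \<forall>y\<in>V \<inter> P0. f y = g y))"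
      by (simp add: reduced_subspace_def)
    have fsecD: "f \<circ> \<phi> \<in> fsec (analytic_space D) {w \<in> D. \<phi> w \<in> P0} \<longleftrightarrow>
        analytic_fun_on (%w. f (\<phi> w)) {w \<in> D. \<phi> w \<in> P0}"
      by (simp add: analytic_space_def o_def)
    show ?thesis unfolding fsecY fsecD
    proof
      assume loc: "\<forall>x\<in>P0. \<exists>V. openin (ftop X) V \<and> x \<in> V \<and> (\<exists>g\<in>fsec X V. \<forall>y\<in>V \<inter> P0. f y = g y)"
      show "analytic_fun_on (%w. f (\<phi> w)) {w \<in> D. \<phi> w \<in> P0}"
      proof (rule analytic_fun_onI)
        fix w assume w: "w \<in> {w \<in> D. \<phi> w \<in> P0}"
        then have "\<phi> w \<in> P0" by simp
        from bspec[OF loc this] obtain P g where P: "openin (ftop X) P" "\<phi> w \<in> P" "g \<in> fsec X P"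
          "!!y. y \<in> P ==> y \<in> P0 ==> f y = g y" by blast
        have wD: "w \<in> D" using w by simp
        have zw: "z + w \<in> {y \<in> T. q y \<in> P}" using DV(3)[OF wD] P(2) by (simp add: \<phi>_def)
        obtain A F where F: "z + w \<in> A" "cx_holomorphic_on F A"
          "!!y. y \<in> A ==> y \<in> {y \<in> T. q y \<in> P} ==> g (q y) = F y"
          by (rule analytic_fun_onE[OF P(3)[unfolded fsec_X] zw]) (use that in blast)
        obtain P' where P': "open P'" "!!y. y \<in> T ==> q y \<in> P \<longleftrightarrow> y \<in> P'" using openin_X_obtain[OF P(1)] by metis
        let ?A = "{w. z + w \<in> A \<inter> P'}"
        have opA: "open ?A" using F(2) P'(1) by (intro optr open_Int) (auto dest: cx_holomorphic_on_open)
        have "cx_hol_map (%w. z + w) ?A"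
          using cx_hol_map_affine[of "%w. w" ?A z] opA by simp
        then have "cx_holomorphic_on (%w. F (z + w)) ?A"
          by (rule cx_holomorphic_on_compose[OF _ F(2)]) auto
        moreover have "w \<in> ?A" using F(1) P'(2)[of "z + w"] zw by simp
        moreover have "f (\<phi> w') = F (z + w')" if "w' \<in> ?A" "w' \<in> {w \<in> D. \<phi> w \<in> P0}" for w'
        proof -
          have w'D: "w' \<in> D" using that by simp
          then have T': "z + w' \<in> T" using DV by blast
          then have "q (z + w') \<in> P" using P'(2) that(1) by simp
          then show ?thesis using P(4)[of "\<phi> w'"] F(3)[of "z + w'"] that T' by (simp add: \<phi>_def)
        qed
        ultimately show "\<exists>U F. w \<in> U \<and> cx_holomorphic_on F U \<and>
            (\<forall>y. y \<in> U --> y \<in> {w \<in> D. \<phi> w \<in> P0} --> f (\<phi> y) = F y)"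
          by (intro exI[of _ ?A] exI[of _ "%w. F (z + w)"]) simp
      qed
    next
      assume an: "analytic_fun_on (%w. f (\<phi> w)) {w \<in> D. \<phi> w \<in> P0}"
      show "\<forall>x\<in>P0. \<exists>V. openin (ftop X) V \<and> x \<in> V \<and> (\<exists>g\<in>fsec X V. \<forall>y\<in>V \<inter> P0. f y = g y)"
      proof
        fix p assume p: "p \<in> P0"
        then have "p \<in> \<phi> ` D" using Osub unfolding im by (rule subsetD[rotated])
        then obtain w where w: "w \<in> D" "\<phi> w = p" by (elim imageE) simp
        then have w': "w \<in> {w \<in> D. \<phi> w \<in> P0}" using p by simp
        obtain A F where F: "w \<in> A" "cx_holomorphic_on F A"
          "!!w. w \<in> A ==> w \<in> {w \<in> D. \<phi> w \<in> P0} ==> f (\<phi> w) = F w"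
          by (rule analytic_fun_onE[OF an w']) (use that in blast)
        define y0 where "y0 = z + w"
        have y0: "y0 \<in> ball z r" "y0 \<in> T" "y0 \<in> O'" using DV[OF w(1)] O'(2)[OF w(1)] w p by (auto simp: y0_def)
        have "open (A \<inter> {w. z + w \<in> ball z r \<inter> O'})"
          using F(2) O'(1) by (intro open_Int optr open_ball) (auto dest: cx_holomorphic_on_open)
        moreover have "w \<in> A \<inter> {w. z + w \<in> ball z r \<inter> O'}" using F(1) y0 by (simp add: y0_def)
        ultimately obtain s where s: "s > 0" "ball w s \<subseteq> A \<inter> {w. z + w \<in> ball z r \<inter> O'}" using openE by blast
        \<comment> \<open>A function on the component is extended to a ball by orthogonal
          projection. Stabiliser elements fix \<open>V\<close> pointwise and so do not change the
          projection; hence the extension descends to the quotient.\<close>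
        define F' where "F' y = F (cproj V (y - z))" for y
        have wV: "cproj V w = w" using cproj_self[OF V] DV(1)[OF w(1)] by blast
        have pin: "cproj V (y - z) \<in> ball w s" if "y \<in> ball y0 s" for y
        proof -
          interpret bl: bounded_linear "cproj V" by (rule bounded_linear_cproj[OF V])
          have "cproj V (y - z) - w = cproj V (y - y0)"
            using wV by (simp add: y0_def bl.diff bl.add)
          then show ?thesis
            using norm_cproj_le[OF V, of "y - y0"] that
            by (simp add: dist_norm norm_minus_commute[of w] norm_minus_commute[of y0])
        qed
        have yin: "y \<in> ball z r" "y \<in> O'" if "y \<in> ball y0 s" for y
        proof -
          have "y - z \<in> ball w s" using that by (simp add: y0_def dist_norm algebra_simps)
          then have "z + (y - z) \<in> ball z r \<inter> O'" using s(2) by blast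
          then show "y \<in> ball z r" "y \<in> O'" by simp_all
        qed
        have "cx_hol_map (%y. cproj V (- z) + cproj V y) (ball y0 s)" by (rule cx_hol_map_cproj[OF V open_ball])
        then have "cx_hol_map (%y. cproj V (y - z)) (ball y0 s)"
          using linear_add[OF bounded_linear.linear[OF bounded_linear_cproj[OF V]], of "- z"] by simp
        then have F'hol: "cx_holomorphic_on F' (ball y0 s)"
          unfolding F'_def by (rule cx_holomorphic_on_compose[OF _ F(2)]) (use pin s(2) in blast)
        have stz: "g \<in> stab z" if "g \<in> G" "y \<in> ball y0 s" "cx_map g y \<in> ball y0 s" for g y
          using small[OF that(1)] yin that by blast
        have y0V: "y0 - z \<in> V \<times> V" using DV(1)[OF w(1)] by (simp add: y0_def)
        obtain h where h: "h \<in> fsec X (q ` (ball y0 s \<inter> T))" "!!y. y \<in> T \<inter> ball y0 s ==> h (q y) = F' y"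
        proof (rule descend[OF F'hol])
          fix g y assume "g \<in> G" "y \<in> ball y0 s" "cx_map g y \<in> ball y0 s"
          then have "g \<in> stab z" by (rule stz)
          then show "g \<in> stab y0"
            using fixD[of g w] DV(1)[OF w(1)] by (auto simp: stab_def y0_def)
        next
          fix g y assume g: "g \<in> stab y0" and y: "y \<in> T \<inter> ball y0 s"
          have gG: "g \<in> G" using g by (simp add: stab_def)
          have "g \<in> stab z" using stz[OF gG, of y0] g s(1) by (simp add: stab_def)
          then have gz: "cx_map g z = z" and lf: "lin g v = v" if "v \<in> V" for v
            using fx that by (auto simp: stab_def)
          have gz: "cx_map g z = z" using \<open>g \<in> stab z\<close> by (simp add: stab_def)
          have op: "oproj V (lin g v) = oproj V v" for v
          proof -
            have "oproj V (lin g v) = lin g (oproj V v)"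
              using lf lin_inner[OF gG] lin_linear[OF gG]
              by (intro oproj_orthogonal_transformation[OF V]) (auto simp: image_iff)
            then show ?thesis using lf oproj(1)[OF V] by simp
          qed
          have "cx_map g y - z = (lin g (fst y - fst z), lin g (snd y - snd z))"
            using cx_map_diff[OF gG, of y z] gz by simp
          then have "cproj V (cx_map g y - z) = cproj V (y - z)"
            by (simp add: cproj_def op)
          then show "F' (cx_map g y) = F' y" by (simp add: F'_def)
        qed (use that in blast)
        show "\<exists>V. openin (ftop X) V \<and> p \<in> V \<and> (\<exists>g\<in>fsec X V. \<forall>y\<in>V \<inter> P0. f y = g y)"
        proof (intro exI[of _ "q ` (ball y0 s \<inter> T)"] conjI bexI[OF _ h(1)] ballI)
          show "openin (ftop X) (q ` (ball y0 s \<inter> T))" by (rule openin_image) simp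
          show "p \<in> q ` (ball y0 s \<inter> T)"
            using w(2) y0 s(1) by (intro image_eqI[of _ _ y0]) (auto simp: \<phi>_def y0_def)
          fix p' assume p': "p' \<in> q ` (ball y0 s \<inter> T) \<inter> P0"
          then obtain y where y: "y \<in> ball y0 s" "y \<in> T" "p' = q y" by blast
          have "p' \<in> S" using subsetD[OF Osub IntD2[OF p']] by simp
          then have "q y \<in> S" unfolding y(3) .
          then have "y - z \<in> V \<times> V" using S(2)[OF y(2) yin(1)[OF y(1)]] by (rule iffD1[rotated])
          moreover have "norm (y - z) < r" using yin(1)[OF y(1)] by (simp add: dist_norm norm_minus_commute)
          ultimately have yD: "y - z \<in> D" by (simp add: D_def)
          have "y - z \<in> ball w s" using y(1) by (simp add: y0_def dist_norm algebra_simps)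
          then have "f (\<phi> (y - z)) = F (y - z)"
            using F(3)[of "y - z"] s(2) yD y(3) p' by (auto simp: \<phi>_def)
          moreover have "F' y = F (y - z)" using cproj_self[OF V DV(1)[OF yD]] by (simp add: F'_def)
          ultimately show "f p' = h p'" using h(2)[of y] y by (simp add: \<phi>_def)
        qed
      qed
    qed
  qed
  have "fspace_iso (analytic_space D) ?Y \<phi>"
    unfolding fspace_iso_def topD using hom sec by auto
  moreover have "openin (top_of_set (complexify V)) D"
    unfolding complexify_subspace[OF V] D_def by (simp add: openin_open_Int)
  moreover have "q z \<in> U \<inter> S"
    using phiS[of 0] r subspace_0[OF W] by (simp add: \<phi>_def D_def)
  ultimately show ?thesis
    unfolding manifold_point_def using U V by blast
qed

end

section \<open>Germs on unions of linear subspaces\<close>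

text \<open>Complex-linear extension of the real functional \<open>x \<bullet> b\<close>.\<close>

definition cd :: "'a::euclidean_space \<Rightarrow> 'a cx \<Rightarrow> complex" where
  "cd b z = Complex (fst z \<bullet> b) (snd z \<bullet> b)"

text \<open>The complex-bilinear square, not the Hermitian norm: it is holomorphic, preserved by
  linear parts of isometries, and equals \<open>c^2\<close> on the multiple by \<open>c\<close> of a
  real unit vector.\<close>

definition qf :: "'a::euclidean_space cx \<Rightarrow> complex" where
  "qf z = (\<Sum>b\<in>Basis. (cd b z)^2)"

lemma bounded_linear_cd: "bounded_linear (cd b)"
  unfolding linear_conv_bounded_linear[symmetric] cd_def
  by (rule linearI) (auto simp: complex_eq_iff inner_add_left)

lemma complex_linear_cd: "complex_linear (cd b)"
  by (simp add: complex_linear_def cd_def complex_eq_iff)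

lemma cd_holomorphic: "open U ==> cx_holomorphic_on (cd b) U"
  by (rule cx_holomorphic_on_linear[OF bounded_linear_cd complex_linear_cd])

lemma cd_cscale: "cd b (cscale c z) = c * cd b z"
  by (rule complex_linear_cscale[OF bounded_linear.linear[OF bounded_linear_cd] complex_linear_cd])

lemma cd_add: "cd b (y + z) = cd b y + cd b z"
  by (rule linear_add[OF bounded_linear.linear[OF bounded_linear_cd]])

lemma cd_real: "cd b (x, 0) = of_real (x \<bullet> b)"
  by (simp add: cd_def complex_eq_iff)

lemma cmod_cd_le: "cmod (cd b z) <= norm z * norm b"
proof -
  have "(fst z \<bullet> b)\<^sup>2 + (snd z \<bullet> b)\<^sup>2 <= (norm (fst z) * norm b)\<^sup>2 + (norm (snd z) * norm b)\<^sup>2"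
    by (intro add_mono abs_le_square_iff[THEN iffD1]) (simp_all add: Cauchy_Schwarz_ineq2)
  also have "\<dots> = (norm z * norm b)\<^sup>2"
    by (simp add: norm_prod_def power_mult_distrib distrib_right)
  finally show ?thesis
    by (simp add: cd_def cmod_def real_le_lsqrt)
qed

lemma qf_eq: "qf z = Complex (fst z \<bullet> fst z - snd z \<bullet> snd z) (2 * (fst z \<bullet> snd z))"
proof -
  have "Re (qf z) = fst z \<bullet> fst z - snd z \<bullet> snd z"
    unfolding qf_def by (subst (1 2) euclidean_inner)
      (simp add: cd_def power2_eq_square sum_subtractf)
  moreover have "Im (qf z) = 2 * (fst z \<bullet> snd z)"
    unfolding qf_def by (subst euclidean_inner) (simp add: cd_def power2_eq_square sum_distrib_left algebra_simps)
  ultimately show ?thesis by (simp add: complex_eq_iff)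
qed

lemma qf_holomorphic:
  "cx_hol_map P U ==> cx_holomorphic_on (%y. qf (P y)) U"
  unfolding qf_def
  by (intro cx_holomorphic_on_sum cx_holomorphic_on_power
      cx_holomorphic_on_compose[OF _ cd_holomorphic[of UNIV]]) (auto dest: cx_hol_map_open)

lemma qf_cscale_real: "qf (cscale c (u, 0)) = c^2 * of_real (u \<bullet> u)"
  unfolding qf_eq by (simp add: cscale_def complex_eq_iff power2_eq_square algebra_simps)

lemma cproj_cscale_orth:
  assumes "subspace W" "!!w. w \<in> W ==> u \<bullet> w = 0"
  shows "cproj W (cscale c (u, 0)) = 0"
proof -
  have "oproj W u = 0" by (rule oproj_orth[OF assms])
  then show ?thesis
    by (simp add: cproj_def cscale_def linear_scale[OF linear_oproj[OF assms(1)]]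
        linear_0[OF linear_oproj[OF assms(1)]] zero_prod_def)
qed

lemma cx_hol_map_subset: "cx_hol_map P U ==> open V ==> V \<subseteq> U ==> cx_hol_map P V"
  by (auto simp: cx_hol_map_def)

section \<open>Averaging and restriction of invariant germs\<close>

context stable_set
begin

lemma cd_lin: "g \<in> G ==> cd (lin g b) (lin g x, lin g v) = cd b (x, v)"
  by (simp add: cd_def lin_inner)

lemma qf_lin: "g \<in> G ==> qf (lin g x, lin g v) = qf (x, v)"
  by (simp add: qf_eq lin_inner)

lemma hol_germ_ball:
  assumes F: "hol_germ z F"
  obtains r where "r > 0" "cx_holomorphic_on F (ball z r)"
    "!!g y. g \<in> stab z ==> y \<in> T ==> y \<in> ball z r ==> F (cx_map g y) = F y"
proof -
  obtain r1 where r1: "r1 > 0" "cx_holomorphic_on F (ball z r1)" using F by (auto simp: hol_germ_def)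
  have "eventually (%y. \<forall>g\<in>stab z. F (cx_map g y) = F y) (germ z)"
    by (rule eventually_ball_finite[OF finite_stab]) (use F in \<open>simp add: hol_germ_def\<close>)
  then obtain r2 where r2: "r2 > 0" "\<forall>y\<in>T \<inter> ball z r2. \<forall>g\<in>stab z. F (cx_map g y) = F y"
    unfolding eventually_germ by blast
  have "cx_holomorphic_on F (ball z (min r1 r2))"
    by (rule cx_holomorphic_on_subset[OF r1(2)]) auto
  then show ?thesis
    using that[of "min r1 r2"] r1(1) r2 by auto
qed

lemma hol_germI:
  assumes "r > 0" "cx_holomorphic_on F (ball z r)"
    "!!g y. g \<in> stab z ==> y \<in> T ==> y \<in> ball z r ==> F (cx_map g y) = F y"
  shows "hol_germ z F"
  unfolding hol_germ_def eventually_germ using assms by blast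

lemma cx_holomorphic_on_cx_map:
  assumes "cx_holomorphic_on F (ball z r)" "g \<in> stab z"
  shows "cx_holomorphic_on (%y. F (cx_map g y)) (ball z r)"
proof -
  have "g \<in> G" using assms(2) by (simp add: stab_def)
  then show ?thesis
    by (intro cx_holomorphic_on_compose[OF cx_hol_map_cx_map assms(1)]) (use cx_map_ball[OF assms(2)] in blast)+
qed

lemma sum_stab_cx_map:
  assumes "h \<in> stab z"
  shows "(\<Sum>g\<in>stab z. F (cx_map g (cx_map h y))) = (\<Sum>g\<in>stab z. F (cx_map g y))"
proof -
  obtain k where k: "k \<in> stab z" "!!x. k (h x) = x" "!!x. h (k x) = x"
    by (rule stab_inverse[OF assms]) (use that in blast)
  have st: "g \<in> G" if "g \<in> stab z" for g using that by (simp add: stab_def)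
  show ?thesis
  proof (rule sum.reindex_bij_witness[of _ "%g x. g (k x)" "%g x. g (h x)"])
    fix g assume g: "g \<in> stab z"
    show "(%x. g (h x)) \<in> stab z" "(%x. g (k x)) \<in> stab z" using stab_comp g assms k(1) by auto
    show "F (cx_map (%x. g (h x)) y) = F (cx_map g (cx_map h y))"
      using cx_map_comp[OF st[OF g] st[OF assms]] by simp
  qed (simp_all add: k)
qed

text \<open>Averaging makes a function invariant on the whole ball and not only along
  \<open>T\<close>, so that the invariance can later be differentiated at \<open>z\<close>.\<close>

lemma average_germ:
  assumes F: "cx_holomorphic_on F (ball z r)" and r: "r > 0"
  defines "R \<equiv> %y. (\<Sum>g\<in>stab z. F (cx_map g y)) / of_nat (card (stab z))"
  shows "cx_holomorphic_on R (ball z r)" "g \<in> stab z ==> R (cx_map g y) = R y" "hol_germ z R"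
proof -
  have card: "card (stab z) ~= 0" using finite_stab[of z] stab_id[of z] by (metis card_0_eq empty_iff)
  show hol: "cx_holomorphic_on R (ball z r)"
    unfolding R_def using card
    by (intro cx_holomorphic_on_divide cx_holomorphic_on_sum cx_holomorphic_on_cx_map[OF F]) auto
  show inv: "R (cx_map g y) = R y" if "g \<in> stab z" for g y
    unfolding R_def sum_stab_cx_map[OF that, of F y] ..
  show "hol_germ z R" by (rule hol_germI[OF r hol inv])
qed

text \<open>Elements fixing \<open>W\<close> keep the component along \<open>W\<close> and act by
  their linear part on the component normal to it.\<close>

lemma nrm_cx_map:
  assumes g: "g \<in> stab z" and W: "subspace W" and fx: "!!w. w \<in> W ==> lin g w = w"
  shows "cproj W (cx_map g y - z) = cproj W (y - z)"
    and "cx_map g y - z - cproj W (cx_map g y - z) =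
      (lin g (fst (y - z - cproj W (y - z))), lin g (snd (y - z - cproj W (y - z))))"
proof -
  have gG: "g \<in> G" "cx_map g z = z" using g by (auto simp: stab_def)
  have d: "cx_map g y - z = (lin g (fst y - fst z), lin g (snd y - snd z))"
    using cx_map_diff[OF gG(1), of y z] gG(2) by simp
  have im: "lin g ` W = W" using fx by force
  have "oproj W (lin g v) = oproj W v" for v
    using oproj_orthogonal_transformation[OF W lin_inner[OF gG(1)] lin_linear[OF gG(1)] im] fx oproj(1)[OF W]
    by simp
  then show 1: "cproj W (cx_map g y - z) = cproj W (y - z)" unfolding d by (simp add: cproj_def)
  show "cx_map g y - z - cproj W (cx_map g y - z) =
      (lin g (fst (y - z - cproj W (y - z))), lin g (snd (y - z - cproj W (y - z))))"
    unfolding 1 unfolding d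
    by (simp add: cproj_def linear_diff[OF lin_linear[OF gG(1)]] fx oproj(1)[OF W])
qed

text \<open>Holomorphic retraction onto the component through \<open>z\<close> with direction
  \<open>V\<close>; composing with it turns functions on the component into functions on a ball,
  where the ring-theoretic results above apply.\<close>

definition translate_proj :: "'a cx \<Rightarrow> 'a set \<Rightarrow> 'a cx \<Rightarrow> 'a cx" where
  "translate_proj z V y = z + cproj V (y - z)"

lemma cx_hol_map_translate_proj:
  assumes "subspace V" "open U"
  shows "cx_hol_map (translate_proj z V) U"
proof -
  have "cx_hol_map (%y. (z + cproj V (- z)) + cproj V y) U" by (rule cx_hol_map_cproj[OF assms])
  moreover have "(z + cproj V (- z)) + cproj V y = translate_proj z V y" for y
    using linear_add[OF bounded_linear.linear[OF bounded_linear_cproj[OF assms(1)]], of "- z" y]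
    by (simp add: translate_proj_def)
  ultimately show ?thesis by simp
qed

lemma translate_proj_ball: "subspace V ==> y \<in> ball z r ==> translate_proj z V y \<in> ball z r"
  using norm_cproj_le[of V "y - z"]
  by (simp add: translate_proj_def dist_norm norm_minus_commute[of z y])

lemma cx_holomorphic_on_translate_proj:
  assumes "cx_holomorphic_on F (ball z r)" "subspace V"
  shows "cx_holomorphic_on (%y. F (translate_proj z V y)) (ball z r)"
  by (rule cx_holomorphic_on_compose[OF cx_hol_map_translate_proj[OF assms(2) open_ball] assms(1)])
    (rule image_subsetI, rule translate_proj_ball[OF assms(2)])

text \<open>The invariant germs on \<open>T\<close> are determined by their restrictions to the single component with
  direction \<open>V\<close>; \<open>extend\<close> says that quotients of such restrictions extend to \<open>T\<close>.\<close>

lemma normal_germ_via_component: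
  assumes V: "subspace V" and z: "z \<in> T" and r0: "r0 > 0"
    and comp: "!!y. y \<in> ball z r0 ==> y \<in> T \<longleftrightarrow> (\<exists>g\<in>stab z. \<exists>y'. y' - z \<in> V \<times> V \<and> y = cx_map g y')"
    and extend: "!!A B R r. r > 0 ==> r <= r0 ==> cx_holomorphic_on A (ball z r) ==> cx_holomorphic_on B (ball z r) ==>
      (!!g y. g \<in> stab z ==> y \<in> T ==> y \<in> ball z r ==> A (cx_map g y) = A y) ==>
      (!!g y. g \<in> stab z ==> y \<in> T ==> y \<in> ball z r ==> B (cx_map g y) = B y) ==>
      cx_holomorphic_on R (ball z r) ==>
      (!!\<rho>. 0 < \<rho> ==> \<rho> <= r ==> \<exists>p\<in>ball z \<rho>. B (translate_proj z V p) ~= 0) ==>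
      (!!y. y \<in> ball z r ==> A (translate_proj z V y) = R y * B (translate_proj z V y)) ==>
      \<exists>F \<rho>. 0 < \<rho> \<and> \<rho> <= r \<and> cx_holomorphic_on F (ball z \<rho>) \<and>
        (\<forall>y\<in>T \<inter> ball z \<rho>. A y = F y * B y)"
  shows "normal_germ z"
proof -
  have tpT: "translate_proj z V y \<in> T" if "y \<in> ball z r0" for y
  proof -
    have "translate_proj z V y - z \<in> V \<times> V" using cproj_mem[OF V] by (simp add: translate_proj_def)
    moreover have "translate_proj z V y = cx_map (%x. x) (translate_proj z V y)" by (simp add: cx_map_id)
    ultimately show ?thesis
      by (intro comp[OF translate_proj_ball[OF V that], THEN iffD2] bexI[OF _ stab_id] exI conjI)
  qed
  \<comment> \<open>Every point of \<open>T\<close> near \<open>z\<close> is a stabiliser translate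
    of a point of the component, so an invariant germ vanishes exactly when its composition with the
    retraction does.\<close>
  have red: "eventually (%y. F y = 0) (germ z) \<longleftrightarrow> (\<exists>\<rho>>0. \<forall>y\<in>ball z \<rho>. F (translate_proj z V y) = 0)"
    if r: "r > 0" and inv: "!!g y. g \<in> stab z ==> y \<in> T ==> y \<in> ball z r ==> F (cx_map g y) = F y" for F :: "'a cx \<Rightarrow> complex" and r
  proof
    assume "eventually (%y. F y = 0) (germ z)"
    then obtain \<rho> where \<rho>: "\<rho> > 0" "\<forall>y\<in>T \<inter> ball z \<rho>. F y = 0" unfolding eventually_germ by blast
    then have "\<forall>y\<in>ball z (min \<rho> r0). F (translate_proj z V y) = 0"
      using tpT translate_proj_ball[OF V] by simp
    then show "\<exists>\<rho>>0. \<forall>y\<in>ball z \<rho>. F (translate_proj z V y) = 0" using \<rho> r0 by (intro exI[of _ "min \<rho> r0"]) simp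
  next
    assume "\<exists>\<rho>>0. \<forall>y\<in>ball z \<rho>. F (translate_proj z V y) = 0"
    then obtain \<rho> where \<rho>: "\<rho> > 0" "\<forall>y\<in>ball z \<rho>. F (translate_proj z V y) = 0" by blast
    have "F y = 0" if y: "y \<in> T \<inter> ball z (min \<rho> (min r r0))" for y
    proof -
      obtain g y' where gy: "g \<in> stab z" "y' - z \<in> V \<times> V" "y = cx_map g y'"
      proof -
        have "y \<in> ball z r0" "y \<in> T" using y by auto
        then show ?thesis using comp that by metis
      qed
      have "dist z y' = dist z y"
        using dist_cx_map[of g z y'] gy(1,3) by (simp add: stab_def)
      then have y'b: "y' \<in> ball z (min \<rho> (min r r0))" using y by simp
      have y'tp: "translate_proj z V y' = y'" using cproj_self[OF V gy(2)] by (simp add: translate_proj_def)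
      have "y' \<in> T" using tpT[of y'] y'b y'tp by simp
      then have "F y = F y'" using inv[OF gy(1)] y'b gy(3) by simp
      also have "F y' = 0" using bspec[OF \<rho>(2), of y'] y'b y'tp by simp
      finally show ?thesis .
    qed
    then show "eventually (%y. F y = 0) (germ z)"
      unfolding eventually_germ using \<rho>(1) r r0 by (intro exI[of _ "min \<rho> (min r r0)"]) auto
  qed
  have restr: "cx_holomorphic_on F (ball z s)" if "cx_holomorphic_on F (ball z r)" "s <= r" for F r s
    by (rule cx_holomorphic_on_subset[OF that(1)]) (use that(2) in auto)
  show ?thesis
    unfolding normal_germ_def
  proof (intro conjI allI impI)
    fix A B assume A: "hol_germ z A" and B: "hol_germ z B"
      and AB: "eventually (%y. A y * B y = 0) (germ z)"
    obtain r1 where r1: "r1 > 0" "cx_holomorphic_on A (ball z r1)"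
      "!!g y. g \<in> stab z ==> y \<in> T ==> y \<in> ball z r1 ==> A (cx_map g y) = A y" by (rule hol_germ_ball[OF A]) (rule that)
    obtain r2 where r2: "r2 > 0" "cx_holomorphic_on B (ball z r2)"
      "!!g y. g \<in> stab z ==> y \<in> T ==> y \<in> ball z r2 ==> B (cx_map g y) = B y" by (rule hol_germ_ball[OF B]) (rule that)
    have rr: "min r1 r2 > 0" using r1 r2 by simp
    obtain \<rho> where \<rho>: "\<rho> > 0" "\<forall>y\<in>ball z \<rho>. A (translate_proj z V y) * B (translate_proj z V y) = 0"
      using red[OF rr, of "%y. A y * B y"] r1(3) r2(3) AB by auto
    define s where "s = min \<rho> (min r1 r2)"
    have s: "s > 0" "s <= \<rho>" "s <= r1" "s <= r2" using \<rho> rr by (auto simp: s_def)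
    have "(\<forall>y\<in>ball z s. A (translate_proj z V y) = 0) \<or> (\<forall>y\<in>ball z s. B (translate_proj z V y) = 0)"
      by (rule cx_integral_domain[OF cx_holomorphic_on_translate_proj[OF restr[OF r1(2) s(3)] V]
            cx_holomorphic_on_translate_proj[OF restr[OF r2(2) s(4)] V] convex_ball])
        (use \<rho> s in auto)
    then show "eventually (%y. A y = 0) (germ z) \<or> eventually (%y. B y = 0) (germ z)"
      using red[OF r1(1,3)] red[OF r2(1,3)] s(1) by blast
  next
    fix A B and n :: nat and c
    assume A: "hol_germ z A" and B: "hol_germ z B" and c: "\<forall>i<n. hol_germ z (c i)"
      and B0: "\<not> eventually (%y. B y = 0) (germ z)"
      and eq: "eventually (%y. A y ^ n + (\<Sum>i<n. c i y * A y ^ i * B y ^ (n - i)) = 0) (germ z)"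
    obtain r1 where r1: "r1 > 0" "cx_holomorphic_on A (ball z r1)"
      "!!g y. g \<in> stab z ==> y \<in> T ==> y \<in> ball z r1 ==> A (cx_map g y) = A y" by (rule hol_germ_ball[OF A]) (rule that)
    obtain r2 where r2: "r2 > 0" "cx_holomorphic_on B (ball z r2)"
      "!!g y. g \<in> stab z ==> y \<in> T ==> y \<in> ball z r2 ==> B (cx_map g y) = B y" by (rule hol_germ_ball[OF B]) (rule that)
    have "\<exists>r>0. cx_holomorphic_on (c i) (ball z r)" if "i < n" for i using c that by (auto simp: hol_germ_def)
    then obtain rc where rc: "!!i. i < n ==> rc i > 0" "!!i. i < n ==> cx_holomorphic_on (c i) (ball z (rc i))" by metis
    obtain r3 where r3: "r3 > 0" "\<forall>y\<in>T \<inter> ball z r3. A y ^ n + (\<Sum>i<n. c i y * A y ^ i * B y ^ (n - i)) = 0"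
      using eq unfolding eventually_germ by blast
    define s where "s = Min (insert r0 (insert r1 (insert r2 (insert r3 (rc ` {..<n})))))"
    have fin: "finite (insert r0 (insert r1 (insert r2 (insert r3 (rc ` {..<n})))))" by simp
    have "s > 0" unfolding s_def using r0 r1(1) r2(1) r3(1) rc(1) by (subst Min_gr_iff[OF fin]) auto
    moreover have "s <= r0" "s <= r1" "s <= r2" "s <= r3" "!!i. i < n ==> s <= rc i"
      unfolding s_def by (rule Min_le[OF fin], simp)+
    ultimately have s: "s > 0" "s <= r0" "s <= r1" "s <= r2" "s <= r3" "!!i. i < n ==> s <= rc i"
      by blast+
    have sub: "ball z s \<subseteq> ball z r0" "ball z s \<subseteq> ball z r3" using s by auto
    let ?A = "%y. A (translate_proj z V y)" and ?B = "%y. B (translate_proj z V y)"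
    have nz: "\<exists>p\<in>ball z \<rho>. ?B p ~= 0" if "0 < \<rho>" for \<rho>
      using B0 red[OF r2(1,3)] that by blast
    obtain \<rho> R where R: "0 < \<rho>" "\<rho> <= s" "cx_holomorphic_on R (ball z \<rho>)" "!!x. x \<in> ball z \<rho> ==> ?A x = R x * ?B x"
    proof (rule cx_integrally_closed[of ?A z s ?B n "%i y. c i (translate_proj z V y)"])
      show "cx_holomorphic_on ?A (ball z s)"
        by (rule cx_holomorphic_on_translate_proj[OF restr[OF r1(2) s(3)] V])
      show "cx_holomorphic_on ?B (ball z s)"
        by (rule cx_holomorphic_on_translate_proj[OF restr[OF r2(2) s(4)] V])
      show "cx_holomorphic_on (%y. c i (translate_proj z V y)) (ball z s)" if "i < n" for i
        by (rule cx_holomorphic_on_translate_proj[OF restr[OF rc(2)[OF that] s(6)[OF that]] V])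
      show "?A x ^ n + (\<Sum>i<n. c i (translate_proj z V x) * ?A x ^ i * ?B x ^ (n - i)) = 0" if "x \<in> ball z s" for x
        using r3(2) tpT[of x] translate_proj_ball[OF V, of x z s] that sub by blast
    qed (use nz s(1) that in auto)
    have \<rho>: "\<rho> <= r0" "\<rho> <= r1" "\<rho> <= r2" using R(2) s by auto
    have "\<exists>F \<rho>'. 0 < \<rho>' \<and> \<rho>' <= \<rho> \<and> cx_holomorphic_on F (ball z \<rho>') \<and> (\<forall>y\<in>T \<inter> ball z \<rho>'. A y = F y * B y)"
      by (rule extend[OF R(1) \<rho>(1) restr[OF r1(2) \<rho>(2)] restr[OF r2(2) \<rho>(3)] r1(3) r2(3) R(3) nz R(4)])
        (use \<rho> in auto)
    then obtain F \<rho>' where F: "0 < \<rho>'" "\<rho>' <= \<rho>" "cx_holomorphic_on F (ball z \<rho>')" "!!y. y \<in> T ==> y \<in> ball z \<rho>' ==> A y = F y * B y"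
      by blast
    \<comment> \<open>The extension \<open>F\<close> need not be invariant. Its average over the
      stabiliser is, and it still satisfies \<open>A = F' * B\<close> along \<open>T\<close> because
      \<open>A\<close> and \<open>B\<close> are invariant there.\<close>
    define F' where "F' y = (\<Sum>g\<in>stab z. F (cx_map g y)) / of_nat (card (stab z))" for y
    have "hol_germ z F'" unfolding F'_def by (rule average_germ(3)[OF F(3,1)])
    moreover have "A y = F' y * B y" if y: "y \<in> T" "y \<in> ball z \<rho>'" for y
    proof -
      have "F (cx_map g y) * B y = A y" if g: "g \<in> stab z" for g
      proof -
        have "g \<in> G" using g by (simp add: stab_def)
        then have "A (cx_map g y) = F (cx_map g y) * B (cx_map g y)"
          using F(4) T_stable y cx_map_ball[OF g] by blast
        then show ?thesis using r1(3)[OF g] r2(3)[OF g] y F(2) \<rho> by simp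
      qed
      then have "(\<Sum>g\<in>stab z. F (cx_map g y)) * B y = of_nat (card (stab z)) * A y"
        by (simp add: sum_distrib_right)
      moreover have "card (stab z) ~= 0"
        using finite_stab[of z] stab_id[of z] by (metis card_0_eq empty_iff)
      ultimately show ?thesis by (simp add: F'_def field_simps)
    qed
    ultimately show "\<exists>R. hol_germ z R \<and> eventually (%y. A y = R y * B y) (germ z)"
      unfolding eventually_germ using F(1) by blast
  qed
qed

end

context stable_set
begin

text \<open>There is only one component, so the quotient found on it already is the required
  extension.\<close>

lemma normal_germ_smooth:
  assumes V: "subspace V" and z: "z \<in> T" and r0: "r0 > 0"
    and fx: "!!g v. g \<in> \<Gamma> ==> v \<in> V ==> lin g v = v" and \<Gamma>: "\<Gamma> \<subseteq> stab z"
    and comp: "!!y. y \<in> ball z r0 ==> y \<in> T \<longleftrightarrow> y - z \<in> V \<times> V"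
    and stabV: "!!g v. g \<in> stab z ==> v \<in> V ==> lin g v \<in> V"
  shows "normal_germ z"
proof (rule normal_germ_via_component[OF V z r0])
  fix y assume y: "y \<in> ball z r0"
  show "y \<in> T \<longleftrightarrow> (\<exists>g\<in>stab z. \<exists>y'. y' - z \<in> V \<times> V \<and> y = cx_map g y')"
  proof
    assume "y \<in> T"
    then have "y - z \<in> V \<times> V" using comp[OF y] by simp
    moreover have "y = cx_map (%x. x) y" by (simp add: cx_map_id)
    ultimately show "\<exists>g\<in>stab z. \<exists>y'. y' - z \<in> V \<times> V \<and> y = cx_map g y'"
      by (intro bexI[OF _ stab_id] exI conjI)
  next
    assume "\<exists>g\<in>stab z. \<exists>y'. y' - z \<in> V \<times> V \<and> y = cx_map g y'"
    then obtain g y' where g: "g \<in> stab z" "y' - z \<in> V \<times> V" "y = cx_map g y'" by metis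
    have gG: "g \<in> G" "cx_map g z = z" using g(1) by (simp_all add: stab_def)
    have "y - z = (lin g (fst y' - fst z), lin g (snd y' - snd z))"
      using cx_map_diff[OF gG(1), of y' z] gG(2) g(3) by simp
    moreover have "fst y' - fst z \<in> V" "snd y' - snd z \<in> V" using g(2) by (simp_all add: mem_Times_iff)
    ultimately have "y - z \<in> V \<times> V" using stabV[OF g(1)] by simp
    then show "y \<in> T" using comp[OF y] by simp
  qed
next
  fix A B R :: "'a cx \<Rightarrow> complex" and r
  assume r: "r > 0" "r <= r0" and R: "cx_holomorphic_on R (ball z r)"
    and AB: "!!y. y \<in> ball z r ==> A (translate_proj z V y) = R y * B (translate_proj z V y)"
  have "A y = R y * B y" if y: "y \<in> T" "y \<in> ball z r" for y
  proof -
    have "y - z \<in> V \<times> V" using comp[of y] y r by simp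
    then have "translate_proj z V y = y" using cproj_self[OF V] by (simp add: translate_proj_def)
    then show ?thesis using AB[OF y(2)] by simp
  qed
  then show "\<exists>F \<rho>. 0 < \<rho> \<and> \<rho> <= r \<and> cx_holomorphic_on F (ball z \<rho>) \<and> (\<forall>y\<in>T \<inter> ball z \<rho>. A y = F y * B y)"
    using r R by blast
qed

text \<open>An even holomorphic function of \<open>c\<close> is a holomorphic function of \<open>c\<^sup>2\<close>, and on all
  components \<open>c\<^sup>2\<close> is the restriction of the invariant quadratic form \<open>qf\<close> on the normal space.\<close>

lemma even_extension:
  fixes z :: "'a cx" and W :: "'a set" and u :: 'a
  assumes W: "subspace W" and u: "norm u = 1" and uW: "!!w. w \<in> W ==> u \<bullet> w = 0" and r: "r > 0"
    and R: "cx_holomorphic_on R (ball z r)"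
    and even: "!!y c. translate_proj z W y + cscale c (u, 0) \<in> ball z r ==>
      R (translate_proj z W y + cscale c (u, 0)) = R (translate_proj z W y + cscale (- c) (u, 0))"
  obtains F \<rho> where "0 < \<rho>" "\<rho> <= r"
    "cx_holomorphic_on (%y. F (cproj W (y - z)) (qf (y - z - cproj W (y - z)))) (ball z \<rho>)"
    "!!y c. translate_proj z W y + cscale c (u, 0) \<in> ball z \<rho> ==>
       F (cproj W (y - z)) (c^2) = R (translate_proj z W y + cscale c (u, 0))"
proof -
  let ?u = "(u, 0) :: 'a cx"
  let ?t = "translate_proj z W"
  have uu: "u \<bullet> u = 1" using u by (simp add: norm_eq_1)
  have nu: "norm ?u = 1" using u by (simp add: norm_Pair)
  have Wu: "cproj W (cscale c ?u) = 0" for c by (rule cproj_cscale_orth[OF W uW])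
  have cp_add: "cproj W (a + b) = cproj W a + cproj W b" for a b
    by (rule linear_add[OF bounded_linear.linear[OF bounded_linear_cproj[OF W]]])
  have cp_idem: "cproj W (cproj W a) = cproj W a" for a
    by (rule cproj_self[OF W cproj_mem[OF W]])
  have cdW: "cd u (cproj W a) = 0" for a
    using uW[OF oproj(1)[OF W]] by (simp add: cproj_def cd_def complex_eq_iff inner_commute)
  have cdu: "cd u ?u = 1" by (simp add: cd_real uu)
  \<comment> \<open>Coordinate along \<open>u\<close>; in the auxiliary function \<open>f\<close>
    below it plays the role of the square of the transversal coordinate.\<close>
  define s where "s \<xi> = cd u (\<xi> - z)" for \<xi>
  have s_hol: "cx_holomorphic_on s U" if "open U" for U
  proof -
    have "cx_hol_map (%\<xi>. - z + \<xi>) U" using cx_hol_map_affine[of "%w. w" U "- z"] that by simp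
    then have "cx_holomorphic_on (%\<xi>. cd u (- z + \<xi>)) U"
      by (rule cx_holomorphic_on_compose[OF _ cd_holomorphic[OF open_UNIV]]) simp
    then show ?thesis unfolding s_def[abs_def] by simp
  qed
  \<comment> \<open>If \<open>s \<xi>\<close> has modulus below \<open>r1\<close>, its square roots
    have modulus below \<open>r / 2\<close>.\<close>
  define r1 where "r1 = min (r / 2) ((r / 2)^2)"
  have r1: "r1 > 0" "r1 <= r / 2" "r1 <= (r / 2)^2" using r by (auto simp: r1_def)
  have inb: "?t \<xi> + cscale c ?u \<in> ball z r" if "\<xi> \<in> ball z r1" "c^2 = s \<xi>" for \<xi> c
  proof -
    have "cmod (s \<xi>) < r1"
      using cmod_cd_le[of u "\<xi> - z"] u that(1) by (simp add: s_def dist_norm norm_minus_commute)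
    then have "(cmod c)^2 < (r / 2)^2" using that(2) r1(3) by (metis less_le_trans norm_power)
    then have c: "cmod c < r / 2" by (rule power_less_imp_less_base) (use r in simp)
    have "norm (cproj W (\<xi> - z)) < r / 2"
      using norm_cproj_le[OF W, of "\<xi> - z"] that(1) r1(2) by (simp add: dist_norm norm_minus_commute)
    then have "norm (cproj W (\<xi> - z) + cscale c ?u) < r"
      using c norm_triangle_ineq[of "cproj W (\<xi> - z)" "cscale c ?u"] nu by (simp add: norm_cscale)
    moreover have "dist z (?t \<xi> + cscale c ?u) = norm (cproj W (\<xi> - z) + cscale c ?u)"
      using norm_minus_cancel[of "cproj W (\<xi> - z) + cscale c ?u"]
      by (simp add: translate_proj_def dist_norm algebra_simps)
    ultimately show ?thesis by simp
  qed
  \<comment> \<open>By evenness of \<open>R\<close> the choice of the square root does not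
    matter.\<close>
  define f where "f \<xi> = R (?t \<xi> + cscale (csqrt (s \<xi>)) ?u)" for \<xi>
  have f_eq: "f \<xi> = R (?t \<xi> + cscale c ?u)" if "\<xi> \<in> ball z r1" "c^2 = s \<xi>" for \<xi> c
  proof -
    have "c = csqrt (s \<xi>) \<or> c = - csqrt (s \<xi>)"
      using that(2) by (metis power2_csqrt power2_eq_iff)
    then show ?thesis
      using even[of \<xi> "csqrt (s \<xi>)"] inb[OF that(1), of "csqrt (s \<xi>)"] by (auto simp: f_def)
  qed
  have branch: "cx_holomorphic_on f U"
    if U: "open U" "U \<subseteq> ball z r1" and b: "cx_holomorphic_on b U" "!!\<xi>. \<xi> \<in> U ==> (b \<xi>)^2 = s \<xi>" for b U
  proof -
    have "cx_hol_map (%\<xi>. ?t \<xi> + cscale (b \<xi>) ?u) U"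
      by (intro cx_hol_map_add cx_hol_map_translate_proj[OF W U(1)] cx_hol_map_cscale b(1))
    then have "cx_holomorphic_on (%\<xi>. R (?t \<xi> + cscale (b \<xi>) ?u)) U"
      by (rule cx_holomorphic_on_compose[OF _ R]) (use inb b(2) U(2) in blast)
    then show ?thesis
      by (rule cx_holomorphic_on_cong) (use f_eq b(2) U(2) in \<open>metis subsetD\<close>)
  qed
  have sball: "cx_holomorphic_on s (ball z r1)" by (rule s_hol) simp
  have scont: "open {\<xi> \<in> ball z r1. s \<xi> \<in> S}" if "open S" for S
  proof -
    have "{\<xi> \<in> ball z r1. s \<xi> \<in> S} = s -` S \<inter> ball z r1" by blast
    then show ?thesis
      using continuous_on_open_vimage[of "ball z r1" s] cx_holomorphic_on_continuous_on[OF sball] that by simp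
  qed
  \<comment> \<open>Near a nonzero value of \<open>s\<close>, one of \<open>csqrt (s \<xi>)\<close>
    and \<open>\<i> * csqrt (- s \<xi>)\<close> is a holomorphic square root.\<close>
  have f_hol: "cx_holomorphic_on f {\<xi> \<in> ball z r1. s \<xi> ~= 0}"
  proof (rule cx_holomorphic_on_local)
    show "open {\<xi> \<in> ball z r1. s \<xi> ~= 0}" using scont[of "- {0}"] by (simp add: open_Compl)
    have opS: "open (- \<real>\<^sub>\<le>\<^sub>0 :: complex set)" by (simp add: open_Compl closed_nonpos_Reals_complex)
    fix \<xi> assume \<xi>: "\<xi> \<in> {\<xi> \<in> ball z r1. s \<xi> ~= 0}"
    show "\<exists>V. \<xi> \<in> V \<and> cx_holomorphic_on f V"
    proof (cases "s \<xi> \<in> \<real>\<^sub>\<le>\<^sub>0")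
      case False
      let ?V = "{\<xi> \<in> ball z r1. s \<xi> \<in> - \<real>\<^sub>\<le>\<^sub>0}"
      have "cx_holomorphic_on (%\<xi>. csqrt (s \<xi>)) ?V"
        by (rule cx_holomorphic_on_compose_holomorphic[OF s_hol[OF scont[OF opS]] holomorphic_on_csqrt opS]) blast
      then have "cx_holomorphic_on f ?V"
        by (rule branch[OF scont[OF opS], rotated]) (simp_all add: subset_eq)
      then show ?thesis using False \<xi> by (intro exI[of _ ?V]) simp
    next
      case True
      let ?V = "{\<xi> \<in> ball z r1. s \<xi> \<in> uminus ` (- \<real>\<^sub>\<le>\<^sub>0)}"
      have opV: "open ?V" by (rule scont) (simp add: open_negations opS)
      have im: "- s \<xi> \<in> - \<real>\<^sub>\<le>\<^sub>0" if "\<xi> \<in> ?V" for \<xi>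
      proof -
        have "s \<xi> \<in> uminus ` (- \<real>\<^sub>\<le>\<^sub>0)" using that by simp
        then obtain x where "x \<in> - \<real>\<^sub>\<le>\<^sub>0" "s \<xi> = - x" by (rule imageE)
        then show ?thesis by simp
      qed
      have "cx_holomorphic_on (%\<xi>. csqrt (- s \<xi>)) ?V"
        by (rule cx_holomorphic_on_compose_holomorphic[OF cx_holomorphic_on_uminus[OF s_hol[OF opV]] holomorphic_on_csqrt opS])
          (rule image_subsetI, rule im)
      then have "cx_holomorphic_on (%\<xi>. \<i> * csqrt (- s \<xi>)) ?V"
        by (intro cx_holomorphic_on_mult cx_holomorphic_on_const opV)
      then have "cx_holomorphic_on f ?V"
        by (rule branch[OF opV, rotated]) (simp_all add: power_mult_distrib subset_eq)
      moreover have "- s \<xi> \<in> - \<real>\<^sub>\<le>\<^sub>0"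
        using True \<xi> by (simp add: complex_nonpos_Reals_iff complex_eq_iff)
      then have "s \<xi> \<in> uminus ` (- \<real>\<^sub>\<le>\<^sub>0)" by (intro image_eqI[of _ _ "- s \<xi>"]) simp_all
      then have "\<xi> \<in> ?V" using \<xi> by simp
      ultimately show ?thesis by (intro exI[of _ ?V] conjI)
    qed
  qed
  have "compact (R ` cball z (r1))"
    by (intro compact_continuous_image compact_cball continuous_on_subset[OF cx_holomorphic_on_continuous_on[OF R]])
      (use r1 r in auto)
  define r2 where "r2 = r1 / 2"
  have r2: "r2 > 0" "r2 < r1" using r1 by (auto simp: r2_def)
  \<comment> \<open>All values of \<open>f\<close> are values of \<open>R\<close> on the compact
    image of the pairs \<open>(\<xi>, c)\<close> with \<open>c^2 = s \<xi>\<close>; boundedness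
    allows extension across \<open>s \<xi> = 0\<close>.\<close>
  have bound: "\<exists>M. \<forall>\<xi>\<in>cball z r2. cmod (f \<xi>) <= M"
  proof -
    have "\<exists>M. \<forall>y\<in>(%(\<xi>, c). ?t \<xi> + cscale c ?u) ` ({\<xi>c. fst \<xi>c \<in> cball z r2 \<and> (snd \<xi>c)^2 = s (fst \<xi>c)}). cmod (R y) <= M"
    proof -
      let ?K = "{\<xi>c. fst \<xi>c \<in> cball z r2 \<and> (snd \<xi>c)^2 = s (fst \<xi>c)}"
      have cb: "cball z r2 \<subseteq> ball z r1" using r2 by auto
      have cs: "continuous_on UNIV s" using cx_holomorphic_on_continuous_on[OF s_hol[OF open_UNIV]] .
      have "?K = (fst -` cball z r2) \<inter> {\<xi>c. (snd \<xi>c)^2 = s (fst \<xi>c)}" by blast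
      moreover have "closed {\<xi>c. (snd \<xi>c)^2 = s (fst \<xi>c)}"
        by (intro closed_Collect_eq continuous_intros continuous_on_compose2[OF cs]) auto
      moreover have "closed (fst -` cball z r2 :: ('a cx \<times> complex) set)"
        by (intro closed_vimage continuous_intros) auto
      ultimately have "closed ?K" by (simp add: closed_Int)
      moreover have "?K \<subseteq> cball z r2 \<times> cball 0 (r / 2)"
      proof
        fix \<xi>c assume k: "\<xi>c \<in> ?K"
        then have "cmod (s (fst \<xi>c)) <= r1"
          using cmod_cd_le[of u "fst \<xi>c - z"] u r2 by (simp add: s_def dist_norm norm_minus_commute)
        then have "(cmod (snd \<xi>c))^2 <= (r / 2)^2" using k r1(3) by (metis (mono_tags, lifting) mem_Collect_eq norm_power order_trans)
        then have "cmod (snd \<xi>c) <= r / 2" by (rule power2_le_imp_le) (use r in simp)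
        then show "\<xi>c \<in> cball z r2 \<times> cball 0 (r / 2)" using k by (simp add: mem_Times_iff)
      qed
      ultimately have K: "compact ?K"
        using compact_Int_closed[OF compact_Times[OF compact_cball compact_cball], of ?K z r2 0 "r / 2"]
        by (simp only: Int_absorb1)
      have tc: "continuous_on UNIV ?t"
        using cx_hol_map_continuous_on[OF cx_hol_map_translate_proj[OF W open_UNIV]] .
      have "continuous_on ?K (%(\<xi>, c). ?t \<xi> + cscale c ?u)"
        unfolding split_beta by (intro continuous_intros continuous_on_compose2[OF tc]) auto
      then have "compact ((%(\<xi>, c). ?t \<xi> + cscale c ?u) ` ?K)" using K compact_continuous_image by blast
      moreover have "(%(\<xi>, c). ?t \<xi> + cscale c ?u) ` ?K \<subseteq> ball z r"
      proof (rule image_subsetI)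
        fix \<xi>c assume "\<xi>c \<in> ?K"
        then show "(case \<xi>c of (\<xi>, c) \<Rightarrow> ?t \<xi> + cscale c ?u) \<in> ball z r"
          using inb[of "fst \<xi>c" "snd \<xi>c"] cb by (auto simp: split_beta)
      qed
      ultimately have "compact (R ` ((%(\<xi>, c). ?t \<xi> + cscale c ?u) ` ?K))"
        using cx_holomorphic_on_continuous_on[OF R] by (meson compact_continuous_image continuous_on_subset)
      then show ?thesis by (meson bounded_iff compact_imp_bounded imageI)
    qed
    then obtain M where M: "!!y. y \<in> (%(\<xi>, c). ?t \<xi> + cscale c ?u) ` ({\<xi>c. fst \<xi>c \<in> cball z r2 \<and> (snd \<xi>c)^2 = s (fst \<xi>c)}) ==> cmod (R y) <= M"
      by blast
    have "cmod (f \<xi>) <= M" if "\<xi> \<in> cball z r2" for \<xi>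
      unfolding f_def by (rule M, rule image_eqI[of _ _ "(\<xi>, csqrt (s \<xi>))"]) (use that in simp_all)
    then show ?thesis by blast
  qed
  then obtain M where M: "!!\<xi>. \<xi> \<in> cball z r2 ==> cmod (f \<xi>) <= M" by blast
  have sub: "ball z r2 \<subseteq> ball z r1" using r2 by auto
  have op2: "open {\<xi> \<in> ball z r2. s \<xi> ~= 0}"
  proof -
    have "{\<xi> \<in> ball z r2. s \<xi> ~= 0} = ball z r2 \<inter> {\<xi> \<in> ball z r1. s \<xi> \<in> - {0}}" using sub by blast
    then show ?thesis using scont[of "- {0}"] by (simp add: open_Int open_Compl)
  qed
  define p where "p = z + cscale (of_real (r2 / 2)) ?u"
  have p: "p \<in> ball z r2" "s p ~= 0"
    using r2(1) nu by (auto simp: p_def dist_norm norm_cscale s_def cd_cscale cdu)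
  obtain \<rho> H where H: "0 < \<rho>" "\<rho> <= r2" "cx_holomorphic_on H (ball z \<rho>)"
    "!!\<xi>. \<xi> \<in> ball z \<rho> ==> s \<xi> ~= 0 ==> H \<xi> = f \<xi>"
  proof (rule riemann_extension[of s z r2 p f M])
    show "cx_holomorphic_on s (ball z r2)" by (rule s_hol) simp
    show "cx_holomorphic_on f {x \<in> ball z r2. s x ~= 0}"
      by (rule cx_holomorphic_on_subset[OF f_hol op2]) (use sub in blast)
  qed (use p M that in auto)
  define F where "F w a = H (z + w + cscale a ?u)" for w a
  \<comment> \<open>Sends \<open>y\<close> to the point with the same component along
    \<open>W\<close> whose coordinate along \<open>u\<close> is \<open>qf\<close> of the normal
    component of \<open>y\<close>; then \<open>H (P y)\<close> is the function sought.\<close>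
  define P where "P y = ?t y + cscale (qf (y - z - cproj W (y - z))) ?u" for y
  have nrm_map: "cx_hol_map (%y. y - z - cproj W (y - z)) U" if "open U" for U
  proof -
    have "cx_hol_map (%y. (cproj W z - z) + (y - cproj W y)) U"
      by (rule cx_hol_map_affine)
        (auto intro!: bounded_linear_sub bounded_linear_ident bounded_linear_cproj[OF W] that
          simp: cproj_cscale[OF W] cscale.diff_right)
    moreover have "(cproj W z - z) + (y - cproj W y) = y - z - cproj W (y - z)" for y
      by (simp add: linear_diff[OF bounded_linear.linear[OF bounded_linear_cproj[OF W]]])
    ultimately show ?thesis by simp
  qed
  have Pmap: "cx_hol_map P UNIV" unfolding P_def[abs_def]
    by (intro cx_hol_map_add cx_hol_map_translate_proj[OF W open_UNIV] cx_hol_map_cscale qf_holomorphic nrm_map open_UNIV)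
  have cz: "cproj W 0 = 0"
    by (rule linear_0[OF bounded_linear.linear[OF bounded_linear_cproj[OF W]]])
  have cd0: "cd b 0 = 0" for b by (simp add: cd_def complex_eq_iff)
  have Pz: "P z = z"
    by (simp add: P_def translate_proj_def cz qf_def cd0 cscale.zero_left)
  have "open (P -` ball z \<rho>)"
    using continuous_on_open_vimage[of UNIV P] cx_hol_map_continuous_on[OF Pmap] by simp
  moreover have "z \<in> P -` ball z \<rho>" using Pz H(1) by simp
  ultimately obtain \<rho>1 where \<rho>1: "\<rho>1 > 0" "ball z \<rho>1 \<subseteq> P -` ball z \<rho>" using openE by blast
  define \<rho>2 where "\<rho>2 = min \<rho>1 r1"
  have \<rho>2: "\<rho>2 > 0" "\<rho>2 <= \<rho>1" "\<rho>2 <= r1" "\<rho>2 <= r" using \<rho>1 r1 r by (auto simp: \<rho>2_def)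
  have FP: "F (cproj W (y - z)) (qf (y - z - cproj W (y - z))) = H (P y)" for y
    by (simp add: F_def P_def translate_proj_def)
  have HP: "cx_holomorphic_on (%y. H (P y)) (ball z \<rho>2)"
  proof (rule cx_holomorphic_on_compose[OF cx_hol_map_subset[OF Pmap] H(3)])
    show "P ` ball z \<rho>2 \<subseteq> ball z \<rho>"
    proof (rule image_subsetI)
      fix y assume "y \<in> ball z \<rho>2"
      then have "y \<in> ball z \<rho>1" using \<rho>2(2) by simp
      then show "P y \<in> ball z \<rho>" using \<rho>1(2) by blast
    qed
  qed auto
  text \<open>Both sides agree where \<open>c ~= 0\<close>, hence everywhere by the identity theorem.\<close>

  define E where "E y = ?t y + cscale (s y) ?u" for y
  have E_map: "cx_hol_map E UNIV" unfolding E_def[abs_def]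
    by (intro cx_hol_map_add cx_hol_map_translate_proj[OF W open_UNIV] cx_hol_map_cscale s_hol open_UNIV)
  have E_eq: "E (?t y + cscale c ?u) = ?t y + cscale c ?u" for y c
    by (simp add: E_def translate_proj_def s_def cd_add cdW cd_cscale cdu cp_add cp_idem Wu add.assoc)
  have PE: "P (E y) = ?t y + cscale ((s y)^2) ?u" for y
    by (simp add: P_def E_def translate_proj_def cp_add cp_idem Wu add.assoc qf_cscale_real uu)
  have Ez: "E z = z"
    by (simp add: E_def translate_proj_def s_def cd0 cz cscale.zero_left)
  have "open (E -` ball z \<rho>2)"
    using continuous_on_open_vimage[of UNIV E] cx_hol_map_continuous_on[OF E_map] by simp
  moreover have "z \<in> E -` ball z \<rho>2" using Ez \<rho>2(1) by simp
  ultimately obtain \<rho>3 where \<rho>3: "\<rho>3 > 0" "ball z \<rho>3 \<subseteq> E -` ball z \<rho>2" using openE by blast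
  define \<rho>4 where "\<rho>4 = min \<rho>3 \<rho>2"
  have \<rho>4: "\<rho>4 > 0" "\<rho>4 <= \<rho>3" "\<rho>4 <= \<rho>2" "\<rho>4 <= r" using \<rho>3 \<rho>2 by (auto simp: \<rho>4_def)
  have Ein: "E y \<in> ball z \<rho>2" if "y \<in> ball z \<rho>4" for y
  proof -
    have "y \<in> ball z \<rho>3" using that \<rho>4(2) by simp
    then show ?thesis using \<rho>3(2) by blast
  qed
  have K1: "cx_holomorphic_on (%y. H (P (E y)) + - R (E y)) (ball z \<rho>4)"
  proof -
    have E4: "cx_hol_map E (ball z \<rho>4)" by (rule cx_hol_map_subset[OF E_map]) auto
    have "cx_holomorphic_on (%y. H (P (E y))) (ball z \<rho>4)"
      by (rule cx_holomorphic_on_compose[OF E4 HP]) (use Ein in blast)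
    moreover have "cx_holomorphic_on (%y. R (E y)) (ball z \<rho>4)"
      by (rule cx_holomorphic_on_compose[OF E4 R])
        (rule image_subsetI, use Ein \<rho>2(4) in \<open>force simp only: mem_ball\<close>)
    ultimately show ?thesis by (intro cx_holomorphic_on_add cx_holomorphic_on_uminus)
  qed
  \<comment> \<open>The factor \<open>s y\<close> covers the points with \<open>s y = 0\<close>,
    where \<open>H\<close> is not yet known to agree with \<open>f\<close>; it is cancelled
    afterwards.\<close>
  have K0: "(H (P (E y)) + - R (E y)) * s y = 0" if y: "y \<in> ball z \<rho>4" for y
  proof (cases "s y = 0")
    case False
    have "E y \<in> ball z \<rho>1" using Ein[OF y] \<rho>2(2) by simp
    then have "P (E y) \<in> ball z \<rho>" using \<rho>1(2) by blast
    moreover have sP: "s (P (E y)) = (s y)^2"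
      unfolding PE by (simp add: s_def translate_proj_def cd_add cdW cd_cscale cdu)
    ultimately have "H (P (E y)) = f (P (E y))" using H(4)[of "P (E y)"] False by simp
    also have "\<dots> = R (?t (P (E y)) + cscale (s y) ?u)"
      by (rule f_eq) (use \<open>P (E y) \<in> ball z \<rho>\<close> H(2) r2 sP in auto)
    also have "?t (P (E y)) = ?t y"
      unfolding PE by (simp add: translate_proj_def cp_add cp_idem Wu)
    finally show ?thesis by (simp add: E_def)
  qed simp
  have "(\<forall>y\<in>ball z \<rho>4. H (P (E y)) + - R (E y) = 0) \<or> (\<forall>y\<in>ball z \<rho>4. s y = 0)"
    by (rule cx_integral_domain[OF K1 s_hol convex_ball K0]) auto
  moreover have "\<not> (\<forall>y\<in>ball z \<rho>4. s y = 0)"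
  proof
    assume a: "\<forall>y\<in>ball z \<rho>4. s y = 0"
    have "z + cscale (of_real (\<rho>4 / 2)) ?u \<in> ball z \<rho>4"
      using \<rho>4(1) nu by (simp add: dist_norm norm_cscale)
    then have "s (z + cscale (of_real (\<rho>4 / 2)) ?u) = 0" using a by blast
    then show False using \<rho>4(1) by (simp add: s_def cd_cscale cdu)
  qed
  ultimately have HR: "H (P (E y)) = R (E y)" if "y \<in> ball z \<rho>4" for y using that by (simp add: add_eq_0_iff2)
  have fin: "F (cproj W (y - z)) (c^2) = R (?t y + cscale c ?u)" if "?t y + cscale c ?u \<in> ball z \<rho>4" for y c
  proof -
    have "H (P (?t y + cscale c ?u)) = R (?t y + cscale c ?u)"
      using HR[OF that] unfolding E_eq .
    moreover have "P (?t y + cscale c ?u) = z + cproj W (y - z) + cscale (c^2) ?u"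
      by (simp add: P_def translate_proj_def cp_add cp_idem Wu add.assoc qf_cscale_real uu)
    ultimately show ?thesis by (simp add: F_def)
  qed
  have hol4: "cx_holomorphic_on (%y. F (cproj W (y - z)) (qf (y - z - cproj W (y - z)))) (ball z \<rho>4)"
    unfolding FP by (rule cx_holomorphic_on_subset[OF HP]) (use \<rho>4(3) in auto)
  show ?thesis by (rule that[OF \<rho>4(1,4) hol4 fin])
qed

end

section \<open>Normality from a reflection of one component\<close>

context stable_set
begin

text \<open>The quotient \<open>R\<close> on one component is even, because \<sigma> reverses
  \<open>u\<close> and preserves \<open>A\<close> and \<open>B\<close>.
  \<open>even_extension\<close> then writes it through the component along \<open>W\<close> and
  \<open>qf\<close> of the normal component. Elements fixing \<open>W\<close> preserve both, so one
  formula serves all components.\<close>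

lemma normal_germ_reflection:
  assumes W: "subspace W" and z: "z \<in> T" and r0: "r0 > 0"
    and u: "norm u = 1" and uW: "!!w. w \<in> W ==> u \<bullet> w = 0"
    and comp: "!!y. y \<in> ball z r0 ==> y \<in> T \<longleftrightarrow>
      (\<exists>g\<in>stab z. (\<forall>w\<in>W. lin g w = w) \<and> (\<exists>y' c. y' - z = cproj W (y' - z) + cscale c (u, 0) \<and> y = cx_map g y'))"
    and \<sigma>: "\<sigma> \<in> stab z" "!!w. w \<in> W ==> lin \<sigma> w = w" "lin \<sigma> u = - u"
  shows "normal_germ z"
proof -
  let ?u = "(u, 0) :: 'a cx"
  define V where "V = {w + a *\<^sub>R u | w a. w \<in> W}"
  have V: "subspace V"
  proof -
    have "V = {x + y | x y. x \<in> W \<and> y \<in> span {u}}"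
      unfolding V_def by (auto simp: span_singleton)
    then show ?thesis using subspace_sums[OF W subspace_span[of "{u}"]] by simp
  qed
  have uu: "u \<bullet> u = 1" using u by (simp add: norm_eq_1)
  have Wu: "cproj W (cscale c ?u) = 0" for c by (rule cproj_cscale_orth[OF W uW])
  have cp_add: "cproj W (a + b) = cproj W a + cproj W b" for a b
    by (rule linear_add[OF bounded_linear.linear[OF bounded_linear_cproj[OF W]]])
  have cp_idem: "cproj W (cproj W a) = cproj W a" for a
    by (rule cproj_self[OF W cproj_mem[OF W]])
  have VV: "w + cscale c ?u \<in> V \<times> V" if "w \<in> W \<times> W" for w c
    using that by (cases w) (auto simp: V_def cscale_def)
  have VVE: "y = cproj W y + cscale (cd u y) ?u" if yV: "y \<in> V \<times> V" for y
  proof -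
    obtain w a w' a' where y: "y = (w + a *\<^sub>R u, w' + a' *\<^sub>R u)" "w \<in> W" "w' \<in> W"
    proof -
      have "fst y \<in> V" "snd y \<in> V" using yV by (simp_all add: mem_Times_iff)
      then obtain w a w' a' where "fst y = w + a *\<^sub>R u" "w \<in> W" "snd y = w' + a' *\<^sub>R u" "w' \<in> W"
        unfolding V_def by blast
      then show thesis by (intro that[of w a w' a']) (simp_all add: prod_eq_iff)
    qed
    have op: "oproj W (v + b *\<^sub>R u) = v" if "v \<in> W" for v b
      by (rule oproj_unique[OF W that]) (use uW in simp)
    have "cd u y = Complex a a'"
      using y uW[of w] uW[of w'] by (simp add: cd_def inner_add_left uu inner_commute[of w u] inner_commute[of w' u])
    then show ?thesis using y op by (simp add: cproj_def cscale_def)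
  qed
  have VVI: "y \<in> V \<times> V" if "y = cproj W y + cscale c ?u" for y c
    using VV[OF cproj_mem[OF W], of y c] that by simp
  have tpV: "translate_proj z V y = y" if "y - z \<in> V \<times> V" for y
    using cproj_self[OF V that] by (simp add: translate_proj_def)
  have inT: "y \<in> T" if "y \<in> ball z r0" "y - z \<in> V \<times> V" for y
  proof (rule comp[OF that(1), THEN iffD2], intro bexI[of _ "%x. x"] conjI ballI exI)
    show "y - z = cproj W (y - z) + cscale (cd u (y - z)) ?u" by (rule VVE[OF that(2)])
    show "y = cx_map (%x. x) y" by (simp add: cx_map_id)
    show "lin (%x. x) w = w" for w :: 'a by (simp add: lin_def)
  qed (rule stab_id)
  have distg: "cx_map g y \<in> ball z s \<longleftrightarrow> y \<in> ball z s" if "g \<in> stab z" for g y s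
    using dist_cx_map[of g z y] that by (simp add: stab_def)
  have \<sigma>V: "cx_map \<sigma> y - z = cproj W (y - z) + cscale (- cd u (y - z)) ?u" if "y - z \<in> V \<times> V" for y
  proof -
    have sG: "\<sigma> \<in> G" "cx_map \<sigma> z = z" using \<sigma>(1) by (simp_all add: stab_def)
    have "cx_map \<sigma> y - z = (lin \<sigma> (fst (y - z)), lin \<sigma> (snd (y - z)))"
      using cx_map_diff[OF sG(1), of y z] sG(2) by simp
    also have "y - z = cproj W (y - z) + cscale (cd u (y - z)) ?u" by (rule VVE[OF that])
    finally show ?thesis
      using \<sigma>(2)[OF oproj(1)[OF W]] \<sigma>(3)
      by (simp add: cproj_def cscale_def linear_add[OF lin_linear[OF sG(1)]] linear_scale[OF lin_linear[OF sG(1)]]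
          linear_diff[OF lin_linear[OF sG(1)]])
  qed
  show ?thesis
  proof (rule normal_germ_via_component[OF V z r0])
    fix y assume y: "y \<in> ball z r0"
    show "y \<in> T \<longleftrightarrow> (\<exists>g\<in>stab z. \<exists>y'. y' - z \<in> V \<times> V \<and> y = cx_map g y')"
    proof
      assume "y \<in> T"
      then obtain g y' c where "g \<in> stab z" "y' - z = cproj W (y' - z) + cscale c ?u" "y = cx_map g y'"
        using comp[OF y] by metis
      then show "\<exists>g\<in>stab z. \<exists>y'. y' - z \<in> V \<times> V \<and> y = cx_map g y'" using VVI by (intro bexI[of _ g] exI[of _ y'] conjI)
    next
      assume "\<exists>g\<in>stab z. \<exists>y'. y' - z \<in> V \<times> V \<and> y = cx_map g y'"
      then obtain g y' where g: "g \<in> stab z" "y' - z \<in> V \<times> V" "y = cx_map g y'" by metis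
      have "y' \<in> T" using inT[of y'] distg[OF g(1)] g y by simp
      then show "y \<in> T" using T_stable g by (simp add: stab_def)
    qed
  next
    fix A B R :: "'a cx \<Rightarrow> complex" and r
    assume r: "r > 0" "r <= r0" and A: "cx_holomorphic_on A (ball z r)" and B: "cx_holomorphic_on B (ball z r)"
      and invA: "!!g y. g \<in> stab z ==> y \<in> T ==> y \<in> ball z r ==> A (cx_map g y) = A y"
      and invB: "!!g y. g \<in> stab z ==> y \<in> T ==> y \<in> ball z r ==> B (cx_map g y) = B y"
      and R: "cx_holomorphic_on R (ball z r)"
      and nz: "!!\<rho>. 0 < \<rho> ==> \<rho> <= r ==> \<exists>p\<in>ball z \<rho>. B (translate_proj z V p) ~= 0"
      and AB: "!!y. y \<in> ball z r ==> A (translate_proj z V y) = R y * B (translate_proj z V y)"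
    let ?t = "translate_proj z V"
    have tV: "?t y - z \<in> V \<times> V" for y using cproj_mem[OF V] by (simp add: translate_proj_def)
    have ABV: "A p = R p * B p" if "p \<in> ball z r" "p - z \<in> V \<times> V" for p
      using AB[OF that(1)] tpV[OF that(2)] by simp
    have \<sigma>in: "cx_map \<sigma> p - z \<in> V \<times> V" if "p - z \<in> V \<times> V" for p
      unfolding \<sigma>V[OF that] by (rule VV[OF cproj_mem[OF W]])
    \<comment> \<open>Invariance of \<open>A\<close> and \<open>B\<close> under \<sigma> shows that
      the odd part of \<open>R\<close> times \<open>B\<close> vanishes on the component;
      \<open>B\<close> is cancelled next.\<close>
    have R12: "(R (cx_map \<sigma> (?t y)) + - R (?t y)) * B (?t y) = 0" if y: "y \<in> ball z r" for y
    proof -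
      let ?p = "?t y"
      have p: "?p \<in> ball z r" by (rule translate_proj_ball[OF V y])
      have pT: "?p \<in> T" using inT[of ?p] p r tV by simp
      have "A (cx_map \<sigma> ?p) = R (cx_map \<sigma> ?p) * B (cx_map \<sigma> ?p)"
        by (rule ABV) (use distg[OF \<sigma>(1)] p \<sigma>in[OF tV] in simp_all)
      then have h1: "A ?p = R (cx_map \<sigma> ?p) * B ?p"
        using invA[OF \<sigma>(1) pT p] invB[OF \<sigma>(1) pT p] by simp
      have "A ?p = R ?p * B ?p" by (rule ABV[OF p tV])
      then have "R (cx_map \<sigma> ?p) * B ?p = R ?p * B ?p" by (rule trans[OF h1[symmetric]])
      then show ?thesis by (simp only: distrib_right mult_minus_left add.right_inverse)
    qed
    have "(\<forall>y\<in>ball z r. R (cx_map \<sigma> (?t y)) + - R (?t y) = 0) \<or> (\<forall>y\<in>ball z r. B (?t y) = 0)"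
    proof (rule cx_integral_domain[OF _ cx_holomorphic_on_translate_proj[OF B V] convex_ball R12])
      show "cx_holomorphic_on (%y. R (cx_map \<sigma> (?t y)) + - R (?t y)) (ball z r)"
        by (intro cx_holomorphic_on_add cx_holomorphic_on_uminus cx_holomorphic_on_translate_proj[OF R V]
            cx_holomorphic_on_translate_proj[OF cx_holomorphic_on_cx_map[OF R \<sigma>(1)] V])
    qed
    then have R\<sigma>: "R (cx_map \<sigma> p) = R p" if "p \<in> ball z r" "p - z \<in> V \<times> V" for p
      using nz[OF r(1) order_refl] tpV[OF that(2)] that(1) by (metis add_eq_0_iff2 minus_minus)
    obtain F \<rho> where F: "0 < \<rho>" "\<rho> <= r"
      "cx_holomorphic_on (%y. F (cproj W (y - z)) (qf (y - z - cproj W (y - z)))) (ball z \<rho>)"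
      "!!y c. translate_proj z W y + cscale c ?u \<in> ball z \<rho> ==>
         F (cproj W (y - z)) (c^2) = R (translate_proj z W y + cscale c ?u)"
    proof (rule even_extension[OF W u uW r(1) R])
      fix y c assume p: "translate_proj z W y + cscale c ?u \<in> ball z r"
      let ?p = "translate_proj z W y + cscale c ?u"
      have pz: "?p - z = cproj W (y - z) + cscale c ?u" by (simp add: translate_proj_def)
      have pV: "?p - z \<in> V \<times> V" unfolding pz by (rule VV[OF cproj_mem[OF W]])
      have "cproj W (?p - z) = cproj W (y - z)" unfolding pz cp_add cp_idem Wu by simp
      moreover have "cd u (?p - z) = c"
        unfolding pz using uW[OF oproj(1)[OF W]]
        by (simp add: cd_add cd_cscale cd_real uu) (simp add: cproj_def cd_def inner_commute complex_eq_iff)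
      ultimately have "cx_map \<sigma> ?p - z = cproj W (y - z) + cscale (- c) ?u" using \<sigma>V[OF pV] by simp
      then have "cx_map \<sigma> ?p = translate_proj z W y + cscale (- c) ?u"
        by (simp add: translate_proj_def algebra_simps)
      then show "R ?p = R (translate_proj z W y + cscale (- c) ?u)" using R\<sigma>[OF p pV] by simp
    qed (assumption | rule that)+
    define \<Phi> where "\<Phi> y = F (cproj W (y - z)) (qf (y - z - cproj W (y - z)))" for y
    have \<Phi>R: "\<Phi> p = R p" if p: "p \<in> ball z \<rho>" "p - z \<in> V \<times> V" for p
    proof -
      have e: "p - z = cproj W (p - z) + cscale (cd u (p - z)) ?u" by (rule VVE[OF p(2)])
      then have e': "p = translate_proj z W p + cscale (cd u (p - z)) ?u"
        by (simp add: translate_proj_def algebra_simps)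
      have "p - z - cproj W (p - z) = cscale (cd u (p - z)) ?u"
        using e by (metis add_diff_cancel_left')
      then have "\<Phi> p = F (cproj W (p - z)) ((cd u (p - z))^2)"
        by (simp add: \<Phi>_def qf_cscale_real uu)
      also have "\<dots> = R (translate_proj z W p + cscale (cd u (p - z)) ?u)"
        by (rule F(4)) (use e' p(1) in simp)
      finally show ?thesis using e' by simp
    qed
    have "A y = \<Phi> y * B y" if y: "y \<in> T" "y \<in> ball z \<rho>" for y
    proof -
      have yr: "y \<in> ball z r0" "y \<in> ball z r" using y(2) F(2) r by simp_all
      obtain g y' c where g: "g \<in> stab z" "\<forall>w\<in>W. lin g w = w"
        "y' - z = cproj W (y' - z) + cscale c ?u" "y = cx_map g y'"
        using comp[OF yr(1)] y(1) by metis
      have gG: "g \<in> G" using g(1) by (simp add: stab_def)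
      have y'V: "y' - z \<in> V \<times> V" by (rule VVI[OF g(3)])
      have y'b: "y' \<in> ball z \<rho>" "y' \<in> ball z r" "y' \<in> ball z r0"
        using distg[OF g(1), of y'] y(2) yr g(4) by simp_all
      have y'T: "y' \<in> T" by (rule inT[OF y'b(3) y'V])
      have gW: "lin g w = w" if "w \<in> W" for w using g(2) that by simp
      have "cx_map g y' - z - cproj W (cx_map g y' - z) =
          (lin g (fst (y' - z - cproj W (y' - z))), lin g (snd (y' - z - cproj W (y' - z))))"
        by (rule nrm_cx_map(2)[OF g(1) W]) (rule gW)
      then have "qf (cx_map g y' - z - cproj W (cx_map g y' - z)) = qf (y' - z - cproj W (y' - z))"
        by (simp only: qf_lin[OF gG] prod.collapse)
      then have "\<Phi> y = \<Phi> y'"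
        unfolding \<Phi>_def g(4) using nrm_cx_map(1)[OF g(1) W gW, of y'] by simp
      also have "\<dots> = R y'" by (rule \<Phi>R[OF y'b(1) y'V])
      finally have "\<Phi> y * B y = R y' * B y'" using invB[OF g(1) y'T y'b(2)] g(4) by simp
      also have "\<dots> = A y'" using ABV[OF y'b(2) y'V] by simp
      also have "\<dots> = A y" using invA[OF g(1) y'T y'b(2)] g(4) by simp
      finally show ?thesis by simp
    qed
    then show "\<exists>F \<rho>. 0 < \<rho> \<and> \<rho> <= r \<and> cx_holomorphic_on F (ball z \<rho>) \<and> (\<forall>y\<in>T \<inter> ball z \<rho>. A y = F y * B y)"
      using F(1,2,3) unfolding \<Phi>_def[symmetric] by (intro exI[of _ \<Phi>] exI[of _ \<rho>]) simp
  qed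
qed

end

lemma inner_eq_one_unit:
  fixes u v :: "'a::real_inner"
  assumes "norm u = 1" "norm v = 1" "(u \<bullet> v)^2 = 1"
  shows "u = v \<or> u = - v"
proof -
  have "\<bar>u \<bullet> v\<bar> = norm u * norm v" using assms by (auto simp: power2_eq_1_iff)
  then have "norm u *\<^sub>R v = norm v *\<^sub>R u \<or> norm u *\<^sub>R v = - norm v *\<^sub>R u"
    by (simp only: norm_cauchy_schwarz_abs_eq)
  then show ?thesis unfolding assms(1,2) by auto
qed

section \<open>Failure of normality without transitivity\<close>

context stable_set
begin

lemma prod_cd_lin:
  assumes S: "finite S" and g: "g \<in> G" and gS: "!!u. u \<in> S ==> lin g u \<in> S"
  shows "(\<Prod>u\<in>S. f (cd u (lin g (fst n), lin g (snd n)))) = (\<Prod>u\<in>S. f (cd u n))"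
proof -
  have inj: "inj_on (lin g) S"
    using lin_norm[OF g] linear_diff[OF lin_linear[OF g]]
    by (intro inj_onI) (metis eq_iff_diff_eq_0 norm_eq_zero)
  then have "lin g ` S = S" using S gS by (intro endo_inj_surj) auto
  then have "(\<Prod>u\<in>S. f (cd u (lin g (fst n), lin g (snd n)))) =
      (\<Prod>u\<in>lin g ` S. f (cd u (lin g (fst n), lin g (snd n))))" by simp
  also have "\<dots> = (\<Prod>u\<in>S. f (cd (lin g u) (lin g (fst n), lin g (snd n))))"
    using inj by (simp add: prod.reindex)
  also have "\<dots> = (\<Prod>u\<in>S. f (cd u n))"
    using cd_lin[OF g] by simp
  finally show ?thesis .
qed

lemma sum_stab_cd_lin:
  assumes h: "h \<in> stab z"
  shows "(\<Sum>g\<in>stab z. f (cd (lin g u) (lin h (fst n), lin h (snd n)))) = (\<Sum>g\<in>stab z. f (cd (lin g u) n))"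
proof -
  obtain k where k: "k \<in> stab z" "!!x. k (h x) = x" "!!x. h (k x) = x"
    by (rule stab_inverse[OF h]) (use that in blast)
  have st: "g \<in> G" if "g \<in> stab z" for g using that by (simp add: stab_def)
  show ?thesis
  proof (rule sum.reindex_bij_witness[of _ "%g x. h (g x)" "%g x. k (g x)"])
    fix g assume g: "g \<in> stab z"
    show "(%x. h (g x)) \<in> stab z" "(%x. k (g x)) \<in> stab z" using stab_comp g h k(1) by auto
    have "lin g u = lin h (lin (%x. k (g x)) u)"
      using lin_comp[OF st[OF h] st[OF stab_comp[OF k(1) g]], of u] by (simp add: k(3))
    then show "f (cd (lin (%x. k (g x)) u) n) = f (cd (lin g u) (lin h (fst n), lin h (snd n)))"
      using cd_lin[OF st[OF h]] by simp
  qed (simp_all add: k)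
qed

text \<open>If the orbit of the line of \<open>u1\<close> misses some line, invariant functions
  separate the two groups of components and multiply to zero. Otherwise no stabiliser element
  reverses \<open>u1\<close>, and there is a quotient \<open>A / B\<close> that is a nonzero
  multiple of the coordinate on the line of \<open>u1\<close> and whose square is a multiple of
  \<open>qf\<close>. An invariant holomorphic germ equal to it would have an invariant linear part,
  which by \<open>nofix\<close> vanishes on \<open>u1\<close>.\<close>

lemma nonnormal_germ:
  fixes U :: "'a set"
  assumes W: "subspace W" and z: "z \<in> T" and r0: "r0 > 0"
    and fx: "!!g w. g \<in> stab z ==> w \<in> W ==> lin g w = w"
    and U: "finite U" "!!u. u \<in> U ==> norm u = 1" "!!u w. u \<in> U ==> w \<in> W ==> u \<bullet> w = 0"
      "!!u. u \<in> U ==> - u \<in> U" "!!g u. g \<in> stab z ==> u \<in> U ==> lin g u \<in> U"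
    and comp: "!!y. y \<in> ball z r0 ==> y \<in> T \<longleftrightarrow> (\<exists>u\<in>U. \<exists>c. y - z = cproj W (y - z) + cscale c (u, 0))"
    and nofix: "!!n. (!!w. w \<in> W ==> n \<bullet> w = 0) ==> (!!g. g \<in> stab z ==> lin g n = n) ==> n = 0"
    and nontrans: "u1 \<in> U" "u2 \<in> U" "!!g. g \<in> stab z ==> lin g u1 ~= u2"
  shows "\<not> normal_germ z"
proof
  assume ng: "normal_germ z"
  have st: "g \<in> G" if "g \<in> stab z" for g using that by (simp add: stab_def)
  define nr where "nr y = y - z - cproj W (y - z)" for y
  have cp_add: "cproj W (a + b) = cproj W a + cproj W b" for a b
    by (rule linear_add[OF bounded_linear.linear[OF bounded_linear_cproj[OF W]]])
  have Wu: "cproj W (cscale c (u, 0)) = 0" if "u \<in> U" for u c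
    by (rule cproj_cscale_orth[OF W U(3)[OF that]])
  have uu: "u \<bullet> u = 1" if "u \<in> U" for u using U(2)[OF that] by (simp add: norm_eq_1)
  have nr_map: "cx_hol_map nr S" if "open S" for S
  proof -
    have "cx_hol_map (%y. (cproj W z - z) + (y - cproj W y)) S"
      by (rule cx_hol_map_affine)
        (auto intro!: bounded_linear_sub bounded_linear_ident bounded_linear_cproj[OF W] that
          simp: cproj_cscale[OF W] cscale.diff_right)
    moreover have "(cproj W z - z) + (y - cproj W y) = nr y" for y
      by (simp add: nr_def linear_diff[OF bounded_linear.linear[OF bounded_linear_cproj[OF W]]])
    ultimately show ?thesis by simp
  qed
  have nr_g: "nr (cx_map g y) = (lin g (fst (nr y)), lin g (snd (nr y)))" if "g \<in> stab z" for g y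
    unfolding nr_def using nrm_cx_map(2)[OF that W fx[OF that]] by simp
  have nr_comp: "\<exists>u\<in>U. \<exists>c. nr y = cscale c (u, 0)" if yT: "y \<in> T" and yb: "y \<in> ball z r0" for y
  proof -
    obtain u c where "u \<in> U" "y - z = cproj W (y - z) + cscale c (u, 0)" using comp[OF yb] yT by metis
    then show ?thesis unfolding nr_def by (metis add_diff_cancel_left')
  qed
  define pt where "pt u t = z + cscale (of_real t) (u, 0)" for u :: 'a and t :: real
  have pt: "nr (pt u t) = cscale (of_real t) (u, 0)" "dist z (pt u t) = \<bar>t\<bar>" if "u \<in> U" for u t
    using U(2)[OF that] by (simp_all add: pt_def nr_def Wu[OF that] dist_norm norm_cscale norm_Pair)
  have ptT: "pt u t \<in> T" if u: "u \<in> U" and t: "\<bar>t\<bar> < r0" for u t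
  proof (rule comp[THEN iffD2])
    show "pt u t \<in> ball z r0" using pt(2)[OF u] t by simp
    show "\<exists>u'\<in>U. \<exists>c. pt u t - z = cproj W (pt u t - z) + cscale c (u', 0)"
      by (rule bexI[OF _ u], rule exI[of _ "of_real t"]) (simp add: pt_def Wu[OF u])
  qed
  have pt_germ: "\<exists>t>0. P (pt u t)" if u: "u \<in> U" and ev: "eventually P (germ z)" for P u
  proof -
    obtain r where r: "r > 0" "\<forall>y\<in>T \<inter> ball z r. P y" using ev unfolding eventually_germ by blast
    define t where "t = min r r0 / 2"
    have t: "t > 0" "t < r" "t < r0" using r r0 by (auto simp: t_def)
    have "pt u t \<in> T \<inter> ball z r" using ptT[OF u, of t] pt(2)[OF u] t by simp
    then have "P (pt u t)" using r(2) by blast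
    then show ?thesis using t(1) by blast
  qed
  have qf_hol: "cx_holomorphic_on (%y. qf (nr y)) (ball z r0)"
    by (rule qf_holomorphic[OF nr_map]) simp
  have cd_hol: "cx_holomorphic_on (%y. cd u (nr y)) (ball z r0)" for u
    by (rule cx_holomorphic_on_compose[OF nr_map cd_holomorphic[of UNIV]]) auto
  have qf_inv: "qf (nr (cx_map g y)) = qf (nr y)" if "g \<in> stab z" for g y
    unfolding nr_g[OF that] using qf_lin[OF st[OF that]] by simp
  have cd_cs: "cd v (cscale c (u, 0)) = c * of_real (u \<bullet> v)" for u v c
    by (simp add: cd_cscale cd_real)
  \<comment> \<open>Directions whose line lies in the orbit of the line of \<open>u1\<close>; signs
    are ignored because a component contains both opposite rays.\<close>
  define O1 where "O1 = {u \<in> U. \<exists>g\<in>stab z. lin g u1 = u \<or> lin g u1 = - u}"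
  \<comment> \<open>The factor for \<open>u\<close> vanishes on the line of \<open>u\<close>; at the
    multiple by \<open>c\<close> of a unit vector \<open>v\<close> it is
    \<open>c^2 * (1 - (v \<bullet> u)^2)\<close>, which for nonzero \<open>c\<close> vanishes only
    if \<open>v\<close> is \<open>u\<close> or \<open>- u\<close>.\<close>
  define p where "p S y = (\<Prod>u\<in>S. qf (nr y) - (cd u (nr y))^2)" for S y
  have p_germ: "hol_germ z (p S)" if S: "S \<subseteq> U" "!!g u. g \<in> stab z ==> u \<in> S ==> lin g u \<in> S" for S
  proof (rule hol_germI[OF r0])
    have "cx_holomorphic_on (%y. qf (nr y) + - ((cd u (nr y))^2)) (ball z r0)" for u
      by (intro cx_holomorphic_on_add cx_holomorphic_on_uminus cx_holomorphic_on_power qf_hol cd_hol)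
    then show "cx_holomorphic_on (p S) (ball z r0)"
      unfolding p_def by (intro cx_holomorphic_on_prod) simp_all
    show "p S (cx_map g y) = p S y" if g: "g \<in> stab z" for g y
    proof -
      have "finite S" using S(1) U(1) finite_subset by blast
      from prod_cd_lin[OF this st[OF g] S(2)[OF g], of "%a. qf (nr y) - a^2" "nr y"] show ?thesis
        unfolding p_def qf_inv[OF g] unfolding nr_g[OF g] .
    qed
  qed
  have p_pt: "p S (pt u t) = (\<Prod>v\<in>S. of_real (t^2 * (1 - (u \<bullet> v)^2)))" if "u \<in> U" for S u t
    unfolding p_def pt(1)[OF that] qf_cscale_real cd_cs
    by (intro prod.cong refl) (simp add: uu[OF that] power_mult_distrib right_diff_distrib)
  have p_ne: "\<not> eventually (%y. p S y = 0) (germ z)" if u: "u \<in> U" and S: "S \<subseteq> U" "u \<notin> S" "- u \<notin> S" for S u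
  proof
    assume "eventually (%y. p S y = 0) (germ z)"
    from pt_germ[OF u this] obtain t where t: "t > 0" "p S (pt u t) = 0" by blast
    have "finite S" using S(1) U(1) finite_subset by blast
    then obtain v where v: "v \<in> S" "of_real (t^2 * (1 - (u \<bullet> v)^2)) = (0::complex)"
      using t(2) unfolding p_pt[OF u] by (auto simp: prod_zero_iff)
    then have "(u \<bullet> v)^2 = 1" using t(1) by (simp only: of_real_eq_0_iff) simp
    then have "u = v \<or> u = - v" using inner_eq_one_unit U(2) u v(1) S(1) by blast
    then show False using S v(1) by auto
  qed
  have O1U: "O1 \<subseteq> U" by (auto simp: O1_def)
  have negO1: "- u \<in> O1" if "u \<in> O1" for u using that U(4) by (force simp: O1_def)
  have O1g: "lin g u \<in> O1" if g: "g \<in> stab z" and u: "u \<in> O1" for g u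
  proof -
    obtain h where h: "h \<in> stab z" "lin h u1 = u \<or> lin h u1 = - u" using u by (auto simp: O1_def)
    have "lin (%x. g (h x)) u1 = lin g u \<or> lin (%x. g (h x)) u1 = - lin g u"
      using h(2) lin_comp[OF st[OF g] st[OF h(1)], of u1] linear_neg[OF lin_linear[OF st[OF g]]] by auto
    then show ?thesis using stab_comp[OF g h(1)] U(5)[OF g] u by (auto simp: O1_def)
  qed
  have u1O1: "u1 \<in> O1"
    using nontrans(1) stab_id[of z] by (auto simp: O1_def lin_def intro!: bexI[of _ "%x. x"])
  have O1UO: "lin g u \<in> U - O1" if g: "g \<in> stab z" and u: "u \<in> U - O1" for g u
  proof
    show "lin g u \<in> U" using U(5) g u by blast
    show "lin g u \<notin> O1"
    proof
      assume a: "lin g u \<in> O1"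
      obtain k where k: "k \<in> stab z" "!!x. k (g x) = x" by (rule stab_inverse[OF g]) (use that in blast)
      have "lin k (lin g u) = u" using lin_comp[OF st[OF k(1)] st[OF g], of u] by (simp add: k(2) lin_def)
      then show False using O1g[OF k(1) a] u by simp
    qed
  qed
  have "U \<subseteq> O1"
  proof (rule ccontr)
    assume "\<not> U \<subseteq> O1"
    then obtain u where u: "u \<in> U" "u \<notin> O1" by blast
    have "eventually (%y. p O1 y * p (U - O1) y = 0) (germ z)"
      unfolding eventually_germ
    proof (intro exI[of _ r0] conjI ballI r0)
      fix y assume "y \<in> T \<inter> ball z r0"
      then obtain v c where v: "v \<in> U" "nr y = cscale c (v, 0)" using nr_comp by (meson IntE)
      have "p S y = 0" if "v \<in> S" "S \<subseteq> U" for S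
      proof -
        have "finite S" using that U(1) finite_subset by blast
        moreover have "qf (nr y) - (cd v (nr y))^2 = 0"
          unfolding v(2) qf_cscale_real cd_cs by (simp add: uu[OF v(1)] power_mult_distrib)
        ultimately show ?thesis unfolding p_def using that(1) by (intro prod_zero) auto
      qed
      then show "p O1 y * p (U - O1) y = 0" using v(1) O1U by (cases "v \<in> O1") auto
    qed
    moreover have "hol_germ z (p O1)" "hol_germ z (p (U - O1))"
      using p_germ[OF O1U O1g] p_germ[of "U - O1"] O1UO by auto
    ultimately have "eventually (%y. p O1 y = 0) (germ z) \<or> eventually (%y. p (U - O1) y = 0) (germ z)"
      using ng unfolding normal_germ_def by blast
    moreover have "- u \<notin> O1" using negO1[of "- u"] u(2) by auto
    ultimately show False
      using p_ne[OF u(1) O1U u(2)] p_ne[OF nontrans(1), of "U - O1"] u1O1 negO1[OF u1O1] by blast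
  qed
  then have all: "!!u. u \<in> U ==> \<exists>g\<in>stab z. lin g u1 = u \<or> lin g u1 = - u" by (auto simp: O1_def)
  \<comment> \<open>A reversal of \<open>u1\<close> followed by an element sending \<open>u1\<close>
    to \<open>- u2\<close> would send \<open>u1\<close> to \<open>u2\<close>.\<close>
  have noneg: "lin g u1 ~= - u1" if g: "g \<in> stab z" for g
  proof
    assume a: "lin g u1 = - u1"
    obtain h where h: "h \<in> stab z" "lin h u1 = u2 \<or> lin h u1 = - u2" using all[OF nontrans(2)] by blast
    have "lin h u1 ~= u2" using nontrans(3)[OF h(1)] .
    then have "lin h u1 = - u2" using h(2) by blast
    then have "lin (%x. h (g x)) u1 = u2"
      using lin_comp[OF st[OF h(1)] st[OF g], of u1] a linear_neg[OF lin_linear[OF st[OF h(1)]]] by simp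
    then show False using nontrans(3)[OF stab_comp[OF h(1) g]] by blast
  qed
  define \<alpha> where "\<alpha> g = lin g u1 \<bullet> u1" for g
  have n1: "norm u1 = 1" "norm (lin g u1) = 1" if "g \<in> G" for g
    using U(2)[OF nontrans(1)] lin_norm[OF that] by simp_all
  have \<alpha>: "\<alpha> g = 1 \<or> \<bar>\<alpha> g\<bar> < 1" if g: "g \<in> stab z" for g
  proof -
    have le: "\<bar>\<alpha> g\<bar> <= 1"
      using Cauchy_Schwarz_ineq2[of "lin g u1" u1] n1[OF st[OF g]] by (simp add: \<alpha>_def)
    show ?thesis
    proof (cases "\<bar>\<alpha> g\<bar> < 1")
      case False
      then have "(\<alpha> g)^2 = 1" using le by (simp add: power2_eq_1_iff abs_if split: if_splits)
      then have "lin g u1 = u1 \<or> lin g u1 = - u1"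
        using inner_eq_one_unit[of "lin g u1" u1] n1[OF st[OF g]] by (simp add: \<alpha>_def)
      then show ?thesis using noneg[OF g] uu[OF nontrans(1)] by (auto simp: \<alpha>_def)
    qed simp
  qed
  \<comment> \<open>Since the value -1 is excluded for \<open>\<alpha> g\<close>, the sums of odd
    powers tend to the number of stabiliser elements fixing \<open>u1\<close>, which is at least 1.
    So some \<open>k\<close> makes \<kappa> nonzero.\<close>
  have "(%k. \<Sum>g\<in>stab z. \<alpha> g ^ (2 * k + 1)) \<longlonglongrightarrow> (\<Sum>g\<in>stab z. if \<alpha> g = 1 then 1 else 0)"
  proof (rule tendsto_sum)
    fix g assume g: "g \<in> stab z"
    show "(%k. \<alpha> g ^ (2 * k + 1)) \<longlonglongrightarrow> (if \<alpha> g = 1 then 1 else 0)"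
    proof (cases "\<alpha> g = 1")
      case False
      then have "(%n. \<alpha> g ^ n) \<longlonglongrightarrow> 0" using \<alpha>[OF g] by (intro LIMSEQ_power_zero) simp
      then have "((%n. \<alpha> g ^ n) \<circ> (%k. 2 * k + 1)) \<longlonglongrightarrow> 0"
        by (rule LIMSEQ_subseq_LIMSEQ) (simp add: strict_mono_def)
      then show ?thesis using False by (simp add: o_def)
    qed simp
  qed
  moreover have "(\<Sum>g\<in>stab z. if \<alpha> g = 1 then 1 else (0::real)) >= 1"
  proof -
    have "\<alpha> (%x. x) = 1" using uu[OF nontrans(1)] by (simp add: \<alpha>_def lin_def)
    then have "(if \<alpha> (%x. x) = 1 then 1 else (0::real)) <= (\<Sum>g\<in>stab z. if \<alpha> g = 1 then 1 else 0)"
      by (intro member_le_sum stab_id finite_stab) auto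
    then show ?thesis using \<open>\<alpha> (%x. x) = 1\<close> by simp
  qed
  ultimately have "eventually (%k. (\<Sum>g\<in>stab z. \<alpha> g ^ (2 * k + 1)) > 1 / 2) sequentially"
    by (intro order_tendstoD(1)) auto
  then obtain k where k: "(\<Sum>g\<in>stab z. \<alpha> g ^ (2 * k + 1)) > 1 / 2"
    using eventually_happens by fastforce
  define \<kappa> where "\<kappa> = (\<Sum>g\<in>stab z. \<alpha> g ^ (2 * k + 1))"
  have \<kappa>: "\<kappa> ~= 0" using k by (simp add: \<kappa>_def)
  \<comment> \<open>On the line of \<open>u1\<close> the function \<open>A\<close> is \<kappa> times
    the power \<open>2 * k + 1\<close> of the coordinate, and \<open>B\<close> is its power
    \<open>2 * k\<close>. On all components \<open>A^2 = \<kappa>^2 * qf * B^2\<close>, a monic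
    equation of degree 2 for \<open>A / B\<close> with constant coefficient \<open>C\<close> and no
    linear term.\<close>
  define A where "A y = (\<Sum>g\<in>stab z. (cd (lin g u1) (nr y)) ^ (2 * k + 1))" for y
  define B where "B y = (qf (nr y)) ^ k" for y
  define C where "C y = of_real (- (\<kappa>^2)) * qf (nr y)" for y
  have A: "hol_germ z A"
  proof (rule hol_germI[OF r0])
    show "cx_holomorphic_on A (ball z r0)"
      unfolding A_def[abs_def] by (intro cx_holomorphic_on_sum cx_holomorphic_on_power cd_hol) simp
    show "A (cx_map g y) = A y" if g: "g \<in> stab z" for g y
      unfolding A_def nr_g[OF g] by (rule sum_stab_cd_lin[OF g])
  qed
  have B: "hol_germ z B"
    by (rule hol_germI[OF r0]) (simp_all add: B_def[abs_def] qf_inv cx_holomorphic_on_power[OF qf_hol])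
  have "cx_holomorphic_on C (ball z r0)"
    unfolding C_def[abs_def] by (intro cx_holomorphic_on_mult cx_holomorphic_on_const qf_hol open_ball)
  then have C: "hol_germ z C"
    by (rule hol_germI[OF r0]) (simp add: C_def qf_inv)
  have zero: "hol_germ z (%_. 0)"
    by (rule hol_germI[OF r0]) simp_all
  have B_pt: "B (pt u1 t) = of_real (t ^ (2 * k))" for t
    unfolding B_def pt(1)[OF nontrans(1)] qf_cscale_real by (simp add: uu[OF nontrans(1)] power_mult)
  have A_cs: "A y = of_real \<kappa> * c ^ (2 * k + 1)" if "nr y = cscale c (u1, 0)" for y c
  proof -
    have "A y = (\<Sum>g\<in>stab z. c ^ (2 * k + 1) * of_real (\<alpha> g ^ (2 * k + 1)))"
      unfolding A_def that cd_cs by (simp only: power_mult_distrib inner_commute[of u1] \<alpha>_def of_real_power)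
    then show ?thesis by (simp only: \<kappa>_def of_real_sum sum_distrib_right mult.commute[of "c ^ (2 * k + 1)"])
  qed
  have eq: "A y ^ 2 + C y * B y ^ 2 = 0" if y: "y \<in> T" "y \<in> ball z r0" for y
  proof -
    obtain v c where v: "v \<in> U" "nr y = cscale c (v, 0)" using nr_comp[OF y] by blast
    obtain h where h: "h \<in> stab z" "lin h u1 = v \<or> lin h u1 = - v" using all[OF v(1)] by blast
    obtain m where m: "m \<in> stab z" "!!x. m (h x) = x" by (rule stab_inverse[OF h(1)]) (use that in blast)
    have mv: "lin m (lin h u1) = u1" using lin_comp[OF st[OF m(1)] st[OF h(1)], of u1] by (simp add: m(2) lin_def)
    have "\<exists>d. d^2 = c^2 \<and> nr (cx_map m y) = cscale d (u1, 0)"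
    proof -
      have "nr (cx_map m y) = cscale c (lin m v, 0)"
        unfolding nr_g[OF m(1)] v(2)
        by (simp add: cscale_def linear_scale[OF lin_linear[OF st[OF m(1)]]] lin_def[of _ 0])
      moreover have "lin m v = u1 \<or> lin m v = - u1"
        using h(2) mv linear_neg[OF lin_linear[OF st[OF m(1)]], of v] by (metis minus_minus)
      moreover have "cscale c (- u1, 0) = cscale (- c) (u1, 0)" by (simp add: cscale_def)
      ultimately show ?thesis by (metis power2_minus)
    qed
    then obtain d where d: "d^2 = c^2" "nr (cx_map m y) = cscale d (u1, 0)" by blast
    have Am: "A (cx_map m y) = A y" unfolding A_def nr_g[OF m(1)] by (rule sum_stab_cd_lin[OF m(1)])
    have "A y = of_real \<kappa> * d ^ (2 * k + 1)" using A_cs[OF d(2)] Am by simp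
    then have "A y ^ 2 = (of_real \<kappa>)^2 * (d^2) ^ (2 * k + 1)"
      by (simp only: power_mult_distrib power_mult[symmetric] mult.commute)
    moreover have "qf (nr y) = c^2" unfolding v(2) qf_cscale_real by (simp add: uu[OF v(1)])
    then have "C y * B y ^ 2 = - ((of_real \<kappa>)^2 * (c^2) ^ (2 * k + 1))"
      by (simp add: B_def C_def power_mult[symmetric] power_add mult.commute[of k 2])
    ultimately show ?thesis using d(1) by simp
  qed
  have ev: "eventually (%y. A y ^ 2 + (\<Sum>i<2. (if i = 0 then C else (%_. 0)) y * A y ^ i * B y ^ (2 - i)) = 0) (germ z)"
    unfolding eventually_germ
  proof (intro exI[of _ r0] conjI ballI r0)
    fix y assume "y \<in> T \<inter> ball z r0"
    then show "A y ^ 2 + (\<Sum>i<2. (if i = 0 then C else (%_. 0)) y * A y ^ i * B y ^ (2 - i)) = 0"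
      using eq[of y] by (simp add: numeral_2_eq_2)
  qed
  have B0: "\<not> eventually (%y. B y = 0) (germ z)"
  proof
    assume "eventually (%y. B y = 0) (germ z)"
    from pt_germ[OF nontrans(1) this] show False unfolding B_pt by auto
  qed
  have cs: "\<forall>i<2. hol_germ z (if i = 0 then C else (%_. 0))" for i :: nat using C zero by simp
  obtain R where R: "hol_germ z R" "eventually (%y. A y = R y * B y) (germ z)"
  proof -
    have "\<exists>R. hol_germ z R \<and> eventually (%y. A y = R y * B y) (germ z)"
      using ng[unfolded normal_germ_def, THEN conjunct2, rule_format,
          OF A B _ B0, of 2 "%i. if i = 0 then C else (%_. 0)"] ev C zero by simp
    then show ?thesis using that by blast
  qed
  obtain r where r: "r > 0" "cx_holomorphic_on R (ball z r)"
    "!!g y. g \<in> stab z ==> y \<in> T ==> y \<in> ball z r ==> R (cx_map g y) = R y"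
    by (rule hol_germ_ball[OF R(1)]) (rule that)
  \<comment> \<open>The average is invariant off \<open>T\<close> as well, so its derivative at
    \<open>z\<close> is invariant under the linear parts of the stabiliser.\<close>
  define S where "S y = (\<Sum>g\<in>stab z. R (cx_map g y)) / of_nat (card (stab z))" for y
  have S: "cx_holomorphic_on S (ball z r)" "!!g y. g \<in> stab z ==> S (cx_map g y) = S y"
    unfolding S_def[abs_def] using average_germ(1,2)[OF r(2,1)] by blast+
  obtain D where D: "(S has_derivative D) (at z)" "complex_linear D"
    using S(1) r(1) by (auto elim: cx_holomorphic_onE[where z = z])
  have linD: "linear D" using D(1) has_derivative_linear by blast
  have Dg: "D (lin g x, 0) = D (x, 0)" if g: "g \<in> stab z" for g x
  proof -
    have gG: "g \<in> G" "cx_map g z = z" using g by (simp_all add: stab_def)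
    let ?M = "%w. (lin g (fst w), lin g (snd w))"
    have "linear ?M"
      by (intro linearI) (auto simp: linear_add[OF lin_linear[OF gG(1)]] linear_scale[OF lin_linear[OF gG(1)]])
    then have "((%y. cx_map g 0 + ?M y) has_derivative ?M) (at z)"
      unfolding linear_conv_bounded_linear
      using has_derivative_add[OF has_derivative_const[of "cx_map g 0"] bounded_linear_imp_has_derivative, of ?M]
      by simp
    then have "(cx_map g has_derivative ?M) (at z)" by (simp only: cx_map_eq[OF gG(1), symmetric])
    then have "((%y. S (cx_map g y)) has_derivative (%w. D (?M w))) (at z)"
      using diff_chain_at[of "cx_map g" ?M z S D] D(1) gG(2) by (simp add: o_def)
    then have "(S has_derivative (%w. D (?M w))) (at z)" using S(2)[OF g] by simp
    then have "(%w. D (?M w)) = D" using D(1) has_derivative_unique by blast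
    then have "D (?M (x, 0)) = D (x, 0)" by metis
    then show ?thesis using linear_0[OF lin_linear[OF gG(1)]] by simp
  qed
  \<comment> \<open>Along the real ray of \<open>u1\<close> the function \<open>S\<close> is
    \<kappa> times the parameter, which determines the derivative in this direction.\<close>
  have Du: "D (u1, 0) = of_real \<kappa>"
  proof -
    have d: "((%c. S (z + cscale c (u1, 0))) has_field_derivative D (u1, 0)) (at 0)"
      by (rule deriv_cx_line[OF D])
    obtain r' where r': "r' > 0" "\<forall>y\<in>T \<inter> ball z r'. A y = R y * B y" using R(2) unfolding eventually_germ by blast
    define s where "s = min r (min r' r0)"
    have s: "s > 0" "s <= r" "s <= r'" "s <= r0" using r(1) r'(1) r0 by (auto simp: s_def)
    have Sc: "S (pt u1 t) = of_real \<kappa> * of_real t" if t: "t ~= 0" "\<bar>t\<bar> < s" for t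
    proof -
      have p: "pt u1 t \<in> T" "pt u1 t \<in> ball z r" "pt u1 t \<in> ball z r'"
        using ptT[OF nontrans(1)] pt(2)[OF nontrans(1)] t s by simp_all
      have "S (pt u1 t) = (\<Sum>g\<in>stab z. R (pt u1 t)) / of_nat (card (stab z))"
        unfolding S_def using r(3)[OF _ p(1,2)] by simp
      also have "\<dots> = R (pt u1 t)"
        using finite_stab[of z] stab_id[of z] by (simp add: card_gt_0_iff) (metis empty_iff)
      finally have S_R: "S (pt u1 t) = R (pt u1 t)" .
      have "of_real \<kappa> * of_real t ^ (2 * k + 1) = R (pt u1 t) * of_real (t ^ (2 * k))"
        using r'(2) p A_cs[OF pt(1)[OF nontrans(1)], of t] B_pt[of t] by (metis IntI)
      then have "(of_real \<kappa> * of_real t - R (pt u1 t)) * of_real (t ^ (2 * k)) = 0"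
        by (simp add: algebra_simps)
      then show ?thesis using t(1) S_R by simp
    qed
    define h where "h c = S (z + cscale c (u1, 0))" for c
    have hd: "(h has_field_derivative D (u1, 0)) (at 0)" using d unfolding h_def[abs_def] .
    have fl: "filterlim (of_real :: real \<Rightarrow> complex) (at 0) (at 0)"
      by (rule filterlim_atI) (auto intro!: tendsto_eq_intros simp: eventually_at_filter)
    have ev: "eventually (%t::real. h (of_real t) = of_real \<kappa> * of_real t) (at 0)"
      unfolding eventually_at using s(1) Sc by (intro exI[of _ s]) (simp add: h_def pt_def)
    have hl: "((%t::real. of_real \<kappa> * of_real t) \<longlongrightarrow> (0::complex)) (at 0)"
      by (auto intro!: tendsto_eq_intros)
    have h0: "h 0 = 0"
    proof -
      have "(h \<longlongrightarrow> h 0) (at 0)" using DERIV_isCont[OF hd] by (simp add: isCont_def)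
      then have "((%t. h (of_real t)) \<longlongrightarrow> h 0) (at (0::real))" using fl by (rule filterlim_compose)
      then have "((%t::real. of_real \<kappa> * of_real t) \<longlongrightarrow> h 0) (at 0)"
        by (rule Lim_transform_eventually) (rule ev)
      then show ?thesis using hl by (rule tendsto_unique[OF at_neq_bot])
    qed
    have "((%c. (h c - h 0) / (c - 0)) \<longlongrightarrow> D (u1, 0)) (at 0)"
      using hd unfolding has_field_derivative_iff .
    then have "((%t. (h (of_real t) - h 0) / (of_real t - 0)) \<longlongrightarrow> D (u1, 0)) (at (0::real))"
      using fl by (rule filterlim_compose)
    moreover have "eventually (%t::real. (h (of_real t) - h 0) / (of_real t - 0) = of_real \<kappa>) (at 0)"
      using ev eventually_neq_at_within[of 0 0 UNIV] by eventually_elim (simp add: h0)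
    ultimately have "((%t::real. of_real \<kappa>) \<longlongrightarrow> D (u1, 0)) (at 0)"
      by (rule Lim_transform_eventually)
    then show ?thesis by (simp add: tendsto_const_iff)
  qed
  \<comment> \<open>The gradient of the real part of \<open>D\<close> on real vectors. Invariance of
    \<open>D\<close> makes it a fixed vector, so by \<open>nofix\<close> it lies in \<open>W\<close>
    and is orthogonal to \<open>u1\<close>, contradicting the nonzero derivative.\<close>
  define n where "n = (\<Sum>b\<in>Basis. Re (D (b, 0)) *\<^sub>R b)"
  have Dn: "Re (D (x, 0)) = n \<bullet> x" for x
  proof -
    have l: "linear (%x. Re (D (x, 0)))"
      using linD by (intro linearI)
        (simp_all add: linear_add[OF linD, of "(_, 0)" "(_, 0)", simplified] linear_scale[OF linD, of _ "(_, 0)", simplified])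
    have "Re (D (x, 0)) = Re (D ((\<Sum>b\<in>Basis. (x \<bullet> b) *\<^sub>R b), 0))" by (simp add: euclidean_representation)
    also have "\<dots> = (\<Sum>b\<in>Basis. (x \<bullet> b) * Re (D (b, 0)))"
      using linear_sum[OF l, of "%b. (x \<bullet> b) *\<^sub>R b" Basis] linear_scale[OF l] by simp
    also have "\<dots> = n \<bullet> x" unfolding n_def inner_sum_left
      by (intro sum.cong) (simp_all add: inner_commute[of x])
    finally show ?thesis .
  qed
  have ng': "lin g n = n" if g: "g \<in> stab z" for g
  proof -
    have "(lin g n - n) \<bullet> lin g x = 0" for x
    proof -
      have "lin g n \<bullet> lin g x = n \<bullet> x" using lin_inner[OF st[OF g]] .
      also have "\<dots> = n \<bullet> lin g x" using Dn Dg[OF g] by metis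
      finally show ?thesis by (simp add: inner_diff_left)
    qed
    moreover obtain h where h: "h \<in> stab z" "!!x. g (h x) = x" by (rule stab_inverse[OF g]) (use that in blast)
    have "lin g (lin h x) = x" for x using lin_comp[OF st[OF g] st[OF h(1)], of x] by (simp add: h(2) lin_def)
    ultimately have "(lin g n - n) \<bullet> x = 0" for x by metis
    then show ?thesis by (metis eq_iff_diff_eq_0 inner_eq_zero_iff)
  qed
  have "n - oproj W n = 0"
  proof (rule nofix)
    show "(n - oproj W n) \<bullet> w = 0" if "w \<in> W" for w by (rule oproj(2)[OF W that])
    show "lin g (n - oproj W n) = n - oproj W n" if "g \<in> stab z" for g
      using ng'[OF that] fx[OF that oproj(1)[OF W]] linear_diff[OF lin_linear[OF st[OF that]]] by simp
  qed
  then have "n \<in> W" using oproj(1)[OF W, of n] by simp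
  then have "n \<bullet> u1 = 0" using U(3)[OF nontrans(1)] by (simp add: inner_commute)
  then show False using Dn[of u1] Du \<kappa> by simp
qed

end

section \<open>Convex sets covered by affine subspaces\<close>

lemma affine_line_mem:
  fixes M :: "'a::real_vector set"
  assumes "affine M" "p \<in> M" "p + t *\<^sub>R (s - p) \<in> M" "t ~= 0"
  shows "s \<in> M"
proof -
  have "(1 - 1 / t) *\<^sub>R p + (1 / t) *\<^sub>R (p + t *\<^sub>R (s - p)) \<in> M"
    using assms unfolding affine_def by (metis add.commute diff_add_cancel)
  moreover have "(1 - 1 / t) *\<^sub>R p + (1 / t) *\<^sub>R (p + t *\<^sub>R (s - p)) = s"
    using assms(4) by (simp add: algebra_simps)
  ultimately show ?thesis by simp
qed

text \<open>Step size of at most 1 that moves a point along \<open>v\<close> by less than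
  \<open>e\<close>; the added 1 avoids division by zero.\<close>

lemma scaled_norm_less:
  fixes v :: "'a::real_normed_vector"
  assumes e: "e > (0::real)"
  shows "min 1 (e / (2 * (norm v + 1))) * norm v < e"
proof -
  have np: "norm v + 1 > 0" by (simp add: add_nonneg_pos)
  have "min 1 (e / (2 * (norm v + 1))) * norm v <= e / (2 * (norm v + 1)) * norm v"
    by (intro mult_right_mono) auto
  also have "\<dots> = e * (norm v / (2 * (norm v + 1)))" by simp
  also have "\<dots> < e * 1"
  proof (rule mult_strict_left_mono[OF _ e])
    have "norm v < norm v + (norm v + 2)" by (simp add: add_nonneg_pos)
    then have "norm v < 2 * (norm v + 1)" by simp
    then show "norm v / (2 * (norm v + 1)) < 1" using np by simp
  qed
  finally show ?thesis by simp
qed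

text \<open>Shrinking \<open>s\<close> towards \<open>p\<close> lands in the ball; the line through
  \<open>p\<close> and the shrunk point lies in \<open>M\<close> and contains
  \<open>s\<close>.\<close>

lemma convex_ball_subset_affine:
  fixes S M :: "'a::real_normed_vector set"
  assumes S: "convex S" and M: "affine M" and p: "p \<in> S" and e: "e > 0" and sub: "ball p e \<inter> S \<subseteq> M"
  shows "S \<subseteq> M"
proof
  fix s assume s: "s \<in> S"
  define t where "t = min 1 (e / (2 * (norm (s - p) + 1)))"
  have np: "norm (s - p) + 1 > 0" by (simp add: add_nonneg_pos)
  have t: "0 < t" "t <= 1" using e np by (simp_all add: t_def)
  have "t * norm (s - p) < e" unfolding t_def using scaled_norm_less[OF e] .
  then have "p + t *\<^sub>R (s - p) \<in> ball p e" using t by (simp add: dist_norm)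
  moreover have "p + t *\<^sub>R (s - p) \<in> S"
  proof -
    have "(1 - t) *\<^sub>R p + t *\<^sub>R s \<in> S" using S p s t by (simp add: convexD)
    then show ?thesis by (simp add: algebra_simps)
  qed
  ultimately have "p + t *\<^sub>R (s - p) \<in> M" using sub by blast
  moreover have "p \<in> M" using sub p e by auto
  ultimately show "s \<in> M" using affine_line_mem[OF M, of p t s] t(1) by simp
qed

text \<open>Baire's theorem: in a closed relative ball of \<open>C\<close>, the complement of each
  \<open>M i\<close> not containing \<open>C\<close> is open and dense, so countably many of them
  have a common point. Generic points with respect to infinitely many hyperplanes are obtained from
  this lemma.\<close>

lemma convex_covered_by_affine:
  fixes C :: "'a::euclidean_space set"
  assumes C: "convex C" "C ~= {}" and I: "countable I" and M: "!!i. i \<in> I ==> affine (M i)"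
    and cov: "C \<subseteq> (\<Union>i\<in>I. M i)"
  shows "\<exists>i\<in>I. C \<subseteq> M i"
proof (rule ccontr)
  assume "\<not> ?thesis"
  then have nsub: "\<not> C \<subseteq> M i" if "i \<in> I" for i using that by blast
  obtain x where x: "x \<in> rel_interior C" using C rel_interior_eq_empty by blast
  then obtain e where e: "e > 0" "cball x e \<inter> affine hull C \<subseteq> C" "x \<in> C"
    by (auto simp: rel_interior_cball)
  define S where "S = cball x e \<inter> affine hull C"
  have S: "closed S" "convex S" "x \<in> S" "S \<subseteq> C"
    using e by (auto simp: S_def hull_inc affine_imp_convex intro!: convex_Int)
  have nS: "\<not> S \<subseteq> M i" if i: "i \<in> I" for i
  proof
    assume "S \<subseteq> M i"
    then have "ball x e \<inter> C \<subseteq> M i" by (auto simp: S_def hull_inc)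
    then show False using convex_ball_subset_affine[OF C(1) M[OF i] e(3,1)] nsub[OF i] by blast
  qed
  have "S \<subseteq> closure (\<Inter>((%i. S - M i) ` I))"
  proof (rule Baire[OF S(1)])
    show "countable ((%i. S - M i) ` I)" using I by simp
    fix T assume "T \<in> (%i. S - M i) ` I"
    then obtain i where i: "i \<in> I" "T = S - M i" by blast
    have "closed (M i)" using M[OF i(1)] by (metis affine_hull_eq closed_affine_hull)
    then have "openin (top_of_set S) T"
      unfolding i(2) Diff_eq by (simp add: openin_open_Int open_Compl)
    moreover have "S \<subseteq> closure T"
    proof
      fix p assume p: "p \<in> S"
      show "p \<in> closure T"
      proof (rule ccontr)
        assume "p \<notin> closure T"
        then obtain d where d: "d > 0" "ball p d \<inter> T = {}"
          using open_contains_ball[of "- closure T"] closure_subset[of T] by (metis (no_types, opaque_lifting) Compl_iff closed_closure disjoint_eq_subset_Compl open_Compl order_trans compl_le_compl_iff)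
        then have "ball p d \<inter> S \<subseteq> M i" using i(2) by blast
        then show False using convex_ball_subset_affine[OF S(2) M[OF i(1)] p d(1)] nS[OF i(1)] by blast
      qed
    qed
    ultimately show "openin (top_of_set S) T \<and> S \<subseteq> closure T" by blast
  qed
  then have "\<Inter>((%i. S - M i) ` I) ~= {}" using S(3) by (metis closure_empty empty_iff subsetD)
  moreover obtain i where "i \<in> I" using cov C(2) by blast
  ultimately obtain s where "s \<in> S" "!!i. i \<in> I ==> s \<notin> M i" by blast
  then show False using S(4) cov by blast
qed

section \<open>Isometries and reflections\<close>

definition isom :: "('a::euclidean_space \<Rightarrow> 'a) \<Rightarrow> bool" where
  "isom g \<longleftrightarrow> bij g \<and> (\<forall>x y. dist (g x) (g y) = dist x y)"

lemma isom_lin: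
  assumes "isom g"
  shows "linear (lin g)" "lin g x \<bullet> lin g y = x \<bullet> y" "norm (lin g x) = norm x"
    "g (x + v) = g x + lin g v" "g x - g y = lin g (x - y)"
proof -
  have "dist (lin g x) (lin g y) = dist x y" for x y
  proof -
    have "dist (lin g x) (lin g y) = dist (g x) (g y)" by (simp add: dist_norm lin_def)
    then show ?thesis using assms by (simp add: isom_def)
  qed
  then have o: "orthogonal_transformation (lin g)"
    unfolding orthogonal_transformation_isometry by (simp add: lin_def)
  show l: "linear (lin g)" "lin g x \<bullet> lin g y = x \<bullet> y" "norm (lin g x) = norm x"
    using o by (auto simp: orthogonal_transformation_def orthogonal_transformation_norm)
  show "g (x + v) = g x + lin g v" "g x - g y = lin g (x - y)"
    using linear_add[OF l(1), of x v] linear_diff[OF l(1), of x y] by (simp_all add: lin_def)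
qed

lemma isom_bij: "isom g ==> bij g"
  by (simp add: isom_def)

lemma isom_inj: "isom g ==> g x = g y \<longleftrightarrow> x = y"
  by (metis isom_bij bij_is_inj inj_eq)

lemma isom_id: "isom (%x. x)"
  by (simp add: isom_def bij_def)

lemma isom_comp: "isom g ==> isom h ==> isom (%x. g (h x))"
  unfolding isom_def using bij_comp[of h g] by (simp add: o_def)

lemma isom_inv: "isom g ==> isom (inv_into UNIV g)"
  unfolding isom_def
  by (metis bij_imp_bij_inv bij_inv_eq_iff)

lemma isom_inv_apply: "isom g ==> inv_into UNIV g (g x) = x" "isom g ==> g (inv_into UNIV g x) = x"
  by (simp_all add: isom_def bij_is_inj inv_f_f bij_is_surj surj_f_inv_f)

lemma isom_affine_hull: "isom g ==> affine hull (g ` S) = g ` (affine hull S)"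
proof -
  assume g: "isom g"
  have "g ` S' = (+) (g 0) ` (lin g ` S')" for S'
    by (auto simp: lin_def image_iff)
  then show ?thesis
    using affine_hull_linear_image[OF linear_conv_bounded_linear[THEN iffD1, OF isom_lin(1)[OF g]], of S]
    by (metis affine_hull_translation)
qed

lemma isom_affine: "isom g ==> affine S ==> affine (g ` S)"
  using isom_affine_hull[of g S] by (metis affine_affine_hull affine_hull_eq)

lemma hyperplane_subset_normal:
  fixes n m :: "'a::euclidean_space"
  assumes sub: "{x. n \<bullet> x = c} \<subseteq> {x. m \<bullet> x = d}" and n: "norm n = 1" and m: "norm m = 1"
  shows "(m = n \<and> d = c) \<or> (m = - n \<and> d = - c)"
proof -
  have nn: "n \<bullet> n = 1" and mm: "m \<bullet> m = 1" using n m by (simp_all add: norm_eq_1)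
  have md: "m \<bullet> (c *\<^sub>R n) = d"
  proof -
    have "c *\<^sub>R n \<in> {x. n \<bullet> x = c}" using nn by simp
    then have "c *\<^sub>R n \<in> {x. m \<bullet> x = d}" using sub by (rule subsetD[rotated])
    then show ?thesis by simp
  qed
  have mv: "m \<bullet> v = 0" if "n \<bullet> v = 0" for v
  proof -
    have "c *\<^sub>R n + v \<in> {x. n \<bullet> x = c}" using nn that by (simp add: inner_add_right)
    then have "c *\<^sub>R n + v \<in> {x. m \<bullet> x = d}" using sub by (rule subsetD[rotated])
    then have "m \<bullet> (c *\<^sub>R n + v) = d" by simp
    then show ?thesis using md by (simp add: inner_add_right)
  qed
  define r where "r = m \<bullet> n"
  have "n \<bullet> (m - r *\<^sub>R n) = 0" using nn by (simp add: inner_diff_right r_def inner_commute)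
  then have "m \<bullet> (m - r *\<^sub>R n) = 0" by (rule mv)
  then have "r^2 = 1" using mm by (simp add: inner_diff_right r_def power2_eq_square)
  moreover have "(m \<bullet> n)^2 = 1 ==> m = n \<or> m = - n" by (rule inner_eq_one_unit[OF m n])
  ultimately have "m = n \<or> m = - n" by (simp add: r_def)
  then show ?thesis using md nn by auto
qed

lemma isometry_group_facts:
  "carrier isometry_group = {g. isom g}"
  "isom g ==> isom h ==> g \<otimes>\<^bsub>isometry_group\<^esub> h = (%x. g (h x))"
  "\<one>\<^bsub>isometry_group\<^esub> = (%x. x)"
  unfolding isometry_group_def BijGroup_def isom_def
  by (auto simp: Bij_def compose_def extensional_def fun_eq_iff bij_betw_def)

lemma group_isometry_group: "group isometry_group"
proof (rule groupI)
  fix x assume x: "x \<in> carrier (isometry_group :: ('a \<Rightarrow> 'a) monoid)"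
  then have "isom x" by (simp add: isometry_group_facts(1))
  then show "\<exists>y\<in>carrier isometry_group. y \<otimes>\<^bsub>isometry_group\<^esub> x = \<one>\<^bsub>isometry_group\<^esub>"
    using isom_inv[of x] isom_inv_apply(1)[of x]
    by (intro bexI[of _ "inv_into UNIV x"]) (simp_all add: isometry_group_facts fun_eq_iff)
qed (auto simp: isometry_group_facts isom_comp isom_id)

lemma isometry_group_inv:
  assumes "isom g"
  shows "inv\<^bsub>isometry_group\<^esub> g = inv_into UNIV g"
proof -
  interpret group "isometry_group :: ('a \<Rightarrow> 'a) monoid" by (rule group_isometry_group)
  show ?thesis
    using assms isom_inv[OF assms] isom_inv_apply[OF assms]
    by (intro inv_equality) (auto simp: isometry_group_facts)
qed

text \<open>Words rather than group elements, because the exchange argument deletes letters. The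
  last letter acts first.\<close>

definition wd :: "'a::euclidean_space set list \<Rightarrow> 'a \<Rightarrow> 'a" where
  "wd Hs = foldr (%H g x. orth_reflection H (g x)) Hs (%x. x)"

lemma wd_simps [simp]: "wd [] x = x" "wd (H # Hs) x = orth_reflection H (wd Hs x)"
  by (simp_all add: wd_def)

lemma wd_append: "wd (Hs @ Ks) x = wd Hs (wd Ks x)"
  by (induction Hs) simp_all

section \<open>Hyperplanes, reflections and the chamber\<close>

locale arrangement =
  fixes \<H> :: "'a::euclidean_space set set" and \<A> :: "'a set"
  assumes admissible: "admissible_arrangement \<H>" and chamber: "chamber \<H> \<A>"
begin

definition a0 :: 'a where "a0 = (SOME a. a \<in> \<A>)"

text \<open>Unit normal and offset. Of the two possible signs the one with \<open>a0\<close> on the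
  nonnegative side is chosen, so that \<open>sg H\<close> below is the signed distance to
  \<open>H\<close>, positive on the chamber.\<close>

definition nc :: "'a set \<Rightarrow> 'a \<times> real" where
  "nc H = (SOME nc. norm (fst nc) = 1 \<and> H = {x. fst nc \<bullet> x = snd nc} \<and> fst nc \<bullet> a0 >= snd nc)"

definition nv :: "'a set \<Rightarrow> 'a" where "nv H = fst (nc H)"

definition sg :: "'a set \<Rightarrow> 'a \<Rightarrow> real" where "sg H x = nv H \<bullet> x - snd (nc H)"

lemma nc:
  assumes "H \<in> \<H>"
  shows "norm (nv H) = 1" "x \<in> H \<longleftrightarrow> sg H x = 0" "sg H a0 >= 0"
proof -
  have "affine_hyperplane H" using admissible assms unfolding admissible_arrangement_def by blast
  then obtain n b where n: "n ~= 0" "H = {x. n \<bullet> x = b}"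
    unfolding affine_hyperplane_def by metis
  define m where "m = n /\<^sub>R norm n"
  have nm: "n = norm n *\<^sub>R m" using n(1) by (simp add: m_def)
  have "H = {x. m \<bullet> x = b / norm n}"
    unfolding n(2) by (subst nm) (use n(1) in \<open>simp add: eq_divide_eq mult.commute\<close>)
  moreover have "norm m = 1" using n(1) by (simp add: m_def)
  ultimately have m: "norm m = 1" "H = {x. m \<bullet> x = b / norm n}" by simp_all
  have "\<exists>nc. norm (fst nc) = 1 \<and> H = {x. fst nc \<bullet> x = snd nc} \<and> fst nc \<bullet> a0 >= snd nc"
  proof (cases "m \<bullet> a0 >= b / norm n")
    case True
    then show ?thesis using m by (intro exI[of _ "(m, b / norm n)"]) simp
  next
    case False
    moreover have "H = {x. (- m) \<bullet> x = - (b / norm n)}" using m(2) by auto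
    ultimately show ?thesis using m(1) by (intro exI[of _ "(- m, - (b / norm n))"]) simp
  qed
  from someI_ex[OF this] have "norm (nv H) = 1 \<and> H = {x. nv H \<bullet> x = snd (nc H)} \<and> nv H \<bullet> a0 >= snd (nc H)"
    unfolding nv_def nc_def .
  then show "norm (nv H) = 1" "x \<in> H \<longleftrightarrow> sg H x = 0" "sg H a0 >= 0" by (auto simp: sg_def)
qed

lemma H_eq: "H \<in> \<H> ==> H = {x. nv H \<bullet> x = snd (nc H)}"
  using nc(2) by (auto simp: sg_def)

lemma H_mem: "H \<in> \<H> ==> x \<in> H \<longleftrightarrow> nv H \<bullet> x = snd (nc H)"
  by (simp add: nc(2) sg_def)

lemma nn: "H \<in> \<H> ==> nv H \<bullet> nv H = 1"
  using nc(1) by (simp add: norm_eq_1)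

lemma sg_diff: "sg H x - sg H y = nv H \<bullet> (x - y)"
  by (simp add: sg_def inner_diff_right)

lemma sg_lipschitz: "H \<in> \<H> ==> \<bar>sg H x - sg H y\<bar> <= dist x y"
  using Cauchy_Schwarz_ineq2[of "nv H" "x - y"] nc(1) by (simp add: sg_diff dist_norm)

lemma sg_affine: "sg H ((1 - t) *\<^sub>R x + t *\<^sub>R y) = (1 - t) * sg H x + t * sg H y"
  by (simp add: sg_def inner_add_right algebra_simps)

lemma H_affine: "H \<in> \<H> ==> affine H"
  using affine_hyperplane[of "nv H" "snd (nc H)"] H_eq[of H] by simp

lemma H_closed: "H \<in> \<H> ==> closed H"
  using closed_hyperplane[of "nv H" "snd (nc H)"] H_eq[of H] by simp

lemma refl: "H \<in> \<H> ==> orth_reflection H x = x - (2 * sg H x) *\<^sub>R nv H"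
proof -
  assume H: "H \<in> \<H>"
  have "closest_point H x = x - sg H x *\<^sub>R nv H"
  proof (rule sym, rule closest_point_unique)
    show "convex H" "closed H" using H_affine[OF H] H_closed[OF H] by (simp_all add: affine_imp_convex)
    show "x - sg H x *\<^sub>R nv H \<in> H"
      using nn[OF H] nc(2)[OF H] by (simp add: sg_def inner_diff_right)
    show "\<forall>z\<in>H. dist x (x - sg H x *\<^sub>R nv H) <= dist x z"
    proof
      fix z assume "z \<in> H"
      then show "dist x (x - sg H x *\<^sub>R nv H) <= dist x z"
        using sg_lipschitz[OF H, of x z] nc(2)[OF H] nc(1)[OF H] by (simp add: dist_norm)
    qed
  qed
  then show ?thesis unfolding orth_reflection_def by simp
qed

lemma refl_refl: "H \<in> \<H> ==> orth_reflection H (orth_reflection H x) = x"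
  using nn by (simp add: refl sg_def inner_diff_right algebra_simps)

lemma refl_fixed: "H \<in> \<H> ==> orth_reflection H x = x \<longleftrightarrow> x \<in> H"
proof -
  assume H: "H \<in> \<H>"
  have "nv H ~= 0" using nc(1)[OF H] by force
  then show ?thesis using nc(2)[OF H, of x] by (simp add: refl[OF H])
qed

text \<open>If \<open>x\<close> and \<open>y\<close> lie strictly on opposite sides of
  \<open>H\<close>, reflecting \<open>x\<close> brings it closer to \<open>y\<close>; folding by
  reflections of \<H> rests on this formula.\<close>

lemma refl_dist_sq: "H \<in> \<H> ==> (dist (orth_reflection H x) y)^2 = (dist x y)^2 + 4 * sg H x * sg H y"
proof -
  assume H: "H \<in> \<H>"
  have "(dist (orth_reflection H x) y)^2 = (x - y - (2 * sg H x) *\<^sub>R nv H) \<bullet> (x - y - (2 * sg H x) *\<^sub>R nv H)"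
    by (simp add: dist_norm power2_norm_eq_inner refl[OF H] algebra_simps)
  also have "\<dots> = (x - y) \<bullet> (x - y) - 4 * sg H x * (nv H \<bullet> (x - y)) + 4 * (sg H x)^2 * (nv H \<bullet> nv H)"
    by (simp add: inner_diff_left inner_diff_right inner_commute power2_eq_square algebra_simps)
  also have "nv H \<bullet> (x - y) = sg H x - sg H y" by (simp add: sg_diff)
  also have "(x - y) \<bullet> (x - y) - 4 * sg H x * (sg H x - sg H y) + 4 * (sg H x)^2 * (nv H \<bullet> nv H) =
      (x - y) \<bullet> (x - y) + 4 * sg H x * sg H y"
    unfolding nn[OF H] by (simp add: right_diff_distrib power2_eq_square)
  finally show ?thesis by (simp add: dist_norm power2_norm_eq_inner)
qed

lemma isom_refl:
  assumes H: "H \<in> \<H>"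
  shows "isom (orth_reflection H)"
  unfolding isom_def
proof (intro conjI allI)
  show "bij (orth_reflection H)" by (rule involuntory_imp_bij) (rule refl_refl[OF H])
  fix x y
  have "sg H (orth_reflection H y) = - sg H y"
    using nn[OF H] by (simp add: refl[OF H] sg_def inner_diff_right)
  then have "(dist (orth_reflection H x) (orth_reflection H y))^2 =
      (dist (orth_reflection H y) x)^2 - 4 * sg H x * sg H y"
    using refl_dist_sq[OF H, of x "orth_reflection H y"] by (simp add: dist_commute)
  also have "\<dots> = (dist x y)^2"
    using refl_dist_sq[OF H, of y x] by (simp add: dist_commute algebra_simps)
  finally show "dist (orth_reflection H x) (orth_reflection H y) = dist x y"
    by (simp add: power2_eq_iff_nonneg)
qed

abbreviation "W \<equiv> refl_group \<H>"

lemma isom_wd: "Hs \<in> lists \<H> ==> isom (wd Hs)"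
proof (induction Hs)
  case Nil
  then show ?case using isom_id by (simp add: wd_def)
next
  case (Cons H Hs)
  then have "isom (%x. orth_reflection H (wd Hs x))" by (intro isom_comp[OF isom_refl]) auto
  moreover have "(%x. orth_reflection H (wd Hs x)) = wd (H # Hs)" by (simp add: fun_eq_iff)
  ultimately show ?case by simp
qed

text \<open>Reflections are involutions, so inverses in the generated group need no letters of their
  own.\<close>

lemma W_words: "W = wd ` lists \<H>"
proof
  interpret I: group "isometry_group :: ('a \<Rightarrow> 'a) monoid" by (rule group_isometry_group)
  show "W \<subseteq> wd ` lists \<H>"
  proof
    fix w assume "w \<in> W"
    then have "w \<in> generate isometry_group (orth_reflection ` \<H>)" by (simp add: refl_group_def)
    then show "w \<in> wd ` lists \<H>"
    proof induction
      case one
      then show ?case by (auto simp: isometry_group_facts(3) wd_def intro!: image_eqI[of _ _ "[]"])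
    next
      case (incl h)
      then obtain H where H: "H \<in> \<H>" "h = orth_reflection H" by blast
      then have "h = wd [H]" by (simp add: fun_eq_iff)
      then show ?case using H(1) by (intro image_eqI[of _ _ "[H]"]) auto
    next
      case (inv h)
      then obtain H where H: "H \<in> \<H>" "h = orth_reflection H" by blast
      have "inv_into UNIV h = h" using refl_refl[OF H(1)] H(2) by (intro inv_equality) auto
      then have "inv\<^bsub>isometry_group\<^esub> h = wd [H]"
        unfolding isometry_group_inv[OF isom_refl[OF H(1)], folded H(2)] \<open>inv_into UNIV h = h\<close>
        using H(2) by (simp add: fun_eq_iff)
      then show ?case using H(1) by (intro image_eqI[of _ _ "[H]"]) auto
    next
      case (eng h1 h2)
      then obtain Hs Ks where "h1 = wd Hs" "Hs \<in> lists \<H>" "h2 = wd Ks" "Ks \<in> lists \<H>" by blast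
      then have "h1 \<otimes>\<^bsub>isometry_group\<^esub> h2 = wd (Hs @ Ks)"
        using isometry_group_facts(2)[OF isom_wd[OF \<open>Hs \<in> lists \<H>\<close>] isom_wd[OF \<open>Ks \<in> lists \<H>\<close>]]
        unfolding \<open>h1 = wd Hs\<close> \<open>h2 = wd Ks\<close> by (simp add: fun_eq_iff wd_append)
      then show ?case using \<open>Hs \<in> lists \<H>\<close> \<open>Ks \<in> lists \<H>\<close> by (intro image_eqI[of _ _ "Hs @ Ks"]) auto
    qed
  qed
  have "wd Hs \<in> W" if "Hs \<in> lists \<H>" for Hs using that
  proof (induction Hs)
    case Nil
    have "wd [] = \<one>\<^bsub>isometry_group\<^esub>" by (simp add: wd_def isometry_group_facts(3))
    then show ?case unfolding refl_group_def by (metis generate.one)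
  next
    case (Cons H Hs)
    then have "orth_reflection H \<otimes>\<^bsub>isometry_group\<^esub> wd Hs \<in> W"
      unfolding refl_group_def by (intro generate.eng[OF generate.incl]) auto
    moreover have "orth_reflection H \<otimes>\<^bsub>isometry_group\<^esub> wd Hs = wd (H # Hs)"
      using Cons isom_wd isom_refl by (subst isometry_group_facts(2)) (auto simp: fun_eq_iff)
    ultimately show ?case by argo
  qed
  then show "wd ` lists \<H> \<subseteq> W" by blast
qed

lemma W_isom: "w \<in> W ==> isom w"
  using isom_wd by (auto simp: W_words)

lemma W_comp: "v \<in> W ==> w \<in> W ==> (%x. v (w x)) \<in> W"
proof -
  assume "v \<in> W" "w \<in> W"
  then obtain Hs Ks where "v = wd Hs" "Hs \<in> lists \<H>" "w = wd Ks" "Ks \<in> lists \<H>" by (auto simp: W_words)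
  then show ?thesis unfolding W_words by (intro image_eqI[of _ _ "Hs @ Ks"]) (auto simp: wd_append fun_eq_iff)
qed

lemma wd_rev: "Hs \<in> lists \<H> ==> wd (rev Hs) (wd Hs x) = x"
  by (induction Hs arbitrary: x) (simp_all add: wd_append refl_refl)

lemma W_inv: "w \<in> W ==> inv_into UNIV w \<in> W"
proof -
  assume "w \<in> W"
  then obtain Hs where Hs: "w = wd Hs" "Hs \<in> lists \<H>" by (auto simp: W_words)
  have "wd (rev Hs) (w x) = x" "w (wd (rev Hs) x) = x" for x
    using wd_rev[OF Hs(2)] wd_rev[of "rev Hs"] Hs by (simp_all add: lists_eq_set)
  then have "inv_into UNIV w = wd (rev Hs)" by (intro inv_equality)
  then show ?thesis using Hs by (auto simp: W_words)
qed

lemma W_image: "w \<in> W ==> H \<in> \<H> ==> w ` H \<in> \<H>"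
  using admissible unfolding admissible_arrangement_def by blast

lemma W_refl: "H \<in> \<H> ==> orth_reflection H \<in> W"
  unfolding W_words by (intro image_eqI[of _ _ "[H]"]) (auto simp: fun_eq_iff)

text \<open>The preimage of \<open>C \<times> C\<close> under the proper map is compact, and its
  projection to the discrete group is compact, hence finite.\<close>

lemma W_proper:
  assumes C: "compact C"
  shows "finite {w \<in> W. \<exists>x\<in>C. w x \<in> C}"
proof -
  let ?X = "prod_topology (discrete_topology W) (euclidean :: 'a topology)"
  let ?f = "%(g, x). (g x, x) :: 'a \<times> 'a"
  have "proper_map ?X euclidean ?f"
    using admissible unfolding admissible_arrangement_def acts_properly_def by blast
  moreover have "compactin (euclidean :: ('a \<times> 'a) topology) (C \<times> C)"
    using C by (simp add: compact_Times)
  ultimately have "compactin ?X {x \<in> topspace ?X. ?f x \<in> C \<times> C}"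
    by (rule compactin_proper_map_preimage)
  then have "compactin (discrete_topology W) (fst ` {x \<in> topspace ?X. ?f x \<in> C \<times> C})"
    using continuous_map_fst image_compactin by blast
  then have "finite (fst ` {x \<in> topspace ?X. ?f x \<in> C \<times> C})"
    by (simp add: compactin_discrete_topology)
  moreover have "{w \<in> W. \<exists>x\<in>C. w x \<in> C} \<subseteq> fst ` {x \<in> topspace ?X. ?f x \<in> C \<times> C}"
    by (force simp: image_iff)
  ultimately show ?thesis by (rule finite_subset[rotated])
qed

text \<open>A hyperplane meeting \<open>C\<close> gives a reflection with a fixed point in
  \<open>C\<close>, and the hyperplane is recovered as the fixed set of that reflection.\<close>

lemma finite_H_meeting:
  assumes C: "compact C"
  shows "finite {H \<in> \<H>. H \<inter> C ~= {}}"
proof (rule finite_imageD)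
  show "inj_on orth_reflection {H \<in> \<H>. H \<inter> C ~= {}}"
  proof (rule inj_onI)
    fix H H' assume "H \<in> {H \<in> \<H>. H \<inter> C ~= {}}" "H' \<in> {H \<in> \<H>. H \<inter> C ~= {}}" "orth_reflection H = orth_reflection H'"
    then have "x \<in> H \<longleftrightarrow> x \<in> H'" for x using refl_fixed[of H x] refl_fixed[of H' x] by simp
    then show "H = H'" by blast
  qed
  have "orth_reflection ` {H \<in> \<H>. H \<inter> C ~= {}} \<subseteq> {w \<in> W. \<exists>x\<in>C. w x \<in> C}"
    using W_refl refl_fixed by force
  then show "finite (orth_reflection ` {H \<in> \<H>. H \<inter> C ~= {}})"
    using W_proper[OF C] finite_subset by blast
qed

lemma H_meets_cball: "H \<in> \<H> ==> \<bar>sg H x\<bar> <= r ==> H \<inter> cball x r ~= {}"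
proof -
  assume H: "H \<in> \<H>" "\<bar>sg H x\<bar> <= r"
  have "x - sg H x *\<^sub>R nv H \<in> H" using nn[OF H(1)] nc(2)[OF H(1)] by (simp add: sg_def inner_diff_right)
  moreover have "x - sg H x *\<^sub>R nv H \<in> cball x r" using H nc(1)[OF H(1)] by (simp add: dist_norm)
  ultimately show ?thesis by blast
qed

lemma finite_sg_le: "finite {H \<in> \<H>. \<bar>sg H x\<bar> <= r}"
  by (rule finite_subset[OF _ finite_H_meeting[OF compact_cball[of x r]]]) (use H_meets_cball in blast)

lemma countable_H: "countable \<H>"
proof -
  have "\<H> \<subseteq> (\<Union>n::nat. {H \<in> \<H>. \<bar>sg H 0\<bar> <= real n})" using real_arch_simple by blast
  moreover have "countable (\<Union>n::nat. {H \<in> \<H>. \<bar>sg H 0\<bar> <= real n})"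
    using finite_sg_le by (intro countable_UN) (auto intro: countable_finite)
  ultimately show ?thesis by (rule countable_subset)
qed

text \<open>Only finitely many hyperplanes come within distance 1 of \<open>x\<close>, so those
  missing \<open>x\<close> stay at a positive distance.\<close>

lemma sg_gap: "\<exists>\<epsilon>>0. \<forall>H\<in>\<H>. sg H x = 0 \<or> \<epsilon> <= \<bar>sg H x\<bar>"
proof -
  let ?F = "{H \<in> \<H>. \<bar>sg H x\<bar> <= 1 \<and> sg H x ~= 0}"
  have fin: "finite ?F" by (rule finite_subset[OF _ finite_sg_le[of x 1]]) auto
  let ?e = "Min (insert 1 ((%H. \<bar>sg H x\<bar>) ` ?F))"
  have "?e > 0" using fin by auto
  moreover have "sg H x = 0 \<or> ?e <= \<bar>sg H x\<bar>" if "H \<in> \<H>" for H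
  proof (cases "H \<in> ?F")
    case True
    then have "?e <= \<bar>sg H x\<bar>" using fin by (intro Min_le) auto
    then show ?thesis ..
  next
    case False
    moreover have "?e <= 1" using fin by (intro Min_le) auto
    ultimately show ?thesis using that by auto
  qed
  ultimately show ?thesis by blast
qed

lemma a0_mem: "a0 \<in> \<A>"
  using chamber in_components_nonempty unfolding chamber_def a0_def by (metis some_in_eq)

lemma sg_a0: "H \<in> \<H> ==> sg H a0 > 0"
proof -
  assume H: "H \<in> \<H>"
  have "a0 \<notin> \<Union>\<H>" using a0_mem chamber in_components_subset unfolding chamber_def by blast
  then show ?thesis using nc[OF H] H by force
qed

text \<open>Connectedness keeps every \<open>sg H\<close> positive on the chamber. Conversely the
  set of positivity is convex, avoids all hyperplanes and contains \<open>a0\<close>.\<close>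

lemma chamber_eq: "\<A> = {x. \<forall>H\<in>\<H>. sg H x > 0}"
proof
  have comp: "\<A> \<in> components (UNIV - \<Union>\<H>)" using chamber by (simp add: chamber_def)
  have con: "connected \<A>" by (rule in_components_connected[OF comp])
  show "\<A> \<subseteq> {x. \<forall>H\<in>\<H>. sg H x > 0}"
  proof (intro subsetI CollectI ballI, rule ccontr)
    fix x H assume x: "x \<in> \<A>" and H: "H \<in> \<H>" and "\<not> sg H x > 0"
    then have "nv H \<bullet> x <= snd (nc H)" "snd (nc H) <= nv H \<bullet> a0" using nc(3)[OF H] by (simp_all add: sg_def)
    then obtain z where "z \<in> \<A>" "nv H \<bullet> z = snd (nc H)"
      using connected_ivt_hyperplane[OF con x a0_mem] by blast
    then have "z \<in> H" "z \<in> \<A>" using nc(2)[OF H] by (simp_all add: sg_def)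
    then show False using in_components_subset[OF comp] H by blast
  qed
  have "convex {x. \<forall>H\<in>\<H>. sg H x > 0}"
  proof -
    have "{x. \<forall>H\<in>\<H>. sg H x > 0} = (\<Inter>H\<in>\<H>. {x. nv H \<bullet> x > snd (nc H)})" by (auto simp: sg_def)
    moreover have "convex (\<Inter>H\<in>\<H>. {x. nv H \<bullet> x > snd (nc H)})"
      by (intro convex_INT convex_halfspace_gt)
    ultimately show ?thesis by simp
  qed
  then have "connected {x. \<forall>H\<in>\<H>. sg H x > 0}" by (rule convex_connected)
  moreover have "{x. \<forall>H\<in>\<H>. sg H x > 0} \<subseteq> UNIV - \<Union>\<H>"
  proof
    fix x assume x: "x \<in> {x. \<forall>H\<in>\<H>. sg H x > 0}"
    have "x \<notin> H" if "H \<in> \<H>" for H using nc(2)[OF that, of x] x that by auto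
    then show "x \<in> UNIV - \<Union>\<H>" by blast
  qed
  moreover have "\<A> \<inter> {x. \<forall>H\<in>\<H>. sg H x > 0} ~= {}" using a0_mem sg_a0 by blast
  ultimately show "{x. \<forall>H\<in>\<H>. sg H x > 0} \<subseteq> \<A>" using components_maximal[OF comp] by blast
qed

lemma chamber_mem: "x \<in> \<A> \<longleftrightarrow> (\<forall>H\<in>\<H>. sg H x > 0)"
  using arg_cong[OF chamber_eq, of "%S. x \<in> S"] unfolding mem_Collect_eq .

lemma closure_chamber: "closure \<A> = {x. \<forall>H\<in>\<H>. sg H x >= 0}"
proof
  have "{x. \<forall>H\<in>\<H>. sg H x >= 0} = (\<Inter>H\<in>\<H>. {x. nv H \<bullet> x >= snd (nc H)})" by (auto simp: sg_def)
  moreover have "closed (\<Inter>H\<in>\<H>. {x. nv H \<bullet> x >= snd (nc H)})"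
    by (intro closed_INT ballI closed_halfspace_ge)
  ultimately have "closed {x. \<forall>H\<in>\<H>. sg H x >= 0}" by simp
  moreover have "\<A> \<subseteq> {x. \<forall>H\<in>\<H>. sg H x >= 0}" by (auto simp: chamber_mem less_imp_le)
  ultimately show "closure \<A> \<subseteq> {x. \<forall>H\<in>\<H>. sg H x >= 0}" by (rule closure_minimal[rotated])
  show "{x. \<forall>H\<in>\<H>. sg H x >= 0} \<subseteq> closure \<A>"
  proof
    fix x assume x: "x \<in> {x. \<forall>H\<in>\<H>. sg H x >= 0}"
    have "\<exists>y\<in>\<A>. dist y x < e" if e: "e > 0" for e
    proof -
      define t where "t = min 1 (e / (2 * (norm (a0 - x) + 1)))"
      have np: "norm (a0 - x) + 1 > 0" by (simp add: add_nonneg_pos)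
      have t: "0 < t" "t <= 1" using e np by (simp_all add: t_def)
      have d: "t * norm (a0 - x) < e" unfolding t_def using scaled_norm_less[OF e] .
      have "(1 - t) *\<^sub>R x + t *\<^sub>R a0 \<in> \<A>"
        unfolding chamber_mem
      proof (intro ballI)
        fix H assume H: "H \<in> \<H>"
        have "0 <= (1 - t) * sg H x" using x t H by simp
        moreover have "0 < t * sg H a0" using t(1) sg_a0[OF H] by simp
        ultimately show "0 < sg H ((1 - t) *\<^sub>R x + t *\<^sub>R a0)" unfolding sg_affine by linarith
      qed
      moreover have "dist ((1 - t) *\<^sub>R x + t *\<^sub>R a0) x = t * norm (a0 - x)"
        using t by (simp add: dist_norm algebra_simps flip: scaleR_diff_right)
      ultimately show ?thesis using d by metis
    qed
    then show "x \<in> closure \<A>" by (simp add: closure_approachable)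
  qed
qed

lemma closure_chamber_diff: "closure \<A> - \<A> \<subseteq> \<Union>\<H>"
proof
  fix x assume "x \<in> closure \<A> - \<A>"
  then obtain H where H: "H \<in> \<H>" "sg H x >= 0" "\<not> sg H x > 0"
    unfolding closure_chamber Diff_iff chamber_mem mem_Collect_eq by blast
  then have "x \<in> H" using nc(2)[OF H(1), of x] by simp
  then show "x \<in> \<Union>\<H>" using H(1) by blast
qed

lemma convex_closure_chamber: "convex (closure \<A>)"
proof -
  have "closure \<A> = (\<Inter>H\<in>\<H>. {x. nv H \<bullet> x >= snd (nc H)})" by (auto simp: sg_def closure_chamber)
  moreover have "convex (\<Inter>H\<in>\<H>. {x. nv H \<bullet> x >= snd (nc H)})"
    by (intro convex_INT convex_halfspace_ge)
  ultimately show ?thesis by simp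
qed

end

context arrangement
begin

section \<open>Faces of the chamber\<close>

text \<open>The relatively open face of the closed chamber in a flat, given by strict inequalities
  so that convexity and openness in \<open>L\<close> are visible. \<open>flat_interior_cell\<close>
  identifies it with the face of the theorem.\<close>

definition cell :: "'a set \<Rightarrow> 'a set" where
  "cell L = {x \<in> L. \<forall>H\<in>\<H>. L \<subseteq> H \<or> sg H x > 0}"

lemma flat_affine:
  assumes "flat \<H> L"
  shows "affine L"
proof -
  obtain \<S> where "\<S> \<subseteq> \<H>" "L = \<Inter>\<S>" using assms unfolding flat_def by metis
  then show ?thesis using H_affine by (simp add: affine_Inter subset_eq)
qed

lemma flat_UNIV: "flat \<H> UNIV"
  unfolding flat_def by (intro conjI exI[of _ "{}"]) simp_all

lemma flat_H: "H \<in> \<H> ==> flat \<H> H"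
proof -
  assume H: "H \<in> \<H>"
  have "snd (nc H) *\<^sub>R nv H \<in> H" using nn[OF H] nc(2)[OF H] by (simp add: sg_def)
  then have "H ~= {}" by blast
  then show ?thesis unfolding flat_def using H by (intro conjI exI[of _ "{H}"]) simp_all
qed

lemma flat_Int_H:
  assumes "flat \<H> L" "H \<in> \<H>" "L \<inter> H ~= {}"
  shows "flat \<H> (L \<inter> H)"
proof -
  obtain \<S> where S: "\<S> \<subseteq> \<H>" "L = \<Inter>\<S>" using assms(1) unfolding flat_def by metis
  show ?thesis unfolding flat_def
    by (intro conjI exI[of _ "insert H \<S>"]) (use S assms(2,3) in \<open>auto simp: Int_commute\<close>)
qed

lemma flat_mem:
  assumes "flat \<H> L" "x \<notin> L"
  obtains H where "H \<in> \<H>" "L \<subseteq> H" "x \<notin> H"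
proof -
  obtain \<S> where S: "\<S> \<subseteq> \<H>" "L = \<Inter>\<S>" using assms(1) unfolding flat_def by metis
  then obtain H where "H \<in> \<S>" "x \<notin> H" using assms(2) by blast
  then show ?thesis using S by (intro that[of H]) auto
qed

lemma cell_subset: "cell L \<subseteq> L"
  by (auto simp: cell_def)

lemma cell_sg: "x \<in> cell L ==> H \<in> \<H> ==> \<not> L \<subseteq> H ==> sg H x > 0"
  by (auto simp: cell_def)

lemma cell_closure: "x \<in> cell L ==> x \<in> closure \<A>"
proof -
  assume x: "x \<in> cell L"
  have "sg H x >= 0" if H: "H \<in> \<H>" for H
  proof (cases "L \<subseteq> H")
    case True
    then have "x \<in> H" using x cell_subset by blast
    then show ?thesis using nc(2)[OF H, of x] by simp
  next
    case False
    then show ?thesis using cell_sg[OF x H] by simp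
  qed
  then show ?thesis by (simp add: closure_chamber)
qed

lemma cell_UNIV: "cell UNIV = \<A>"
proof -
  have "\<not> UNIV \<subseteq> H" if H: "H \<in> \<H>" for H using sg_a0[OF H] nc(2)[OF H, of a0] by auto
  then show ?thesis by (auto simp: cell_def chamber_mem)
qed

lemma convex_cell:
  assumes "flat \<H> L"
  shows "convex (cell L)"
proof -
  have "cell L = L \<inter> (\<Inter>H\<in>{H \<in> \<H>. \<not> L \<subseteq> H}. {x. nv H \<bullet> x > snd (nc H)})"
    by (auto simp: cell_def sg_def)
  moreover have "convex (L \<inter> (\<Inter>H\<in>{H \<in> \<H>. \<not> L \<subseteq> H}. {x. nv H \<bullet> x > snd (nc H)}))"
    by (intro convex_Int convex_INT convex_halfspace_gt affine_imp_convex flat_affine assms)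
  ultimately show ?thesis by simp
qed

lemma cell_ball:
  assumes p: "p \<in> cell L"
  obtains \<epsilon> where "\<epsilon> > 0" "ball p \<epsilon> \<inter> L \<subseteq> cell L"
proof -
  obtain \<epsilon> where e: "\<epsilon> > 0" "!!H. H \<in> \<H> ==> sg H p = 0 \<or> \<epsilon> <= \<bar>sg H p\<bar>" using sg_gap[of p] by blast
  have "ball p \<epsilon> \<inter> L \<subseteq> cell L"
  proof
    fix x assume x: "x \<in> ball p \<epsilon> \<inter> L"
    have "sg H x > 0" if H: "H \<in> \<H>" "\<not> L \<subseteq> H" for H
    proof -
      have "sg H p >= \<epsilon>" using cell_sg[OF p H] e(2)[OF H(1)] by simp
      moreover have "\<bar>sg H p - sg H x\<bar> < \<epsilon>" using sg_lipschitz[OF H(1), of p x] x by simp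
      ultimately show ?thesis by linarith
    qed
    then show "x \<in> cell L" using x by (auto simp: cell_def)
  qed
  then show ?thesis using that e(1) by blast
qed

text \<open>A nonempty face is open in \<open>L\<close>, so an affine subspace containing it
  contains \<open>L\<close>.\<close>

lemma cell_hull:
  assumes L: "flat \<H> L" and p: "p \<in> cell L" and M: "affine M" and sub: "cell L \<subseteq> M"
  shows "L \<subseteq> M"
proof -
  obtain \<epsilon> where e: "\<epsilon> > 0" "ball p \<epsilon> \<inter> L \<subseteq> cell L" using cell_ball[OF p] by blast
  show ?thesis
    by (rule convex_ball_subset_affine[OF affine_imp_convex[OF flat_affine[OF L]] M _ e(1)])
      (use p cell_subset e(2) sub in auto)
qed

lemma flat_interior_eq:
  assumes L: "flat \<H> L"
  shows "flat_interior \<H> L = {x \<in> L. \<forall>H\<in>\<H>. x \<in> H --> L \<subseteq> H}"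
proof
  show "flat_interior \<H> L \<subseteq> {x \<in> L. \<forall>H\<in>\<H>. x \<in> H --> L \<subseteq> H}"
  proof
    fix x assume x: "x \<in> flat_interior \<H> L"
    have "L \<subseteq> H" if H: "H \<in> \<H>" "x \<in> H" for H
    proof (rule ccontr)
      assume "\<not> L \<subseteq> H"
      moreover have "flat \<H> (L \<inter> H)" using x H by (intro flat_Int_H[OF L]) (auto simp: flat_interior_def)
      ultimately show False using x H by (auto simp: flat_interior_def)
    qed
    then show "x \<in> {x \<in> L. \<forall>H\<in>\<H>. x \<in> H --> L \<subseteq> H}" using x by (auto simp: flat_interior_def)
  qed
  show "{x \<in> L. \<forall>H\<in>\<H>. x \<in> H --> L \<subseteq> H} \<subseteq> flat_interior \<H> L"
  proof
    fix x assume x: "x \<in> {x \<in> L. \<forall>H\<in>\<H>. x \<in> H --> L \<subseteq> H}"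
    have "x \<notin> M" if M: "flat \<H> M" "M \<subset> L" for M
    proof
      assume "x \<in> M"
      obtain y where "y \<in> L" "y \<notin> M" using M by blast
      then obtain H where "H \<in> \<H>" "M \<subseteq> H" "y \<notin> H" using flat_mem[OF M(1)] by metis
      then show False using x \<open>x \<in> M\<close> \<open>y \<in> L\<close> by blast
    qed
    then show "x \<in> flat_interior \<H> L" using x by (auto simp: flat_interior_def)
  qed
qed

lemma flat_interior_cell:
  assumes "flat \<H> L"
  shows "flat_interior \<H> L \<inter> closure \<A> = cell L"
proof
  show "flat_interior \<H> L \<inter> closure \<A> \<subseteq> cell L"
  proof
    fix x assume x: "x \<in> flat_interior \<H> L \<inter> closure \<A>"
    have "sg H x > 0" if H: "H \<in> \<H>" "\<not> L \<subseteq> H" for H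
    proof -
      have "x \<notin> H" using x H unfolding flat_interior_eq[OF assms] by blast
      moreover have "sg H x >= 0" using x H by (simp add: closure_chamber)
      ultimately show ?thesis using nc(2)[OF H(1), of x] by simp
    qed
    then show "x \<in> cell L" using x by (auto simp: cell_def flat_interior_eq[OF assms])
  qed
  show "cell L \<subseteq> flat_interior \<H> L \<inter> closure \<A>"
  proof
    fix x assume x: "x \<in> cell L"
    have "L \<subseteq> H" if H: "H \<in> \<H>" "x \<in> H" for H
      using cell_sg[OF x H(1)] nc(2)[OF H(1), of x] H(2) by fastforce
    then show "x \<in> flat_interior \<H> L \<inter> closure \<A>"
      using x cell_closure[OF x] cell_subset by (auto simp: flat_interior_eq[OF assms])
  qed
qed

text \<open>If the face were empty, the convex set \<open>L \<inter> closure \<A>\<close> would be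
  covered by the hyperplanes not containing \<open>L\<close>, hence lie in one of them, and could
  not span \<open>L\<close>.\<close>

lemma lies_over_cell:
  assumes L: "flat \<H> L"
  shows "lies_over \<A> L \<longleftrightarrow> cell L ~= {}"
proof
  assume lo: "lies_over \<A> L"
  show "cell L ~= {}"
  proof
    assume empty: "cell L = {}"
    let ?C = "L \<inter> closure \<A>"
    have ne: "?C ~= {}"
    proof
      assume "?C = {}"
      then have "L = {}" using lo by (simp add: lies_over_def)
      then show False using L by (simp add: flat_def)
    qed
    have "?C \<subseteq> (\<Union>H\<in>{H \<in> \<H>. \<not> L \<subseteq> H}. H)"
    proof
      fix x assume x: "x \<in> ?C"
      then have "x \<notin> cell L" using empty by simp
      then obtain H where H: "H \<in> \<H>" "\<not> L \<subseteq> H" "\<not> sg H x > 0" using x by (auto simp: cell_def)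
      moreover have "sg H x >= 0" using x H(1) by (simp add: closure_chamber)
      ultimately have "x \<in> H" using nc(2)[OF H(1), of x] by simp
      then show "x \<in> (\<Union>H\<in>{H \<in> \<H>. \<not> L \<subseteq> H}. H)" using H by blast
    qed
    moreover have "countable {H \<in> \<H>. \<not> L \<subseteq> H}" by (rule countable_subset[OF _ countable_H]) auto
    moreover have "convex ?C"
      by (intro convex_Int affine_imp_convex flat_affine L convex_closure_chamber)
    ultimately obtain H where H: "H \<in> \<H>" "\<not> L \<subseteq> H" "?C \<subseteq> H"
      using convex_covered_by_affine[of ?C "{H \<in> \<H>. \<not> L \<subseteq> H}" "%H. H"] ne H_affine by blast
    have "L \<subseteq> H" using lo hull_minimal[OF H(3), of affine] H_affine[OF H(1)] by (simp add: lies_over_def)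
    then show False using H(2) by simp
  qed
next
  assume "cell L ~= {}"
  then obtain p where p: "p \<in> cell L" by blast
  have "cell L \<subseteq> affine hull (L \<inter> closure \<A>)"
    using cell_subset cell_closure hull_subset[of "L \<inter> closure \<A>" affine] by blast
  then have "L \<subseteq> affine hull (L \<inter> closure \<A>)" by (rule cell_hull[OF L p affine_affine_hull])
  moreover have "affine hull (L \<inter> closure \<A>) \<subseteq> L" by (rule hull_minimal) (auto simp: flat_affine[OF L])
  ultimately show "lies_over \<A> L" by (simp add: lies_over_def)
qed

text \<open>A segment from a generic point of the face of \<open>L\<close> to a point of \<open>L\<close> outside the chamber
  leaves the chamber through the relative interior of a facet of that face.\<close>

lemma exit_facet:
  assumes L: "flat \<H> L" and p: "p \<in> cell L" and y: "y \<in> L" "y \<notin> closure \<A>"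
  obtains H where "H \<in> \<H>" "\<not> L \<subseteq> H" "sg H y < 0" "cell (L \<inter> H) ~= {}"
proof -
  \<comment> \<open>Hyperplanes strictly separating \<open>p\<close> from \<open>y\<close>; each
    meets the segment between them, so there are finitely many.\<close>
  define N where "N = {H \<in> \<H>. sg H y < 0}"
  have N: "H \<in> \<H>" "sg H y < 0" "\<not> L \<subseteq> H" if "H \<in> N" for H
    using that y(1) nc(2)[of H y] by (auto simp: N_def)
  have "finite N"
  proof (rule finite_subset[OF _ finite_H_meeting[OF compact_segment[of p y]]])
    show "N \<subseteq> {H \<in> \<H>. H \<inter> closed_segment p y ~= {}}"
    proof
      fix H assume H: "H \<in> N"
      have "nv H \<bullet> y <= snd (nc H)" "snd (nc H) <= nv H \<bullet> p"
        using N[OF H] cell_sg[OF p N(1,3)[OF H]] by (simp_all add: sg_def)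
      then obtain z where "z \<in> closed_segment p y" "nv H \<bullet> z = snd (nc H)"
        using connected_ivt_hyperplane[of "closed_segment p y" y p] by auto
      then show "H \<in> {H \<in> \<H>. H \<inter> closed_segment p y ~= {}}"
        using N(1)[OF H] nc(2)[of H z] by (auto simp: sg_def)
    qed
  qed
  have "N ~= {}" using y(2) by (force simp: N_def closure_chamber)
  \<comment> \<open>The affine locus of starting points from which the segment to \<open>y\<close>
    crosses \<open>H\<close> and \<open>H'\<close> at the same parameter.\<close>
  define M where "M = (%(H, H'). {x. sg H x * sg H' y = sg H' x * sg H y})"
  define B where "B = {(H, H'). H \<in> N \<and> H' \<in> N \<and> L \<inter> H ~= L \<inter> H'}"
  have M_affine: "affine (M HH)" for HH
  proof -
    obtain H H' where HH: "HH = (H, H')" by fastforce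
    have "M HH = {x. (sg H' y *\<^sub>R nv H - sg H y *\<^sub>R nv H') \<bullet> x = snd (nc H) * sg H' y - snd (nc H') * sg H y}"
      by (auto simp: HH M_def sg_def[of _ "_::'a"] inner_diff_left algebra_simps)
    then show ?thesis by (simp add: affine_hyperplane)
  qed
  \<comment> \<open>A starting point off these loci exists: a locus containing the face would
    contain \<open>L\<close>, and then \<open>H\<close> and \<open>H'\<close> would have the same
    trace on \<open>L\<close>.\<close>
  have "\<not> cell L \<subseteq> (\<Union>HH\<in>B. M HH)"
  proof
    assume "cell L \<subseteq> (\<Union>HH\<in>B. M HH)"
    moreover have "countable B"
      by (rule countable_subset[of _ "N \<times> N"]) (auto simp: B_def \<open>finite N\<close> intro: countable_finite)
    ultimately have "\<exists>HH\<in>B. cell L \<subseteq> M HH"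
      by (intro convex_covered_by_affine convex_cell L M_affine) (use p in auto)
    then obtain HH where HH: "HH \<in> B" "cell L \<subseteq> M HH" by (metis (no_types))
    obtain H H' where H: "HH = (H, H')" "H \<in> N" "H' \<in> N" "L \<inter> H ~= L \<inter> H'" using HH(1) by (auto simp: B_def)
    have LM: "L \<subseteq> M HH" by (rule cell_hull[OF L p M_affine HH(2)])
    have "x \<in> H \<longleftrightarrow> x \<in> H'" if "x \<in> L" for x
    proof -
      have "sg H x * sg H' y = sg H' x * sg H y" using LM that H(1) by (auto simp: M_def)
      then show ?thesis using N(1,2)[OF H(2)] N(1,2)[OF H(3)] nc(2)[of H x] nc(2)[of H' x] by auto
    qed
    then show False using H(4) by blast
  qed
  then obtain b where b: "b \<in> cell L" "!!HH. HH \<in> B ==> b \<notin> M HH" by blast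
  have bN: "sg H b > 0" if "H \<in> N" for H by (rule cell_sg[OF b(1) N(1,3)[OF that]])
  \<comment> \<open>Parameter at which the segment from \<open>b\<close> to \<open>y\<close> crosses
    \<open>H\<close>; the smallest one gives the exit point \<open>e\<close>.\<close>
  define \<tau> where "\<tau> H = sg H b / (sg H b - sg H y)" for H
  have \<tau>: "0 < \<tau> H" "\<tau> H < 1" if "H \<in> N" for H
    using bN[OF that] N(2)[OF that] by (simp_all add: \<tau>_def)
  obtain H where H: "H \<in> N" "!!H'. H' \<in> N ==> \<tau> H <= \<tau> H'"
    using ex_min_if_finite[of "\<tau> ` N"] \<open>finite N\<close> \<open>N ~= {}\<close> by (metis (no_types, lifting) finite_imageI image_is_empty imageE imageI not_le)
  define t where "t = \<tau> H"
  define e where "e = (1 - t) *\<^sub>R b + t *\<^sub>R y"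
  have t: "0 < t" "t < 1" using \<tau>[OF H(1)] by (simp_all add: t_def)
  have sge: "sg H' e = (1 - t) * sg H' b + t * sg H' y" for H' by (simp add: e_def sg_affine)
  have "sg H e = 0"
  proof -
    have "sg H e = sg H b - \<tau> H * (sg H b - sg H y)" unfolding sge t_def by (simp add: algebra_simps)
    then show ?thesis using bN[OF H(1)] N(2)[OF H(1)] by (simp add: \<tau>_def)
  qed
  then have eH: "e \<in> H" using nc(2)[OF N(1)[OF H(1)]] by simp
  have eL: "e \<in> L"
    unfolding e_def using flat_affine[OF L] b(1) cell_subset y(1) unfolding affine_def by (metis subsetD diff_add_cancel)
  have "sg H' e > 0" if H': "H' \<in> \<H>" "\<not> L \<inter> H \<subseteq> H'" for H'
  proof -
    have nL: "\<not> L \<subseteq> H'" using H'(2) by blast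
    have sb: "sg H' b > 0" by (rule cell_sg[OF b(1) H'(1) nL])
    show ?thesis
    proof (cases "H' \<in> N")
      case False
      then have "sg H' y >= 0" using H'(1) by (simp add: N_def)
      then show ?thesis unfolding sge using t sb by (intro add_pos_nonneg mult_pos_pos mult_nonneg_nonneg) auto
    next
      case True
      have "\<tau> H ~= \<tau> H'"
      proof
        assume eq: "\<tau> H = \<tau> H'"
        have "sg H b * (sg H' b - sg H' y) = sg H' b * (sg H b - sg H y)"
          using eq bN[OF H(1)] N(2)[OF H(1)] sb N(2)[OF True] unfolding \<tau>_def by (simp add: frac_eq_eq)
        then have "b \<in> M (H, H')" by (simp add: M_def algebra_simps)
        moreover have "(H, H') \<in> B" using H(1) True H'(2) by (auto simp: B_def)
        ultimately show False using b(2) by blast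
      qed
      then have "t < \<tau> H'" using H(2)[OF True] by (simp add: t_def)
      then have "t * (sg H' b - sg H' y) < sg H' b"
        using sb N(2)[OF True] by (simp add: \<tau>_def pos_less_divide_eq)
      then show ?thesis unfolding sge by (simp add: algebra_simps)
    qed
  qed
  then have "e \<in> cell (L \<inter> H)" using eL eH by (auto simp: cell_def)
  then show ?thesis using that[of H] N[OF H(1)] by blast
qed

text \<open>Take an image of \<open>y\<close> nearest to \<open>p\<close>. If it lay outside the
  closed chamber, a segment from the face would leave through a facet, and the map attached to that
  facet would bring it nearer. The family \<open>N\<close> is kept general to serve both words in
  walls and the stabiliser of a flat.\<close>

lemma fold_into_chamber:
  assumes L: "flat \<H> L" and p: "p \<in> cell L"
    and N: "(%x. x) \<in> N" "!!n x. n \<in> N ==> x \<in> L ==> n x \<in> L"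
    and fin: "!!y. finite {n \<in> N. dist (n y) p <= dist y p}"
    and refl: "!!H. H \<in> \<H> ==> \<not> L \<subseteq> H ==> cell (L \<inter> H) ~= {} ==>
      \<exists>\<gamma>. (\<forall>n\<in>N. (%x. \<gamma> (n x)) \<in> N) \<and> (\<forall>x\<in>L. sg H x < 0 --> dist (\<gamma> x) p < dist x p)"
    and y: "y \<in> L"
  shows "\<exists>n\<in>N. n y \<in> closure \<A>"
proof -
  let ?F = "{n \<in> N. dist (n y) p <= dist y p}"
  have "(%x. x) \<in> ?F" using N(1) by simp
  then have "?F ~= {}" by (metis empty_iff)
  then obtain n where "is_arg_min (%n. dist (n y) p) (%n. n \<in> ?F) n"
    using ex_is_arg_min_if_finite[OF fin[of y], of "%n. dist (n y) p"] by auto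
  then have am: "n \<in> ?F \<and> (\<forall>m. m \<in> ?F --> dist (n y) p <= dist (m y) p)"
    unfolding is_arg_min_linorder .
  have n: "n \<in> ?F" using am by (rule conjunct1)
  have min: "dist (n y) p <= dist (m y) p" if "m \<in> ?F" for m by (rule am[THEN conjunct2, THEN spec, THEN mp, OF that])
  have "n y \<in> closure \<A>"
  proof (rule ccontr)
    assume "n y \<notin> closure \<A>"
    moreover have nL: "n y \<in> L" using N(2) n y by simp
    ultimately obtain H where H: "H \<in> \<H>" "\<not> L \<subseteq> H" "sg H (n y) < 0" "cell (L \<inter> H) ~= {}"
      using exit_facet[OF L p] by metis
    obtain \<gamma> where g: "\<forall>n\<in>N. (%x. \<gamma> (n x)) \<in> N" "\<forall>x\<in>L. sg H x < 0 --> dist (\<gamma> x) p < dist x p"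
      using refl[OF H(1,2,4)] by blast
    have "dist (\<gamma> (n y)) p < dist (n y) p" using g(2) nL H(3) by blast
    moreover have "(%x. \<gamma> (n x)) \<in> ?F" using calculation g(1) n by auto
    ultimately show False using min by fastforce
  qed
  then show ?thesis using n by blast
qed

section \<open>The chamber as a fundamental domain\<close>

lemma isom_image_H:
  assumes g: "isom g" and H: "H \<in> \<H>"
  shows "g ` H = {y. lin g (nv H) \<bullet> y = snd (nc H) + lin g (nv H) \<bullet> g 0}"
proof -
  have e: "lin g (nv H) \<bullet> g x = nv H \<bullet> x + lin g (nv H) \<bullet> g 0" for x
    using isom_lin(4)[OF g, of 0 x] isom_lin(2)[OF g, of "nv H" x] by (simp add: inner_add_right)
  show ?thesis
  proof
    show "g ` H \<subseteq> {y. lin g (nv H) \<bullet> y = snd (nc H) + lin g (nv H) \<bullet> g 0}"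
    proof
      fix y assume "y \<in> g ` H"
      then obtain x where x: "x \<in> H" "y = g x" by blast
      have "lin g (nv H) \<bullet> y = snd (nc H) + lin g (nv H) \<bullet> g 0"
        unfolding x(2) e[of x] using x(1) H_mem[OF H, of x] by simp
      then show "y \<in> {y. lin g (nv H) \<bullet> y = snd (nc H) + lin g (nv H) \<bullet> g 0}" by simp
    qed
    show "{y. lin g (nv H) \<bullet> y = snd (nc H) + lin g (nv H) \<bullet> g 0} \<subseteq> g ` H"
    proof
      fix y assume y: "y \<in> {y. lin g (nv H) \<bullet> y = snd (nc H) + lin g (nv H) \<bullet> g 0}"
      obtain x where x: "y = g x" using isom_bij[OF g] by (metis bij_pointE)
      have "nv H \<bullet> x = snd (nc H)" using y e[of x] unfolding x mem_Collect_eq by linarith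
      then have "x \<in> H" using H_mem[OF H, of x] by simp
      then show "y \<in> g ` H" unfolding x by (rule imageI)
    qed
  qed
qed

lemma isom_normal:
  assumes g: "isom g" and H: "H \<in> \<H>" "g ` H \<in> \<H>"
  shows "(nv (g ` H) = lin g (nv H) \<and> (\<forall>x. sg (g ` H) (g x) = sg H x)) \<or>
    (nv (g ` H) = - lin g (nv H) \<and> (\<forall>x. sg (g ` H) (g x) = - sg H x))"
proof -
  have "{y. lin g (nv H) \<bullet> y = snd (nc H) + lin g (nv H) \<bullet> g 0} \<subseteq> {x. nv (g ` H) \<bullet> x = snd (nc (g ` H))}"
    unfolding isom_image_H[OF g H(1), symmetric] using H_mem[OF H(2)] by blast
  moreover have "norm (lin g (nv H)) = 1" "norm (nv (g ` H)) = 1" using nc(1) H isom_lin(3)[OF g] by simp_all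
  ultimately have D: "(nv (g ` H) = lin g (nv H) \<and> snd (nc (g ` H)) = snd (nc H) + lin g (nv H) \<bullet> g 0) \<or>
    (nv (g ` H) = - lin g (nv H) \<and> snd (nc (g ` H)) = - (snd (nc H) + lin g (nv H) \<bullet> g 0))"
    by (rule hyperplane_subset_normal)
  have e: "lin g (nv H) \<bullet> g x = nv H \<bullet> x + lin g (nv H) \<bullet> g 0" for x
    using isom_lin(4)[OF g, of 0 x] isom_lin(2)[OF g, of "nv H" x] by (simp add: inner_add_right)
  show ?thesis using D
  proof
    assume a: "nv (g ` H) = lin g (nv H) \<and> snd (nc (g ` H)) = snd (nc H) + lin g (nv H) \<bullet> g 0"
    then have "sg (g ` H) (g x) = sg H x" for x using e[of x] unfolding sg_def by simp
    then show ?thesis using a by blast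
  next
    assume a: "nv (g ` H) = - lin g (nv H) \<and> snd (nc (g ` H)) = - (snd (nc H) + lin g (nv H) \<bullet> g 0)"
    have "nv (g ` H) \<bullet> g x = - (lin g (nv H) \<bullet> g x)" for x using a by simp
    then have "sg (g ` H) (g x) = - sg H x" for x using e[of x] a unfolding sg_def by smt
    then show ?thesis using a by blast
  qed
qed

lemma refl_conj:
  assumes g: "isom g" and H: "H \<in> \<H>" "g ` H \<in> \<H>"
  shows "orth_reflection (g ` H) (g x) = g (orth_reflection H x)"
proof -
  have "g (orth_reflection H x) = g x + lin g (- (2 * sg H x) *\<^sub>R nv H)"
    using isom_lin(4)[OF g, of x "- (2 * sg H x) *\<^sub>R nv H"] by (simp add: refl[OF H(1)])
  also have "\<dots> = g x - (2 * sg H x) *\<^sub>R lin g (nv H)"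
    using linear_scale[OF isom_lin(1)[OF g]] linear_neg[OF isom_lin(1)[OF g]] by simp
  finally show ?thesis using isom_normal[OF g H] by (auto simp: refl[OF H(2)])
qed

lemma H_subset_eq: "H \<in> \<H> ==> H' \<in> \<H> ==> H \<subseteq> H' ==> H = H'"
proof -
  assume H: "H \<in> \<H>" "H' \<in> \<H>" "H \<subseteq> H'"
  have "{x. nv H \<bullet> x = snd (nc H)} \<subseteq> {x. nv H' \<bullet> x = snd (nc H')}"
    using H(3) unfolding H_eq[OF H(1), symmetric] H_eq[OF H(2), symmetric] .
  then have "(nv H' = nv H \<and> snd (nc H') = snd (nc H)) \<or> (nv H' = - nv H \<and> snd (nc H') = - snd (nc H))"
    by (rule hyperplane_subset_normal) (use nc(1) H in auto)
  then have "x \<in> H \<longleftrightarrow> x \<in> H'" for x using nc(2)[OF H(1), of x] nc(2)[OF H(2), of x] by (auto simp: sg_def)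
  then show "H = H'" by blast
qed

definition walls :: "'a set set" where
  "walls = {H \<in> \<H>. cell H ~= {}}"

lemma walls_H: "H \<in> walls ==> H \<in> \<H>"
  by (simp add: walls_def)

lemma wall_words: "Hs \<in> lists walls ==> Hs \<in> lists \<H>"
  using walls_H by (auto simp: lists_eq_set)

lemma finite_W_dist: "finite {w \<in> W. dist (w y) p <= r}"
proof (rule finite_subset[OF _ W_proper[of "cball p (max r (dist y p))"]])
  show "{w \<in> W. dist (w y) p <= r} \<subseteq> {w \<in> W. \<exists>x\<in>cball p (max r (dist y p)). w x \<in> cball p (max r (dist y p))}"
    by (auto simp: dist_commute intro!: bexI[of _ y])
qed simp

text \<open>The case of the whole space in \<open>fold_into_chamber\<close>, with the reflections in
  walls as the maps attached to the facets.\<close>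

lemma wall_fold:
  obtains Hs where "Hs \<in> lists walls" "wd Hs y \<in> closure \<A>"
proof -
  have "\<exists>n\<in>wd ` lists walls. n y \<in> closure \<A>"
  proof (rule fold_into_chamber[OF flat_UNIV])
    show "a0 \<in> cell UNIV" using a0_mem by (simp add: cell_UNIV)
    show "(%x. x) \<in> wd ` lists walls" by (rule image_eqI[of _ _ "[]"]) (simp_all add: fun_eq_iff)
    show "finite {n \<in> wd ` lists walls. dist (n y) a0 <= dist y a0}" for y
      by (rule finite_subset[OF _ finite_W_dist[of y a0 "dist y a0"]]) (use wall_words W_words in blast)
    fix H assume H: "H \<in> \<H>" "cell (UNIV \<inter> H) ~= {}"
    then have w: "H \<in> walls" by (simp add: walls_def)
    show "\<exists>\<gamma>. (\<forall>n\<in>wd ` lists walls. (%x. \<gamma> (n x)) \<in> wd ` lists walls) \<and>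
        (\<forall>x\<in>UNIV. sg H x < 0 --> dist (\<gamma> x) a0 < dist x a0)"
    proof (intro exI[of _ "orth_reflection H"] conjI ballI impI)
      fix n assume "n \<in> wd ` lists walls"
      then obtain Hs where Hs: "Hs \<in> lists walls" "n = wd Hs" by blast
      then show "(%x. orth_reflection H (n x)) \<in> wd ` lists walls"
        using w by (intro image_eqI[of _ _ "H # Hs"]) (simp_all add: fun_eq_iff)
    next
      fix x assume "sg H x < 0"
      then have "4 * sg H x * sg H a0 < 0" using sg_a0[OF H(1)] by (simp add: mult_neg_pos)
      then have "(dist (orth_reflection H x) a0)^2 < (dist x a0)^2"
        using refl_dist_sq[OF H(1), of x a0] by linarith
      then show "dist (orth_reflection H x) a0 < dist x a0" by (rule power_less_imp_less_base) simp
    qed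
  qed simp_all
  then show ?thesis using that by blast
qed

text \<open>Crossing a wall changes the side of that wall only. A point \<open>e\<close> of its
  facet is fixed by the reflection and strictly positive for \<open>H'\<close>, which decides the
  sign relating \<open>H'\<close> to its reflected hyperplane.\<close>

lemma wall_adjacent:
  assumes H: "H \<in> walls" and H': "H' \<in> \<H>" "H' ~= H"
  shows "sg H' (orth_reflection H a0) > 0"
proof -
  have HH: "H \<in> \<H>" by (rule walls_H[OF H])
  obtain e where e: "e \<in> cell H" using H by (auto simp: walls_def)
  have eH: "e \<in> H" using e cell_subset by blast
  have e': "sg H' e > 0" using cell_sg[OF e H'(1)] H_subset_eq[OF HH H'(1)] H'(2) by blast
  let ?s = "orth_reflection H" and ?H = "orth_reflection H ` H'"
  have im: "?H \<in> \<H>" by (rule W_image[OF W_refl[OF HH] H'(1)])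
  have im2: "?s ` ?H = H'" using refl_refl[OF HH] by (simp add: image_image)
  have n: "(\<forall>x. sg H' (?s x) = sg ?H x) \<or> (\<forall>x. sg H' (?s x) = - sg ?H x)"
    using isom_normal[OF isom_refl[OF HH] im] H'(1) unfolding im2 by blast
  have "?s e = e" using refl_fixed[OF HH] eH by blast
  moreover have "sg ?H e >= 0" using cell_closure[OF e] im by (simp add: closure_chamber)
  ultimately have "sg H' (?s e) ~= - sg ?H e" using e' by simp
  then have "\<forall>x. sg H' (?s x) = sg ?H x" using n by blast
  then show ?thesis using sg_a0[OF im] by simp
qed

lemma H_W_vanish: "w \<in> W ==> H \<in> \<H> ==> (\<forall>x. sg H (w x) = sg (inv_into UNIV w ` H) x) \<or> (\<forall>x. sg H (w x) = - sg (inv_into UNIV w ` H) x)"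
  and H_W_mem: "w \<in> W ==> H \<in> \<H> ==> inv_into UNIV w ` H \<in> \<H>"
proof -
  assume w: "w \<in> W" and H: "H \<in> \<H>"
  let ?H = "inv_into UNIV w ` H"
  show im: "?H \<in> \<H>" by (rule W_image[OF W_inv[OF w] H])
  have "w ` ?H = H" using isom_inv_apply(2)[OF W_isom[OF w]] by (simp add: image_image)
  then show "(\<forall>x. sg H (w x) = sg ?H x) \<or> (\<forall>x. sg H (w x) = - sg ?H x)"
    using isom_normal[OF W_isom[OF w] im] H by auto
qed

text \<open>The standard exchange argument: a word that does not move the chamber across its first wall
  can be shortened.\<close>

lemma fundamental_domain_words:
  assumes "Hs \<in> lists walls" "x \<in> closure \<A>" "wd Hs x \<in> closure \<A>"
  shows "wd Hs x = x \<and> (\<exists>Ks\<in>lists {H \<in> \<H>. x \<in> H}. \<forall>y. wd Ks y = wd Hs y)"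
  using assms
proof (induction "length Hs" arbitrary: Hs rule: less_induct)
  case less
  show ?case
  proof (cases Hs)
    case Nil
    then show ?thesis by (auto intro!: bexI[of _ "[]"])
  next
    case (Cons H1 Hs')
    have H1: "H1 \<in> walls" "H1 \<in> \<H>" and Hs': "Hs' \<in> lists walls" using less.prems(1) Cons walls_H by auto
    have wW: "wd Hs \<in> W" using wall_words[OF less.prems(1)] W_words by blast
    show ?thesis
    proof (cases "sg H1 (wd Hs a0) < 0")
      case True
      have im: "inv_into UNIV (wd Hs) ` H1 \<in> \<H>" by (rule H_W_mem[OF wW H1(2)])
      have "\<forall>y. sg H1 (wd Hs y) = - sg (inv_into UNIV (wd Hs) ` H1) y"
        using H_W_vanish[OF wW H1(2)] True sg_a0[OF im] by (metis not_less_iff_gr_or_eq)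
      moreover have "sg (inv_into UNIV (wd Hs) ` H1) x >= 0" using less.prems(2) im by (simp add: closure_chamber)
      moreover have "sg H1 (wd Hs x) >= 0" using less.prems(3) H1 by (simp add: closure_chamber)
      ultimately have "sg H1 (wd Hs x) = 0" by fastforce
      then have "wd Hs x \<in> H1" using nc(2)[OF H1(2)] by simp
      then have "orth_reflection H1 (wd Hs x) = wd Hs x" using refl_fixed[OF H1(2)] by blast
      then have e: "wd Hs' x = wd Hs x" using Cons refl_refl[OF H1(2)] by simp
      then have "wd Hs' x \<in> closure \<A>" using less.prems(3) by simp
      then have IH: "wd Hs' x = x" "\<exists>Ks\<in>lists {H \<in> \<H>. x \<in> H}. \<forall>y. wd Ks y = wd Hs' y"
        using less.hyps[of Hs'] Cons Hs' less.prems(2) by auto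
      have "x \<in> H1" using IH(1) e \<open>wd Hs x \<in> H1\<close> by simp
      moreover obtain Ks where "Ks \<in> lists {H \<in> \<H>. x \<in> H}" "\<forall>y. wd Ks y = wd Hs' y" using IH(2) by blast
      ultimately have "H1 # Ks \<in> lists {H \<in> \<H>. x \<in> H}" "\<forall>y. wd (H1 # Ks) y = wd Hs y"
        using H1(2) Cons by simp_all
      then show ?thesis using IH(1) e by metis
    next
      case False
      \<comment> \<open>\<open>P j\<close> says that the chamber reached after \<open>j\<close>
        letters lies beyond \<open>H1\<close>. It holds for one letter and fails for the whole word,
        so the letter at some position \<open>j >= 1\<close> crosses back.\<close>
      define P where "P j \<longleftrightarrow> sg H1 (wd (take j Hs) a0) < 0" for j
      have "sg H1 (orth_reflection H1 a0) < 0"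
        using sg_a0[OF H1(2)] nn[OF H1(2)] by (simp add: refl[OF H1(2)] sg_def inner_diff_right)
      then have P1: "P 1" using Cons by (simp add: P_def)
      have nP: "\<not> P (length Hs)" using False by (simp add: P_def)
      define m where "m = (LEAST m. 1 <= m \<and> \<not> P m)"
      have "1 <= length Hs \<and> \<not> P (length Hs)" using nP Cons by simp
      then have m: "1 <= m \<and> \<not> P m" "m <= length Hs"
        unfolding m_def by (rule LeastI, rule Least_le)
      define j where "j = m - 1"
      have "m ~= 1" using m(1) P1 by auto
      then have j: "1 <= j" "m = Suc j" "j < length Hs" using m by (auto simp: j_def)
      have "j < m" using j(2) by simp
      then have "\<not> (1 <= j \<and> \<not> P j)" unfolding m_def by (rule not_less_Least)
      then have Pj: "P j" using j(1) by blast
      let ?v = "wd (take j Hs)" and ?H = "Hs ! j"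
      have tk: "take (Suc j) Hs = take j Hs @ [?H]" using j(3) by (rule take_Suc_conv_app_nth)
      have "?H \<in> set Hs" using j(3) by (rule nth_mem)
      then have Hw: "?H \<in> walls" using less.prems(1) by (metis in_listsD)
      then have Hw: "?H \<in> walls" "?H \<in> \<H>" using walls_H by blast+
      have tl: "take j Hs \<in> lists walls" using less.prems(1) by (auto simp: lists_eq_set dest: in_set_takeD)
      have vW: "?v \<in> W" using wall_words[OF tl] W_words by blast
      let ?K = "inv_into UNIV ?v ` H1"
      have K: "?K \<in> \<H>" by (rule H_W_mem[OF vW H1(2)])
      have sK: "\<forall>y. sg H1 (?v y) = - sg ?K y"
        using H_W_vanish[OF vW H1(2)] Pj sg_a0[OF K] unfolding P_def by (metis not_less_iff_gr_or_eq)
      have "\<not> sg H1 (?v (orth_reflection ?H a0)) < 0"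
        using m(1) unfolding P_def j(2) tk wd_append by simp
      then have "\<not> sg ?K (orth_reflection ?H a0) > 0" using sK by simp
      then have KH: "?K = ?H" using wall_adjacent[OF Hw(1) K] by blast
      have vH: "?v ` ?H = H1"
        unfolding KH[symmetric] using isom_inv_apply(2)[OF W_isom[OF vW]] by (simp add: image_image)
      have conj: "orth_reflection H1 (?v y) = ?v (orth_reflection ?H y)" for y
        using refl_conj[OF W_isom[OF vW] Hw(2), of y] vH H1(2) by simp
      \<comment> \<open>The prefix carries the hyperplane of the letter at position \<open>j\<close>
        to \<open>H1\<close>, so this letter and the first one cancel;
        \<open>take (j - 1) Hs'\<close> consists of the letters strictly between them.\<close>
      define Ks where "Ks = take (j - 1) Hs' @ drop (Suc j) Hs"
      have split: "Hs = take (Suc j) Hs @ drop (Suc j) Hs" by simp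
      have tj: "take j Hs = H1 # take (j - 1) Hs'" using j(1) Cons by (cases j) simp_all
      have w_eq: "wd Hs y = wd Ks y" for y
      proof -
        have "wd Hs y = ?v (orth_reflection ?H (wd (drop (Suc j) Hs) y))"
          by (subst split, subst tk) (simp add: wd_append)
        also have "\<dots> = orth_reflection H1 (?v (wd (drop (Suc j) Hs) y))" by (simp add: conj)
        also have "\<dots> = wd Ks y" unfolding tj Ks_def by (simp add: wd_append refl_refl[OF H1(2)])
        finally show ?thesis .
      qed
      have "length Ks < length Hs" using j Cons by (simp add: Ks_def)
      moreover have "Ks \<in> lists walls"
        using less.prems(1) Hs' by (auto simp: Ks_def lists_eq_set dest: in_set_takeD in_set_dropD)
      ultimately have "wd Ks x = x \<and> (\<exists>Js\<in>lists {H \<in> \<H>. x \<in> H}. \<forall>y. wd Js y = wd Ks y)"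
        using less.hyps[of Ks] less.prems(2,3) w_eq by simp
      then show ?thesis using w_eq by simp
    qed
  qed
qed

text \<open>Some point of \<open>H\<close> lies on no other hyperplane, by the covering lemma.
  Folded into the closed chamber, it lies in the open facet of the image of \<open>H\<close>, which
  is therefore a wall.\<close>

lemma H_conj_wall:
  assumes H: "H \<in> \<H>"
  obtains Hs where "Hs \<in> lists walls" "wd Hs ` H \<in> walls"
proof -
  have cvx: "convex H" "H ~= {}" using H_affine[OF H] flat_H[OF H] by (auto simp: affine_imp_convex flat_def)
  have "\<not> H \<subseteq> (\<Union>H'\<in>\<H> - {H}. H')"
  proof
    assume "H \<subseteq> (\<Union>H'\<in>\<H> - {H}. H')"
    then obtain H' where "H' \<in> \<H> - {H}" "H \<subseteq> H'"
      using convex_covered_by_affine[OF cvx, of "\<H> - {H}" "%H. H"] H_affine countable_H by auto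
    then show False using H_subset_eq[OF H] by blast
  qed
  then obtain h where h: "h \<in> H" "!!H'. H' \<in> \<H> ==> h \<in> H' ==> H' = H" by blast
  obtain Hs where Hs: "Hs \<in> lists walls" "wd Hs h \<in> closure \<A>" by (rule wall_fold)
  have wW: "wd Hs \<in> W" using wall_words[OF Hs(1)] W_words by blast
  have im: "wd Hs ` H \<in> \<H>" by (rule W_image[OF wW H])
  have "wd Hs h \<in> cell (wd Hs ` H)"
  proof -
    have "sg H' (wd Hs h) > 0" if H': "H' \<in> \<H>" "\<not> wd Hs ` H \<subseteq> H'" for H'
    proof -
      have "sg H' (wd Hs h) ~= 0"
      proof
        assume "sg H' (wd Hs h) = 0"
        then have "wd Hs h \<in> H'" using nc(2)[OF H'(1)] by simp
        then have "h \<in> inv_into UNIV (wd Hs) ` H'"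
          using isom_inv_apply(1)[OF W_isom[OF wW]] by (metis imageI)
        then have "inv_into UNIV (wd Hs) ` H' = H" using h(2) H_W_mem[OF wW H'(1)] by blast
        then have "wd Hs ` H = H'"
          using isom_inv_apply(2)[OF W_isom[OF wW]] by (metis (no_types, lifting) image_image image_ident image_cong)
        then show False using H'(2) by simp
      qed
      then show ?thesis using Hs(2) H'(1) by (simp add: closure_chamber order_less_le)
    qed
    then show ?thesis using h(1) by (auto simp: cell_def)
  qed
  then show ?thesis using that[OF Hs(1)] im by (auto simp: walls_def)
qed

text \<open>Each reflection is conjugate to a wall reflection by a word in walls.\<close>

lemma W_wall_words: "W = wd ` lists walls"
proof
  have ex: "\<exists>Ks\<in>lists walls. wd Ks = wd Hs" if "Hs \<in> lists \<H>" for Hs using that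
  proof (induction Hs)
    case Nil
    then show ?case by (intro bexI[of _ "[]"]) simp_all
  next
    case (Cons H Hs)
    then obtain Ks where Ks: "Ks \<in> lists walls" "wd Ks = wd Hs" by auto
    have H: "H \<in> \<H>" using Cons.hyps by simp
    obtain Js where Js: "Js \<in> lists walls" "wd Js ` H \<in> walls" by (rule H_conj_wall[OF H])
    have JW: "wd Js \<in> W" using wall_words[OF Js(1)] W_words by blast
    have "orth_reflection H y = wd (rev Js @ [wd Js ` H] @ Js) y" for y
    proof -
      have "wd Js (orth_reflection H y) = orth_reflection (wd Js ` H) (wd Js y)"
        using refl_conj[OF W_isom[OF JW] H walls_H[OF Js(2)]] by simp
      then show ?thesis
        using wd_rev[OF wall_words[OF Js(1)], of "orth_reflection H y"] by (simp add: wd_append)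
    qed
    then have "wd ((rev Js @ [wd Js ` H] @ Js) @ Ks) = wd (H # Hs)"
      using Ks(2) by (simp add: fun_eq_iff wd_append[of _ Ks] del: append_assoc)
    moreover have "(rev Js @ [wd Js ` H] @ Js) @ Ks \<in> lists walls" using Js Ks(1) by auto
    ultimately show ?case by blast
  qed
  show "W \<subseteq> wd ` lists walls"
  proof
    fix w assume "w \<in> W"
    then obtain Hs where "Hs \<in> lists \<H>" "w = wd Hs" unfolding W_words by blast
    then show "w \<in> wd ` lists walls" using ex[of Hs] by (metis imageI)
  qed
  show "wd ` lists walls \<subseteq> W" using wall_words W_words by blast
qed

lemma fundamental_domain:
  assumes "w \<in> W" "x \<in> closure \<A>" "w x \<in> closure \<A>"
  shows "w x = x" "\<exists>Ks\<in>lists {H \<in> \<H>. x \<in> H}. w = wd Ks"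
proof -
  obtain Hs where Hs: "Hs \<in> lists walls" "w = wd Hs" using assms(1) unfolding W_wall_words by blast
  have "wd Hs x = x \<and> (\<exists>Ks\<in>lists {H \<in> \<H>. x \<in> H}. \<forall>y. wd Ks y = wd Hs y)"
    by (rule fundamental_domain_words[OF Hs(1) assms(2)]) (use assms(3) Hs(2) in simp)
  then obtain Ks where Ks: "wd Hs x = x" "Ks \<in> lists {H \<in> \<H>. x \<in> H}" "\<forall>y. wd Ks y = wd Hs y" by blast
  show "w x = x" using Ks(1) Hs(2) by simp
  have "w = wd Ks" using Ks(3) Hs(2) by (simp add: fun_eq_iff)
  then show "\<exists>Ks\<in>lists {H \<in> \<H>. x \<in> H}. w = wd Ks" using Ks(2) by (rule bexI)
qed

end

lemma direction_affine:
  assumes A: "affine A" and a: "a \<in> A"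
  shows "subspace (direction A)" "x \<in> A \<longleftrightarrow> x - a \<in> direction A" "int (dim (direction A)) = aff_dim A"
proof -
  have d: "direction A = (%x. x - a) ` A"
  proof
    show "(%x. x - a) ` A \<subseteq> direction A" using a by (auto simp: direction_def)
    show "direction A \<subseteq> (%x. x - a) ` A"
    proof
      fix v assume "v \<in> direction A"
      then obtain x y where xy: "x \<in> A" "y \<in> A" "v = x - y" by (auto simp: direction_def)
      have "a + 1 *\<^sub>R (x - y) \<in> A" by (rule mem_affine_3_minus[OF A a xy(1,2)])
      then show "v \<in> (%x. x - a) ` A" using xy(3) by (intro image_eqI[of _ _ "a + (x - y)"]) simp_all
    qed
  qed
  have "(%x. x - a) ` A = {x - a | x. x \<in> A}" by auto
  then show "subspace (direction A)" using affine_diffs_subspace_subtract[OF A a] d by simp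
  show "x \<in> A \<longleftrightarrow> x - a \<in> direction A" unfolding d by auto
  show "int (dim (direction A)) = aff_dim A" unfolding d using aff_dim_dim_affine_diffs[OF A a] by simp
qed

lemma direction_image: "isom g ==> direction (g ` A) = lin g ` direction A"
proof -
  assume g: "isom g"
  have "direction (g ` A) = {g x - g y | x y. x \<in> A \<and> y \<in> A}" unfolding direction_def by blast
  also have "\<dots> = lin g ` direction A" unfolding direction_def using isom_lin(5)[OF g] by (auto simp: image_iff)
  finally show ?thesis .
qed

lemma isom_convex: "isom g ==> convex C ==> convex (g ` C)"
proof -
  assume g: "isom g" and C: "convex C"
  have "g ` C = (+) (g 0) ` (lin g ` C)" by (auto simp: lin_def image_iff)
  then show ?thesis using convex_translation[OF convex_linear_image[OF isom_lin(1)[OF g] C]] by simp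
qed

section \<open>The group extended by \<open>K\<close> and its discreteness\<close>

locale extended_arrangement = arrangement +
  fixes K :: "('a \<Rightarrow> 'a) set"
  assumes K_admissible: "admissible_group \<H> \<A> K"
begin

lemma K_subgroup: "subgroup K isometry_group"
  using K_admissible by (simp add: admissible_group_def)

lemma K_isom: "k \<in> K ==> isom k"
  using subgroup.subset[OF K_subgroup] by (auto simp: isometry_group_facts(1))

lemma K_id: "(%x. x) \<in> K"
  using subgroup.one_closed[OF K_subgroup] by (simp add: isometry_group_facts(3))

lemma K_comp: "k \<in> K ==> k' \<in> K ==> (%x. k (k' x)) \<in> K"
  using subgroup.m_closed[OF K_subgroup, of k k'] isometry_group_facts(2)[OF K_isom K_isom, of k k'] by simp

lemma K_inv: "k \<in> K ==> inv_into UNIV k \<in> K"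
  using subgroup.m_inv_closed[OF K_subgroup] isometry_group_inv[OF K_isom] by simp

lemma K_chamber: "k \<in> K ==> k x \<in> \<A> \<longleftrightarrow> x \<in> \<A>"
proof -
  assume k: "k \<in> K"
  have "k ` \<A> = \<A>" using K_admissible k by (simp add: admissible_group_def)
  then show ?thesis using isom_inj[OF K_isom[OF k]] by (metis imageE imageI)
qed

lemma K_closure1: "k \<in> K ==> x \<in> closure \<A> ==> k x \<in> closure \<A>"
  unfolding closure_approachable
proof (intro allI impI)
  fix e :: real
  assume k: "k \<in> K" and x: "\<forall>e>0. \<exists>y\<in>\<A>. dist y x < e" and e: "e > 0"
  obtain y where y: "y \<in> \<A>" "dist y x < e" using x e by blast
  have "k y \<in> \<A>" using K_chamber[OF k] y(1) by simp
  moreover have "dist (k y) (k x) = dist y x" using K_isom[OF k] by (simp add: isom_def)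
  ultimately show "\<exists>y\<in>\<A>. dist y (k x) < e" using y(2) by (intro bexI[of _ "k y"]) simp_all
qed

lemma K_closure: "k \<in> K ==> k x \<in> closure \<A> \<longleftrightarrow> x \<in> closure \<A>"
  using K_closure1[of k x] K_closure1[of "inv_into UNIV k" "k x"] K_inv isom_inv_apply(1)[OF K_isom] by metis

text \<open>That \<open>k\<close> permutes hyperplanes has to be derived from its stabilising \<A>.
  It carries a convex piece of a facet into the boundary of the chamber, which the hyperplanes
  cover; by convexity one of them contains the image piece and so equals the image of
  \<open>H\<close>.\<close>

lemma K_wall:
  assumes k: "k \<in> K" and Hw: "H \<in> walls"
  shows "k ` H \<in> walls"
proof -
  have ki: "isom k" by (rule K_isom[OF k])
  have H: "H \<in> \<H>" by (rule walls_H[OF Hw])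
  obtain e where e: "e \<in> cell H" using Hw by (auto simp: walls_def)
  obtain \<epsilon> where eps: "\<epsilon> > 0" "ball e \<epsilon> \<inter> H \<subseteq> cell H" using cell_ball[OF e] by blast
  have eH: "e \<in> H" using e cell_subset by blast
  let ?C = "ball e \<epsilon> \<inter> H"
  have C: "convex ?C" "e \<in> ?C"
    using H_affine[OF H] eH eps(1) by (auto intro: convex_Int affine_imp_convex)
  have "k ` ?C \<subseteq> (\<Union>H'\<in>\<H>. H')"
  proof
    fix y assume "y \<in> k ` ?C"
    then obtain x where x: "x \<in> ?C" "y = k x" by blast
    have "x \<in> closure \<A>" using eps(2) x(1) cell_closure by blast
    then have "y \<in> closure \<A>" using K_closure[OF k] x(2) by simp
    moreover have "x \<notin> \<A>" using x(1) H nc(2)[OF H, of x] chamber_mem[of x] by force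
    then have "y \<notin> \<A>" using K_chamber[OF k] x(2) by simp
    ultimately show "y \<in> (\<Union>H'\<in>\<H>. H')" using closure_chamber_diff by blast
  qed
  moreover have "k ` ?C ~= {}" using C(2) by blast
  ultimately obtain H' where H': "H' \<in> \<H>" "k ` ?C \<subseteq> H'"
    using convex_covered_by_affine[OF isom_convex[OF ki C(1)] _ countable_H, of "%H. H"] H_affine by auto
  let ?M = "inv_into UNIV k ` H'"
  have "affine ?M" by (rule isom_affine[OF isom_inv[OF ki] H_affine[OF H'(1)]])
  moreover have "?C \<subseteq> ?M"
  proof
    fix x assume "x \<in> ?C"
    then have "k x \<in> H'" using H'(2) by blast
    then show "x \<in> ?M" using isom_inv_apply(1)[OF ki, of x] by (intro image_eqI[of _ _ "k x"]) simp_all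
  qed
  ultimately have HM: "H \<subseteq> ?M"
    by (rule convex_ball_subset_affine[OF affine_imp_convex[OF H_affine[OF H]] _ eH eps(1)])
  have sub: "k ` H \<subseteq> H'"
  proof
    fix y assume "y \<in> k ` H"
    then obtain x where "x \<in> ?M" "y = k x" using HM by blast
    then show "y \<in> H'" using isom_inv_apply(2)[OF ki] by auto
  qed
  have "{y. lin k (nv H) \<bullet> y = snd (nc H) + lin k (nv H) \<bullet> k 0} \<subseteq> {x. nv H' \<bullet> x = snd (nc H')}"
    unfolding isom_image_H[OF ki H, symmetric] using sub H_mem[OF H'(1)] by blast
  then have "(nv H' = lin k (nv H) \<and> snd (nc H') = snd (nc H) + lin k (nv H) \<bullet> k 0) \<or>
      (nv H' = - lin k (nv H) \<and> snd (nc H') = - (snd (nc H) + lin k (nv H) \<bullet> k 0))"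
    by (rule hyperplane_subset_normal) (use nc(1) H H'(1) isom_lin(3)[OF ki] in auto)
  then have "y \<in> k ` H \<longleftrightarrow> y \<in> H'" for y
    unfolding isom_image_H[OF ki H] H_mem[OF H'(1)] by auto
  then have kH: "k ` H = H'" by blast
  have im: "k ` (H \<inter> closure \<A>) = k ` H \<inter> closure \<A>" using K_closure[OF k] by auto
  have "lies_over \<A> H" using lies_over_cell[OF flat_H[OF H]] e by blast
  then have "k ` H = affine hull (k ` H \<inter> closure \<A>)"
    using isom_affine_hull[OF ki, of "H \<inter> closure \<A>"] unfolding im lies_over_def by simp
  then have "lies_over \<A> H'" unfolding kH lies_over_def .
  then show ?thesis unfolding kH walls_def using lies_over_cell[OF flat_H[OF H'(1)]] H'(1) by simp
qed

lemma K_image_word: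
  assumes k: "k \<in> K" and H0: "H0 \<in> walls" and Ks: "Ks \<in> lists walls"
  shows "k ` (wd Ks ` H0) \<in> \<H>"
  using Ks
proof (induction Ks)
  case Nil
  have "wd [] ` H0 = H0" by simp
  then show ?case using walls_H[OF K_wall[OF k H0]] by simp
next
  case (Cons H Ks)
  have H: "H \<in> walls" "k ` H \<in> walls" using Cons.hyps K_wall[OF k] by simp_all
  have "k ` (wd (H # Ks) ` H0) = orth_reflection (k ` H) ` (k ` (wd Ks ` H0))"
    using refl_conj[OF K_isom[OF k] walls_H[OF H(1)] walls_H[OF H(2)]] by (simp add: image_image)
  then show ?case using W_image[OF W_refl[OF walls_H[OF H(2)]] Cons.IH] by simp
qed

text \<open>Every hyperplane is the image of a wall under a word in walls, and \<open>k\<close>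
  carries walls to walls and conjugates their reflections accordingly.\<close>

lemma K_H:
  assumes k: "k \<in> K" and H: "H \<in> \<H>"
  shows "k ` H \<in> \<H>"
proof -
  obtain Hs where Hs: "Hs \<in> lists walls" "wd Hs ` H \<in> walls" by (rule H_conj_wall[OF H])
  have "wd (rev Hs) ` (wd Hs ` H) = H" using wd_rev[OF wall_words[OF Hs(1)]] by (simp add: image_image)
  moreover have "rev Hs \<in> lists walls" using Hs(1) by (auto simp: lists_eq_set)
  ultimately show ?thesis using K_image_word[OF k Hs(2), of "rev Hs"] by simp
qed

text \<open>Conjugation by \<open>k\<close> replaces every letter of a word by its image under
  \<open>k\<close>, so \<open>K\<close> normalises the reflection group.\<close>

lemma K_conj:
  assumes k: "k \<in> K" and w: "w \<in> W"
  shows "\<exists>w'\<in>W. \<forall>x. k (w x) = w' (k x)"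
proof -
  obtain Hs where Hs: "Hs \<in> lists \<H>" "w = wd Hs" using w unfolding W_words by blast
  have "\<forall>x. k (wd Hs x) = wd (map ((`) k) Hs) (k x)" using Hs(1)
  proof (induction Hs)
    case (Cons H Hs)
    have H: "H \<in> \<H>" using Cons.hyps by simp
    have "k (orth_reflection H y) = orth_reflection (k ` H) (k y)" for y
      using refl_conj[OF K_isom[OF k] H K_H[OF k H]] by simp
    then show ?case using Cons.IH by simp
  qed simp
  moreover have "wd (map ((`) k) Hs) \<in> W"
    unfolding W_words by (rule imageI) (use Hs(1) K_H[OF k] in \<open>auto simp: lists_eq_set\<close>)
  ultimately show ?thesis using Hs(2) by blast
qed

abbreviation "G \<equiv> ext_group \<H> K"

lemma G_iff: "g \<in> G \<longleftrightarrow> (\<exists>k\<in>K. \<exists>w\<in>W. g = (%x. k (w x)))"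
  unfolding ext_group_def set_mult_def
  using isometry_group_facts(2)[OF K_isom W_isom] by fastforce

lemma G_isom: "g \<in> G ==> isom g"
  unfolding G_iff using isom_comp[OF K_isom W_isom] by blast

lemma G_image: "g \<in> G ==> H \<in> \<H> ==> g ` H \<in> \<H>"
proof -
  assume g: "g \<in> G" and H: "H \<in> \<H>"
  obtain k w where kw: "k \<in> K" "w \<in> W" "g = (%x. k (w x))" using g unfolding G_iff by blast
  have "g ` H = k ` (w ` H)" unfolding kw(3) by (simp add: image_image)
  then show ?thesis using K_H[OF kw(1) W_image[OF kw(2) H]] by simp
qed

lemma W_G: "w \<in> W ==> w \<in> G"
  unfolding G_iff by (intro bexI[OF _ K_id] bexI[of _ w]) simp_all

lemma K_G: "k \<in> K ==> k \<in> G"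
proof -
  assume "k \<in> K"
  moreover have "(%x. x) \<in> W" unfolding W_words by (rule image_eqI[of _ _ "[]"]) (simp_all add: fun_eq_iff)
  ultimately show ?thesis unfolding G_iff by (intro bexI[of _ k] bexI[of _ "%x. x"]) simp_all
qed

lemma W_K_swap:
  assumes k: "k \<in> K" and w: "w \<in> W"
  shows "\<exists>w'\<in>W. \<forall>x. w (k x) = k (w' x)"
proof -
  obtain w' where w': "w' \<in> W" "\<forall>y. inv_into UNIV k (w y) = w' (inv_into UNIV k y)"
    using K_conj[OF K_inv[OF k] w] by blast
  have "w (k x) = k (w' x)" for x
    using w'(2)[rule_format, of "k x"] isom_inv_apply[OF K_isom[OF k]] by metis
  then show ?thesis using w'(1) by blast
qed

lemma G_comp: "g \<in> G ==> h \<in> G ==> (%x. g (h x)) \<in> G"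
proof -
  assume g: "g \<in> G" and h: "h \<in> G"
  obtain k w where kw: "k \<in> K" "w \<in> W" "g = (%x. k (w x))" using g unfolding G_iff by blast
  obtain k' w' where kw': "k' \<in> K" "w' \<in> W" "h = (%x. k' (w' x))" using h unfolding G_iff by blast
  obtain v where v: "v \<in> W" "\<forall>x. w (k' x) = k' (v x)" using W_K_swap[OF kw'(1) kw(2)] by blast
  have "(%x. g (h x)) = (%x. (%y. k (k' y)) ((%y. v (w' y)) x))" unfolding kw(3) kw'(3) using v(2) by simp
  then show ?thesis unfolding G_iff using K_comp[OF kw(1) kw'(1)] W_comp[OF v(1) kw'(2)] by metis
qed

lemma G_inverse: "g \<in> G ==> inv_into UNIV g \<in> G"
proof -
  assume g: "g \<in> G"
  obtain k w where kw: "k \<in> K" "w \<in> W" "g = (%x. k (w x))" using g unfolding G_iff by blast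
  have "inv_into UNIV g = (%x. inv_into UNIV w (inv_into UNIV k x))"
    using isom_inv_apply[OF K_isom[OF kw(1)]] isom_inv_apply[OF W_isom[OF kw(2)]] kw(3)
    by (intro inv_equality) simp_all
  then show ?thesis
    using G_comp[OF W_G[OF W_inv[OF kw(2)]] K_G[OF K_inv[OF kw(1)]]] by simp
qed

lemma direction_H: "H \<in> \<H> ==> v \<in> direction H \<longleftrightarrow> nv H \<bullet> v = 0"
proof -
  assume H: "H \<in> \<H>"
  obtain h where h: "h \<in> H" using flat_H[OF H] by (auto simp: flat_def)
  have "v \<in> direction H \<longleftrightarrow> h + v \<in> H" using direction_affine(2)[OF H_affine[OF H] h, of "h + v"] by simp
  also have "\<dots> \<longleftrightarrow> nv H \<bullet> v = 0" using h by (simp add: H_mem[OF H] inner_add_right)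
  finally show ?thesis .
qed

lemma V_arr_iff: "v \<in> V_arr \<H> \<longleftrightarrow> (\<forall>H\<in>\<H>. nv H \<bullet> v = 0)"
  unfolding V_arr_def using direction_H by blast

lemma subspace_V_arr: "subspace (V_arr \<H>)"
  by (auto simp: subspace_def V_arr_iff inner_add_right)

lemma lin_wd_V_arr: "Hs \<in> lists \<H> ==> v \<in> V_arr \<H> ==> wd Hs (x + v) = wd Hs x + v"
proof (induction Hs arbitrary: x)
  case (Cons H Hs)
  have H: "H \<in> \<H>" using Cons.prems by simp
  have "orth_reflection H (y + v) = orth_reflection H y + v" for y
    using Cons.prems H by (simp add: refl[OF H] sg_def inner_add_right V_arr_iff)
  then show ?case using Cons by simp
qed simp

lemma G_V_arr:
  assumes g: "g \<in> G" and v: "v \<in> V_arr \<H>"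
  shows "lin g v = v"
proof -
  obtain k w where kw: "k \<in> K" "w \<in> W" "g = (%x. k (w x))" using g unfolding G_iff by blast
  obtain Hs where Hs: "Hs \<in> lists \<H>" "w = wd Hs" using kw(2) unfolding W_words by blast
  have "k (x + v) = k x + v" for x
    using K_admissible kw(1) v unfolding admissible_group_def by metis
  moreover have "w (0 + v) = w 0 + v" unfolding Hs(2) by (rule lin_wd_V_arr[OF Hs(1) v])
  ultimately show ?thesis unfolding lin_def kw(3) by simp
qed

text \<open>In the definition of admissible groups \<open>(+) p ` (V_arr \<H>)\<^sup>\<bottom>\<close> is the orthogonal complement of
  \<open>p + V_arr \<H>\<close>, a linear subspace; so the base point can always be taken to be the origin.\<close>

lemma G_base_point: "\<exists>p. \<forall>g\<in>G. g p - p \<in> (V_arr \<H>)\<^sup>\<bottom>"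
proof (intro exI[of _ 0] ballI)
  let ?V = "V_arr \<H>"
  let ?P = "?V\<^sup>\<bottom>"
  have P: "subspace ?P" by (rule subspace_orthogonal_comp)
  have nP: "c *\<^sub>R nv H \<in> ?P" if "H \<in> \<H>" for H c
    using that by (auto simp: orthogonal_comp_def orthogonal_def V_arr_iff inner_commute)
  have wP: "wd Hs x - x \<in> ?P" if "Hs \<in> lists \<H>" for Hs x using that
  proof (induction Hs)
    case Nil
    then show ?case using subspace_0[OF P] by simp
  next
    case (Cons H Hs)
    have H: "H \<in> \<H>" using Cons.hyps by simp
    have E: "wd (H # Hs) x - x = (wd Hs x - x) + (- 2 * sg H (wd Hs x)) *\<^sub>R nv H"
      by (simp add: refl[OF H])
    show ?case unfolding E by (rule subspace_add[OF P Cons.IH nP[OF H]])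
  qed
  have kP: "k y \<in> ?P" if k: "k \<in> K" and y: "y \<in> ?P" for k y
  proof -
    obtain p where "\<forall>k\<in>K. k ` (((+) p ` ?V)\<^sup>\<bottom>) = ((+) p ` ?V)\<^sup>\<bottom> \<and> (\<forall>x. \<forall>v\<in>?V. k (x + v) = k x + v)"
      using K_admissible unfolding admissible_group_def by blast
    then have p: "k ` (((+) p ` ?V)\<^sup>\<bottom>) = ((+) p ` ?V)\<^sup>\<bottom>" using k by blast
    have "0 \<in> ((+) p ` ?V)\<^sup>\<bottom>" by (simp add: orthogonal_comp_def orthogonal_def)
    then have "k 0 \<in> k ` (((+) p ` ?V)\<^sup>\<bottom>)" by (rule imageI)
    then have k0: "k 0 \<in> ((+) p ` ?V)\<^sup>\<bottom>" unfolding p .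
    have "v \<bullet> k y = 0" if v: "v \<in> ?V" for v
    proof -
      have "p \<in> (+) p ` ?V" using subspace_0[OF subspace_V_arr] by (intro image_eqI[of _ _ 0]) simp_all
      \<comment> \<open>Both \<open>p\<close> and \<open>p + v\<close> belong to the translated
        subspace, so \<open>k 0\<close> is orthogonal to their difference \<open>v\<close>.\<close>
      then have 1: "p \<bullet> k 0 = 0" using k0 unfolding orthogonal_comp_def orthogonal_def by blast
      have "p + v \<in> (+) p ` ?V" using v by (rule imageI)
      then have "(p + v) \<bullet> k 0 = 0" using k0 unfolding orthogonal_comp_def orthogonal_def by blast
      then have 2: "v \<bullet> k 0 = 0" using 1 by (simp add: inner_add_left)
      have "v \<bullet> y = 0" using y v unfolding orthogonal_comp_def orthogonal_def by blast
      then have "lin k v \<bullet> lin k y = 0" using isom_lin(2)[OF K_isom[OF k]] by simp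
      then have 3: "v \<bullet> lin k y = 0" using G_V_arr[OF K_G[OF k] v] by simp
      have "k y = k 0 + lin k y" by (simp add: lin_def)
      then show ?thesis using 2 3 by (simp add: inner_add_right)
    qed
    then show ?thesis by (simp add: orthogonal_comp_def orthogonal_def)
  qed
  fix g assume g: "g \<in> G"
  obtain k w where kw: "k \<in> K" "w \<in> W" "g = (%x. k (w x))" using g unfolding G_iff by blast
  obtain Hs where Hs: "Hs \<in> lists \<H>" "w = wd Hs" using kw(2) unfolding W_words by blast
  have "w 0 \<in> ?P" unfolding Hs(2) using wP[OF Hs(1), of 0] by simp
  then show "g 0 - 0 \<in> ?P" unfolding kw(3) using kP[OF kw(1)] by simp
qed

text \<open>An element is determined by its effect on finitely many hyperplanes whose normals span
  all normals. This fixes the linear part, as vectors of \<open>V_arr \<H>\<close> are not moved,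
  and the translation part up to such a vector, which \<open>G_base_point\<close> excludes. Bounded
  displacement leaves finitely many possible images of these hyperplanes.\<close>

lemma finite_G_displacement: "finite {g \<in> G. dist (g x) x <= R}"
proof -
  obtain B where B: "B \<subseteq> nv ` \<H>" "independent B" "nv ` \<H> \<subseteq> span B"
    using maximal_independent_subset[of "nv ` \<H>"] by blast
  have finB: "finite B" using B(2) by (rule independent_imp_finite)
  obtain \<H>0 where H0: "\<H>0 \<subseteq> \<H>" "finite \<H>0" "B = nv ` \<H>0"
    using finite_subset_image[OF finB B(1)] by blast
  define F where "F = (\<Union>H\<in>\<H>0. {H' \<in> \<H>. \<bar>sg H' x\<bar> <= \<bar>sg H x\<bar> + R})"
  have finF: "finite F" unfolding F_def using H0(2) finite_sg_le by blast
  \<comment> \<open>The image of the normal is recorded as well, because the image hyperplane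
    determines it only up to sign.\<close>
  define \<Phi> where "\<Phi> g = restrict (%H. (g ` H, lin g (nv H))) \<H>0" for g
  let ?D = "{g \<in> G. dist (g x) x <= R}"
  obtain p where p: "\<forall>g\<in>G. g p - p \<in> (V_arr \<H>)\<^sup>\<bottom>" using G_base_point by blast
  have "\<Phi> ` ?D \<subseteq> PiE \<H>0 (%_. F \<times> (nv ` F \<union> uminus ` nv ` F))"
  proof (intro image_subsetI)
    fix g assume g: "g \<in> ?D"
    have gG: "g \<in> G" "isom g" using g G_isom by auto
    have "(g ` H, lin g (nv H)) \<in> F \<times> (nv ` F \<union> uminus ` nv ` F)" if H: "H \<in> \<H>0" for H
    proof -
      have HH: "H \<in> \<H>" "g ` H \<in> \<H>" using H H0(1) G_image[OF gG(1)] by blast+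
      have n: "nv (g ` H) = lin g (nv H) \<or> nv (g ` H) = - lin g (nv H)" "\<bar>sg (g ` H) (g x)\<bar> = \<bar>sg H x\<bar>"
        using isom_normal[OF gG(2) HH] by auto
      have "\<bar>sg (g ` H) (g x) - sg (g ` H) x\<bar> <= dist (g x) x" by (rule sg_lipschitz[OF HH(2)])
      then have "\<bar>sg (g ` H) x\<bar> <= \<bar>sg H x\<bar> + R" using n(2) g by auto
      then have F: "g ` H \<in> F" using H HH(2) by (auto simp: F_def)
      have "lin g (nv H) = nv (g ` H) \<or> lin g (nv H) = - nv (g ` H)" using n(1) by (metis minus_minus)
      then show ?thesis using F by blast
    qed
    then show "\<Phi> g \<in> PiE \<H>0 (%_. F \<times> (nv ` F \<union> uminus ` nv ` F))" by (simp add: \<Phi>_def)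
  qed
  moreover have "finite (PiE \<H>0 (%_. F \<times> (nv ` F \<union> uminus ` nv ` F)))"
    using H0(2) finF by (intro finite_PiE) simp_all
  ultimately have "finite (\<Phi> ` ?D)" by (rule finite_subset)
  moreover have "inj_on \<Phi> ?D"
  proof (rule inj_onI)
    fix g h assume g: "g \<in> ?D" and h: "h \<in> ?D" and eq: "\<Phi> g = \<Phi> h"
    have gi: "g \<in> G" "isom g" and hi: "h \<in> G" "isom h" using g h G_isom by auto
    have data: "g ` H = h ` H" "lin g (nv H) = lin h (nv H)" if "H \<in> \<H>0" for H
      using fun_cong[OF eq, of H] that by (simp_all add: \<Phi>_def)
    have V_arrI: "v \<in> V_arr \<H>" if "!!H. H \<in> \<H>0 ==> nv H \<bullet> v = 0" for v
    proof -
      have "orthogonal v b" if "b \<in> B" for b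
        using that \<open>!!H. H \<in> \<H>0 ==> nv H \<bullet> v = 0\<close> H0(3) by (auto simp: orthogonal_def inner_commute)
      then have "orthogonal v y" if "y \<in> span B" for y using that orthogonal_to_span by blast
      then show ?thesis unfolding V_arr_iff using B(3) by (metis basic_trans_rules(31) image_eqI inner_commute orthogonal_def)
    qed
    have lin_eq: "lin g v = lin h v" for v
    proof -
      let ?S = "span B"
      have S: "subspace ?S" by simp
      have "lin g y = lin h y" if "y \<in> ?S" for y
      proof (rule linear_eq_on_span[OF isom_lin(1)[OF gi(2)] isom_lin(1)[OF hi(2)] _ that])
        fix b assume "b \<in> B"
        then obtain H where "H \<in> \<H>0" "b = nv H" using H0(3) by blast
        then show "lin g b = lin h b" using data(2) by simp
      qed
      then have 1: "lin g (oproj ?S v) = lin h (oproj ?S v)" using oproj(1)[OF S] by blast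
      have "v - oproj ?S v \<in> V_arr \<H>"
      proof (rule V_arrI)
        fix H assume "H \<in> \<H>0"
        then have "nv H \<in> ?S" using H0(3) span_base by (metis imageI)
        then show "nv H \<bullet> (v - oproj ?S v) = 0" using oproj(2)[OF S] by (simp add: inner_commute)
      qed
      then have "lin g (v - oproj ?S v) = lin h (v - oproj ?S v)" using G_V_arr gi(1) hi(1) by simp
      then show ?thesis
        using 1 linear_diff[OF isom_lin(1)[OF gi(2)]] linear_diff[OF isom_lin(1)[OF hi(2)]] by simp
    qed
    \<comment> \<open>Equal images of the hyperplanes force \<open>d\<close> into
      \<open>V_arr \<H>\<close>, and the base point forces it into the orthogonal complement; so
      \<open>d = 0\<close>.\<close>
    define d where "d = g 0 - h 0"
    have gd: "g y = h y + d" for y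
      using lin_eq[of y] by (simp add: lin_def d_def algebra_simps)
    obtain d' where d': "d = lin g d'"
    proof -
      have "lin g ((inv_into UNIV g) (g 0 + d)) = d"
        using isom_inv_apply(2)[OF gi(2)] by (simp add: lin_def)
      then show ?thesis using that by metis
    qed
    have "nv H \<bullet> d' = 0" if H: "H \<in> \<H>0" for H
    proof -
      have HH: "H \<in> \<H>" "g ` H \<in> \<H>" using H H0(1) G_image[OF gi(1)] by blast+
      obtain y where y: "y \<in> H" using flat_H[OF HH(1)] by (auto simp: flat_def)
      have "g y \<in> g ` H" "h y \<in> g ` H" using y data(1)[OF H] by auto
      then have "nv (g ` H) \<bullet> d = 0" using gd[of y] by (simp add: H_mem[OF HH(2)] inner_add_right)
      then have "lin g (nv H) \<bullet> lin g d' = 0" using isom_normal[OF gi(2) HH] d' by auto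
      then show ?thesis using isom_lin(2)[OF gi(2)] by simp
    qed
    then have "d' \<in> V_arr \<H>" by (rule V_arrI)
    then have dV: "d \<in> V_arr \<H>" using d' G_V_arr[OF gi(1)] by simp
    have "(g p - p) - (h p - p) \<in> (V_arr \<H>)\<^sup>\<bottom>"
      by (rule subspace_diff[OF subspace_orthogonal_comp]) (use p gi(1) hi(1) in blast)+
    then have "d \<in> (V_arr \<H>)\<^sup>\<bottom>" using gd[of p] by simp
    then have "d \<bullet> d = 0" using dV by (auto simp: orthogonal_comp_def orthogonal_def)
    then show "g = h" using gd by (simp add: fun_eq_iff)
  qed
  ultimately show ?thesis by (rule finite_imageD)
qed

sublocale discrete_isometry_group G
proof
  show "(%x. x) \<in> G" by (rule K_G[OF K_id])
  show "(%x. g (h x)) \<in> G" if "g \<in> G" "h \<in> G" for g h by (rule G_comp[OF that])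
  show "\<exists>h\<in>G. (\<forall>x. h (g x) = x) \<and> (\<forall>x. g (h x) = x)" if "g \<in> G" for g
    using G_inverse[OF that] isom_inv_apply[OF G_isom[OF that]] by (intro bexI[of _ "inv_into UNIV g"]) simp_all
  show "dist (g x) (g y) = dist x y" if "g \<in> G" for g x y using G_isom[OF that] by (simp add: isom_def)
  show "finite {g \<in> G. dist (g x) x <= R}" for R x by (rule finite_G_displacement)
qed

lemma countable_G: "countable G"
proof -
  have c: "countable {g \<in> G. dist (g 0) 0 <= real n}" for n
    by (rule countable_finite[OF finite_G_displacement])
  have "G \<subseteq> (\<Union>n::nat. {g \<in> G. dist (g 0) 0 <= real n})" using real_arch_simple by blast
  moreover have "countable (\<Union>n::nat. {g \<in> G. dist (g 0) 0 <= real n})"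
    by (rule countable_UN[OF countableI_type]) (rule c)
  ultimately show ?thesis by (rule countable_subset)
qed

lemma flat_G: "g \<in> G ==> flat \<H> P ==> flat \<H> (g ` P)"
proof -
  assume g: "g \<in> G" and P: "flat \<H> P"
  obtain \<S> where S: "\<S> \<subseteq> \<H>" "P = \<Inter>\<S>" "P ~= {}" using P unfolding flat_def by metis
  have b: "bij g" by (rule isom_bij[OF G_isom[OF g]])
  have "g ` P = \<Inter>((`) g ` \<S>)"
  proof (cases "\<S> = {}")
    case True
    then show ?thesis using S(2) b by (simp add: bij_is_surj)
  next
    case False
    then show ?thesis unfolding S(2) using bij_image_INT[OF b, of "%x. x" \<S>] by simp
  qed
  then show ?thesis unfolding flat_def using S(1,3) G_image[OF g] by (intro conjI exI[of _ "(`) g ` \<S>"]) auto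
qed

end

section \<open>Complexified flats\<close>

lemma aff_dim_isom:
  assumes g: "isom g"
  shows "aff_dim (g ` A) = aff_dim A"
proof -
  have e: "g ` A = (+) (g 0) ` (lin g ` A)" by (auto simp: lin_def image_iff)
  have "inj (lin g)" using isom_inj[OF g] by (auto simp: inj_def lin_def)
  then have "aff_dim (lin g ` A) = aff_dim A" using aff_dim_injective_linear_image isom_lin(1)[OF g] by blast
  then show ?thesis unfolding e using aff_dim_translation_eq[of "g 0" "lin g ` A"] by simp
qed

lemma complexify_iff: "z \<in> complexify A \<longleftrightarrow> fst z \<in> A \<and> snd z \<in> direction A"
  by (simp add: complexify_def mem_Times_iff)

lemma complexify_diff:
  assumes A: "affine A" and z: "z \<in> complexify A"
  shows "y \<in> complexify A \<longleftrightarrow> y - z \<in> direction A \<times> direction A"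
proof -
  have a: "fst z \<in> A" "snd z \<in> direction A" using z by (simp_all add: complexify_iff)
  have s: "subspace (direction A)" by (rule direction_affine(1)[OF A a(1)])
  have "snd y \<in> direction A \<longleftrightarrow> snd y - snd z \<in> direction A"
    using subspace_diff[OF s _ a(2), of "snd y"] subspace_add[OF s _ a(2), of "snd y - snd z"] by auto
  then show ?thesis using direction_affine(2)[OF A a(1), of "fst y"] by (simp add: complexify_iff mem_Times_iff)
qed

lemma aff_dim_complexify:
  assumes A: "affine A" and a: "a \<in> A"
  shows "aff_dim (complexify A) = 2 * aff_dim A"
proof -
  let ?D = "direction A"
  have s: "subspace ?D" by (rule direction_affine(1)[OF A a])
  have z: "(a, 0) \<in> complexify A" using a subspace_0[OF s] by (simp add: complexify_iff)
  have "complexify A = (+) (a, 0) ` (?D \<times> ?D)"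
  proof
    show "complexify A \<subseteq> (+) (a, 0) ` (?D \<times> ?D)"
    proof
      fix y assume "y \<in> complexify A"
      then have "y - (a, 0) \<in> ?D \<times> ?D" using complexify_diff[OF A z] by simp
      then show "y \<in> (+) (a, 0) ` (?D \<times> ?D)" by (intro image_eqI[of _ _ "y - (a, 0)"]) simp_all
    qed
    show "(+) (a, 0) ` (?D \<times> ?D) \<subseteq> complexify A"
    proof
      fix y assume "y \<in> (+) (a, 0) ` (?D \<times> ?D)"
      then obtain d where d: "y = (a, 0) + d" "d \<in> ?D \<times> ?D" by (rule imageE)
      then have "y - (a, 0) \<in> ?D \<times> ?D" by simp
      then show "y \<in> complexify A" using complexify_diff[OF A z] by simp
    qed
  qed
  then have "aff_dim (complexify A) = aff_dim (?D \<times> ?D)" using aff_dim_translation_eq[of "(a, 0)"] by simp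
  also have "\<dots> = int (dim (?D \<times> ?D))" by (rule aff_dim_subspace[OF subspace_Times[OF s s]])
  also have "\<dots> = 2 * aff_dim A" using dim_Times[OF s s] direction_affine(3)[OF A a] by simp
  finally show ?thesis .
qed

lemma cx_map_complexify:
  assumes g: "isom g"
  shows "cx_map g ` complexify P = complexify (g ` P)"
proof -
  have "cx_map g = map_prod g (lin g)" by (auto simp: fun_eq_iff cx_map_def lin_def)
  then show ?thesis unfolding complexify_def direction_image[OF g] using map_prod_surj_on[OF refl refl] by simp
qed

lemma affine_fixed_points:
  assumes g: "isom g"
  shows "affine {x. g x = x}"
  unfolding affine_def
proof (intro ballI allI impI)
  fix x y and u v :: real
  assume x: "x \<in> {x. g x = x}" and y: "y \<in> {x. g x = x}" and uv: "u + v = 1"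
  have l: "g z = lin g z + g 0" for z by (simp add: lin_def)
  have e: "lin g x = x - g 0" "lin g y = y - g 0" using x y by (simp_all add: lin_def)
  have "g (u *\<^sub>R x + v *\<^sub>R y) = u *\<^sub>R (x - g 0) + v *\<^sub>R (y - g 0) + g 0"
    unfolding l[of "u *\<^sub>R x + v *\<^sub>R y"] linear_add[OF isom_lin(1)[OF g]] linear_scale[OF isom_lin(1)[OF g]] e ..
  also have "\<dots> = u *\<^sub>R x + v *\<^sub>R y + (1 - (u + v)) *\<^sub>R g 0" by (simp add: algebra_simps)
  finally show "u *\<^sub>R x + v *\<^sub>R y \<in> {x. g x = x}" using uv by simp
qed

lemma codim_one_decomp:
  fixes V D :: "'a::euclidean_space set"
  assumes D: "subspace D" and V: "subspace V" and DV: "D \<subseteq> V" and dim: "dim V = dim D + 1"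
    and u: "u \<in> V" "norm u = 1" "\<forall>w\<in>D. u \<bullet> w = 0" and v: "v \<in> V"
  shows "v = oproj D v + (v \<bullet> u) *\<^sub>R u"
proof -
  have uu: "u \<bullet> u = 1" using u(2) by (simp add: norm_eq_1)
  have sD: "span D = D" using D by (simp add: span_eq_iff)
  have "u \<notin> span D" unfolding sD using u(3) uu by auto
  then have d: "dim (insert u D) = dim D + 1" by (simp add: dim_insert)
  have sub: "span (insert u D) \<subseteq> V" by (rule span_minimal) (use u(1) DV V in auto)
  have "span (insert u D) = V" by (rule subspace_dim_equal[OF subspace_span V sub]) (simp add: d dim)
  then have "v \<in> span (insert u D)" using v by simp
  then obtain k where "v - k *\<^sub>R u \<in> span D" by (metis span_breakdown_eq)
  then have k: "v - k *\<^sub>R u \<in> D" unfolding sD .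
  have "u \<bullet> (v - k *\<^sub>R u) = 0" using u(3) k by blast
  then have k': "k = v \<bullet> u" using uu by (simp add: inner_diff_right inner_commute)
  define d where "d = (v - k *\<^sub>R u) - oproj D v"
  have dD: "d \<in> D" unfolding d_def by (rule subspace_diff[OF D k oproj(1)[OF D]])
  have "(v - oproj D v) \<bullet> d = 0" by (rule oproj(2)[OF D dD])
  moreover have "u \<bullet> d = 0" using u(3) dD by blast
  moreover have "d \<bullet> d = (v - oproj D v) \<bullet> d - k * (u \<bullet> d)" by (simp add: d_def inner_diff_left inner_diff_right algebra_simps)
  ultimately have "d = 0" by simp
  then show ?thesis unfolding d_def k' by (simp add: algebra_simps)
qed

lemma cscale_real: "cscale c (u, 0) = (Re c *\<^sub>R u, Im c *\<^sub>R u)"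
  by (simp add: cscale_def)

text \<open>Real and imaginary parts are decomposed separately; their coefficients along
  \<open>u\<close> combine to \<open>c\<close>.\<close>

lemma codim_one_cx:
  fixes V D :: "'a::euclidean_space set"
  assumes D: "subspace D" and V: "subspace V" and DV: "D \<subseteq> V" and dim: "dim V = dim D + 1"
    and u: "u \<in> V" "norm u = 1" "\<forall>w\<in>D. u \<bullet> w = 0"
  shows "d \<in> V \<times> V \<longleftrightarrow> (\<exists>c. d = cproj D d + cscale c (u, 0))"
proof
  assume "d \<in> V \<times> V"
  then have "fst d \<in> V" "snd d \<in> V" by (simp_all add: mem_Times_iff)
  then have "fst d = oproj D (fst d) + (fst d \<bullet> u) *\<^sub>R u" "snd d = oproj D (snd d) + (snd d \<bullet> u) *\<^sub>R u"
    using codim_one_decomp[OF D V DV dim u] by blast+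
  then have "d = cproj D d + cscale (Complex (fst d \<bullet> u) (snd d \<bullet> u)) (u, 0)"
    by (simp add: prod_eq_iff cproj_def cscale_real)
  then show "\<exists>c. d = cproj D d + cscale c (u, 0)" by (rule exI)
next
  assume "\<exists>c. d = cproj D d + cscale c (u, 0)"
  then obtain c where c: "d = cproj D d + cscale c (u, 0)" by (rule exE)
  have "fst d = fst (cproj D d + cscale c (u, 0))" "snd d = snd (cproj D d + cscale c (u, 0))"
    by (rule arg_cong[OF c])+
  note a = this
  have "fst (cproj D d + cscale c (u, 0)) = oproj D (fst d) + Re c *\<^sub>R u"
    "snd (cproj D d + cscale c (u, 0)) = oproj D (snd d) + Im c *\<^sub>R u"
    by (simp_all add: cproj_def cscale_real)
  note b = this
  have "fst d = oproj D (fst d) + Re c *\<^sub>R u" by (rule trans[OF a(1) b(1)])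
  moreover have "snd d = oproj D (snd d) + Im c *\<^sub>R u" by (rule trans[OF a(2) b(2)])
  moreover have "oproj D y + t *\<^sub>R u \<in> V" for y t
    using subspace_add[OF V _ subspace_scale[OF V u(1)]] oproj(1)[OF D, of y] DV by blast
  ultimately show "d \<in> V \<times> V" by (metis mem_Times_iff)
qed

lemma codim_one_unit:
  fixes V D :: "'a::euclidean_space set"
  assumes D: "subspace D" and V: "subspace V" and DV: "D \<subseteq> V" and dim: "dim V = dim D + 1"
  obtains u where "u \<in> V" "norm u = 1" "\<forall>w\<in>D. u \<bullet> w = 0"
proof -
  have "\<not> V \<subseteq> D" using dim_subset[of V D] dim by auto
  then obtain v where v: "v \<in> V" "v \<notin> D" by blast
  define x where "x = v - oproj D v"
  have "x ~= 0" using v(2) oproj(1)[OF D, of v] by (auto simp: x_def)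
  moreover have "x \<in> V" unfolding x_def using subspace_diff[OF V v(1)] oproj(1)[OF D] DV by blast
  moreover have "x \<bullet> w = 0" if "w \<in> D" for w unfolding x_def by (rule oproj(2)[OF D that])
  ultimately show ?thesis by (intro that[of "x /\<^sub>R norm x"]) (simp_all add: subspace_scale[OF V])
qed

lemma codim_one_unit_unique:
  fixes V D :: "'a::euclidean_space set"
  assumes D: "subspace D" and V: "subspace V" and DV: "D \<subseteq> V" and dim: "dim V = dim D + 1"
    and u: "u \<in> V" "norm u = 1" "\<forall>w\<in>D. u \<bullet> w = 0"
    and v: "v \<in> V" "norm v = 1" "\<forall>w\<in>D. v \<bullet> w = 0"
  shows "v = u \<or> v = - u"
proof -
  have "oproj D v = 0" by (rule oproj_orth[OF D]) (use v(3) in blast)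
  then have e: "v = (v \<bullet> u) *\<^sub>R u" using codim_one_decomp[OF D V DV dim u v(1)] by simp
  have "norm v = \<bar>v \<bullet> u\<bar> * norm u" using arg_cong[OF e, of norm] by simp
  then have "v \<bullet> u = 1 \<or> v \<bullet> u = - 1" using u(2) v(2) by auto
  then show ?thesis using e by auto
qed

section \<open>Components of the stratum at a complex point\<close>

locale flat_stratum = extended_arrangement +
  fixes L :: "'a set"
  assumes L_flat: "flat \<H> L" and L_over: "lies_over \<A> L"
begin

abbreviation "T \<equiv> \<Union>w\<in>G. cx_map w ` complexify L"

lemma T_closed: "g \<in> G ==> z \<in> T ==> cx_map g z \<in> T"
proof -
  assume g: "g \<in> G" and z: "z \<in> T"
  obtain w where w0: "w \<in> G" "z \<in> cx_map w ` complexify L" using z by (rule UN_E)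
  obtain y where y: "z = cx_map w y" "y \<in> complexify L" using w0(2) by (rule imageE)
  note w = w0(1) y(2,1)
  have e: "cx_map g z = cx_map (%x. g (w x)) y" unfolding w(3) using cx_map_comp[OF g w(1)] by simp
  show ?thesis unfolding e by (rule UN_I[OF G_comp[OF g w(1)] imageI[OF w(2)]])
qed

sublocale stable_set G T
  by unfold_locales (rule T_closed)

lemma flat_supsets: "flat \<H> P ==> x \<in> P \<longleftrightarrow> (\<forall>H\<in>\<H>. P \<subseteq> H --> x \<in> H)"
  by (metis flat_mem subsetD)

lemma flat_ne: "flat \<H> P ==> P ~= {}"
  by (simp add: flat_def)

lemma flat_direction:
  assumes P: "flat \<H> P"
  shows "v \<in> direction P \<longleftrightarrow> (\<forall>H\<in>\<H>. P \<subseteq> H --> nv H \<bullet> v = 0)"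
proof -
  obtain a where a: "a \<in> P" using flat_ne[OF P] by blast
  have "v \<in> direction P \<longleftrightarrow> a + v \<in> P" using direction_affine(2)[OF flat_affine[OF P] a, of "a + v"] by simp
  also have "\<dots> \<longleftrightarrow> (\<forall>H\<in>\<H>. P \<subseteq> H --> a + v \<in> H)" by (rule flat_supsets[OF P])
  also have "\<dots> \<longleftrightarrow> (\<forall>H\<in>\<H>. P \<subseteq> H --> nv H \<bullet> v = 0)"
  proof -
    have "a + v \<in> H \<longleftrightarrow> nv H \<bullet> v = 0" if H: "H \<in> \<H>" "P \<subseteq> H" for H
    proof -
      have "nv H \<bullet> a = snd (nc H)" using H a H_mem[OF H(1)] by blast
      then show ?thesis by (simp add: H_mem[OF H(1)] inner_add_right)
    qed
    then show ?thesis by blast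
  qed
  finally show ?thesis .
qed

definition vanishes :: "'a set \<Rightarrow> 'a cx \<Rightarrow> bool" where
  "vanishes H z \<longleftrightarrow> sg H (fst z) = 0 \<and> nv H \<bullet> snd z = 0"

lemma complexify_flat_iff:
  assumes P: "flat \<H> P"
  shows "z \<in> complexify P \<longleftrightarrow> (\<forall>H\<in>\<H>. P \<subseteq> H --> vanishes H z)"
  unfolding complexify_iff flat_supsets[OF P, of "fst z"] flat_direction[OF P] vanishes_def using nc(2) by blast

text \<open>The smallest flat whose complexification contains \<open>z\<close>. A component of
  \<open>T\<close> passes through \<open>z\<close> exactly when its real flat contains
  \<open>supp z\<close>.\<close>

definition supp :: "'a cx \<Rightarrow> 'a set" where
  "supp z = \<Inter>{H \<in> \<H>. vanishes H z}"

lemma supp_mem: "x \<in> supp z \<longleftrightarrow> (\<forall>H\<in>\<H>. vanishes H z --> x \<in> H)"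
  by (auto simp: supp_def)

lemma fst_supp: "fst z \<in> supp z"
  unfolding supp_mem vanishes_def using nc(2) by blast

lemma supp_flat: "flat \<H> (supp z)"
  unfolding flat_def
proof (intro conjI exI[of _ "{H \<in> \<H>. vanishes H z}"])
  show "supp z ~= {}" using fst_supp by blast
qed (auto simp: supp_def)

text \<open>The real points \<open>fst z\<close> and \<open>fst z + snd z\<close> both lie in
  \<open>supp z\<close>, and a hyperplane containing them vanishes at \<open>z\<close>.\<close>

lemma supp_subset_H:
  assumes H: "H \<in> \<H>"
  shows "supp z \<subseteq> H \<longleftrightarrow> vanishes H z"
proof
  assume s: "supp z \<subseteq> H"
  have 1: "fst z \<in> H" using s fst_supp by blast
  have "fst z + snd z \<in> supp z"
    unfolding supp_mem
  proof (intro ballI impI)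
    fix H' assume H': "H' \<in> \<H>" "vanishes H' z"
    then show "fst z + snd z \<in> H'" by (simp add: nc(2) vanishes_def sg_def inner_add_right)
  qed
  then have "fst z + snd z \<in> H" using s by blast
  then show "vanishes H z" using 1 by (simp add: H_mem[OF H] vanishes_def sg_def inner_add_right)
next
  assume "vanishes H z"
  then show "supp z \<subseteq> H" using H by (auto simp: supp_mem)
qed

lemma supp_subset:
  assumes P: "flat \<H> P"
  shows "supp z \<subseteq> P \<longleftrightarrow> z \<in> complexify P"
proof
  assume s: "supp z \<subseteq> P"
  show "z \<in> complexify P"
    unfolding complexify_flat_iff[OF P]
  proof (intro ballI impI)
    fix H assume H: "H \<in> \<H>" "P \<subseteq> H"
    then have "supp z \<subseteq> H" using s by blast
    then show "vanishes H z" using supp_subset_H[OF H(1)] by blast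
  qed
next
  assume z: "z \<in> complexify P"
  show "supp z \<subseteq> P"
  proof
    fix x assume x: "x \<in> supp z"
    have "x \<in> H" if "H \<in> \<H>" "P \<subseteq> H" for H
      using that z x unfolding complexify_flat_iff[OF P] supp_mem by blast
    then show "x \<in> P" unfolding flat_supsets[OF P] by blast
  qed
qed

lemma supp_self: "z \<in> complexify (supp z)"
  using supp_subset[OF supp_flat] by blast

text \<open>Hyperplanes whose complexification misses \<open>z\<close> miss a whole neighbourhood:
  \<open>sg_gap\<close> separates the real parts, and the hyperplanes through \<open>fst z\<close>
  are finitely many, so the imaginary parts are separated as well.\<close>

lemma supp_near:
  obtains r where "r > 0" "\<forall>y\<in>ball z r. supp z \<subseteq> supp y"
proof -
  obtain \<epsilon>1 where e1: "\<epsilon>1 > 0" "!!H. H \<in> \<H> ==> sg H (fst z) = 0 \<or> \<epsilon>1 <= \<bar>sg H (fst z)\<bar>" using sg_gap[of "fst z"] by blast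
  let ?S = "{H \<in> \<H>. sg H (fst z) = 0 \<and> nv H \<bullet> snd z ~= 0}"
  have fin: "finite ?S" by (rule finite_subset[OF _ finite_sg_le[of "fst z" 0]]) auto
  define \<epsilon>2 where "\<epsilon>2 = Min (insert 1 ((%H. \<bar>nv H \<bullet> snd z\<bar>) ` ?S))"
  have e2: "\<epsilon>2 > 0" using fin by (auto simp: \<epsilon>2_def)
  have le2: "\<epsilon>2 <= \<bar>nv H \<bullet> snd z\<bar>" if "H \<in> ?S" for H unfolding \<epsilon>2_def using fin that by (intro Min_le) auto
  have key: "supp z \<subseteq> supp y" if y: "y \<in> ball z (min \<epsilon>1 \<epsilon>2)" for y
  proof -
    have d: "dist (fst z) (fst y) < \<epsilon>1" "dist (snd z) (snd y) < \<epsilon>2"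
      using y dist_fst_le[of z y] dist_snd_le[of z y] by simp_all
    have "vanishes H z" if H: "H \<in> \<H>" "vanishes H y" for H
    proof -
      have v: "sg H (fst y) = 0" "nv H \<bullet> snd y = 0" using H(2) by (simp_all add: vanishes_def)
      have "\<bar>sg H (fst z)\<bar> < \<epsilon>1" using sg_lipschitz[OF H(1), of "fst z" "fst y"] v(1) d(1) by simp
      then have 1: "sg H (fst z) = 0" using e1(2)[OF H(1)] by auto
      have "\<bar>nv H \<bullet> (snd z - snd y)\<bar> <= norm (nv H) * norm (snd z - snd y)" by (rule Cauchy_Schwarz_ineq2)
      then have "\<bar>nv H \<bullet> snd z\<bar> < \<epsilon>2" using v(2) nc(1)[OF H(1)] d(2) by (simp add: inner_diff_right dist_norm)
      then have "nv H \<bullet> snd z = 0" using le2[of H] H(1) 1 by force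
      then show ?thesis using 1 by (simp add: vanishes_def)
    qed
    then show ?thesis unfolding supp_def by blast
  qed
  show ?thesis
  proof (rule that)
    show "min \<epsilon>1 \<epsilon>2 > 0" using e1(1) e2 by simp
    show "\<forall>y\<in>ball z (min \<epsilon>1 \<epsilon>2). supp z \<subseteq> supp y" by (intro ballI key)
  qed
qed

lemma T_iff: "z \<in> T \<longleftrightarrow> (\<exists>g\<in>G. supp z \<subseteq> g ` L)"
proof -
  have "z \<in> T \<longleftrightarrow> (\<exists>g\<in>G. z \<in> cx_map g ` complexify L)" by (rule UN_iff)
  also have "\<dots> \<longleftrightarrow> (\<exists>g\<in>G. supp z \<subseteq> g ` L)"
    by (intro bex_cong HOL.refl) (simp add: cx_map_complexify[OF G_isom] supp_subset[OF flat_G[OF _ L_flat]])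
  finally show ?thesis .
qed

lemma flat_dim_eq: "flat \<H> P ==> flat \<H> Q ==> P \<subseteq> Q ==> aff_dim Q <= aff_dim P ==> P = Q"
  using affine_dim_equal[OF flat_affine flat_affine flat_ne] aff_dim_subset by (metis order_antisym)

lemma aff_dim_G: "g \<in> G ==> aff_dim (g ` P) = aff_dim P"
  by (rule aff_dim_isom[OF G_isom])

lemma flat_gL: "g \<in> G ==> flat \<H> (g ` L)"
  by (rule flat_G[OF _ L_flat])

lemma subspace_direction: "flat \<H> P ==> subspace (direction P)"
  using direction_affine(1)[OF flat_affine] flat_ne by blast

lemma dim_direction: "flat \<H> P ==> int (dim (direction P)) = aff_dim P"
  using direction_affine(3)[OF flat_affine] flat_ne by blast

text \<open>The flat of any component that comes near \<open>z\<close> contains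
  \<open>supp z\<close>, which already has the dimension of \<open>L\<close>; so all of them
  coincide.\<close>

lemma smooth_local:
  assumes g: "g \<in> G" and z: "supp z = g ` L"
  obtains r where "r > 0" "\<forall>y\<in>ball z r. y \<in> T \<longleftrightarrow> y - z \<in> direction (g ` L) \<times> direction (g ` L)"
proof -
  obtain r where r0: "r > 0" "\<forall>y\<in>ball z r. supp z \<subseteq> supp y" by (rule supp_near)
  note r = r0(1) bspec[OF r0(2)]
  have zc: "z \<in> complexify (g ` L)" using supp_self[of z] z by simp
  have key: "y \<in> T \<longleftrightarrow> y - z \<in> direction (g ` L) \<times> direction (g ` L)" if y: "y \<in> ball z r" for y
  proof -
    have "y \<in> T \<longleftrightarrow> supp y \<subseteq> g ` L"
    proof
      assume "y \<in> T"
      then obtain h where h: "h \<in> G" "supp y \<subseteq> h ` L" unfolding T_iff by (rule bexE)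
      then have "g ` L \<subseteq> h ` L" using r(2)[OF y] z by blast
      then have "g ` L = h ` L" by (rule flat_dim_eq[OF flat_gL[OF g] flat_gL[OF h(1)]]) (simp add: aff_dim_G g h(1))
      then show "supp y \<subseteq> g ` L" using h(2) by simp
    next
      assume "supp y \<subseteq> g ` L"
      then show "y \<in> T" unfolding T_iff by (rule bexI[OF _ g])
    qed
    then show ?thesis
      using supp_subset[OF flat_gL[OF g], of y] complexify_diff[OF flat_affine[OF flat_gL[OF g]] zc, of y] by simp
  qed
  show ?thesis by (intro that[OF r(1)] ballI key)
qed

lemma stab_supp:
  assumes s: "s \<in> stab z"
  shows "s ` supp z = supp z"
proof -
  have sG: "s \<in> G" "cx_map s z = z" using s by (simp_all add: stab_def)
  have "cx_map s z \<in> complexify (s ` supp z)"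
    using imageI[OF supp_self[of z], of "cx_map s"] unfolding cx_map_complexify[OF G_isom[OF sG(1)]] .
  then have "supp z \<subseteq> s ` supp z" unfolding sG(2) supp_subset[OF flat_G[OF sG(1) supp_flat]] .
  then have "supp z = s ` supp z"
    by (rule flat_dim_eq[OF supp_flat flat_G[OF sG(1) supp_flat]]) (simp add: aff_dim_G sG(1))
  then show ?thesis by (rule sym)
qed

lemma normal_smooth:
  assumes g: "g \<in> G" and z: "supp z = g ` L"
  shows "normal_germ z"
proof -
  obtain r where r0: "r > 0" "\<forall>y\<in>ball z r. y \<in> T \<longleftrightarrow> y - z \<in> direction (g ` L) \<times> direction (g ` L)"
    by (rule smooth_local[OF assms])
  note r = r0(1) bspec[OF r0(2)]
  have zT: "z \<in> T" unfolding T_iff using g z by blast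
  have st: "lin s v \<in> direction (g ` L)" if s: "s \<in> stab z" and v: "v \<in> direction (g ` L)" for s v
  proof -
    have "direction (s ` supp z) = lin s ` direction (supp z)"
      by (rule direction_image[OF G_isom]) (use s in \<open>simp add: stab_def\<close>)
    then have "direction (g ` L) = lin s ` direction (g ` L)" unfolding stab_supp[OF s] z using \<open>s ` supp z = supp z\<close> z by argo
    then show ?thesis using v by blast
  qed
  show ?thesis
    by (rule normal_germ_smooth[OF subspace_direction[OF flat_gL[OF g]] zT r(1), where \<Gamma> = "{}"]) (use r(2) st in auto)
qed

section \<open>Transversal rays at a flat of codimension one\<close>

abbreviation "PS \<equiv> pointwise_stabiliser G"

lemma PS_iff: "s \<in> PS P \<longleftrightarrow> s \<in> G \<and> (\<forall>x\<in>P. s x = x)"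
  by (simp add: pointwise_stabiliser_def)

lemma PS_lin:
  assumes s: "s \<in> PS P" and w: "w \<in> direction P"
  shows "lin s w = w"
proof -
  obtain x y where xy: "x \<in> P" "y \<in> P" "w = x - y" using w by (auto simp: direction_def)
  have "s x - s y = lin s (x - y)" by (rule isom_lin(5)[OF G_isom]) (use s in \<open>simp add: PS_iff\<close>)
  then show ?thesis using s xy by (simp add: PS_iff)
qed

lemma PS_stab:
  assumes s: "s \<in> PS P" and z: "z \<in> complexify P"
  shows "s \<in> stab z"
proof -
  have "s (fst z) = fst z" "lin s (snd z) = snd z"
    using s z PS_lin[OF s] by (simp_all add: PS_iff complexify_iff)
  then have "cx_map s (fst z, snd z) = (fst z, snd z)" unfolding cx_map_lin by simp
  then show ?thesis using s by (simp add: stab_def PS_iff)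
qed

text \<open>Directions of the rays orthogonal to \<open>P\<close> in the components containing
  \<open>P\<close>. If \<open>P\<close> has codimension one, each component contributes one opposite
  pair.\<close>

definition units :: "'a set \<Rightarrow> 'a set" where
  "units P = {u. norm u = 1 \<and> (\<forall>w\<in>direction P. u \<bullet> w = 0) \<and> (\<exists>h\<in>G. P \<subseteq> h ` L \<and> u \<in> direction (h ` L))}"

text \<open>Ray transitivity: the local form of the orbit condition, stated for the full group and
  for arbitrary flats, not only for those over the chamber.\<close>

definition RT :: "'a set \<Rightarrow> bool" where
  "RT P \<longleftrightarrow> (\<forall>u1\<in>units P. \<forall>u2\<in>units P. \<exists>s\<in>PS P. lin s u1 = u2)"

lemma direction_mono: "A \<subseteq> B ==> direction A \<subseteq> direction B"
  unfolding direction_def by blast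

lemma codim1:
  assumes P: "flat \<H> P" "aff_dim P = aff_dim L - 1" and h: "h \<in> G" "P \<subseteq> h ` L"
  shows "subspace (direction P)" "subspace (direction (h ` L))" "direction P \<subseteq> direction (h ` L)"
    "dim (direction (h ` L)) = dim (direction P) + 1"
proof -
  show "subspace (direction P)" "subspace (direction (h ` L))" "direction P \<subseteq> direction (h ` L)"
    using subspace_direction P(1) flat_gL[OF h(1)] direction_mono[OF h(2)] by blast+
  show "dim (direction (h ` L)) = dim (direction P) + 1"
    using dim_direction[OF P(1)] dim_direction[OF flat_gL[OF h(1)]] aff_dim_G[OF h(1), of L] P(2) by linarith
qed

lemma units_ex:
  assumes P: "flat \<H> P" "aff_dim P = aff_dim L - 1" and h: "h \<in> G" "P \<subseteq> h ` L"
  obtains u where "u \<in> units P" "u \<in> direction (h ` L)"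
proof -
  obtain u where "u \<in> direction (h ` L)" "norm u = 1" "\<forall>w\<in>direction P. u \<bullet> w = 0"
    by (rule codim_one_unit[OF codim1[OF P h]])
  then show ?thesis using h by (intro that[of u]) (auto simp: units_def)
qed

lemma unitsD: "u \<in> units P ==> norm u = 1" "u \<in> units P ==> \<forall>w\<in>direction P. u \<bullet> w = 0"
  by (simp_all add: units_def)

lemma units_orth: "u \<in> units P ==> w \<in> direction P ==> u \<bullet> w = 0"
  by (simp add: units_def)

lemma units_uminus: "u \<in> units P ==> - u \<in> units P"
  using subspace_neg[OF subspace_direction[OF flat_gL]] unfolding units_def by auto

lemma units_image:
  assumes g: "g \<in> G" and u: "u \<in> units P"
  shows "lin g u \<in> units (g ` P)"
proof -
  obtain h where h: "h \<in> G" "P \<subseteq> h ` L" "u \<in> direction (h ` L)" using u by (auto simp: units_def)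
  have gi: "isom g" by (rule G_isom[OF g])
  have s1: "g ` P \<subseteq> (%x. g (h x)) ` L" using image_mono[OF h(2), of g] by (simp add: image_image)
  have s2: "lin g u \<in> direction ((%x. g (h x)) ` L)"
    using direction_image[OF gi, of "h ` L"] h(3) by (simp add: image_image)
  have s3: "lin g u \<bullet> w = 0" if "w \<in> direction (g ` P)" for w
  proof -
    obtain v where v: "w = lin g v" "v \<in> direction P" using that unfolding direction_image[OF gi] using \<open>!!A. direction (g ` A) = lin g ` direction A\<close> \<open>w \<in> direction (g ` P)\<close> by auto
    show ?thesis unfolding v(1) isom_lin(2)[OF gi] by (rule units_orth[OF u v(2)])
  qed
  have n: "norm (lin g u) = 1" using isom_lin(3)[OF gi, of u] unitsD(1)[OF u] by simp
  show ?thesis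
    unfolding units_def by (intro CollectI conjI ballI bexI[OF _ G_comp[OF g h(1)]] n s1 s2 s3)
qed

lemma PS_image: "s \<in> PS P ==> s ` P = P"
  by (simp add: PS_iff)

text \<open>Near \<open>z\<close> only components containing \<open>P\<close> occur, and each of
  them is the complexified \<open>P\<close> plus the complex line of a unit normal.\<close>

lemma codim1_local:
  assumes P: "flat \<H> P" "aff_dim P = aff_dim L - 1" and z: "supp z = P"
  obtains r where "r > 0" "\<forall>y\<in>ball z r. y \<in> T \<longleftrightarrow> (\<exists>u\<in>units P. \<exists>c. y - z = cproj (direction P) (y - z) + cscale c (u, 0))"
proof -
  obtain r where r0: "r > 0" "\<forall>y\<in>ball z r. supp z \<subseteq> supp y" by (rule supp_near)
  note r = r0(1) bspec[OF r0(2)]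
  have key: "y \<in> T \<longleftrightarrow> (\<exists>u\<in>units P. \<exists>c. y - z = cproj (direction P) (y - z) + cscale c (u, 0))" if y: "y \<in> ball z r" for y
  proof
    assume "y \<in> T"
    then obtain h where h: "h \<in> G" "supp y \<subseteq> h ` L" unfolding T_iff by (rule bexE)
    have Ph: "P \<subseteq> h ` L" using r(2)[OF y] z h(2) by simp
    have c: "y \<in> complexify (h ` L)" by (rule iffD1[OF supp_subset[OF flat_gL[OF h(1)]] h(2)])
    have zc: "z \<in> complexify (h ` L)" by (rule iffD1[OF supp_subset[OF flat_gL[OF h(1)]]]) (simp add: z Ph)
    obtain u where u: "u \<in> units P" "u \<in> direction (h ` L)" by (rule units_ex[OF P h(1) Ph])
    have "y - z \<in> direction (h ` L) \<times> direction (h ` L)"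
      by (rule iffD1[OF complexify_diff[OF flat_affine[OF flat_gL[OF h(1)]] zc] c])
    then have "\<exists>c. y - z = cproj (direction P) (y - z) + cscale c (u, 0)"
      by (rule iffD1[OF codim_one_cx[OF codim1[OF P h(1) Ph] u(2) unitsD[OF u(1)]]])
    then show "(\<exists>u\<in>units P. \<exists>c. y - z = cproj (direction P) (y - z) + cscale c (u, 0))" by (rule bexI[OF _ u(1)])
  next
    assume "(\<exists>u\<in>units P. \<exists>c. y - z = cproj (direction P) (y - z) + cscale c (u, 0))"
    then obtain u where u: "u \<in> units P" "\<exists>c. y - z = cproj (direction P) (y - z) + cscale c (u, 0)" by (rule bexE)
    obtain h where h: "h \<in> G" "P \<subseteq> h ` L" "u \<in> direction (h ` L)" using u(1) by (auto simp: units_def)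
    have d: "y - z \<in> direction (h ` L) \<times> direction (h ` L)"
      by (rule iffD2[OF codim_one_cx[OF codim1[OF P h(1,2)] h(3) unitsD[OF u(1)]] u(2)])
    have zc: "z \<in> complexify (h ` L)" by (rule iffD1[OF supp_subset[OF flat_gL[OF h(1)]]]) (simp add: z h(2))
    have "y \<in> complexify (h ` L)" by (rule iffD2[OF complexify_diff[OF flat_affine[OF flat_gL[OF h(1)]] zc] d])
    then have "supp y \<subseteq> h ` L" by (rule iffD2[OF supp_subset[OF flat_gL[OF h(1)]]])
    then show "y \<in> T" unfolding T_iff by (rule bexI[OF _ h(1)])
  qed
  show ?thesis by (intro that[OF r(1)] ballI key)
qed

text \<open>Transitivity supplies an element reversing \<open>u\<close>, since \<open>- u\<close> is
  a ray too, and elements carrying the chosen component to all the others.\<close>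

lemma normal_RT:
  assumes P: "flat \<H> P" "aff_dim P = aff_dim L - 1" and z: "supp z = P" and h: "h \<in> G" "P \<subseteq> h ` L" and rt: "RT P"
  shows "normal_germ z"
proof -
  let ?D = "direction P"
  obtain r where r0: "r > 0" "\<forall>y\<in>ball z r. y \<in> T \<longleftrightarrow>
    (\<exists>u\<in>units P. \<exists>c. y - z = cproj ?D (y - z) + cscale c (u, 0))"
    by (rule codim1_local[OF P z])
  note r = r0(1) bspec[OF r0(2)]
  have zT: "z \<in> T" unfolding T_iff using h z by blast
  have zP: "z \<in> complexify P" using supp_self[of z] z by simp
  obtain u where u: "u \<in> units P" "u \<in> direction (h ` L)" by (rule units_ex[OF P h])
  obtain \<sigma> where s: "\<sigma> \<in> PS P" "lin \<sigma> u = - u" using rt units_uminus[OF u(1)] u(1) unfolding RT_def by blast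
  have D: "subspace ?D" by (rule subspace_direction[OF P(1)])
  show ?thesis
  proof (rule normal_germ_reflection[OF D zT r(1), where u = u and \<sigma> = \<sigma>])
    show "u \<bullet> w = 0" if "w \<in> ?D" for w by (rule units_orth[OF u(1) that])
    show "norm u = 1" by (rule unitsD(1)[OF u(1)])
    show "\<sigma> \<in> stab z" by (rule PS_stab[OF s(1) zP])
    show "lin \<sigma> w = w" if "w \<in> ?D" for w by (rule PS_lin[OF s(1) that])
    show "lin \<sigma> u = - u" by (rule s(2))
    fix y assume y: "y \<in> ball z r"
    show "y \<in> T \<longleftrightarrow> (\<exists>g\<in>stab z. (\<forall>w\<in>?D. lin g w = w) \<and>
        (\<exists>y' c. y' - z = cproj ?D (y' - z) + cscale c (u, 0) \<and> y = cx_map g y'))"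
    proof
      assume "y \<in> T"
      then have "\<exists>u\<in>units P. \<exists>c. y - z = cproj ?D (y - z) + cscale c (u, 0)" by (rule iffD1[OF r(2)[OF y]])
      then obtain u' where u0: "u' \<in> units P" "\<exists>c. y - z = cproj ?D (y - z) + cscale c (u', 0)" by (rule bexE)
      obtain c where c: "y - z = cproj ?D (y - z) + cscale c (u', 0)" using u0(2) by (rule exE)
      note u' = u0(1) c
      obtain g where g: "g \<in> PS P" "lin g u = u'" using rt u(1) u'(1) unfolding RT_def by blast
      have gG: "g \<in> G" using g(1) by (simp add: PS_iff)
      have gz: "g \<in> stab z" by (rule PS_stab[OF g(1) zP])
      define y' where "y' = z + (cproj ?D (y - z) + cscale c (u, 0))"
      have p: "cproj ?D (cproj ?D (y - z) + cscale c (u, 0)) = cproj ?D (y - z)"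
      proof -
        have lo: "linear (oproj ?D)" by (rule linear_oproj[OF D])
        have "oproj ?D u = 0" by (rule oproj_orth[OF D]) (rule units_orth[OF u(1)])
        moreover have "oproj ?D (oproj ?D x) = oproj ?D x" for x
          by (rule oproj_self[OF D oproj(1)[OF D]])
        ultimately show ?thesis
          by (simp add: cproj_def cscale_real linear_add[OF lo] linear_scale[OF lo])
      qed
      have 1: "y' - z = cproj ?D (y' - z) + cscale c (u, 0)" using p by (simp add: y'_def)
      have li: "linear (lin g)" by (rule isom_lin(1)[OF G_isom[OF gG]])
      have "cx_map g y' - cx_map g z = (lin g (fst (y' - z)), lin g (snd (y' - z)))"
        using cx_map_diff[OF gG, of y' z] by simp
      also have "\<dots> = cproj ?D (y - z) + cscale c (u', 0)"
        using PS_lin[OF g(1) oproj(1)[OF D]] g(2)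
        by (simp add: y'_def cproj_def cscale_real linear_add[OF li] linear_scale[OF li])
      also have "\<dots> = y - z" using u'(2) by simp
      finally have "cx_map g y' = y" using gz by (simp add: stab_def)
      then show "\<exists>g\<in>stab z. (\<forall>w\<in>?D. lin g w = w) \<and>
        (\<exists>y' c. y' - z = cproj ?D (y' - z) + cscale c (u, 0) \<and> y = cx_map g y')"
      proof (intro bexI[OF _ gz] conjI ballI exI[of _ y'] exI[of _ c])
        show "lin g w = w" if "w \<in> ?D" for w by (rule PS_lin[OF g(1) that])
        show "y' - z = cproj ?D (y' - z) + cscale c (u, 0)" by (rule 1)
        show "y = cx_map g y'" by (rule \<open>cx_map g y' = y\<close>[symmetric])
      qed
    next
      assume "\<exists>g\<in>stab z. (\<forall>w\<in>?D. lin g w = w) \<and>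
        (\<exists>y' c. y' - z = cproj ?D (y' - z) + cscale c (u, 0) \<and> y = cx_map g y')"
      then obtain g where g0: "g \<in> stab z" "(\<forall>w\<in>?D. lin g w = w) \<and>
        (\<exists>y' c. y' - z = cproj ?D (y' - z) + cscale c (u, 0) \<and> y = cx_map g y')" by (rule bexE)
      obtain y' where "\<exists>c. y' - z = cproj ?D (y' - z) + cscale c (u, 0) \<and> y = cx_map g y'"
        using g0(2)[THEN conjunct2] by (rule exE)
      then obtain c where c: "y' - z = cproj ?D (y' - z) + cscale c (u, 0) \<and> y = cx_map g y'" by (rule exE)
      have "\<exists>c. y' - z = cproj ?D (y' - z) + cscale c (u, 0)" using c[THEN conjunct1] by (rule exI)
      then have d: "y' - z \<in> direction (h ` L) \<times> direction (h ` L)"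
        by (rule iffD2[OF codim_one_cx[OF codim1[OF P h] u(2) unitsD[OF u(1)]]])
      have zc: "z \<in> complexify (h ` L)" by (rule iffD1[OF supp_subset[OF flat_gL[OF h(1)]]]) (simp add: z h(2))
      have "y' \<in> complexify (h ` L)" by (rule iffD2[OF complexify_diff[OF flat_affine[OF flat_gL[OF h(1)]] zc] d])
      then have "supp y' \<subseteq> h ` L" by (rule iffD2[OF supp_subset[OF flat_gL[OF h(1)]]])
      then have yT: "y' \<in> T" unfolding T_iff by (rule bexI[OF _ h(1)])
      have gG: "g \<in> G" using g0(1) by (simp add: stab_def)
      show "y \<in> T" unfolding c[THEN conjunct2] by (rule T_closed[OF gG yT])
    qed
  qed
qed

lemma finite_supsets:
  assumes P: "flat \<H> P"
  shows "finite {H \<in> \<H>. P \<subseteq> H}"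
proof -
  obtain x where x: "x \<in> P" using flat_ne[OF P] by blast
  have "{H \<in> \<H>. P \<subseteq> H} \<subseteq> {H \<in> \<H>. \<bar>sg H x\<bar> <= 0}"
  proof
    fix H assume "H \<in> {H \<in> \<H>. P \<subseteq> H}"
    then show "H \<in> {H \<in> \<H>. \<bar>sg H x\<bar> <= 0}" using x nc(2)[of H x] by auto
  qed
  then show ?thesis by (rule finite_subset[OF _ finite_sg_le])
qed

lemma flat_eq_Inter: "flat \<H> P ==> P = \<Inter>{H \<in> \<H>. P \<subseteq> H}"
  using flat_supsets[of P] by blast

text \<open>Finitely many hyperplanes contain \<open>P\<close>, hence finitely many flats do, and
  each accounts for at most two opposite rays.\<close>

lemma finite_units:
  assumes P: "flat \<H> P" "aff_dim P = aff_dim L - 1"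
  shows "finite (units P)"
proof -
  let ?Q = "{Q. flat \<H> Q \<and> P \<subseteq> Q}"
  have "?Q \<subseteq> Inter ` Pow {H \<in> \<H>. P \<subseteq> H}"
  proof
    fix Q assume Q: "Q \<in> ?Q"
    then have "Q = \<Inter>{H \<in> \<H>. Q \<subseteq> H}" using flat_eq_Inter by blast
    moreover have "{H \<in> \<H>. Q \<subseteq> H} \<in> Pow {H \<in> \<H>. P \<subseteq> H}" using Q by blast
    ultimately show "Q \<in> Inter ` Pow {H \<in> \<H>. P \<subseteq> H}" by (rule image_eqI)
  qed
  then have finQ: "finite ?Q" using finite_supsets[OF P(1)] by (meson finite_Pow_iff finite_imageI finite_subset)
  let ?U = "%Q. {u \<in> units P. \<exists>h\<in>G. Q = h ` L \<and> P \<subseteq> h ` L \<and> u \<in> direction (h ` L)}"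
  have "finite (?U Q)" for Q
  proof (cases "?U Q = {}")
    case True
    show ?thesis unfolding True by simp
  next
    case False
    then obtain u where u: "u \<in> ?U Q" by blast
    have "?U Q \<subseteq> {u, - u}"
    proof
      fix v assume v: "v \<in> ?U Q"
      obtain h where h: "h \<in> G" "P \<subseteq> h ` L" "u \<in> direction (h ` L)" "v \<in> direction (h ` L)" using u v by auto
      have "v = u \<or> v = - u"
        using codim_one_unit_unique[OF codim1[OF P h(1,2)] h(3) _ _ h(4)] unitsD u v by blast
      then show "v \<in> {u, - u}" by blast
    qed
    then show ?thesis by (rule finite_subset) simp
  qed
  then have "finite (\<Union>Q\<in>?Q. ?U Q)" using finQ by blast
  moreover have "units P \<subseteq> (\<Union>Q\<in>?Q. ?U Q)"
  proof
    fix u assume u: "u \<in> units P"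
    then obtain h where h: "h \<in> G" "P \<subseteq> h ` L" "u \<in> direction (h ` L)" by (auto simp: units_def)
    have "u \<in> ?U (h ` L)" using u h by blast
    moreover have "h ` L \<in> ?Q" using flat_gL[OF h(1)] h(2) by blast
    ultimately show "u \<in> (\<Union>Q\<in>?Q. ?U Q)" by blast
  qed
  ultimately show ?thesis by (rule finite_subset[rotated])
qed

text \<open>The condition \<open>nofix\<close> of \<open>nonnormal_germ\<close> holds because the
  stabiliser contains the reflections in the hyperplanes containing \<open>P\<close>: a vector fixed
  by all of these lies in the direction of \<open>P\<close>.\<close>

lemma nonnormal_not_RT:
  assumes P: "flat \<H> P" "aff_dim P = aff_dim L - 1" and z: "supp z = P" and st: "stab z = PS P" and rt: "\<not> RT P"
  shows "\<not> normal_germ z"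
proof -
  let ?D = "direction P"
  obtain r where r0: "r > 0" "\<forall>y\<in>ball z r. y \<in> T \<longleftrightarrow>
    (\<exists>u\<in>units P. \<exists>c. y - z = cproj ?D (y - z) + cscale c (u, 0))"
    by (rule codim1_local[OF P z])
  note r = r0(1) bspec[OF r0(2)]
  obtain u1 u2 where u: "u1 \<in> units P" "u2 \<in> units P" "!!s. s \<in> PS P ==> lin s u1 ~= u2" using rt unfolding RT_def by blast
  obtain h where "h \<in> G" "P \<subseteq> h ` L" using u(1) by (auto simp: units_def)
  then have zT: "z \<in> T" unfolding T_iff using z by blast
  show ?thesis
  proof (rule nonnormal_germ[OF subspace_direction[OF P(1)] zT r(1), where U = "units P"])
    show "lin g w = w" if "g \<in> stab z" "w \<in> ?D" for g w using PS_lin that st by blast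
    show "finite (units P)" by (rule finite_units[OF P])
    show "norm u = 1" if "u \<in> units P" for u by (rule unitsD(1)[OF that])
    show "u \<bullet> w = 0" if "u \<in> units P" "w \<in> ?D" for u w by (rule units_orth[OF that])
    show "- u \<in> units P" if "u \<in> units P" for u by (rule units_uminus[OF that])
    show "lin g u \<in> units P" if "g \<in> stab z" "u \<in> units P" for g u
    proof -
      have "g \<in> PS P" using that(1) st by simp
      then show ?thesis using units_image[of g u P] that(2) PS_image by (simp add: PS_iff)
    qed
    show "y \<in> T \<longleftrightarrow> (\<exists>u\<in>units P. \<exists>c. y - z = cproj ?D (y - z) + cscale c (u, 0))" if "y \<in> ball z r" for y
      by (rule r(2)[OF that])
    show "u1 \<in> units P" "u2 \<in> units P" by (rule u(1), rule u(2))
    show "lin g u1 ~= u2" if "g \<in> stab z" for g using u(3) that st by blast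
    fix n assume n: "!!w. w \<in> ?D ==> n \<bullet> w = 0" "!!g. g \<in> stab z ==> lin g n = n"
    have "n \<in> ?D"
      unfolding flat_direction[OF P(1)]
    proof (intro ballI impI)
      fix H assume H: "H \<in> \<H>" "P \<subseteq> H"
      have "orth_reflection H \<in> PS P"
        unfolding PS_iff using W_G[OF W_refl[OF H(1)]] refl_fixed[OF H(1)] H(2) by blast
      then have "lin (orth_reflection H) n = n" using n(2) st by blast
      moreover have "lin (orth_reflection H) n = n - (2 * (nv H \<bullet> n)) *\<^sub>R nv H"
        by (simp add: lin_def refl[OF H(1)] sg_def algebra_simps)
      ultimately have "(2 * (nv H \<bullet> n)) *\<^sub>R nv H = 0" by simp
      moreover have "nv H ~= 0" using nc(1)[OF H(1)] by force
      ultimately show "nv H \<bullet> n = 0" by simp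
    qed
    then show "n = 0" using n(1) by fastforce
  qed
qed

text \<open>By the covering lemma some point of \<open>P\<close> avoids every hyperplane not
  containing \<open>P\<close> and every fixed set of a group element not containing
  \<open>P\<close>; both families are countable.\<close>

lemma generic_point:
  assumes P: "flat \<H> P"
  obtains x where "x \<in> P" "supp (x, 0) = P" "stab (x, 0) = PS P"
proof -
  let ?N = "{H \<in> \<H>. \<not> P \<subseteq> H} \<union> (%g. {x. g x = x}) ` {g \<in> G. \<not> P \<subseteq> {x. g x = x}}"
  have cnt: "countable ?N"
    using countable_H countable_G by (intro countable_Un countable_image) (auto intro: countable_subset[rotated])
  have aff: "affine N" if "N \<in> ?N" for N
    using that H_affine affine_fixed_points[OF G_isom] by blast
  have "\<not> P \<subseteq> (\<Union>N\<in>?N. N)"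
  proof
    assume sub: "P \<subseteq> (\<Union>N\<in>?N. N)"
    have "\<exists>N\<in>?N. P \<subseteq> N"
      by (rule convex_covered_by_affine[OF affine_imp_convex[OF flat_affine[OF P]] flat_ne[OF P] cnt _ sub]) (rule aff)
    then show False by blast
  qed
  then obtain x where x0: "x \<in> P" "x \<notin> (\<Union>N\<in>?N. N)" by (meson subsetI)
  have xN: "x \<notin> N" if "N \<in> ?N" for N using x0(2) UN_I[OF that, of x "%N. N"] by metis
  have xH: "x \<in> H \<longleftrightarrow> P \<subseteq> H" if H: "H \<in> \<H>" for H
  proof -
    have "\<not> P \<subseteq> H ==> H \<in> ?N" using H by (intro UnI1) simp
    then show ?thesis using xN x0(1) by (meson subsetD)
  qed
  have "vanishes H (x, 0) \<longleftrightarrow> P \<subseteq> H" if "H \<in> \<H>" for H using xH[OF that] nc(2)[OF that, of x] by (simp add: vanishes_def)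
  then have "{H \<in> \<H>. vanishes H (x, 0)} = {H \<in> \<H>. P \<subseteq> H}" by blast
  then have s: "supp (x, 0) = P" unfolding supp_def using flat_eq_Inter[OF P] by simp
  have "stab (x, 0) = PS P"
  proof
    show "stab (x, 0) \<subseteq> PS P"
    proof
      fix g assume g: "g \<in> stab (x, 0)"
      then have gG: "g \<in> G" and "g x = x" by (simp_all add: stab_def cx_map_def)
      then have "x \<in> {x. g x = x}" by simp
      moreover have "\<not> P \<subseteq> {x. g x = x} ==> {x. g x = x} \<in> ?N"
        using gG by (intro UnI2 image_eqI[of _ _ g]) simp_all
      ultimately have "P \<subseteq> {x. g x = x}" using xN by meson
      then show "g \<in> PS P" using gG by (auto simp: PS_iff)
    qed
    show "PS P \<subseteq> stab (x, 0)" using PS_stab[of _ P "(x, 0)"] supp_self[of "(x, 0)"] s by auto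
  qed
  then show ?thesis by (rule that[OF x0(1) s])
qed

section \<open>Dimensions\<close>

text \<open>Complexified flats have twice the real dimension of the flats, so
  \<open>manifold_point_dim_le\<close> compares the chart dimension with the dimension of a
  flat.\<close>

lemma cdim_le:
  assumes cnt: "countable \<P>" and P: "!!P. P \<in> \<P> ==> flat \<H> P \<and> real_of_int (aff_dim P) <= e"
    and S: "S \<subseteq> q ` (T \<inter> \<Union>(complexify ` \<P>))"
  shows "cdim X S <= ereal e"
  unfolding cdim_def
proof (rule SUP_least)
  fix k assume "k \<in> {k. \<exists>x\<in>S. manifold_point X S x k}"
  then obtain x where "manifold_point X S x k" by blast
  then have "\<exists>Q\<in>complexify ` \<P>. 2 * int k <= aff_dim Q"
    by (rule manifold_point_dim_le[OF _ countable_image[OF cnt] S])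
  then obtain P where PP: "P \<in> \<P>" "2 * int k <= aff_dim (complexify P)" by blast
  obtain a where a: "a \<in> P" using P[OF PP(1)] flat_ne by blast
  have "int k <= aff_dim P" using PP(2) aff_dim_complexify[OF flat_affine a] P[OF PP(1)] by simp
  then have "real k <= e" using P[OF PP(1)] by linarith
  then show "ereal (real k) <= ereal e" by simp
qed

lemma cdim_ge: "manifold_point X S x k ==> x \<in> S ==> ereal (real k) <= cdim X S"
  unfolding cdim_def by (rule SUP_upper) blast

text \<open>The translates of \<open>L\<close> cover the stratum and bound its dimension; the bound
  is attained at a generic real point of \<open>L\<close>.\<close>

lemma cdim_top:
  shows "cdim X (topspace (ftop X)) = ereal (real_of_int (aff_dim L))"
proof (rule antisym)
  show "cdim X (topspace (ftop X)) <= ereal (real_of_int (aff_dim L))"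
  proof (rule cdim_le)
    show "countable ((%g. g ` L) ` G)" using countable_G by (rule countable_image)
    show "flat \<H> P \<and> real_of_int (aff_dim P) <= real_of_int (aff_dim L)" if "P \<in> (%g. g ` L) ` G" for P
      using that flat_gL aff_dim_G by auto
    show "topspace (ftop X) \<subseteq> q ` (T \<inter> \<Union>(complexify ` (%g. g ` L) ` G))"
    proof -
      have "T \<subseteq> \<Union>(complexify ` (%g. g ` L) ` G)"
      proof
        fix y assume "y \<in> T"
        then obtain g where g: "g \<in> G" "supp y \<subseteq> g ` L" unfolding T_iff by (rule bexE)
        then have "y \<in> complexify (g ` L)" using supp_subset[OF flat_gL[OF g(1)]] by simp
        then show "y \<in> \<Union>(complexify ` (%g. g ` L) ` G)" by (rule UnionI[OF imageI[OF imageI[OF g(1)]]])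
      qed
      then have "T \<inter> \<Union>(complexify ` (%g. g ` L) ` G) = T" by (rule Int_absorb2)
      then show ?thesis unfolding topspace_X by simp
    qed
  qed
  obtain x where x: "x \<in> L" "supp (x, 0) = L" "stab (x, 0) = PS L" by (rule generic_point[OF L_flat])
  have i: "(%x. x) \<in> G" "supp (x, 0) = (%x. x) ` L" using id_mem x(2) by simp_all
  obtain r1 where r10: "r1 > 0" "\<forall>y\<in>ball (x, 0) r1. y \<in> T \<longleftrightarrow> y - (x, 0) \<in> direction L \<times> direction L"
    by (rule smooth_local[OF i, unfolded image_ident])
  note r1 = r10(1) bspec[OF r10(2)]
  obtain r2 where r2: "r2 > 0" "!!g y. g \<in> G ==> y \<in> ball (x, 0) r2 ==> cx_map g y \<in> ball (x, 0) r2 ==> g \<in> stab (x, 0)"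
    using small_ball_ex[of "(x, 0)"] by metis
  let ?z = "(x, 0) :: 'a cx" and ?r = "min r1 r2"
  have zT: "?z \<in> T" unfolding T_iff using i by blast
  have "manifold_point X (topspace (ftop X)) (q ?z) (dim (direction L))"
  proof (rule manifold_pointI[OF zT subspace_direction[OF L_flat], where r = "?r"])
    show "?r > 0" using r1(1) r2(1) by simp
    show "g \<in> stab ?z" if "g \<in> G" "y \<in> ball ?z ?r" "cx_map g y \<in> ball ?z ?r" for g y
      using r2(2) that(1,2,3) by fastforce
    show "lin g v = v" if "g \<in> stab ?z" "v \<in> direction L" for g v using PS_lin that x(3) by blast
    show "?z + w \<in> T" if w: "w \<in> direction L \<times> direction L" "norm w < ?r" for w
    proof -
      have "?z + w \<in> ball ?z r1" using w(2) by (simp add: dist_norm)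
      moreover have "(?z + w) - ?z = w" by simp
      ultimately show ?thesis using r1(2) w(1) by metis
    qed
    show "topspace (ftop X) \<subseteq> q ` T" by (simp add: topspace_X)
    show "q y \<in> topspace (ftop X) \<longleftrightarrow> y - ?z \<in> direction L \<times> direction L" if "y \<in> T" "y \<in> ball ?z ?r" for y
    proof -
      have "y \<in> ball ?z r1" using that(2) by simp
      then show ?thesis using r1(2) that(1) unfolding topspace_X by blast
    qed
  qed
  moreover have "q ?z \<in> topspace (ftop X)" unfolding topspace_X using zT by (rule imageI)
  ultimately have "ereal (real (dim (direction L))) <= cdim X (topspace (ftop X))" by (rule cdim_ge)
  moreover have "real (dim (direction L)) = real_of_int (aff_dim L)" using dim_direction[OF L_flat] by linarith
  ultimately show "ereal (real_of_int (aff_dim L)) <= cdim X (topspace (ftop X))" by simp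
qed

lemma countable_flats: "countable {P. flat \<H> P}"
proof -
  have "{P. flat \<H> P} \<subseteq> Inter ` {\<S>. finite \<S> \<and> \<S> \<subseteq> \<H>}"
  proof
    fix P assume "P \<in> {P. flat \<H> P}"
    then have P: "flat \<H> P" by simp
    show "P \<in> Inter ` {\<S>. finite \<S> \<and> \<S> \<subseteq> \<H>}"
    proof (rule image_eqI[where f = Inter and x = "{H \<in> \<H>. P \<subseteq> H}"])
      show "P = \<Inter>{H \<in> \<H>. P \<subseteq> H}" by (rule flat_eq_Inter[OF P])
      show "{H \<in> \<H>. P \<subseteq> H} \<in> {\<S>. finite \<S> \<and> \<S> \<subseteq> \<H>}" using finite_supsets[OF P] by blast
    qed
  qed
  moreover have "countable (Inter ` {\<S>. finite \<S> \<and> \<S> \<subseteq> \<H>})"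
    by (intro countable_image countable_Collect_finite_subset countable_H)
  ultimately show ?thesis by (rule countable_subset)
qed

lemma mem_nonnormal_locus: "y \<in> T ==> q y \<in> nonnormal_locus X \<longleftrightarrow> \<not> normal_germ y"
  using normal_domain_stalk_iff unfolding nonnormal_locus_def topspace_X by blast

text \<open>The support of a nonnormal point has codimension at least 2 in its component, since
  \<open>normal_smooth\<close> settles codimension 0 and \<open>normal_RT\<close> codimension
  1.\<close>

theorem normal_if_RT:
  assumes rt: "!!P g. flat \<H> P ==> g \<in> G ==> P \<subseteq> g ` L ==> aff_dim P = aff_dim L - 1 ==> RT P"
  shows "normal_in_codim_1 X"
proof -
  let ?P = "{P. flat \<H> P \<and> aff_dim P <= aff_dim L - 2}"
  have "cdim X (nonnormal_locus X) <= ereal (real_of_int (aff_dim L) - 2)"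
  proof (rule cdim_le)
    show "countable ?P" by (rule countable_subset[OF _ countable_flats]) blast
    show "flat \<H> P \<and> real_of_int (aff_dim P) <= real_of_int (aff_dim L) - 2" if "P \<in> ?P" for P
    proof -
      have "aff_dim P <= aff_dim L - 2" using that by blast
      then have "real_of_int (aff_dim P) <= real_of_int (aff_dim L - 2)" by (rule of_int_le_iff[THEN iffD2])
      then show ?thesis using that by simp
    qed
    show "nonnormal_locus X \<subseteq> q ` (T \<inter> \<Union>(complexify ` ?P))"
      unfolding nonnormal_locus_X
    proof (rule image_mono, rule subsetI)
      fix z assume "z \<in> {z \<in> T. \<not> normal_germ z}"
      then have z: "z \<in> T" "\<not> normal_germ z" by simp_all
      obtain g where g: "g \<in> G" "supp z \<subseteq> g ` L" using z(1) unfolding T_iff by (rule bexE)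
      have le: "aff_dim (supp z) <= aff_dim L" using aff_dim_subset[OF g(2)] aff_dim_G[OF g(1)] by simp
      have "aff_dim (supp z) ~= aff_dim L"
      proof
        assume "aff_dim (supp z) = aff_dim L"
        then have "supp z = g ` L" by (intro flat_dim_eq[OF supp_flat flat_gL[OF g(1)] g(2)]) (simp add: aff_dim_G[OF g(1)])
        then show False using normal_smooth[OF g(1)] z(2) by blast
      qed
      moreover have "aff_dim (supp z) ~= aff_dim L - 1"
      proof
        assume d: "aff_dim (supp z) = aff_dim L - 1"
        show False using normal_RT[OF supp_flat d HOL.refl g rt[OF supp_flat g d]] z(2) by blast
      qed
      ultimately have "supp z \<in> ?P" using le supp_flat by simp
      then show "z \<in> T \<inter> \<Union>(complexify ` ?P)" using z(1) supp_self[of z] by blast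
    qed
  qed
  then have "ereal (real_of_int (aff_dim L)) - ereal (real_of_int (aff_dim L) - 2) <= codim X (nonnormal_locus X)"
    unfolding codim_def cdim_top by (rule ereal_minus_mono[OF order_refl])
  then have "ereal 2 <= codim X (nonnormal_locus X)" by simp
  then show ?thesis unfolding normal_in_codim_1_def by (rule less_le_trans[rotated]) (simp add: one_ereal_def)
qed

text \<open>If transitivity failed at \<open>P\<close>, then near a generic real point of
  \<open>P\<close> the nonnormal locus would be exactly the image of the complexified
  \<open>P\<close>, a manifold of codimension one in the stratum.\<close>

theorem RT_if_normal:
  assumes nrm: "normal_in_codim_1 X" and P: "flat \<H> P" "aff_dim P = aff_dim L - 1" and h: "h \<in> G" "P \<subseteq> h ` L"
  shows "RT P"
proof (rule ccontr)
  assume rt: "\<not> RT P"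
  obtain x where x: "x \<in> P" "supp (x, 0) = P" "stab (x, 0) = PS P" by (rule generic_point[OF P(1)])
  let ?z = "(x, 0) :: 'a cx" and ?D = "direction P"
  obtain r1 where r10: "r1 > 0" "\<forall>y\<in>ball ?z r1. supp ?z \<subseteq> supp y" by (rule supp_near)
  note r1 = r10(1) bspec[OF r10(2)]
  obtain r2 where r2: "r2 > 0" "!!g y. g \<in> G ==> y \<in> ball ?z r2 ==> cx_map g y \<in> ball ?z r2 ==> g \<in> stab ?z"
    using small_ball_ex[of "(x, 0)"] by metis
  let ?r = "min r1 r2"
  have zP: "?z \<in> complexify P" using supp_self[of ?z] x(2) by simp
  have zT: "?z \<in> T" unfolding T_iff using h x(2) by blast
  \<comment> \<open>Close to the generic point, all points of the complexified \<open>P\<close> have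
    support \<open>P\<close> and the same stabiliser, so nonnormality holds at each of them.\<close>
  have non: "\<not> normal_germ y" if y: "y \<in> complexify P" "y \<in> ball ?z ?r" for y
  proof (rule nonnormal_not_RT[OF P _ _ rt])
    show "supp y = P" using r1(2)[of y] y(2) x(2) supp_subset[OF P(1), of y] y(1) by auto
    show "stab y = PS P"
    proof
      show "PS P \<subseteq> stab y" using PS_stab y(1) by blast
      show "stab y \<subseteq> PS P"
      proof
        fix g assume "g \<in> stab y"
        then have "g \<in> G" "cx_map g y = y" by (simp_all add: stab_def)
        then show "g \<in> PS P" using r2(2)[of g y] y(2) x(3) by simp
      qed
    qed
  qed
  have "manifold_point X (nonnormal_locus X) (q ?z) (dim ?D)"
  proof (rule manifold_pointI[OF zT subspace_direction[OF P(1)], where r = "?r"])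
    show "?r > 0" using r1(1) r2(1) by simp
    show "g \<in> stab ?z" if "g \<in> G" "y \<in> ball ?z ?r" "cx_map g y \<in> ball ?z ?r" for g y
      using r2(2) that(1,2,3) by fastforce
    show "lin g v = v" if "g \<in> stab ?z" "v \<in> ?D" for g v using PS_lin that x(3) by blast
    show "?z + w \<in> T" if w: "w \<in> ?D \<times> ?D" "norm w < ?r" for w
    proof -
      have "(?z + w) - ?z = w" by simp
      then have "?z + w \<in> complexify P" using complexify_diff[OF flat_affine[OF P(1)] zP] w(1) by metis
      then have "supp (?z + w) \<subseteq> P" using supp_subset[OF P(1)] by blast
      then show ?thesis unfolding T_iff using h by blast
    qed
    show "nonnormal_locus X \<subseteq> q ` T" unfolding nonnormal_locus_X by (rule image_mono) blast
    show "q y \<in> nonnormal_locus X \<longleftrightarrow> y - ?z \<in> ?D \<times> ?D" if y: "y \<in> T" "y \<in> ball ?z ?r" for y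
      unfolding mem_nonnormal_locus[OF y(1)] complexify_diff[OF flat_affine[OF P(1)] zP, symmetric]
    proof
      assume n: "\<not> normal_germ y"
      obtain g where g: "g \<in> G" "supp y \<subseteq> g ` L" using y(1) unfolding T_iff by (rule bexE)
      have Py: "P \<subseteq> supp y" using r1(2)[of y] y(2) x(2) by simp
      show "y \<in> complexify P"
      proof (rule ccontr)
        assume "y \<notin> complexify P"
        then have "P ~= supp y" using supp_self[of y] by metis
        then have "\<not> aff_dim (supp y) <= aff_dim P" using flat_dim_eq[OF P(1) supp_flat Py] by blast
        then have "supp y = g ` L"
          by (intro flat_dim_eq[OF supp_flat flat_gL[OF g(1)] g(2)]) (simp add: aff_dim_G[OF g(1)] P(2))
        then show False using normal_smooth[OF g(1)] n by blast
      qed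
    next
      assume "y \<in> complexify P"
      then show "\<not> normal_germ y" using non y(2) by blast
    qed
  qed
  moreover have "\<not> normal_germ ?z" using non[OF zP] r1(1) r2(1) by simp
  then have "q ?z \<in> nonnormal_locus X" using mem_nonnormal_locus[OF zT] by blast
  ultimately have "ereal (real (dim ?D)) <= cdim X (nonnormal_locus X)" by (rule cdim_ge)
  moreover have "real (dim ?D) = real_of_int (aff_dim L) - 1" using dim_direction[OF P(1)] P(2) by linarith
  ultimately have "ereal (real_of_int (aff_dim L) - 1) <= cdim X (nonnormal_locus X)" by simp
  then have "codim X (nonnormal_locus X) <= ereal (real_of_int (aff_dim L)) - ereal (real_of_int (aff_dim L) - 1)"
    unfolding codim_def cdim_top by (rule ereal_minus_mono[OF order_refl])
  then have "codim X (nonnormal_locus X) <= 1" by (simp add: one_ereal_def)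
  then show False using nrm unfolding normal_in_codim_1_def by (meson not_less)
qed

end

context flat_stratum
begin

section \<open>Faces and transversal rays\<close>

lemma G_inv_apply: "g \<in> G ==> inv_into UNIV g (g x) = x" "g \<in> G ==> g (inv_into UNIV g x) = x"
  using isom_inv_apply[OF G_isom] by blast+

lemma flat_interior_G_subset:
  assumes g: "g \<in> G" and P: "flat \<H> P"
  shows "g ` flat_interior \<H> P \<subseteq> flat_interior \<H> (g ` P)"
  unfolding flat_interior_eq[OF P] flat_interior_eq[OF flat_G[OF g P]]
proof
  fix y assume "y \<in> g ` {x \<in> P. \<forall>H\<in>\<H>. x \<in> H --> P \<subseteq> H}"
  then obtain x where x: "x \<in> P" "\<forall>H\<in>\<H>. x \<in> H --> P \<subseteq> H" "y = g x" by blast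
  have "g ` P \<subseteq> H" if H: "H \<in> \<H>" "g x \<in> H" for H
  proof -
    have "inv_into UNIV g ` H \<in> \<H>" by (rule G_image[OF G_inverse[OF g] H(1)])
    moreover have "x \<in> inv_into UNIV g ` H" using imageI[OF H(2), of "inv_into UNIV g"] G_inv_apply(1)[OF g] by simp
    ultimately have "P \<subseteq> inv_into UNIV g ` H" using x(2) by blast
    then have "g ` P \<subseteq> g ` inv_into UNIV g ` H" by (rule image_mono)
    then show "g ` P \<subseteq> H" using G_inv_apply(2)[OF g] by (simp add: image_image)
  qed
  then show "y \<in> {x \<in> g ` P. \<forall>H\<in>\<H>. x \<in> H --> g ` P \<subseteq> H}" using x(1,3) by blast
qed

lemma flat_interior_G:
  assumes g: "g \<in> G" and P: "flat \<H> P"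
  shows "g ` flat_interior \<H> P = flat_interior \<H> (g ` P)"
proof
  show "g ` flat_interior \<H> P \<subseteq> flat_interior \<H> (g ` P)" by (rule flat_interior_G_subset[OF assms])
  have "inv_into UNIV g ` flat_interior \<H> (g ` P) \<subseteq> flat_interior \<H> (inv_into UNIV g ` g ` P)"
    by (rule flat_interior_G_subset[OF G_inverse[OF g] flat_G[OF g P]])
  moreover have "inv_into UNIV g ` g ` P = P" using G_inv_apply(1)[OF g] by (simp add: image_image)
  ultimately have "g ` inv_into UNIV g ` flat_interior \<H> (g ` P) \<subseteq> g ` flat_interior \<H> P" by (metis image_mono)
  then show "flat_interior \<H> (g ` P) \<subseteq> g ` flat_interior \<H> P" using G_inv_apply(2)[OF g] by (simp add: image_image)
qed

lemma cell_K:
  assumes k: "k \<in> K" and P: "flat \<H> P"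
  shows "k ` cell P = cell (k ` P)"
proof -
  have i: "inj k" using isom_inj[OF K_isom[OF k]] by (simp add: inj_def)
  have "k ` closure \<A> = closure \<A>"
  proof
    show "k ` closure \<A> \<subseteq> closure \<A>" using K_closure[OF k] by blast
    show "closure \<A> \<subseteq> k ` closure \<A>"
    proof
      fix x assume "x \<in> closure \<A>"
      then have "inv_into UNIV k x \<in> closure \<A>" using K_closure[OF K_inv[OF k]] by simp
      then show "x \<in> k ` closure \<A>" using isom_inv_apply(2)[OF K_isom[OF k], of x] by (metis imageI)
    qed
  qed
  then show ?thesis
    unfolding flat_interior_cell[OF P, symmetric] flat_interior_cell[OF flat_G[OF K_G[OF k] P], symmetric]
      image_Int[OF i] flat_interior_G[OF K_G[OF k] P] by simp
qed

lemma cell_inj: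
  assumes P: "flat \<H> P" and Q: "flat \<H> Q" and eq: "cell P = cell Q" and ne: "cell P ~= {}"
  shows "P = Q"
proof
  obtain p where p: "p \<in> cell P" using ne by blast
  have pQ: "p \<in> cell Q" using p eq by simp
  show "P \<subseteq> Q" by (rule cell_hull[OF P p flat_affine[OF Q]]) (use eq cell_subset[of Q] in simp)
  show "Q \<subseteq> P" by (rule cell_hull[OF Q pQ flat_affine[OF P]]) (use eq[symmetric] cell_subset[of P] in simp)
qed

text \<open>One direction holds because a nonempty face spans its flat and flats are closed. For the
  other, a short step from \<open>x\<close> towards a point of \<open>cell Q\<close> enters
  \<open>cell Q\<close>.\<close>

lemma cell_subset_closure_cell:
  assumes P: "flat \<H> P" "cell P ~= {}" and Q: "flat \<H> Q" "cell Q ~= {}"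
  shows "cell P \<subseteq> closure (cell Q) \<longleftrightarrow> P \<subseteq> Q"
proof
  assume c: "cell P \<subseteq> closure (cell Q)"
  have "closed Q" using flat_affine[OF Q(1)] by (metis affine_hull_eq closed_affine_hull)
  then have "closure (cell Q) \<subseteq> Q" by (rule closure_minimal[OF cell_subset])
  then have cP: "cell P \<subseteq> Q" using c by blast
  obtain p where "p \<in> cell P" using P(2) by blast
  then show "P \<subseteq> Q" using cell_hull[OF P(1) _ flat_affine[OF Q(1)] cP] by blast
next
  assume PQ: "P \<subseteq> Q"
  obtain b where b: "b \<in> cell Q" using Q(2) by blast
  show "cell P \<subseteq> closure (cell Q)"
  proof
    fix x assume x: "x \<in> cell P"
    have xA: "sg H x >= 0" if "H \<in> \<H>" for H using cell_closure[OF x] that by (simp add: closure_chamber)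
    show "x \<in> closure (cell Q)"
      unfolding closure_approachable
    proof (intro allI impI)
      fix e :: real assume e: "e > 0"
      define t where "t = min 1 (e / (2 * (norm (b - x) + 1)))"
      have np: "norm (b - x) + 1 > 0" by (simp add: add_nonneg_pos)
      have t: "0 < t" "t <= 1" using e np by (simp_all add: t_def)
      have d: "t * norm (b - x) < e" unfolding t_def using scaled_norm_less[OF e] .
      let ?y = "(1 - t) *\<^sub>R x + t *\<^sub>R b"
      have "?y \<in> Q" using flat_affine[OF Q(1)] x b cell_subset PQ unfolding affine_def
        by (metis diff_add_cancel subsetD)
      moreover have "sg H ?y > 0" if H: "H \<in> \<H>" "\<not> Q \<subseteq> H" for H
      proof -
        have "0 <= (1 - t) * sg H x" using xA[OF H(1)] t by simp
        moreover have "0 < t * sg H b" using t(1) cell_sg[OF b H] by simp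
        ultimately show ?thesis unfolding sg_affine by linarith
      qed
      ultimately have "?y \<in> cell Q" by (auto simp: cell_def)
      moreover have "dist ?y x = t * norm (b - x)"
        using t by (simp add: dist_norm algebra_simps flip: scaleR_diff_right)
      ultimately show "\<exists>y\<in>cell Q. dist y x < e" using d by metis
    qed
  qed
qed

text \<open>The set of faces in the theorem, indexed by flats: inclusion in a closure has become
  inclusion of flats.\<close>

definition facets :: "'a set \<Rightarrow> 'a set set" where
  "facets P = {F. \<exists>w\<in>G. F = cell (w ` L) \<and> cell (w ` L) ~= {} \<and> P \<subseteq> w ` L}"

lemma facets_eq:
  assumes P: "flat \<H> P" "cell P ~= {}"
  shows "{F \<in> Sigma_faces \<H> \<A> K L. flat_interior \<H> P \<inter> closure \<A> \<subseteq> closure F} = facets P"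
proof -
  have S: "Sigma_faces \<H> \<A> K L = {cell (w ` L) | w. w \<in> G \<and> cell (w ` L) ~= {}}"
  proof -
    have 1: "w ` flat_interior \<H> L \<inter> closure \<A> = cell (w ` L)" if "w \<in> G" for w
      using flat_interior_G[OF that L_flat] flat_interior_cell[OF flat_gL[OF that]] by simp
    have 2: "lies_over \<A> (w ` L) \<longleftrightarrow> cell (w ` L) ~= {}" if "w \<in> G" for w
      by (rule lies_over_cell[OF flat_gL[OF that]])
    show ?thesis unfolding Sigma_faces_def using 1 2 by (intro Collect_cong) metis
  qed
  have c: "cell P \<subseteq> closure (cell (w ` L)) \<longleftrightarrow> P \<subseteq> w ` L" if "w \<in> G" "cell (w ` L) ~= {}" for w
    by (rule cell_subset_closure_cell[OF P flat_gL[OF that(1)] that(2)])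
  show ?thesis
    unfolding S flat_interior_cell[OF P(1)] facets_def using c by (intro Collect_cong) (smt (verit) mem_Collect_eq)
qed

lemma H_point_normal: "H \<in> \<H> ==> e \<in> H ==> sg H x = nv H \<bullet> (x - e)"
  using sg_diff[of H x e] nc(2)[of H e] by simp

lemma flat_decomp:
  assumes P: "flat \<H> P" "aff_dim P = aff_dim L - 1" and h: "h \<in> G" "P \<subseteq> h ` L"
    and u: "u \<in> units P" "u \<in> direction (h ` L)" and e: "e \<in> P" and x: "x \<in> h ` L"
  obtains w where "w \<in> direction P" "x = e + w + ((x - e) \<bullet> u) *\<^sub>R u"
proof -
  have "e \<in> h ` L" using e h(2) by blast
  then have "x - e \<in> direction (h ` L)" using x direction_affine(2)[OF flat_affine[OF flat_gL[OF h(1)]]] by blast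
  then have "x - e = oproj (direction P) (x - e) + ((x - e) \<bullet> u) *\<^sub>R u"
    using codim_one_decomp[OF codim1[OF P h] u(2) unitsD[OF u(1)]] by blast
  then have "x = e + oproj (direction P) (x - e) + ((x - e) \<bullet> u) *\<^sub>R u" by (simp add: algebra_simps)
  then show ?thesis using oproj(1)[OF subspace_direction[OF P(1)]] by (intro that)
qed

lemma codim1_hyperplane:
  assumes P: "flat \<H> P" "aff_dim P = aff_dim L - 1" and h: "h \<in> G" "P \<subseteq> h ` L"
  obtains H where "H \<in> \<H>" "P \<subseteq> H" "\<not> h ` L \<subseteq> H"
proof -
  have "P ~= h ` L" using P(2) aff_dim_G[OF h(1), of L] by auto
  then obtain x where x: "x \<in> h ` L" "x \<notin> P" using h(2) by blast
  obtain H where "H \<in> \<H>" "P \<subseteq> H" "x \<notin> H" by (rule flat_mem[OF P(1) x(2)])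
  then show ?thesis using that x(1) by blast
qed

lemma facet_not_cell:
  assumes P: "flat \<H> P" "aff_dim P = aff_dim L - 1" and h: "h \<in> G" "P \<subseteq> h ` L" and e: "e \<in> P"
  shows "e \<notin> cell (h ` L)"
proof
  assume ec: "e \<in> cell (h ` L)"
  obtain H where H: "H \<in> \<H>" "P \<subseteq> H" "\<not> h ` L \<subseteq> H" by (rule codim1_hyperplane[OF P h])
  have "sg H e > 0" by (rule cell_sg[OF ec H(1,3)])
  moreover have "e \<in> H" using e H(2) by blast
  ultimately show False using nc(2)[OF H(1), of e] by simp
qed

text \<open>Among the hyperplanes not containing \<open>Q\<close>, those containing \<open>P\<close>
  have the same sign along the ray as at \<open>b\<close>, and the others remain positive as long as
  \<open>t\<close> is below the gap at \<open>e\<close>.\<close>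

lemma ray_cell:
  assumes P: "flat \<H> P" and e: "e \<in> cell P" and PQ: "P \<subseteq> Q" and Q: "flat \<H> Q"
    and u: "u \<in> direction Q" "norm u = 1" and b: "b \<in> cell Q" and w: "w \<in> direction P" and c: "c > 0"
    and beq: "b = e + w + c *\<^sub>R u"
  obtains \<delta> where "\<delta> > 0" "\<forall>t. 0 < t --> t < \<delta> --> e + t *\<^sub>R u \<in> cell Q"
proof -
  have eP: "e \<in> P" using e cell_subset by blast
  obtain \<epsilon> where eps: "\<epsilon> > 0" "!!H. H \<in> \<H> ==> sg H e = 0 \<or> \<epsilon> <= \<bar>sg H e\<bar>" using sg_gap[of e] by blast
  have key: "e + t *\<^sub>R u \<in> cell Q" if t: "0 < t" "t < \<epsilon>" for t
  proof -
    have "e \<in> Q" using eP PQ by blast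
    then have mem: "e + t *\<^sub>R u \<in> Q"
      using direction_affine(2)[OF flat_affine[OF Q], of e "e + t *\<^sub>R u"] subspace_scale[OF subspace_direction[OF Q] u(1)] by simp
    have "sg H (e + t *\<^sub>R u) > 0" if H: "H \<in> \<H>" "\<not> Q \<subseteq> H" for H
    proof (cases "P \<subseteq> H")
      case True
      have eH: "e \<in> H" using eP True by blast
      have "nv H \<bullet> w = 0" using flat_direction[OF P, of w] w H(1) True by blast
      then have "sg H b = c * (nv H \<bullet> u)" unfolding H_point_normal[OF H(1) eH] beq by (simp add: inner_add_right)
      then have "nv H \<bullet> u > 0" using cell_sg[OF b H] c by (simp add: zero_less_mult_iff)
      then show ?thesis unfolding H_point_normal[OF H(1) eH] using t by simp
    next
      case False
      have "sg H e >= \<epsilon>" using cell_sg[OF e H(1) False] eps(2)[OF H(1)] by simp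
      moreover have "\<bar>sg H (e + t *\<^sub>R u) - sg H e\<bar> <= t" using sg_lipschitz[OF H(1), of "e + t *\<^sub>R u" e] t u(2) by (simp add: dist_norm)
      ultimately show ?thesis using t(2) by linarith
    qed
    then show ?thesis using mem by (auto simp: cell_def)
  qed
  show ?thesis by (intro that[OF eps(1)] allI impI key)
qed

text \<open>A point of the open face of the larger flat lies strictly on one side of
  \<open>P\<close>; of the two unit normals the one pointing to that side is taken.\<close>

lemma facet_ray:
  assumes P: "flat \<H> P" "aff_dim P = aff_dim L - 1" and h: "h \<in> G" "P \<subseteq> h ` L"
    and e: "e \<in> cell P" and ne: "cell (h ` L) ~= {}"
  obtains u \<delta> where "u \<in> units P" "u \<in> direction (h ` L)" "\<delta> > 0"
    "\<forall>t. 0 < t --> t < \<delta> --> e + t *\<^sub>R u \<in> cell (h ` L)"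
proof -
  obtain u0 where u0: "u0 \<in> units P" "u0 \<in> direction (h ` L)" by (rule units_ex[OF P h])
  obtain b where b: "b \<in> cell (h ` L)" using ne by blast
  have eP: "e \<in> P" using e cell_subset by blast
  have bL: "b \<in> h ` L" using b cell_subset by blast
  obtain w where w: "w \<in> direction P" "b = e + w + ((b - e) \<bullet> u0) *\<^sub>R u0" by (rule flat_decomp[OF P h u0 eP bL])
  define c where "c = (b - e) \<bullet> u0"
  have "c ~= 0"
  proof
    assume "c = 0"
    then have "b - e = w" using w(2) by (simp add: c_def)
    then have "b \<in> P" using direction_affine(2)[OF flat_affine[OF P(1)] eP, of b] w(1) by simp
    then show False using facet_not_cell[OF P h] b by blast
  qed
  then consider "c > 0" | "- c > 0" by linarith
  then show ?thesis
  proof cases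
    case 1
    obtain \<delta> where "\<delta> > 0" "\<forall>t. 0 < t --> t < \<delta> --> e + t *\<^sub>R u0 \<in> cell (h ` L)"
      by (rule ray_cell[OF P(1) e h(2) flat_gL[OF h(1)] u0(2) unitsD(1)[OF u0(1)] b w(1) 1 w(2)[folded c_def]])
    then show ?thesis by (rule that[OF u0])
  next
    case 2
    have nu: "- u0 \<in> units P" "- u0 \<in> direction (h ` L)"
      using units_uminus[OF u0(1)] subspace_neg[OF subspace_direction[OF flat_gL[OF h(1)]] u0(2)] by blast+
    have "b = e + w + (- c) *\<^sub>R (- u0)" using w(2)[folded c_def] by simp
    note beq = this
    obtain \<delta> where "\<delta> > 0" "\<forall>t. 0 < t --> t < \<delta> --> e + t *\<^sub>R (- u0) \<in> cell (h ` L)"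
      by (rule ray_cell[OF P(1) e h(2) flat_gL[OF h(1)] nu(2) unitsD(1)[OF nu(1)] b w(1) 2 beq])
    then show ?thesis by (rule that[OF nu])
  qed
qed

text \<open>Minimising the distance to a point of the chamber over the stabiliser of \<open>e\<close> in the reflection
  group moves a short ray issuing from \<open>e\<close> into the closed chamber.\<close>

lemma ray_fold:
  assumes P: "flat \<H> P" "aff_dim P = aff_dim L - 1" and h: "h \<in> G" "P \<subseteq> h ` L"
    and u: "u \<in> units P" "u \<in> direction (h ` L)" and e: "e \<in> cell P"
  obtains w t where "w \<in> W" "w \<in> PS P" "t > 0" "w (e + t *\<^sub>R u) \<in> cell (w ` h ` L)"
proof -
  have eP: "e \<in> P" using e cell_subset by blast
  obtain \<epsilon> where eps: "\<epsilon> > 0" "!!H. H \<in> \<H> ==> sg H e = 0 \<or> \<epsilon> <= \<bar>sg H e\<bar>" using sg_gap[of e] by blast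
  define t where "t = \<epsilon> / 2"
  have t: "t > 0" "t < \<epsilon>" using eps(1) by (simp_all add: t_def)
  define y where "y = e + t *\<^sub>R u"
  \<comment> \<open>As \<open>e\<close> lies in the open face of \<open>P\<close>, hyperplanes
    through \<open>e\<close> contain \<open>P\<close>. Words in them fix \<open>P\<close> pointwise
    and give only finitely many maps, so a minimum exists.\<close>
  let ?E = "{H \<in> \<H>. e \<in> H}"
  have PE: "P \<subseteq> H" if H: "H \<in> ?E" for H
  proof (rule ccontr)
    assume "\<not> P \<subseteq> H"
    then have "sg H e > 0" using cell_sg[OF e] H by simp
    then show False using H nc(2)[of H e] by simp
  qed
  have fixP: "wd Hs x = x" if "Hs \<in> lists ?E" "x \<in> P" for Hs x
    using that
  proof (induction Hs)
    case (Cons H Hs)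
    have H: "H \<in> ?E" using Cons.hyps by simp
    then have "x \<in> H" using PE Cons.prems by blast
    then show ?case using Cons refl_fixed[of H x] H by simp
  qed simp
  have sub: "wd ` lists ?E \<subseteq> W" unfolding W_words by (rule image_mono) auto
  have "wd ` lists ?E \<subseteq> {w \<in> W. dist (w e) e <= 0}" using sub fixP[OF _ eP] by auto
  then have fin: "finite (wd ` lists ?E)" by (rule finite_subset[OF _ finite_W_dist])
  have "wd ` lists ?E ~= {}" by blast
  then obtain w where "is_arg_min (%w. dist (w y) a0) (%w. w \<in> wd ` lists ?E) w"
    using ex_is_arg_min_if_finite[OF fin, of "%w. dist (w y) a0"] by blast
  then have am: "w \<in> wd ` lists ?E \<and> (\<forall>v. v \<in> wd ` lists ?E --> dist (w y) a0 <= dist (v y) a0)"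
    unfolding is_arg_min_linorder .
  then obtain Hs where Hs: "Hs \<in> lists ?E" "w = wd Hs" by blast
  have wW: "w \<in> W" using am sub by blast
  have wi: "isom w" by (rule W_isom[OF wW])
  have wPS: "w \<in> PS P" unfolding PS_iff using W_G[OF wW] fixP[OF Hs(1)] Hs(2) by simp
  have wy: "w y = e + t *\<^sub>R lin w u"
    unfolding y_def isom_lin(4)[OF wi] linear_scale[OF isom_lin(1)[OF wi]] using fixP[OF Hs(1) eP] Hs(2) by simp
  have nonneg: "sg H (w y) >= 0" if H: "H \<in> ?E" for H
  proof (rule ccontr)
    assume n: "\<not> sg H (w y) >= 0"
    have HH: "H \<in> \<H>" using H by simp
    have "wd (H # Hs) \<in> wd ` lists ?E" using Hs(1) H by (intro imageI) simp
    then have "dist (w y) a0 <= dist (wd (H # Hs) y) a0" using am by blast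
    then have "(dist (w y) a0)^2 <= (dist (orth_reflection H (w y)) a0)^2" using Hs(2) by (intro power_mono) simp_all
    then have "0 <= 4 * sg H (w y) * sg H a0" using refl_dist_sq[OF HH, of "w y" a0] by linarith
    then show False using n sg_a0[OF HH] by (simp add: zero_le_mult_iff)
  qed
  have pos: "sg H (w y) > 0" if H: "H \<in> \<H>" "e \<notin> H" for H
  proof -
    have "sg H e > 0" using cell_closure[OF e] H nc(2)[OF H(1), of e] by (simp add: closure_chamber order_less_le)
    then have "sg H e >= \<epsilon>" using eps(2)[OF H(1)] by auto
    moreover have "norm (lin w u) = 1" using isom_lin(3)[OF wi, of u] unitsD(1)[OF u(1)] by simp
    then have "dist (w y) e = t" unfolding wy using t(1) by (simp add: dist_norm)
    then have "\<bar>sg H (w y) - sg H e\<bar> <= t" using sg_lipschitz[OF H(1), of "w y" e] by simp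
    ultimately show ?thesis using t(2) by linarith
  qed
  have yQ: "y \<in> h ` L"
  proof -
    have "e \<in> h ` L" using eP h(2) by blast
    then show ?thesis
      using direction_affine(2)[OF flat_affine[OF flat_gL[OF h(1)]], of e y]
        subspace_scale[OF subspace_direction[OF flat_gL[OF h(1)]] u(2)] by (simp add: y_def)
  qed
  have "sg H (w y) > 0" if H: "H \<in> \<H>" "\<not> w ` h ` L \<subseteq> H" for H
  proof (cases "e \<in> H")
    case True
    have HE: "H \<in> ?E" using H(1) True by simp
    \<comment> \<open>A hyperplane containing \<open>P\<close> and the point \<open>w y\<close> of
      the ray contains the whole translated flat.\<close>
    have "sg H (w y) ~= 0"
    proof
      assume 0: "sg H (w y) = 0"
      have "t * (nv H \<bullet> lin w u) = 0" using 0 unfolding H_point_normal[OF H(1) True] wy by simp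
      then have nu: "nv H \<bullet> lin w u = 0" using t(1) by simp
      have "w x \<in> H" if x: "x \<in> h ` L" for x
      proof -
        obtain v where v: "v \<in> direction P" "x = e + v + ((x - e) \<bullet> u) *\<^sub>R u" by (rule flat_decomp[OF P h u eP x])
        define c where "c = (x - e) \<bullet> u"
        have "w x = w (e + (v + c *\<^sub>R u))" using v(2) by (simp add: c_def add.assoc)
        also have "\<dots> = e + (v + c *\<^sub>R lin w u)"
          unfolding isom_lin(4)[OF wi] linear_add[OF isom_lin(1)[OF wi]] linear_scale[OF isom_lin(1)[OF wi]]
          using PS_lin[OF wPS v(1)] fixP[OF Hs(1) eP] Hs(2) by simp
        finally have "w x = e + (v + c *\<^sub>R lin w u)" .
        moreover have "nv H \<bullet> v = 0" using flat_direction[OF P(1), of v] v(1) H(1) PE[OF HE] by blast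
        ultimately have "sg H (w x) = 0" unfolding H_point_normal[OF H(1) True] by (simp add: inner_add_right nu)
        then show ?thesis using nc(2)[OF H(1)] by simp
      qed
      then show False using H(2) by blast
    qed
    then show ?thesis using nonneg[OF HE] by simp
  next
    case False
    then show ?thesis using pos[OF H(1)] by blast
  qed
  then have "w y \<in> cell (w ` h ` L)" using yQ by (auto simp: cell_def)
  then show ?thesis using that[OF wW wPS t(1)] unfolding y_def by blast
qed

text \<open>Reflections fixing \<open>P\<close> fold both rays into the chamber. Some
  \<open>k\<close> in \<open>K\<close> fixing \<open>P\<close> relates the two facets reached, and
  applying \<open>w1\<close>, then \<open>k\<close>, then the inverse of \<open>w2\<close> carries
  \<open>u1\<close> to \<open>u2\<close> or \<open>- u2\<close>. The negative sign would put a point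
  of \<open>P\<close> into the open face of a larger flat.\<close>

lemma RT_of_orbit:
  assumes P: "flat \<H> P" "aff_dim P = aff_dim L - 1" and ne: "cell P ~= {}"
    and orb: "single_orbit (pointwise_stabiliser K P) (facets P)"
  shows "RT P"
  unfolding RT_def
proof (intro ballI)
  fix u1 u2 assume u1: "u1 \<in> units P" and u2: "u2 \<in> units P"
  obtain e where e: "e \<in> cell P" using ne by blast
  have eP: "e \<in> P" using e cell_subset by blast
  obtain h1 where h1: "h1 \<in> G" "P \<subseteq> h1 ` L" "u1 \<in> direction (h1 ` L)" using u1 by (auto simp: units_def)
  obtain h2 where h2: "h2 \<in> G" "P \<subseteq> h2 ` L" "u2 \<in> direction (h2 ` L)" using u2 by (auto simp: units_def)
  obtain w1 t1 where w1: "w1 \<in> W" "w1 \<in> PS P" "t1 > 0" "w1 (e + t1 *\<^sub>R u1) \<in> cell (w1 ` h1 ` L)"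
    by (rule ray_fold[OF P h1(1,2) u1 h1(3) e])
  obtain w2 t2 where w2: "w2 \<in> W" "w2 \<in> PS P" "t2 > 0" "w2 (e + t2 *\<^sub>R u2) \<in> cell (w2 ` h2 ` L)"
    by (rule ray_fold[OF P h2(1,2) u2 h2(3) e])
  have facet: "cell (w ` h ` L) \<in> facets P" if "w \<in> PS P" "h \<in> G" "P \<subseteq> h ` L" "cell (w ` h ` L) ~= {}" for w h
  proof -
    have "w ` h ` L = (%x. w (h x)) ` L" by (simp add: image_image)
    moreover have "P \<subseteq> w ` h ` L" using image_mono[OF that(3), of w] PS_image[OF that(1)] by simp
    moreover have "(%x. w (h x)) \<in> G" using G_comp that(1,2) by (simp add: PS_iff)
    ultimately show ?thesis unfolding facets_def using that(4) by (intro CollectI bexI[of _ "%x. w (h x)"]) simp_all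
  qed
  let ?F1 = "cell (w1 ` h1 ` L)" and ?F2 = "cell (w2 ` h2 ` L)"
  have F: "?F1 \<in> facets P" "?F2 \<in> facets P" using facet w1 w2 h1 h2 by blast+
  obtain F0 where F0: "facets P = (%g. g ` F0) ` pointwise_stabiliser K P" using orb unfolding single_orbit_def by blast
  obtain k1 where k1: "k1 \<in> pointwise_stabiliser K P" "?F1 = k1 ` F0" using F(1) unfolding F0 by blast
  obtain k2 where k2: "k2 \<in> pointwise_stabiliser K P" "?F2 = k2 ` F0" using F(2) unfolding F0 by blast
  have kK: "k1 \<in> K" "k2 \<in> K" and kP: "!!x. x \<in> P ==> k1 x = x" "!!x. x \<in> P ==> k2 x = x"
    using k1(1) k2(1) by (simp_all add: pointwise_stabiliser_def)
  define k where "k = (%x. k2 (inv_into UNIV k1 x))"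
  have k: "k \<in> K" unfolding k_def by (rule K_comp[OF kK(2) K_inv[OF kK(1)]])
  have kfix: "k x = x" if "x \<in> P" for x
    using kP[OF that] isom_inv_apply(1)[OF K_isom[OF kK(1)], of x] by (simp add: k_def)
  have kF: "k ` ?F1 = ?F2"
    unfolding k1(2) k2(2) k_def using isom_inv_apply(1)[OF K_isom[OF kK(1)]] by (simp add: image_image)
  define g where "g = (%x. k (w1 x))"
  have w1G: "w1 \<in> G" and w2G: "w2 \<in> G" using w1(2) w2(2) by (simp_all add: PS_iff)
  have gG: "g \<in> G" unfolding g_def by (rule G_comp[OF K_G[OF k] w1G])
  have gPS: "g \<in> PS P" using gG kfix w1(2) by (simp add: PS_iff g_def)
  have gi: "isom g" and wi: "isom w2" using G_isom gG w2G by blast+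
  define h2' where "h2' = (%x. w2 (h2 x))"
  have h2': "h2' \<in> G" "h2' ` L = w2 ` h2 ` L" "P \<subseteq> h2' ` L"
    using G_comp[OF w2G h2(1)] image_mono[OF h2(2), of w2] PS_image[OF w2(2)] by (simp_all add: h2'_def image_image)
  define h1' where "h1' = (%x. w1 (h1 x))"
  have h1': "h1' \<in> G" "h1' ` L = w1 ` h1 ` L"
    using G_comp[OF w1G h1(1)] by (simp_all add: h1'_def image_image)
  have Q: "k ` h1' ` L = h2' ` L"
  proof (rule cell_inj[OF flat_G[OF K_G[OF k] flat_gL[OF h1'(1)]] flat_gL[OF h2'(1)]])
    show c: "cell (k ` h1' ` L) = cell (h2' ` L)"
      using cell_K[OF k flat_gL[OF h1'(1)]] kF h1'(2) h2'(2) by simp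
    show "cell (k ` h1' ` L) ~= {}" unfolding c h2'(2) using w2(4) by blast
  qed
  define v1 where "v1 = lin g u1"
  define v2 where "v2 = lin w2 u2"
  have gQ: "g ` h1 ` L = h2' ` L" using Q unfolding h1'(2) g_def by (simp add: image_image)
  have v1: "v1 \<in> units P" "v1 \<in> direction (h2' ` L)"
    using units_image[OF gG u1] PS_image[OF gPS] direction_image[OF gi, of "h1 ` L"] gQ h1(3) by (auto simp: v1_def)
  have v2: "v2 \<in> units P" "v2 \<in> direction (h2' ` L)"
    using units_image[OF w2G u2] PS_image[OF w2(2)] direction_image[OF wi, of "h2 ` L"] h2'(2) h2(3) by (auto simp: v2_def)
  have ge: "g (e + s *\<^sub>R u1) = e + s *\<^sub>R v1" for s
    unfolding isom_lin(4)[OF gi] linear_scale[OF isom_lin(1)[OF gi]] v1_def using gPS eP by (simp add: PS_iff)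
  have we: "w2 (e + s *\<^sub>R u2) = e + s *\<^sub>R v2" for s
    unfolding isom_lin(4)[OF wi] linear_scale[OF isom_lin(1)[OF wi]] v2_def using w2(2) eP by (simp add: PS_iff)
  have "v1 = v2 \<or> v1 = - v2"
    by (rule codim_one_unit_unique[OF codim1[OF P h2'(1,3)] v2(2) unitsD[OF v2(1)] v1(2) unitsD[OF v1(1)]])
  moreover have "v1 ~= - v2"
  proof
    assume n: "v1 = - v2"
    let ?C = "cell (h2' ` L)"
    have p2: "e + t2 *\<^sub>R v2 \<in> ?C" using w2(4) we[of t2] h2'(2) by simp
    have "k (w1 (e + t1 *\<^sub>R u1)) \<in> k ` ?F1" using w1(4) by (rule imageI)
    then have "g (e + t1 *\<^sub>R u1) \<in> ?F2" unfolding kF g_def .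
    then have p1: "e + t1 *\<^sub>R v1 \<in> ?C" using ge[of t1] h2'(2) by simp
    define s where "s = t1 + t2"
    have s: "s > 0" using w1(3) w2(3) by (simp add: s_def)
    \<comment> \<open>With these weights the terms in \<open>v1 = - v2\<close> cancel, and the
      convex combination is \<open>e\<close>.\<close>
    have "(t1 / s) *\<^sub>R (e + t2 *\<^sub>R v2) + (t2 / s) *\<^sub>R (e + t1 *\<^sub>R v1) \<in> ?C"
      by (rule convexD[OF convex_cell[OF flat_gL[OF h2'(1)]] p2 p1])
        (use w1(3) w2(3) s in \<open>simp_all add: s_def add_divide_distrib[symmetric]\<close>)
    moreover have "(t1 / s) *\<^sub>R (e + t2 *\<^sub>R v2) + (t2 / s) *\<^sub>R (e + t1 *\<^sub>R v1) = (t1 / s + t2 / s) *\<^sub>R e"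
      unfolding n by (simp add: algebra_simps)
    moreover have "t1 / s + t2 / s = 1" using s by (simp add: s_def add_divide_distrib[symmetric])
    ultimately have "e \<in> ?C" by simp
    then show False using facet_not_cell[OF P h2'(1,3) eP] by blast
  qed
  ultimately have veq: "v1 = v2" by blast
  define s where "s = (%x. inv_into UNIV w2 (g x))"
  have sG: "s \<in> G" unfolding s_def by (rule G_comp[OF G_inverse[OF w2G] gG])
  have sx: "s x = x" if "x \<in> P" for x
  proof -
    have "g x = w2 x" using gPS w2(2) that by (simp add: PS_iff)
    then show ?thesis unfolding s_def using isom_inv_apply(1)[OF wi] by simp
  qed
  have "s (e + u1) = e + u2"
  proof -
    have "g (e + u1) = w2 (e + u2)" using ge[of 1] we[of 1] veq by simp
    then show ?thesis unfolding s_def using isom_inv_apply(1)[OF wi] by simp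
  qed
  then have "lin s u1 = u2" using isom_lin(4)[OF G_isom[OF sG], of e u1] sx[OF eP] by simp
  moreover have "s \<in> PS P" using sG sx by (simp add: PS_iff)
  ultimately show "\<exists>s\<in>PS P. lin s u1 = u2" by blast
qed

lemma fixed_flat:
  assumes P: "flat \<H> P" and e: "cell P ~= {}" and g: "g \<in> G" and fx: "!!x. x \<in> cell P ==> g x = x"
  shows "x \<in> P ==> g x = x"
proof -
  assume x: "x \<in> P"
  obtain p where p: "p \<in> cell P" using e by blast
  have "P \<subseteq> {x. g x = x}"
    by (rule cell_hull[OF P p affine_fixed_points[OF G_isom[OF g]]]) (use fx in blast)
  then show ?thesis using x by blast
qed

text \<open>Transitivity gives \<open>g\<close>, a product of \<open>k\<close> in \<open>K\<close>
  and \<open>w\<close> in the reflection group, carrying the ray of \<open>L\<close> to that of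
  another facet. Points of both rays lie in the closed chamber, which is a fundamental domain, so
  \<open>w\<close> fixes \<open>P\<close> and a point of the ray; hence \<open>k\<close> already
  does what \<open>g\<close> does.\<close>

lemma orbit_of_RT:
  assumes P: "flat \<H> P" "aff_dim P = aff_dim L - 1" and ne: "cell P ~= {}" and PL: "P \<subseteq> L" and rt: "RT P"
  shows "single_orbit (pointwise_stabiliser K P) (facets P)"
  unfolding single_orbit_def
proof (intro bexI[of _ "cell L"])
  have i: "(%x. x) \<in> G" "(%x. x) ` L = L" using id_mem by simp_all
  have cL: "cell L ~= {}" using lies_over_cell[OF L_flat] L_over by simp
  show "cell L \<in> facets P" unfolding facets_def using i cL PL by (intro CollectI bexI[OF _ i(1)]) simp
  obtain e where e: "e \<in> cell P" using ne by blast
  have eP: "e \<in> P" using e cell_subset by blast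
  show "facets P = (%g. g ` cell L) ` pointwise_stabiliser K P"
  proof
    show "(%g. g ` cell L) ` pointwise_stabiliser K P \<subseteq> facets P"
    proof (intro image_subsetI)
      fix k assume "k \<in> pointwise_stabiliser K P"
      then have k: "k \<in> K" "!!x. x \<in> P ==> k x = x" by (simp_all add: pointwise_stabiliser_def)
      have "P \<subseteq> k ` L"
      proof
        fix x assume x: "x \<in> P"
        show "x \<in> k ` L" by (rule image_eqI[of _ _ x]) (use k(2)[OF x] x PL in auto)
      qed
      moreover have "k ` cell L = cell (k ` L)" by (rule cell_K[OF k(1) L_flat])
      moreover have "k ` cell L ~= {}" using cL by simp
      ultimately show "k ` cell L \<in> facets P"
        unfolding facets_def by (intro CollectI bexI[OF _ K_G[OF k(1)]]) simp
    qed
    show "facets P \<subseteq> (%g. g ` cell L) ` pointwise_stabiliser K P"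
    proof
      fix F assume "F \<in> facets P"
      then obtain h where h: "h \<in> G" "F = cell (h ` L)" "cell (h ` L) ~= {}" "P \<subseteq> h ` L" unfolding facets_def by blast
      have ci: "cell ((%x. x) ` L) ~= {}" "P \<subseteq> (%x. x) ` L" using cL PL by simp_all
      obtain u \<delta> where u: "u \<in> units P" "u \<in> direction ((%x. x) ` L)" "\<delta> > 0"
          "\<forall>t. 0 < t --> t < \<delta> --> e + t *\<^sub>R u \<in> cell ((%x. x) ` L)"
        by (rule facet_ray[OF P i(1) ci(2) e ci(1)])
      obtain u' \<delta>' where u': "u' \<in> units P" "u' \<in> direction (h ` L)" "\<delta>' > 0"
          "\<forall>t. 0 < t --> t < \<delta>' --> e + t *\<^sub>R u' \<in> cell (h ` L)"
        by (rule facet_ray[OF P h(1,4) e h(3)])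
      obtain g where g: "g \<in> PS P" "lin g u = u'" using rt u(1) u'(1) unfolding RT_def by blast
      have gG: "g \<in> G" using g(1) by (simp add: PS_iff)
      obtain k w where kw: "k \<in> K" "w \<in> W" "g = (%x. k (w x))" using gG unfolding G_iff by blast
      have wA: "w x = x" if x: "x \<in> closure \<A>" "g x \<in> closure \<A>" for x
      proof (rule fundamental_domain(1)[OF kw(2) x(1)])
        show "w x \<in> closure \<A>" using x(2) K_closure[OF kw(1)] kw(3) by simp
      qed
      have "w x = x" if x: "x \<in> cell P" for x
      proof (rule wA)
        show "x \<in> closure \<A>" by (rule cell_closure[OF x])
        have "x \<in> P" using x cell_subset by blast
        then show "g x \<in> closure \<A>" using g(1) cell_closure[OF x] by (simp add: PS_iff)
      qed
      then have wP: "w x = x" if "x \<in> P" for x using fixed_flat[OF P(1) ne W_G[OF kw(2)]] that by blast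
      have kP: "k x = x" if x: "x \<in> P" for x
      proof -
        have "g x = x" using g(1) x by (simp add: PS_iff)
        then show ?thesis using wP[OF x] kw(3) by simp
      qed
      define t where "t = min \<delta> \<delta>' / 2"
      have t: "0 < t" "t < \<delta>" "t < \<delta>'" using u(3) u'(3) by (simp_all add: t_def min_def field_simps)
      have gt: "g (e + t *\<^sub>R u) = e + t *\<^sub>R u'"
        unfolding isom_lin(4)[OF G_isom[OF gG]] linear_scale[OF isom_lin(1)[OF G_isom[OF gG]]] g(2)
        using g(1) eP by (simp add: PS_iff)
      have "w (e + t *\<^sub>R u) = e + t *\<^sub>R u"
      proof (rule wA)
        show "e + t *\<^sub>R u \<in> closure \<A>" by (rule cell_closure[OF u(4)[rule_format, OF t(1,2)]])
        show "g (e + t *\<^sub>R u) \<in> closure \<A>" unfolding gt by (rule cell_closure[OF u'(4)[rule_format, OF t(1,3)]])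
      qed
      then have "k (e + t *\<^sub>R u) = e + t *\<^sub>R u'" using gt kw(3) by simp
      then have "e + t *\<^sub>R lin k u = e + t *\<^sub>R u'"
        unfolding isom_lin(4)[OF K_isom[OF kw(1)]] linear_scale[OF isom_lin(1)[OF K_isom[OF kw(1)]]] using kP[OF eP] by simp
      then have ku: "lin k u = u'" using t(1) by simp
      have kG: "k \<in> G" by (rule K_G[OF kw(1)])
      have "h ` L = k ` L"
      proof (rule flat_dim_eq[OF flat_gL[OF h(1)] flat_gL[OF kG]])
        show "aff_dim (k ` L) <= aff_dim (h ` L)" using aff_dim_G[OF kG] aff_dim_G[OF h(1)] by simp
        show "h ` L \<subseteq> k ` L"
        proof
          fix x assume x: "x \<in> h ` L"
          obtain v where v: "v \<in> direction P" "x = e + v + ((x - e) \<bullet> u') *\<^sub>R u'"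
            by (rule flat_decomp[OF P h(1,4) u'(1,2) eP x])
          define c where "c = (x - e) \<bullet> u'"
          have kv: "lin k v = v" using PS_lin[of k P v] kG kP v(1) by (simp add: PS_iff)
          have "x = k (e + (v + c *\<^sub>R u))"
            unfolding isom_lin(4)[OF K_isom[OF kw(1)]] linear_add[OF isom_lin(1)[OF K_isom[OF kw(1)]]]
              linear_scale[OF isom_lin(1)[OF K_isom[OF kw(1)]]] ku kv kP[OF eP]
            using v(2) by (simp add: c_def add.assoc)
          moreover have "e + (v + c *\<^sub>R u) \<in> L"
          proof -
            have "e \<in> L" using eP PL by blast
            moreover have "v \<in> direction L" using v(1) direction_mono[OF PL] by blast
            moreover have "u \<in> direction L" using u(2) by simp
            ultimately show ?thesis
              using direction_affine(2)[OF flat_affine[OF L_flat], of e "e + (v + c *\<^sub>R u)"]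
                subspace_add[OF subspace_direction[OF L_flat]] subspace_scale[OF subspace_direction[OF L_flat]] by simp
          qed
          ultimately show "x \<in> k ` L" by (rule image_eqI)
        qed
      qed
      then have "F = k ` cell L" unfolding h(2) using cell_K[OF kw(1) L_flat] by simp
      moreover have "k \<in> pointwise_stabiliser K P" using kw(1) kP by (simp add: pointwise_stabiliser_def)
      ultimately show "F \<in> (%g. g ` cell L) ` pointwise_stabiliser K P" by (rule image_eqI)
    qed
  qed
qed

lemma RT_image:
  assumes g: "g \<in> G" and rt: "RT P"
  shows "RT (g ` P)"
  unfolding RT_def
proof (intro ballI)
  let ?i = "inv_into UNIV g"
  fix u1 u2 assume u: "u1 \<in> units (g ` P)" "u2 \<in> units (g ` P)"
  have iG: "?i \<in> G" by (rule G_inverse[OF g])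
  have iP: "?i ` g ` P = P" using G_inv_apply(1)[OF g] by (simp add: image_image)
  have "lin ?i u1 \<in> units P" "lin ?i u2 \<in> units P" using units_image[OF iG] u iP by metis+
  then obtain s where s: "s \<in> PS P" "lin s (lin ?i u1) = lin ?i u2" using rt unfolding RT_def by blast
  have sG: "s \<in> G" using s(1) by (simp add: PS_iff)
  have siG: "(%x. s (?i x)) \<in> G" by (rule G_comp[OF sG iG])
  define r where "r = (%x. g (s (?i x)))"
  have rG: "r \<in> G" unfolding r_def by (rule G_comp[OF g siG])
  have "r \<in> PS (g ` P)"
    unfolding PS_iff using rG s(1) G_inv_apply(1)[OF g] by (auto simp: r_def PS_iff)
  moreover have "lin r u1 = u2"
  proof -
    have "lin r u1 = lin g (lin s (lin ?i u1))"
      unfolding r_def using lin_comp[OF g siG] lin_comp[OF sG iG] by simp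
    also have "\<dots> = lin g (lin ?i u2)" using s(2) by simp
    also have "\<dots> = lin (%x. g (?i x)) u2" using lin_comp[OF g iG] by simp
    also have "\<dots> = u2" using G_inv_apply(2)[OF g] by (simp add: lin_def)
    finally show ?thesis .
  qed
  ultimately show "\<exists>s\<in>PS (g ` P). lin s u1 = u2" by blast
qed

text \<open>An element fixing \<open>P\<close> and reversing \<open>u\<close> acts on
  \<open>L\<close> as the orthogonal reflection in \<open>P\<close>. On \<open>L\<close> the
  function \<open>sg H\<close> is a nonzero multiple of the coordinate along \<open>u\<close>, so
  points on the other side from \<open>p\<close> move closer to \<open>p\<close>.\<close>

lemma facet_reflection:
  assumes P: "flat \<H> P" "aff_dim P = aff_dim L - 1" and PL: "P \<subseteq> L" and rt: "RT P"
    and H: "H \<in> \<H>" "P \<subseteq> H" and p: "p \<in> L" "sg H p > 0"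
  obtains \<gamma> where "\<gamma> \<in> G" "\<gamma> ` L = L" "\<forall>x\<in>L. sg H x < 0 --> dist (\<gamma> x) p < dist x p"
proof -
  have i: "(%x. x) \<in> G" "(%x. x) ` L = L" "P \<subseteq> (%x. x) ` L" using id_mem PL by simp_all
  obtain u where u: "u \<in> units P" "u \<in> direction ((%x. x) ` L)" by (rule units_ex[OF P i(1,3)])
  obtain \<gamma> where g: "\<gamma> \<in> PS P" "lin \<gamma> u = - u" using rt u(1) units_uminus[OF u(1)] unfolding RT_def by blast
  have gG: "\<gamma> \<in> G" using g(1) by (simp add: PS_iff)
  have gi: "isom \<gamma>" by (rule G_isom[OF gG])
  obtain e where e: "e \<in> P" using flat_ne[OF P(1)] by blast
  have eH: "e \<in> H" using e H(2) by blast
  have uu: "u \<bullet> u = 1" using unitsD(1)[OF u(1)] by (simp add: norm_eq_1)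
  have gx: "\<gamma> x = x - (2 * ((x - e) \<bullet> u)) *\<^sub>R u" and sx: "sg H x = ((x - e) \<bullet> u) * (nv H \<bullet> u)" if x: "x \<in> L" for x
  proof -
    have "x \<in> (%x. x) ` L" using x by simp
    then obtain w where w: "w \<in> direction P" "x = e + w + ((x - e) \<bullet> u) *\<^sub>R u" by (rule flat_decomp[OF P i(1,3) u e])
    define c where "c = (x - e) \<bullet> u"
    have xe: "x = e + (w + c *\<^sub>R u)" using w(2) by (simp add: c_def add.assoc)
    have "\<gamma> x = \<gamma> e + lin \<gamma> (w + c *\<^sub>R u)" by (subst xe) (rule isom_lin(4)[OF gi])
    also have "\<dots> = e + (w - c *\<^sub>R u)"
      unfolding linear_add[OF isom_lin(1)[OF gi]] linear_scale[OF isom_lin(1)[OF gi]] g(2)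
      using PS_lin[OF g(1) w(1)] g(1) e by (simp add: PS_iff)
    also have "\<dots> = x - (2 * c) *\<^sub>R u" by (subst xe) (simp add: algebra_simps flip: scaleR_add_left)
    finally show "\<gamma> x = x - (2 * ((x - e) \<bullet> u)) *\<^sub>R u" by (simp add: c_def)
    have "nv H \<bullet> w = 0" using flat_direction[OF P(1), of w] w(1) H by blast
    moreover have "sg H x = nv H \<bullet> (x - e)" by (rule H_point_normal[OF H(1) eH])
    moreover have "x - e = w + c *\<^sub>R u" by (subst xe) simp
    ultimately have "sg H x = c * (nv H \<bullet> u)" by (simp add: inner_add_right)
    then show "sg H x = ((x - e) \<bullet> u) * (nv H \<bullet> u)" unfolding c_def .
  qed
  have uL: "u \<in> direction L" using u(2) by simp
  have sub: "\<gamma> ` L \<subseteq> L"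
  proof
    fix y assume "y \<in> \<gamma> ` L"
    then obtain x where x: "x \<in> L" "y = \<gamma> x" by blast
    have E: "y - x = (- (2 * ((x - e) \<bullet> u))) *\<^sub>R u" unfolding x(2) using gx[OF x(1)] by simp
    have "y - x \<in> direction L" unfolding E by (rule subspace_scale[OF subspace_direction[OF L_flat] uL])
    then show "y \<in> L" using direction_affine(2)[OF flat_affine[OF L_flat] x(1), of y] by simp
  qed
  have gL: "\<gamma> ` L = L"
    by (rule flat_dim_eq[OF flat_gL[OF gG] L_flat sub]) (simp add: aff_dim_G[OF gG])
  have key: "dist (\<gamma> x) p < dist x p" if x: "x \<in> L" "sg H x < 0" for x
  proof -
    define a where "a = (x - e) \<bullet> u"
    define b where "b = (p - e) \<bullet> u"
    define m where "m = nv H \<bullet> u"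
    have am: "a * m < 0" "b * m > 0" using sx[OF x(1)] sx[OF p(1)] x(2) p(2) by (simp_all add: a_def b_def m_def)
    have ab: "a * b < 0" using am by (smt (verit) mult_less_0_iff zero_less_mult_iff)
    have n: "(dist x p)^2 = (x - p) \<bullet> (x - p)" by (simp add: dist_norm power2_norm_eq_inner)
    have "(dist (\<gamma> x) p)^2 = ((x - p) - (2 * a) *\<^sub>R u) \<bullet> ((x - p) - (2 * a) *\<^sub>R u)"
      unfolding gx[OF x(1)] by (simp add: dist_norm power2_norm_eq_inner a_def algebra_simps)
    also have "\<dots> = (x - p) \<bullet> (x - p) - 4 * a * ((x - p) \<bullet> u) + 4 * a^2"
      by (simp add: inner_diff_left inner_diff_right inner_commute power2_eq_square uu algebra_simps)
    also have "(x - p) \<bullet> u = a - b" by (simp add: a_def b_def inner_diff_left)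
    also have "(x - p) \<bullet> (x - p) - 4 * a * (a - b) + 4 * a^2 = (dist x p)^2 + 4 * (a * b)"
      unfolding n by (simp add: power2_eq_square right_diff_distrib)
    finally have "(dist (\<gamma> x) p)^2 < (dist x p)^2" using ab by simp
    then show ?thesis by (rule power_less_imp_less_base) simp
  qed
  show ?thesis by (intro that[OF gG gL] ballI impI key)
qed

text \<open>The stabiliser of \<open>L\<close> folds \<open>L\<close> onto its face, each facet
  providing a reflection. A flat of codimension one in \<open>L\<close> is thereby moved to one over
  the chamber, and ray transitivity passes back along group elements.\<close>

lemma RT_all:
  assumes rt: "!!P. flat \<H> P ==> P \<subseteq> L ==> aff_dim P = aff_dim L - 1 ==> cell P ~= {} ==> RT P"
    and P: "flat \<H> P" "aff_dim P = aff_dim L - 1" and h: "h \<in> G" "P \<subseteq> h ` L"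
  shows "RT P"
proof -
  let ?N = "{n \<in> G. n ` L = L}"
  obtain p where p: "p \<in> cell L" using lies_over_cell[OF L_flat] L_over by blast
  have pL: "p \<in> L" using p cell_subset by blast
  have fold: "\<exists>n\<in>?N. n y \<in> closure \<A>" if y: "y \<in> L" for y
  proof (rule fold_into_chamber[OF L_flat p _ _ _ _ y])
    show "(%x. x) \<in> ?N" using id_mem by simp
    show "n x \<in> L" if "n \<in> ?N" "x \<in> L" for n x using that by blast
    show "finite {n \<in> ?N. dist (n y) p <= dist y p}" for y
    proof (rule finite_subset[OF _ finite_displacement[of y "2 * dist y p"]])
      show "{n \<in> ?N. dist (n y) p <= dist y p} \<subseteq> {g \<in> G. dist (g y) y <= 2 * dist y p}"
      proof
        fix n assume n: "n \<in> {n \<in> ?N. dist (n y) p <= dist y p}"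
        have "dist (n y) y <= dist (n y) p + dist y p" using dist_triangle2[of "n y" y p] by simp
        then show "n \<in> {g \<in> G. dist (g y) y <= 2 * dist y p}" using n by simp
      qed
    qed
    fix H assume H: "H \<in> \<H>" "\<not> L \<subseteq> H" "cell (L \<inter> H) ~= {}"
    have neH: "L \<inter> H ~= {}" using H(3) cell_subset[of "L \<inter> H"] by blast
    have fl: "flat \<H> (L \<inter> H)" by (rule flat_Int_H[OF L_flat H(1) neH])
    have dm: "aff_dim (L \<inter> H) = aff_dim L - 1"
      using aff_dim_affine_Int_hyperplane[OF flat_affine[OF L_flat], of "nv H" "snd (nc H)"] H(2) neH
      unfolding H_eq[OF H(1), symmetric] by simp
    have r: "RT (L \<inter> H)" by (rule rt[OF fl _ dm H(3)]) blast
    obtain \<gamma> where g: "\<gamma> \<in> G" "\<gamma> ` L = L" "\<forall>x\<in>L. sg H x < 0 --> dist (\<gamma> x) p < dist x p"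
      by (rule facet_reflection[OF fl dm Int_lower1 r H(1) Int_lower2 pL cell_sg[OF p H(1,2)]])
    show "\<exists>\<gamma>. (\<forall>n\<in>?N. (%x. \<gamma> (n x)) \<in> ?N) \<and> (\<forall>x\<in>L. sg H x < 0 --> dist (\<gamma> x) p < dist x p)"
    proof (intro exI[of _ \<gamma>] conjI ballI impI)
      fix n assume n: "n \<in> ?N"
      have "(%x. \<gamma> (n x)) ` L = \<gamma> ` n ` L" by (simp add: image_image)
      then show "(%x. \<gamma> (n x)) \<in> ?N" using n g(2) G_comp[OF g(1)] by simp
    qed (use g(3) in blast)
  qed
  have inL: "RT Q" if Q: "flat \<H> Q" "aff_dim Q = aff_dim L - 1" "Q \<subseteq> L" for Q
  proof -
    \<comment> \<open>Genericity ensures that a hyperplane through the image of \<open>y\<close>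
      contains the image of \<open>Q\<close>, so that this image point lies in the open
      face.\<close>
    obtain y where y: "y \<in> Q" "supp (y, 0) = Q" "stab (y, 0) = PS Q" by (rule generic_point[OF Q(1)])
    obtain n where n: "n \<in> G" "n ` L = L" "n y \<in> closure \<A>" using fold[of y] y(1) Q(3) by blast
    have "n y \<in> cell (n ` Q)"
    proof -
      have "sg H (n y) > 0" if H: "H \<in> \<H>" "\<not> n ` Q \<subseteq> H" for H
      proof -
        have "n y \<notin> H"
        proof
          assume "n y \<in> H"
          then have "y \<in> inv_into UNIV n ` H" using G_inv_apply(1)[OF n(1), of y] by (metis imageI)
          moreover have iH: "inv_into UNIV n ` H \<in> \<H>" by (rule G_image[OF G_inverse[OF n(1)] H(1)])
          ultimately have "vanishes (inv_into UNIV n ` H) (y, 0)" using nc(2)[OF iH] by (simp add: vanishes_def)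
          then have "Q \<subseteq> inv_into UNIV n ` H" using supp_subset_H[OF iH, of "(y, 0)"] y(2) by simp
          then have "n ` Q \<subseteq> n ` inv_into UNIV n ` H" by (rule image_mono)
          then show False using H(2) G_inv_apply(2)[OF n(1)] by (simp add: image_image)
        qed
        then show ?thesis using n(3) H(1) nc(2)[OF H(1), of "n y"] by (simp add: closure_chamber order_less_le)
      qed
      then show ?thesis using y(1) by (auto simp: cell_def)
    qed
    then have ne: "cell (n ` Q) ~= {}" by blast
    have "n ` Q \<subseteq> L" using image_mono[OF Q(3), of n] n(2) by simp
    then have "RT (n ` Q)" using rt[OF flat_G[OF n(1) Q(1)] _ _ ne] aff_dim_G[OF n(1)] Q(2) by simp
    then have "RT (inv_into UNIV n ` n ` Q)" by (rule RT_image[OF G_inverse[OF n(1)]])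
    then show ?thesis using G_inv_apply(1)[OF n(1)] by (simp add: image_image)
  qed
  let ?Q = "inv_into UNIV h ` P"
  have iG: "inv_into UNIV h \<in> G" by (rule G_inverse[OF h(1)])
  have "?Q \<subseteq> inv_into UNIV h ` h ` L" by (rule image_mono[OF h(2)])
  then have "?Q \<subseteq> L" using G_inv_apply(1)[OF h(1)] by (simp add: image_image)
  then have "RT ?Q" by (intro inL flat_G[OF iG P(1)]) (simp_all add: aff_dim_G[OF iG] P(2))
  then have "RT (h ` ?Q)" by (rule RT_image[OF h(1)])
  then show ?thesis using G_inv_apply(2)[OF h(1)] by (simp add: image_image)
qed

theorem normal_in_codim_1_iff:
  "normal_in_codim_1 (stratum \<H> K L) \<longleftrightarrow>
    (\<forall>P. flat \<H> P \<and> P \<subseteq> L \<and> aff_dim P = aff_dim L - 1 \<and> lies_over \<A> P -->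
      (let F' = flat_interior \<H> P \<inter> closure \<A> in
        single_orbit (pointwise_stabiliser K P)
          {F'' \<in> Sigma_faces \<H> \<A> K L. F' \<subseteq> closure F''}))"
proof -
  have X: "stratum \<H> K L = X" unfolding stratum_def X_def ..
  have i: "(%x. x) \<in> G" "(%x. x) ` L = L" using id_mem by simp_all
  have "normal_in_codim_1 X \<longleftrightarrow> (\<forall>P. flat \<H> P \<and> P \<subseteq> L \<and> aff_dim P = aff_dim L - 1 \<and> cell P ~= {} --> RT P)"
  proof
    assume n: "normal_in_codim_1 X"
    show "\<forall>P. flat \<H> P \<and> P \<subseteq> L \<and> aff_dim P = aff_dim L - 1 \<and> cell P ~= {} --> RT P"
      using RT_if_normal[OF n _ _ i(1)] i(2) by simp
  next
    assume "\<forall>P. flat \<H> P \<and> P \<subseteq> L \<and> aff_dim P = aff_dim L - 1 \<and> cell P ~= {} --> RT P"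
    then have rt: "!!P. flat \<H> P ==> P \<subseteq> L ==> aff_dim P = aff_dim L - 1 ==> cell P ~= {} ==> RT P" by blast
    show "normal_in_codim_1 X"
    proof (rule normal_if_RT)
      fix P g assume "flat \<H> P" "g \<in> G" "P \<subseteq> g ` L" "aff_dim P = aff_dim L - 1"
      then show "RT P" using RT_all[OF rt] by blast
    qed
  qed
  moreover have "RT P \<longleftrightarrow> single_orbit (pointwise_stabiliser K P)
      {F'' \<in> Sigma_faces \<H> \<A> K L. flat_interior \<H> P \<inter> closure \<A> \<subseteq> closure F''}"
    if "flat \<H> P" "P \<subseteq> L" "aff_dim P = aff_dim L - 1" "cell P ~= {}" for P
    unfolding facets_eq[OF that(1,4)]
    using RT_of_orbit[OF that(1,3,4)] orbit_of_RT[OF that(1,3,4,2)] by blast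
  ultimately show ?thesis unfolding X Let_def using lies_over_cell by (metis (no_types, lifting))
qed

end

theorem proposition6p9:
  fixes \<H> :: "'a::euclidean_space set set"
    and \<A> :: "'a set" and K :: "('a \<Rightarrow> 'a) set" and L :: "'a set"
  assumes "admissible_arrangement \<H>"
    and "chamber \<H> \<A>"
    and "admissible_group \<H> \<A> K"
    and "flat \<H> L" and "lies_over \<A> L"
  shows "normal_in_codim_1 (stratum \<H> K L) \<longleftrightarrow>
    (\<forall>L'. flat \<H> L' \<and> L' \<subseteq> L \<and> aff_dim L' = aff_dim L - 1 \<and> lies_over \<A> L' \<longrightarrow>
      (let F' = flat_interior \<H> L' \<inter> closure \<A> in
        single_orbit (pointwise_stabiliser K L')
          {F'' \<in> Sigma_faces \<H> \<A> K L. F' \<subseteq> closure F''}))"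
proof -
  interpret flat_stratum \<H> \<A> K L
    using assms by unfold_locales
  show ?thesis by (rule normal_in_codim_1_iff)
qed

end
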